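(* Let $t>0$ and let $G$ be a positive continuous adapted process on $[0,t]$. Define the sequence of partitions $\{\pi^n\}_{n\ge1}$ (moving sphere scheme) by $$\pi^n_0=0,\qquad \pi^n_{m+1}=\inf\Big\{s>\pi^n_m;\ |W(s)-W(\pi^n_m)|^2>G^n_m\,\psi\Big(\frac{s-\pi^n_m}{G^n_m}\Big)\Big\},$$ where $$G^n_m=\frac1{n\,G(\pi^n_m\wedge t)},\qquad \psi(v)=d\,v\log\frac av,\qquad a=\Big(1+\frac2d\Big)^{1+d/2}.$$ For $K\in\mathbb N$ let $\eta_K=t\wedge\inf\{s>0:\ G(s)>K\text{ or }G(s)<1/K\}$. Then conditions (A), (B) and (C) of the context are satisfied, with (A) and (C) for $\tau=\eta_K$ for every $K\in\mathbb N$, with the given process $G$ and with $$H=\frac{3\,r(d)}{G},\qquad r(d)=\frac{(d+2)^{d+2}}{d^{d/2}(d+4)^{(d+4)/2}}.$$ Moreover, $r(d)<\dfrac{d}{d+1}$ for every integer $d\ge1$.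
   Context: Let $W=(W^1,\dots,W^d)$ be a $d$-dimensional standard Brownian motion on a probability space $(\Omega,\mathcal F,\mathbb P)$, and $\{\mathcal F_s\}_{s\ge0}$ the augmentation of its natural filtration; stopping times and adaptedness refer to it. A partition $\pi=\{\pi_m\}_{m\ge0}$ is an increasing sequence of stopping times with $\pi_0=0$ and $\lim_m\pi_m=\infty$. For a sequence of partitions $\{\pi^n\}_{n\ge1}$ and a finite stopping time $\tau$ put $\Delta_m\pi^n=\pi^n_m-\pi^n_{m-1}$, $\Delta^n_mW^j=W^j(\pi^n_m)-W^j(\pi^n_{m-1})$, $\mathcal F^n_m=\mathcal F_{\pi^n_m}$, $N^n_\tau=\min\{m\ge0;\pi^n_m\ge\tau\}$, and $\pi^n(s)=\pi^n_m$ for $s\in[\pi^n_m,\pi^n_{m+1})$. Put $$G^n(\pi^n_m)=\frac1{n\,\mathbb E[\Delta_{m+1}\pi^n|\mathcal F^n_m]},\quad m=0,1,\dots$$ Conditions on $\{\pi^n\}$, for processes $G$, $H$ ($H$ progressively measurable) and some progressively measurable processes $H^n$: (A) for $\tau$: $\sum_{m=1}^{N^n_\tau}\mathbb E[|\Delta_m\pi^n|^2|\mathcal F^n_{m-1}]\to0$ and $\sup_{0\le s\le\tau}|G^n(\pi^n(s))-G(s)|\to0$ in probability as $n\to\infty$. (B) (symmetry) for every $n$, every $m\ge0$: $\mathbb E[(\Delta^n_{m+1}W^j)^3|\mathcal F^n_m]=0$ and $\mathbb E[|\Delta^n_{m+1}W^j|^4|\mathcal F^n_m]=\frac1{n^2}\frac{H^n(\pi^n_m)}{G^n(\pi^n_m)}$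 for all $1\le j\le d$, and $\mathbb E[L^{n,i,j}_{m+1}|\mathcal F^n_m]=0$ for all $1\le i,j\le d$ with $i\ne j$, where $L^{n,i,j}_m=\int_{\pi^n_{m-1}}^{\pi^n_m}(W^i(s)-W^i(\pi^n_{m-1}))(W^j(s)-W^j(\pi^n_{m-1}))\,\mathrm ds$. (C) for $\tau$: $\sup_{0\le s\le\tau}|H^n(\pi^n(s))-H(s)|\to0$, $n^2\sum_{m=1}^{N^n_\tau}\mathbb E[|\Delta_m\pi^n|^4|\mathcal F^n_{m-1}]\to0$ and $n^2\sum_{m=1}^{N^n_\tau}\mathbb E[|\Delta_m\pi^n|^6|\mathcal F^n_{m-1}]\to0$ in probability as $n\to\infty$. *)

theory Defs
  imports "HOL-Probability.Probability"
begin

subsection \<open>Brownian motion and its augmented filtration\<close>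

definition natural_filtration ::
    "'a measure \<Rightarrow> (real \<Rightarrow> 'a \<Rightarrow> 'b::topological_space) \<Rightarrow> real \<Rightarrow> 'a measure" where
  "natural_filtration M W s =
     sigma (space M) {W u -` B \<inter> space M | u B. 0 \<le> u \<and> u \<le> s \<and> B \<in> sets borel}"

text \<open>
  The null sets are those of the completion of \<open>M\<close>, that is, all subsets of \<open>M\<close>-null sets.
  The augmented filtration therefore lives on the completed probability space, and conditional
  expectations and probabilities below are taken with respect to \<^term>\<open>completion M\<close>.
\<close>

definition augmented_filtration ::
    "'a measure \<Rightarrow> (real \<Rightarrow> 'a \<Rightarrow> 'b::topological_space) \<Rightarrow> real \<Rightarrow> 'a measure" where
  "augmented_filtration M W s =
     sigma (space M) (sets (natural_filtration M W s) \<union> null_sets (completion M))"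

definition standard_brownian_motion ::
    "'a measure \<Rightarrow> (real \<Rightarrow> 'a \<Rightarrow> real ^ 'd) \<Rightarrow> bool" where
  "standard_brownian_motion M W \<longleftrightarrow>
     (\<forall>s\<ge>0. W s \<in> borel_measurable M) \<and>
     (AE \<omega> in M. W 0 \<omega> = 0) \<and>
     (\<forall>\<omega>\<in>space M. continuous_on {0..} (\<lambda>s. W s \<omega>)) \<and>
     (\<forall>s u. 0 \<le> s \<and> s < u \<longrightarrow>
        prob_space.indep_set M (sets (natural_filtration M W s))
          (sets (vimage_algebra (space M) (\<lambda>\<omega>. W u \<omega> - W s \<omega>) borel)) \<and>
        prob_space.indep_vars M (\<lambda>_. borel) (\<lambda>j \<omega>. W u \<omega> $ j - W s \<omega> $ j) UNIV \<and>
        (\<forall>j. distributed M lborel (\<lambda>\<omega>. W u \<omega> $ j - W s \<omega> $ j)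
               (\<lambda>x. ennreal (normal_density 0 (sqrt (u - s)) x))))"

text \<open>\<open>I\<close> is the time interval, starting at \<open>0\<close>, on which the process is considered.\<close>

definition progressive ::
    "(real \<Rightarrow> 'a measure) \<Rightarrow> real set \<Rightarrow> (real \<Rightarrow> 'a \<Rightarrow> real) \<Rightarrow> bool" where
  "progressive F I X \<longleftrightarrow>
     (\<forall>T\<in>I. (\<lambda>(s, \<omega>). X s \<omega>) \<in> borel_measurable (restrict_space borel {0..T} \<Otimes>\<^sub>M F T))"


subsection \<open>Convergence in probability and conditional expectations\<close>

text \<open>
  Convergence to \<open>0\<close> in probability of nonnegative variables. Extended values make suprema and
  sums unconditionally meaningful; measurability is demanded because \<^const>\<open>measure\<close>
  vanishes on non-measurable sets. Sequences are indexed by \<open>n \<ge> 1\<close>.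
\<close>

definition tends_to_0_in_prob :: "'a measure \<Rightarrow> (nat \<Rightarrow> 'a \<Rightarrow> ennreal) \<Rightarrow> bool" where
  "tends_to_0_in_prob P X \<longleftrightarrow>
     (\<forall>n\<ge>1. X n \<in> borel_measurable P) \<and>
     (\<forall>\<epsilon>>0. (\<lambda>n. measure P {\<omega> \<in> space P. X n \<omega> > ennreal \<epsilon>}) \<longlonglongrightarrow> 0)"

text \<open>
  Existence of \<open>E[X | A]\<close> as an almost surely finite variable; \<open>X\<close> itself need not be
  integrable (the steps of the partitions below need not be, as \<open>1/G\<close> may fail to be
  integrable). Under this condition \<^const>\<open>real_cond_exp\<close> has no default values.
\<close>

definition cond_integrable :: "'a measure \<Rightarrow> 'a measure \<Rightarrow> ('a \<Rightarrow> real) \<Rightarrow> bool" where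
  "cond_integrable P A X \<longleftrightarrow>
     X \<in> borel_measurable P \<and> (AE \<omega> in P. nn_cond_exp P A (\<lambda>\<omega>. ennreal \<bar>X \<omega>\<bar>) \<omega> < \<infinity>)"


subsection \<open>Partitions\<close>

text \<open>A partition is a sequence of random times \<open>p m\<close>.\<close>

definition stopping_partition ::
    "'a measure \<Rightarrow> (real \<Rightarrow> 'a measure) \<Rightarrow> (nat \<Rightarrow> 'a \<Rightarrow> real) \<Rightarrow> bool" where
  "stopping_partition P F p \<longleftrightarrow>
     (\<forall>m. stopping_time F (p m)) \<and>
     (\<forall>\<omega>\<in>space P. p 0 \<omega> = 0) \<and>
     (\<forall>\<omega>\<in>space P. incseq (\<lambda>m. p m \<omega>)) \<and>
     (AE \<omega> in P. filterlim (\<lambda>m. p m \<omega>) at_top sequentially)"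

abbreviation stopped_sigma ::
    "'a measure \<Rightarrow> (real \<Rightarrow> 'a measure) \<Rightarrow> ('a \<Rightarrow> real) \<Rightarrow> 'a measure" where
  "stopped_sigma P F T \<equiv> filtration.pre_sigma (space P) F T"

text \<open>Steps are numbered from \<open>0\<close>: \<open>step p m\<close> is the length of the interval from \<open>p m\<close> to \<open>p (m+1)\<close>.\<close>

definition step :: "(nat \<Rightarrow> 'a \<Rightarrow> real) \<Rightarrow> nat \<Rightarrow> 'a \<Rightarrow> real" where
  "step p m \<omega> = p (Suc m) \<omega> - p m \<omega>"

definition W_step ::
    "(real \<Rightarrow> 'a \<Rightarrow> real ^ 'd) \<Rightarrow> (nat \<Rightarrow> 'a \<Rightarrow> real) \<Rightarrow> nat \<Rightarrow> 'd \<Rightarrow> 'a \<Rightarrow> real" where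
  "W_step W p m j \<omega> = W (p (Suc m) \<omega>) \<omega> $ j - W (p m \<omega>) \<omega> $ j"

definition L_step ::
    "(real \<Rightarrow> 'a \<Rightarrow> real ^ 'd) \<Rightarrow> (nat \<Rightarrow> 'a \<Rightarrow> real) \<Rightarrow> nat \<Rightarrow> 'd \<Rightarrow> 'd \<Rightarrow> 'a \<Rightarrow> real" where
  "L_step W p m i j \<omega> =
     (LINT s:{p m \<omega>..p (Suc m) \<omega>}|lborel.
        (W s \<omega> $ i - W (p m \<omega>) \<omega> $ i) * (W s \<omega> $ j - W (p m \<omega>) \<omega> $ j))"

definition num_steps :: "(nat \<Rightarrow> 'a \<Rightarrow> real) \<Rightarrow> ('a \<Rightarrow> real) \<Rightarrow> 'a \<Rightarrow> nat" where
  "num_steps p \<tau> \<omega> = (LEAST m. p m \<omega> \<ge> \<tau> \<omega>)"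

text \<open>The index \<open>m\<close> of the interval containing \<open>s\<close>; thus \<open>p (step_index p s \<omega>) \<omega>\<close> is \<open>\<pi>(s)\<close>.\<close>

definition step_index :: "(nat \<Rightarrow> 'a \<Rightarrow> real) \<Rightarrow> real \<Rightarrow> 'a \<Rightarrow> nat" where
  "step_index p s \<omega> = (THE m. p m \<omega> \<le> s \<and> s < p (Suc m) \<omega>)"

definition step_rate ::
    "'a measure \<Rightarrow> (real \<Rightarrow> 'a measure) \<Rightarrow> nat \<Rightarrow> (nat \<Rightarrow> 'a \<Rightarrow> real) \<Rightarrow> nat \<Rightarrow> 'a \<Rightarrow> real" where
  "step_rate P F n p m \<omega> =
     1 / (real n * real_cond_exp P (stopped_sigma P F (p m)) (step p m) \<omega>)"

definition step_moment_sum ::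
    "'a measure \<Rightarrow> (real \<Rightarrow> 'a measure) \<Rightarrow> nat \<Rightarrow> (nat \<Rightarrow> 'a \<Rightarrow> real) \<Rightarrow> ('a \<Rightarrow> real) \<Rightarrow> 'a \<Rightarrow> ennreal"
  where
  "step_moment_sum P F k p \<tau> \<omega> =
     (\<Sum>m<num_steps p \<tau> \<omega>.
        nn_cond_exp P (stopped_sigma P F (p m)) (\<lambda>\<omega>. ennreal (\<bar>step p m \<omega>\<bar> ^ k)) \<omega>)"


subsection \<open>The conditions on a sequence of partitions\<close>

definition condition_A ::
    "'a measure \<Rightarrow> (real \<Rightarrow> 'a measure) \<Rightarrow> (nat \<Rightarrow> nat \<Rightarrow> 'a \<Rightarrow> real) \<Rightarrow> (real \<Rightarrow> 'a \<Rightarrow> real) \<Rightarrow>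
     ('a \<Rightarrow> real) \<Rightarrow> bool" where
  "condition_A P F \<pi> G \<tau> \<longleftrightarrow>
     (\<forall>n\<ge>1. \<forall>m. cond_integrable P (stopped_sigma P F (\<pi> n m)) (step (\<pi> n) m)) \<and>
     tends_to_0_in_prob P (\<lambda>n. step_moment_sum P F 2 (\<pi> n) \<tau>) \<and>
     tends_to_0_in_prob P (\<lambda>n \<omega>. SUP s\<in>{0..\<tau> \<omega>}.
        ennreal \<bar>step_rate P F n (\<pi> n) (step_index (\<pi> n) s \<omega>) \<omega> - G s \<omega>\<bar>)"

definition condition_B ::
    "'a measure \<Rightarrow> (real \<Rightarrow> 'a measure) \<Rightarrow> (real \<Rightarrow> 'a \<Rightarrow> real ^ 'd) \<Rightarrow>
     (nat \<Rightarrow> nat \<Rightarrow> 'a \<Rightarrow> real) \<Rightarrow> (nat \<Rightarrow> real \<Rightarrow> 'a \<Rightarrow> real) \<Rightarrow> bool" where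
  "condition_B P F W \<pi> Hn \<longleftrightarrow>
     (\<forall>n\<ge>1. \<forall>m. let p = \<pi> n; A = stopped_sigma P F (p m) in
        cond_integrable P A (step p m) \<and>
        (\<forall>j.
           cond_integrable P A (\<lambda>\<omega>. W_step W p m j \<omega> ^ 3) \<and>
           (AE \<omega> in P. real_cond_exp P A (\<lambda>\<omega>. W_step W p m j \<omega> ^ 3) \<omega> = 0) \<and>
           cond_integrable P A (\<lambda>\<omega>. \<bar>W_step W p m j \<omega>\<bar> ^ 4) \<and>
           (AE \<omega> in P. real_cond_exp P A (\<lambda>\<omega>. \<bar>W_step W p m j \<omega>\<bar> ^ 4) \<omega> =
              1 / (real n)\<^sup>2 * (Hn n (p m \<omega>) \<omega> / step_rate P F n p m \<omega>))) \<and>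
        (\<forall>i j. i \<noteq> j \<longrightarrow>
           cond_integrable P A (L_step W p m i j) \<and>
           (AE \<omega> in P. real_cond_exp P A (L_step W p m i j) \<omega> = 0)))"

definition condition_C ::
    "'a measure \<Rightarrow> (real \<Rightarrow> 'a measure) \<Rightarrow> (nat \<Rightarrow> nat \<Rightarrow> 'a \<Rightarrow> real) \<Rightarrow> (real \<Rightarrow> 'a \<Rightarrow> real) \<Rightarrow>
     (nat \<Rightarrow> real \<Rightarrow> 'a \<Rightarrow> real) \<Rightarrow> ('a \<Rightarrow> real) \<Rightarrow> bool" where
  "condition_C P F \<pi> H Hn \<tau> \<longleftrightarrow>
     tends_to_0_in_prob P (\<lambda>n \<omega>. SUP s\<in>{0..\<tau> \<omega>}.
        ennreal \<bar>Hn n (\<pi> n (step_index (\<pi> n) s \<omega>) \<omega>) \<omega> - H s \<omega>\<bar>) \<and>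
     tends_to_0_in_prob P (\<lambda>n \<omega>. ennreal ((real n)\<^sup>2) * step_moment_sum P F 4 (\<pi> n) \<tau> \<omega>) \<and>
     tends_to_0_in_prob P (\<lambda>n \<omega>. ennreal ((real n)\<^sup>2) * step_moment_sum P F 6 (\<pi> n) \<tau> \<omega>)"


subsection \<open>The moving sphere scheme\<close>

definition sphere_a :: "nat \<Rightarrow> real" where
  "sphere_a d = (1 + 2 / real d) powr (1 + real d / 2)"

definition sphere_psi :: "nat \<Rightarrow> real \<Rightarrow> real" where
  "sphere_psi d v = real d * v * ln (sphere_a d / v)"

definition sphere_r :: "nat \<Rightarrow> real" where
  "sphere_r d = real (d + 2) ^ (d + 2) /
     (real d powr (real d / 2) * real (d + 4) powr (real (d + 4) / 2))"

definition sphere_scale ::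
    "(real \<Rightarrow> 'a \<Rightarrow> real) \<Rightarrow> real \<Rightarrow> nat \<Rightarrow> real \<Rightarrow> 'a \<Rightarrow> real" where
  "sphere_scale G t n u \<omega> = 1 / (real n * G (min u t) \<omega>)"

text \<open>
  The set below is nonempty: \<open>\<psi>(v) < 0\<close> for \<open>v > a\<close>. Hence each step is at most \<open>a\<close> times
  the scale, and all times are finite.
\<close>

primrec moving_sphere ::
    "(real \<Rightarrow> 'a \<Rightarrow> real ^ 'd::finite) \<Rightarrow> (real \<Rightarrow> 'a \<Rightarrow> real) \<Rightarrow> real \<Rightarrow> nat \<Rightarrow> nat \<Rightarrow> 'a \<Rightarrow> real" where
  "moving_sphere W G t n 0 = (\<lambda>\<omega>. 0)"
| "moving_sphere W G t n (Suc m) = (\<lambda>\<omega>.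
     let u = moving_sphere W G t n m \<omega>; g = sphere_scale G t n u \<omega> in
       Inf {s. u < s \<and> (norm (W s \<omega> - W u \<omega>))\<^sup>2 > g * sphere_psi CARD('d) ((s - u) / g)})"

text \<open>
  \<open>G\<close> is only given on \<open>[0,t]\<close>; including \<open>t\<close> in the set gives the minimum with \<open>t\<close>
  and makes the infimum over an empty set equal to \<open>t\<close>.
\<close>

definition level_exit :: "(real \<Rightarrow> 'a \<Rightarrow> real) \<Rightarrow> real \<Rightarrow> nat \<Rightarrow> 'a \<Rightarrow> real" where
  "level_exit G t K \<omega> =
     Inf (insert t {s. 0 < s \<and> s \<le> t \<and> (G s \<omega> > real K \<or> G s \<omega> < 1 / real K)})"

end

theory Submission
  imports Defs
begin

text \<open>
  By the strong Markov property and Brownian scaling, given \<open>F(\<pi>\<^sub>m)\<close> the next step is \<open>g T\<close> with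
  \<open>g = 1 / (n G(\<pi>\<^sub>m))\<close>, where \<open>T\<close> is the exit time of a fresh Brownian motion \<open>B\<close> from the
  moving sphere \<open>|x|\<^sup>2 = \<psi>(v)\<close>. The sphere is the level set \<open>1\<close> of
  \<open>R v x = (v / a) powr (d / 2) * exp(|x|\<^sup>2 / (2 v))\<close>, a constant multiple of the reciprocal of the
  Brownian transition density; hence \<open>R v (B v)\<close> is a martingale when \<open>v\<close> runs backwards. Given
  \<open>B s\<close> with \<open>R s (B s) < 1\<close>, let \<open>v\<close> decrease from \<open>s\<close> to \<open>0\<close>: the reversed martingale
  is nonnegative and continuous, and it tends to \<open>0\<close> unless it is stopped at level \<open>1\<close>, so it
  reaches \<open>1\<close> with probability \<open>R s (B s)\<close>. Therefore
  \<open>P(T \<ge> s, B s \<in> dx) = (1 - R s x)\<^sup>+ P(B s \<in> dx)\<close>. This occupation law is explicit and even in each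
  coordinate. It gives \<open>E T = 1\<close>, and with a discretised Dynkin formula it gives
  \<open>E (B\<^sub>j T)\<^sup>3 = 0\<close>, \<open>E (B\<^sub>j T)\<^sup>4 = 6 E \<integral> (B\<^sub>j v)\<^sup>2 dv = 3 r(d)\<close> and a vanishing mixed integral.

  Consequently \<open>G\<^sup>n(\<pi>\<^sub>m) = G(\<pi>\<^sub>m)\<close> holds exactly, and since \<open>T \<le> a\<close> the mesh is pathwise of order
  \<open>1 / n\<close>, so the uniform convergences reduce to uniform continuity of \<open>G\<close>. Up to the exit level,
  \<open>g \<le> K / n\<close>, and the sum of the \<open>g\<close> has the same mean as the sum of the steps, which is bounded;
  this controls the conditional moment sums. The partition exhausts \<open>[0, \<infinity>)\<close> since \<open>E exp(-T)\<close>,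
  conditionally at each step, is bounded by a constant smaller than \<open>1\<close>.
\<close>

subsection \<open>Gaussian measures\<close>

text \<open>Weighting the law of \<open>B r\<close> by \<open>sphere_R\<close> gives a multiple of
  Lebesgue measure, which Gaussian convolution preserves: this invariance is the reversed martingale
  property. Its price is that the expectation of \<open>sphere_R\<close> is infinite (a constant
  times the volume of the whole space). Optional stopping therefore starts from events inside {R <=
  1}; the upper estimate in addition needs levels slightly above 1, an overshoot bound and a
  truncated small-time bound. The constant \<open>a\<close> is the one that makes the mean exit time
  1.

  Conditioning is done by changing the measure. All exit facts are proved for an abstract Brownian
  motion over an arbitrary filtration and are then applied under P( . | A) for every A in the
  stopped sigma-algebra. A bounded variable with the same mean under all these measures has a
  constant conditional expectation. The random scale, which may fail to be integrable, is multiplied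
  in only afterwards.

  The strict inequality in the scheme puts only {T < q} into F(q), so right-continuity of the
  augmented filtration has to be established before the partition consists of stopping
  times.\<close>

lemma nn_integral_lborel_vec_prod:
  fixes f :: "'d::finite \<Rightarrow> real \<Rightarrow> ennreal"
  assumes [measurable]: "\<And>j. f j \<in> borel_measurable borel"
  shows "(\<integral>\<^sup>+x. (\<Prod>j\<in>UNIV. f j (x $ j)) \<partial>(lborel :: (real ^ 'd) measure)) =
    (\<Prod>j\<in>UNIV. \<integral>\<^sup>+x. f j x \<partial>lborel)"
proof -
  have inj: "inj (\<lambda>j::'d. axis j (1::real))"
    by (auto simp: inj_on_def axis_eq_axis)
  have B: "(Basis :: (real ^ 'd) set) = range (\<lambda>j. axis j 1)"
    by (auto simp: Basis_vec_def)
  define g where "g b = f (inv (\<lambda>j::'d. axis j (1::real)) b)" for b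
  have g: "g (axis j 1) = f j" for j
    by (simp add: g_def inv_f_f[OF inj])
  have "(\<integral>\<^sup>+x. (\<Prod>b\<in>Basis. g b (x \<bullet> b)) \<partial>(lborel :: (real ^ 'd) measure)) =
      (\<Prod>b\<in>Basis. \<integral>\<^sup>+x. g b x \<partial>lborel)"
    by (rule nn_integral_lborel_prod) (auto simp: g_def)
  then show ?thesis
    unfolding B by (simp add: prod.reindex[OF inj] g inner_axis)
qed

text \<open>\<open>h\<close> is the variance, hence the duration of an increment. At
  \<open>h = 0\<close> the convention 1 / 0 = 0 gives the null measure and not the point mass at 0;
  the probabilistic facts therefore ask for \<open>0 < h\<close>.\<close>

definition gauss :: "real \<Rightarrow> (real ^ 'd::finite) measure" where
  "gauss h = density lborel (\<lambda>x. ennreal (\<Prod>j\<in>UNIV. normal_density 0 (sqrt h) (x $ j)))"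

lemma sets_gauss [simp, measurable_cong]: "sets (gauss h) = sets borel"
  and space_gauss [simp]: "space (gauss h) = UNIV"
  by (auto simp: gauss_def)

lemma nn_integral_gauss:
  assumes [measurable]: "f \<in> borel_measurable borel"
  shows "(\<integral>\<^sup>+x. f x \<partial>gauss h) =
    (\<integral>\<^sup>+x. ennreal (\<Prod>j\<in>UNIV. normal_density 0 (sqrt h) (x $ j)) * f x \<partial>lborel)"
  unfolding gauss_def by (rule nn_integral_density) auto

lemma nn_integral_gauss_prod:
  fixes f :: "'d::finite \<Rightarrow> real \<Rightarrow> ennreal"
  assumes [measurable]: "\<And>j. f j \<in> borel_measurable borel"
  shows "(\<integral>\<^sup>+x. (\<Prod>j\<in>UNIV. f j (x $ j)) \<partial>(gauss h :: (real ^ 'd) measure)) =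
    (\<Prod>j\<in>UNIV. \<integral>\<^sup>+x. ennreal (normal_density 0 (sqrt h) x) * f j x \<partial>lborel)"
proof -
  have "(\<integral>\<^sup>+x. (\<Prod>j\<in>UNIV. f j (x $ j)) \<partial>(gauss h :: (real ^ 'd) measure)) =
    (\<integral>\<^sup>+x. (\<Prod>j\<in>UNIV. ennreal (normal_density 0 (sqrt h) (x $ j)) * f j (x $ j)) \<partial>(lborel :: (real ^ 'd) measure))"
    by (subst nn_integral_gauss) (auto simp: prod.distrib prod_ennreal intro!: nn_integral_cong)
  then show ?thesis
    using nn_integral_lborel_vec_prod[of "\<lambda>j x. ennreal (normal_density 0 (sqrt h) x) * f j x"] by simp
qed

lemma nn_integral_normal_density:
  "0 < \<sigma> \<Longrightarrow> (\<integral>\<^sup>+x. ennreal (normal_density \<mu> \<sigma> x) \<partial>lborel) = 1"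
  by (subst nn_integral_eq_integral) auto

lemma prob_space_gauss: "0 < h \<Longrightarrow> prob_space (gauss h :: (real ^ 'd::finite) measure)"
  using nn_integral_gauss_prod[of "\<lambda>(_::'d) _. 1" h]
  by (intro prob_spaceI) (simp add: nn_integral_normal_density)

lemma indicator_rectangle:
  "indicator {x :: real ^ 'd::finite. \<forall>j. x $ j \<in> E j} x = (\<Prod>j\<in>UNIV. indicator (E j) (x $ j) :: ennreal)"
  by (auto simp: indicator_def prod_zero_iff)

lemma emeasure_gauss_rectangle:
  assumes [measurable]: "\<And>j. E j \<in> sets borel"
  shows "emeasure (gauss h) {x :: real ^ 'd::finite. \<forall>j. x $ j \<in> E j} =
    (\<Prod>j\<in>UNIV. \<integral>\<^sup>+x. ennreal (normal_density 0 (sqrt h) x) * indicator (E j) x \<partial>lborel)"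
proof -
  have "emeasure (gauss h) {x :: real ^ 'd::finite. \<forall>j. x $ j \<in> E j} =
      (\<integral>\<^sup>+x. (\<Prod>j\<in>UNIV. indicator (E j) (x $ j)) \<partial>(gauss h :: (real ^ 'd) measure))"
    by (simp add: nn_integral_indicator[symmetric] indicator_rectangle del: nn_integral_indicator)
  then show ?thesis
    using nn_integral_gauss_prod[of "\<lambda>j. indicator (E j)" h] by simp
qed

text \<open>Rectangles are stable under intersection and include the open boxes, which generate the
  Borel sets. Product laws can thus be compared coordinatewise.\<close>

lemma measure_eqI_rectangles:
  fixes M N :: "(real ^ 'd::finite) measure"
  assumes "finite_measure M" and [simp]: "sets M = sets borel" "sets N = sets borel"
    and eq: "\<And>E. (\<And>j. E j \<in> sets borel) \<Longrightarrow>
      emeasure M {x. \<forall>j. x $ j \<in> E j} = emeasure N {x. \<forall>j. x $ j \<in> E j}"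
  shows "M = N"
proof (rule measure_eqI_generator_eq[where \<Omega>=UNIV and A="\<lambda>_. UNIV"
      and E="{{x :: real^'d. \<forall>j. x $ j \<in> E j} |E. \<forall>j. E j \<in> sets borel}"])
  let ?E = "{{x :: real^'d. \<forall>j. x $ j \<in> E j} |E. \<forall>j. E j \<in> sets borel}"
  show "Int_stable ?E"
  proof (rule Int_stableI, safe)
    fix E F :: "'d \<Rightarrow> real set"
    assume "\<forall>j. E j \<in> sets borel" "\<forall>j. F j \<in> sets borel"
    then show "\<exists>Ea. {x::real^'d. \<forall>j. x $ j \<in> E j} \<inter> {x. \<forall>j. x $ j \<in> F j} = {x. \<forall>j. x $ j \<in> Ea j} \<and> (\<forall>j. Ea j \<in> sets borel)"
      by (intro exI[of _ "\<lambda>j. E j \<inter> F j"]) auto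
  qed
  have "sets borel = sigma_sets UNIV ?E"
  proof
    show "sigma_sets UNIV ?E \<subseteq> sets borel"
      by (rule sets.sigma_sets_subset[of _ borel, simplified]) auto
    have "sets borel = sigma_sets UNIV (range (\<lambda>(a, b). box a b :: (real^'d) set))"
      by (simp add: borel_eq_box)
    also have "\<dots> \<subseteq> sigma_sets UNIV ?E"
    proof (intro sigma_sets_mono subsetI, safe)
      fix a b :: "real^'d"
      have "box a b = {x. \<forall>j. x $ j \<in> {a $ j <..< b $ j}}"
        by (auto simp: mem_box_cart)
      then show "box a b \<in> sigma_sets UNIV ?E"
        by (intro sigma_sets.Basic CollectI exI[of _ "\<lambda>j. {a $ j <..< b $ j}"]) auto
    qed
    finally show "sets borel \<subseteq> sigma_sets UNIV ?E" .
  qed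
  then show "sets M = sigma_sets UNIV ?E" "sets N = sigma_sets UNIV ?E" by auto
  show "range (\<lambda>_. UNIV) \<subseteq> ?E"
    by (auto intro!: exI[of _ "\<lambda>_. UNIV"])
  show "emeasure M UNIV \<noteq> \<infinity>" for i :: nat
    using finite_measure.emeasure_finite[OF assms(1)] by auto
qed (use eq in auto)

text \<open>All variances are reduced to one fixed measure. This allows time to be integrated before
  space in the occupation formula, and limits in \<open>h\<close> to be taken by dominated
  convergence.\<close>

lemma gauss_scale:
  assumes "0 < h"
  shows "gauss h = distr (gauss 1) borel (\<lambda>x :: real ^ 'd::finite. sqrt h *\<^sub>R x)"
proof (rule measure_eqI_rectangles)
  interpret prob_space "gauss h :: (real ^ 'd::finite) measure" using assms by (rule prob_space_gauss)
  show "finite_measure (gauss h :: (real ^ 'd::finite) measure)" by unfold_locales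
  fix E :: "'d \<Rightarrow> real set" assume [measurable]: "\<And>j. E j \<in> sets borel"
  have 1: "(\<integral>\<^sup>+x. ennreal (normal_density 0 (sqrt h) x) * indicator (E j) x \<partial>lborel) =
      (\<integral>\<^sup>+x. ennreal (normal_density 0 1 x) * indicator (E j) (sqrt h * x) \<partial>lborel)" for j
  proof -
    have "(\<integral>\<^sup>+x. ennreal (normal_density 0 (sqrt h) x) * indicator (E j) x \<partial>lborel) =
        ennreal (sqrt h) * (\<integral>\<^sup>+x. ennreal (normal_density 0 (sqrt h) (sqrt h * x)) * indicator (E j) (sqrt h * x) \<partial>lborel)"
      using assms by (subst nn_integral_real_affine[where c="sqrt h" and t=0]) auto
    also have "\<dots> = (\<integral>\<^sup>+x. ennreal (sqrt h * normal_density 0 (sqrt h) (sqrt h * x)) * indicator (E j) (sqrt h * x) \<partial>lborel)"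
      using assms by (subst nn_integral_cmult[symmetric]) (auto simp: ennreal_mult' mult.assoc)
    also have "(\<lambda>x. sqrt h * normal_density 0 (sqrt h) (sqrt h * x)) = normal_density 0 1"
      using assms by (auto simp: fun_eq_iff normal_density_def real_sqrt_mult field_simps power_mult_distrib)
    finally show ?thesis .
  qed
  have 2: "(\<lambda>x :: real^'d. sqrt h *\<^sub>R x) -` {x. \<forall>j. x $ j \<in> E j} =
     {x. \<forall>j. x $ j \<in> (\<lambda>x. sqrt h * x) -` E j}" by auto
  have 3: "(\<lambda>x. sqrt h * x) -` E j \<in> sets borel" for j
    using measurable_sets[of "\<lambda>x. sqrt h * x" borel borel "E j"] by simp
  show "emeasure (gauss h) {x :: real^'d. \<forall>j. x $ j \<in> E j} =
      emeasure (distr (gauss 1) borel (\<lambda>x. sqrt h *\<^sub>R x)) {x. \<forall>j. x $ j \<in> E j}"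
    using emeasure_gauss_rectangle[of "\<lambda>j. (\<lambda>x. sqrt h * x) -` E j" 1] 3
    by (simp add: emeasure_distr 2 emeasure_gauss_rectangle 1) (simp add: indicator_def)
qed auto

text \<open>The reflection in the hyperplane orthogonal to the \<open>i\<close>-th axis. Both
  \<open>gauss\<close> and \<open>sphere_R\<close> are invariant under it, and this one symmetry
  makes the odd and mixed moments vanish.\<close>

definition flip :: "'d \<Rightarrow> real ^ 'd::finite \<Rightarrow> real ^ 'd" where
  "flip i x = (\<chi> j. if j = i then - x $ j else x $ j)"

lemma flip_nth: "flip i x $ j = (if j = i then - x $ j else x $ j)"
  by (simp add: flip_def)

lemma measurable_flip [measurable]: "flip i \<in> borel_measurable borel"
proof (rule borel_measurable_continuous_onI)
  show "continuous_on UNIV (flip i)"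
    unfolding flip_def[abs_def]
    by (intro continuous_on_vec_lambda, rename_tac j, case_tac "j = i") (auto intro!: continuous_intros)
qed

lemma norm_flip [simp]: "norm (flip i x) = norm x"
  unfolding norm_vec_def L2_set_def flip_def by (intro arg_cong[of _ _ sqrt] sum.cong) auto

lemma distr_gauss_flip:
  assumes "0 < h"
  shows "distr (gauss h) borel (flip i) = (gauss h :: (real ^ 'd::finite) measure)"
proof (rule measure_eqI_rectangles)
  interpret prob_space "gauss h :: (real ^ 'd::finite) measure" using assms by (rule prob_space_gauss)
  show "finite_measure (distr (gauss h) borel (flip i) :: (real ^ 'd::finite) measure)" 
    by (intro prob_space.finite_measure prob_space_distr) auto
  fix E :: "'d \<Rightarrow> real set" assume [measurable]: "\<And>j. E j \<in> sets borel"
  define E' where "E' j = (if j = i then uminus -` E j else E j)" for j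
  have E': "E' j \<in> sets borel" for j
    using measurable_sets[of "uminus :: real \<Rightarrow> real" borel borel "E j"] by (cases "j = i") (auto simp: E'_def)
  have 2: "flip i -` {x. \<forall>j. x $ j \<in> E j} = {x. \<forall>j. x $ j \<in> E' j}"
    by (auto simp: flip_def E'_def split: if_splits)
  have "(\<integral>\<^sup>+x. ennreal (normal_density 0 (sqrt h) x) * indicator (uminus -` E j) x \<partial>lborel) =
      (\<integral>\<^sup>+x. ennreal (normal_density 0 (sqrt h) x) * indicator (E j) x \<partial>lborel)" for j
    by (subst nn_integral_real_affine[where c="-1" and t=0])
       (auto simp: normal_density_def indicator_def intro!: nn_integral_cong)
  then have 3: "(\<integral>\<^sup>+x. ennreal (normal_density 0 (sqrt h) x) * indicator (E' j) x \<partial>lborel) =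
      (\<integral>\<^sup>+x. ennreal (normal_density 0 (sqrt h) x) * indicator (E j) x \<partial>lborel)" for j
    by (simp add: E'_def)
  show "emeasure (distr (gauss h) borel (flip i)) {x :: real^'d. \<forall>j. x $ j \<in> E j} =
      emeasure (gauss h) {x. \<forall>j. x $ j \<in> E j}"
    using emeasure_gauss_rectangle[OF E', of h] 2
    by (simp add: emeasure_distr emeasure_gauss_rectangle 3 vimage_def)
qed auto

lemma distr_gauss_coord:
  assumes "0 < h"
  shows "distr (gauss h) borel (\<lambda>x :: real ^ 'd::finite. x $ j) = density lborel (normal_density 0 (sqrt h))"
proof (rule measure_eqI)
  fix A assume "A \<in> sets (distr (gauss h) borel (\<lambda>x :: real ^ 'd::finite. x $ j))"
  then have A [measurable]: "A \<in> sets borel" by simp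
  have "(\<lambda>x. x $ j) -` A = {x :: real^'d. \<forall>i. x $ i \<in> (if i = j then A else UNIV)}"
    by auto
  then have "emeasure (distr (gauss h) borel (\<lambda>x :: real ^ 'd::finite. x $ j)) A =
    (\<Prod>i\<in>UNIV. \<integral>\<^sup>+x. ennreal (normal_density 0 (sqrt h) x) * indicator (if i = j then A else UNIV) x \<partial>lborel)"
    by (simp add: emeasure_distr emeasure_gauss_rectangle)
  also have "\<dots> = (\<Prod>i\<in>UNIV. if i = j then emeasure (density lborel (normal_density 0 (sqrt h))) A else 1)"
    using assms by (intro prod.cong) (auto simp: emeasure_density nn_integral_normal_density)
  finally show "emeasure (distr (gauss h) borel (\<lambda>x :: real ^ 'd::finite. x $ j)) A = 
     emeasure (density lborel (normal_density 0 (sqrt h))) A"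
    by simp
qed simp

lemma gauss_coord_integral:
  assumes "0 < h" "has_bochner_integral lborel (\<lambda>x. normal_density 0 (sqrt h) x * f x) v"
    and [measurable]: "f \<in> borel_measurable borel"
  shows "has_bochner_integral (gauss h) (\<lambda>x :: real ^ 'd::finite. f (x $ j) :: real) v"
proof -
  have "has_bochner_integral (density lborel (normal_density 0 (sqrt h))) f v"
    using assms by (intro has_bochner_integral_density) auto
  then have "has_bochner_integral (distr (gauss h) borel (\<lambda>x :: real ^ 'd::finite. x $ j)) f v"
    using assms by (simp add: distr_gauss_coord)
  then show ?thesis
    by (simp add: has_bochner_integral_iff integrable_distr_eq integral_distr)
qed

lemma gauss_moments:
  assumes "0 < h"
  shows "has_bochner_integral (gauss h) (\<lambda>x :: real ^ 'd::finite. x $ j) 0"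
    and "has_bochner_integral (gauss h) (\<lambda>x :: real ^ 'd::finite. (x $ j)\<^sup>2) h"
    and "has_bochner_integral (gauss h) (\<lambda>x :: real ^ 'd::finite. (x $ j) ^ 3) 0"
    and "has_bochner_integral (gauss h) (\<lambda>x :: real ^ 'd::finite. (x $ j) ^ 4) (3 * h\<^sup>2)"
proof -
  have p: "0 < sqrt h" using assms by simp
  show "has_bochner_integral (gauss h) (\<lambda>x :: real ^ 'd::finite. x $ j) 0"
    using normal_moment_odd[OF p, where k=0 and \<mu>=0] assms by (intro gauss_coord_integral) auto
  show "has_bochner_integral (gauss h) (\<lambda>x :: real ^ 'd::finite. (x $ j)\<^sup>2) h"
    using normal_moment_even[OF p, where k=1 and \<mu>=0] assms by (intro gauss_coord_integral) auto
  show "has_bochner_integral (gauss h) (\<lambda>x :: real ^ 'd::finite. (x $ j) ^ 3) 0"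
    using normal_moment_odd[OF p, where k=1 and \<mu>=0] assms by (intro gauss_coord_integral) auto
  show "has_bochner_integral (gauss h) (\<lambda>x :: real ^ 'd::finite. (x $ j) ^ 4) (3 * h\<^sup>2)"
    using normal_moment_even[OF p, where k=2 and \<mu>=0] assms
    by (intro gauss_coord_integral) (auto simp: fact_numeral power2_eq_square field_simps)
qed

lemma norm_power2_vec: "(norm (x :: real ^ 'd::finite))\<^sup>2 = (\<Sum>j\<in>UNIV. (x $ j)\<^sup>2)"
  by (simp add: norm_vec_def L2_set_def sum_nonneg)

text \<open>Exponential tilting: the factor changes a standard normal density into a centred one of
  variance 1 / (1 + 2 \<beta>), and the remaining total mass is the new standard deviation.\<close>

lemma gauss_exp_aux:
  assumes "0 \<le> \<beta>"
  defines "\<sigma> \<equiv> (1 + 2 * \<beta>) powr (- 1 / 2)"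
  shows "normal_density 0 1 x * exp (- \<beta> * x\<^sup>2) = \<sigma> * normal_density 0 \<sigma> x"
proof -
  have s: "\<sigma> > 0" "\<sigma>\<^sup>2 = 1 / (1 + 2 * \<beta>)"
    using assms by (auto simp: \<sigma>_def powr_power powr_minus_divide power_divide)
  have "- x\<^sup>2 / 2 + - \<beta> * x\<^sup>2 = - x\<^sup>2 / (2 * \<sigma>\<^sup>2)"
    unfolding s using assms(1) by (simp add: field_simps)
  then have e: "exp (- x\<^sup>2 / 2) * exp (- \<beta> * x\<^sup>2) = exp (- x\<^sup>2 / (2 * \<sigma>\<^sup>2))"
    by (simp only: exp_add[symmetric])
  show ?thesis
    using s(1) e by (simp add: normal_density_def real_sqrt_mult field_simps)
qed

text \<open>The integrand factors over the coordinates: each one contributes \<sigma>, the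
  distinguished one \<sigma> cubed. These are the spatial integrals of the occupation formula, with
  \<beta> = 1 / d for the mean exit time and \<beta> = 2 / d for the second moment.\<close>

lemma nn_integral_gauss_exp:
  assumes "0 \<le> \<beta>"
  shows "(\<integral>\<^sup>+x. ennreal (exp (- \<beta> * (norm x)\<^sup>2)) \<partial>(gauss 1 :: (real ^ 'd::finite) measure)) =
      ennreal ((1 + 2 * \<beta>) powr (- real CARD('d) / 2))"
    and "(\<integral>\<^sup>+x. ennreal ((x $ j)\<^sup>2 * exp (- \<beta> * (norm x)\<^sup>2)) \<partial>(gauss 1 :: (real ^ 'd::finite) measure)) =
      ennreal ((1 + 2 * \<beta>) powr (- real CARD('d) / 2 - 1))"
proof -
  define \<sigma> where "\<sigma> = (1 + 2 * \<beta>) powr (- 1 / 2)"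
  have s: "0 < \<sigma>" using assms by (auto simp: \<sigma>_def)
  note aux = gauss_exp_aux[OF assms, folded \<sigma>_def]
  have e: "exp (- \<beta> * (norm x)\<^sup>2) = (\<Prod>i\<in>UNIV. exp (- \<beta> * (x $ i)\<^sup>2))" for x :: "real^'d"
    by (simp add: norm_power2_vec sum_distrib_left exp_sum[symmetric] flip: sum_negf)
  have 1: "(\<integral>\<^sup>+x. ennreal (normal_density 0 1 x) * ennreal (exp (- \<beta> * x\<^sup>2)) \<partial>lborel) = ennreal \<sigma>"
  proof -
    have "(\<integral>\<^sup>+x. ennreal (normal_density 0 1 x) * ennreal (exp (- \<beta> * x\<^sup>2)) \<partial>lborel) =
      (\<integral>\<^sup>+x. ennreal \<sigma> * ennreal (normal_density 0 \<sigma> x) \<partial>lborel)"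
      using s aux by (intro nn_integral_cong) (simp only: ennreal_mult'[symmetric] normal_density_nonneg less_imp_le)
    then show ?thesis using s by (simp add: nn_integral_cmult nn_integral_normal_density)
  qed
  have 2: "(\<integral>\<^sup>+x. ennreal (normal_density 0 1 x) * ennreal (x\<^sup>2 * exp (- \<beta> * x\<^sup>2)) \<partial>lborel) = ennreal (\<sigma> ^ 3)"
  proof -
    have "(\<integral>\<^sup>+x. ennreal (normal_density 0 1 x) * ennreal (x\<^sup>2 * exp (- \<beta> * x\<^sup>2)) \<partial>lborel) =
      (\<integral>\<^sup>+x. ennreal \<sigma> * ennreal (normal_density 0 \<sigma> x * x\<^sup>2) \<partial>lborel)"
    proof (intro nn_integral_cong)
      fix x
      have "normal_density 0 1 x * (x\<^sup>2 * exp (- \<beta> * x\<^sup>2)) = \<sigma> * (normal_density 0 \<sigma> x * x\<^sup>2)"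
        using aux[of x] by (metis mult.assoc mult.commute)
      then show "ennreal (normal_density 0 1 x) * ennreal (x\<^sup>2 * exp (- \<beta> * x\<^sup>2)) =
          ennreal \<sigma> * ennreal (normal_density 0 \<sigma> x * x\<^sup>2)"
        using s by (simp add: ennreal_mult'[symmetric] del: mult_minus_left)
    qed
    also have "\<dots> = ennreal \<sigma> * (\<integral>\<^sup>+x. ennreal (normal_density 0 \<sigma> x * x\<^sup>2) \<partial>lborel)"
      by (subst nn_integral_cmult) auto
    also have "(\<integral>\<^sup>+x. ennreal (normal_density 0 \<sigma> x * x\<^sup>2) \<partial>lborel) = ennreal (\<sigma>\<^sup>2)"
      using normal_moment_even[OF s, where k=1 and \<mu>=0]
      by (subst nn_integral_eq_integral) (auto simp: has_bochner_integral_iff)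
    finally show ?thesis
      using s by (simp add: ennreal_mult'[symmetric] power3_eq_cube power2_eq_square mult.assoc)
  qed
  have pw: "\<sigma> ^ n = (1 + 2 * \<beta>) powr (- real n / 2)" for n
    using assms by (simp add: \<sigma>_def powr_power)
  have "(\<integral>\<^sup>+x. ennreal (exp (- \<beta> * (norm x)\<^sup>2)) \<partial>(gauss 1 :: (real ^ 'd::finite) measure)) =
     (\<Prod>i\<in>(UNIV::'d set). ennreal \<sigma>)"
    unfolding e
    using nn_integral_gauss_prod[of "\<lambda>(_::'d) x. ennreal (exp (- \<beta> * x\<^sup>2))" 1]
    by (subst prod_ennreal[symmetric]) (simp_all add: 1[simplified])
  also have "\<dots> = ennreal (\<sigma> ^ CARD('d))"
    using s by (simp add: ennreal_power)
  finally show "(\<integral>\<^sup>+x. ennreal (exp (- \<beta> * (norm x)\<^sup>2)) \<partial>(gauss 1 :: (real ^ 'd::finite) measure)) =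
      ennreal ((1 + 2 * \<beta>) powr (- real CARD('d) / 2))"
    by (simp add: pw)
  have e2: "(x $ j)\<^sup>2 * exp (- \<beta> * (norm x)\<^sup>2) = (\<Prod>i\<in>UNIV. (if i = j then (x $ i)\<^sup>2 else 1) * exp (- \<beta> * (x $ i)\<^sup>2))"
    for x :: "real^'d"
    unfolding e prod.distrib by simp
  have "(\<integral>\<^sup>+x. ennreal ((x $ j)\<^sup>2 * exp (- \<beta> * (norm x)\<^sup>2)) \<partial>(gauss 1 :: (real ^ 'd::finite) measure)) =
     (\<Prod>i\<in>(UNIV::'d set). \<integral>\<^sup>+x. ennreal (normal_density 0 1 x) * ennreal ((if i = j then x\<^sup>2 else 1) * exp (- \<beta> * x\<^sup>2)) \<partial>lborel)"
    unfolding e2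
    by (subst prod_ennreal[symmetric])
       (auto simp: nn_integral_gauss_prod[of "\<lambda>i x. ennreal ((if i = j then x\<^sup>2 else 1) * exp (- \<beta> * x\<^sup>2))" 1, simplified])
  also have "\<dots> = (\<Prod>i\<in>(UNIV::'d set). (if i = j then ennreal (\<sigma>^2) else 1) * ennreal \<sigma>)"
  proof (intro prod.cong refl)
    fix i
    have "ennreal (\<sigma> ^ 3) = ennreal (\<sigma>\<^sup>2) * ennreal \<sigma>"
      using s by (subst ennreal_mult'[symmetric]) (simp_all add: power3_eq_cube power2_eq_square)
    then show "(\<integral>\<^sup>+x. ennreal (normal_density 0 1 x) * ennreal ((if i = j then x\<^sup>2 else 1) * exp (- \<beta> * x\<^sup>2)) \<partial>lborel) =
        (if i = j then ennreal (\<sigma>\<^sup>2) else 1) * ennreal \<sigma>"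
      using 1 2 by (cases "i = j") simp_all
  qed
  also have "\<dots> = ennreal (\<sigma> ^ 2 * \<sigma> ^ CARD('d))"
    using s by (simp add: prod.distrib ennreal_mult' ennreal_power)
  also have "\<sigma> ^ 2 * \<sigma> ^ CARD('d) = (1 + 2 * \<beta>) powr (- real CARD('d) / 2 - 1)"
    unfolding pw powr_add[symmetric] by (intro arg_cong2[of _ _ _ _ "(powr)"] refl) (simp add: field_simps)
  finally show "(\<integral>\<^sup>+x. ennreal ((x $ j)\<^sup>2 * exp (- \<beta> * (norm x)\<^sup>2)) \<partial>(gauss 1 :: (real ^ 'd::finite) measure)) =
      ennreal ((1 + 2 * \<beta>) powr (- real CARD('d) / 2 - 1))" .
qed

text \<open>The indicator of an open set is an increasing limit of continuous functions built from
  the distance to its complement. Needed because limits of increments are accessible only through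
  continuous test functions.\<close>

lemma measure_eqI_continuous:
  fixes M N :: "('a::metric_space) measure"
  assumes "finite_measure M" and [simp, measurable_cong]: "sets M = sets borel" "sets N = sets borel"
    and eq: "\<And>f. continuous_on UNIV f \<Longrightarrow> (\<And>x. 0 \<le> f x) \<Longrightarrow> (\<And>x. f x \<le> 1) \<Longrightarrow>
      (\<integral>\<^sup>+x. ennreal (f x) \<partial>M) = (\<integral>\<^sup>+x. ennreal (f x) \<partial>N)"
  shows "M = N"
proof (rule measure_eqI_generator_eq[where \<Omega>=UNIV and A="\<lambda>_. UNIV" and E="{S. open S}"])
  show "Int_stable {S::'a set. open S}" by (auto simp: Int_stable_def)
  show "sets M = sigma_sets UNIV {S. open S}" "sets N = sigma_sets UNIV {S. open S}"
    by (simp_all add: borel_def)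
  show "emeasure M UNIV \<noteq> \<infinity>" for i :: nat
    using finite_measure.emeasure_finite[OF assms(1)] by auto
  fix U :: "'a set" assume "U \<in> {S. open S}"
  then have U: "open U" by simp
  then have [measurable]: "U \<in> sets borel" by simp
  \<comment> \<open>The whole space is treated separately because \<open>infdist x {}\<close> is 0
    by convention.\<close>
  define f where "f n x = (if U = UNIV then 1 else min 1 (real n * infdist x (- U)))" for n x
  have fc: "continuous_on UNIV (f n)" for n
    unfolding f_def by (cases "U = UNIV") (auto intro!: continuous_intros)
  have f0: "0 \<le> f n x" "f n x \<le> 1" for n x
    by (auto simp: f_def infdist_nonneg)
  have inc: "incseq (\<lambda>n. ennreal (f n x))" for x
    unfolding incseq_def f_def
    by (cases "U = UNIV") (auto intro!: ennreal_leI min.coboundedI2 mult_right_mono simp: infdist_nonneg)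
  have lim: "(\<lambda>n. ennreal (f n x)) \<longlonglongrightarrow> indicator U x" for x
  proof (cases "x \<in> U")
    case False
    then show ?thesis by (cases "U = UNIV") (auto simp: f_def)
  next
    case True
    show ?thesis
    proof (cases "U = UNIV")
      case False
      then have "infdist x (- U) > 0"
        using True U by (intro infdist_pos_not_in_closed) auto
      then obtain k where "1 \<le> real k * infdist x (- U)"
        using reals_Archimedean3 by (metis less_imp_le)
      then have "\<forall>n\<ge>k. f n x = 1"
        by (auto simp: f_def min_def infdist_nonneg intro!: antisym order_trans[OF _ mult_right_mono[of "real k"]])
      then have "\<forall>\<^sub>F n in sequentially. ennreal (f n x) = indicator U x"
        using True by (auto simp: eventually_sequentially)
      then show ?thesis by (rule tendsto_eventually)
    qed (use True in \<open>auto simp: f_def\<close>)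
  qed
  have m: "(\<lambda>x. ennreal (f n x)) \<in> borel_measurable borel" for n
    using fc by (auto intro!: borel_measurable_continuous_onI measurable_compose[OF _ measurable_ennreal])
  have "(\<lambda>n. \<integral>\<^sup>+x. ennreal (f n x) \<partial>M) \<longlonglongrightarrow> emeasure M U"
    using nn_integral_LIMSEQ[of "\<lambda>n x. ennreal (f n x)" M "indicator U"] inc lim m
    by (auto simp: incseq_def le_fun_def measurable_cong_sets[OF \<open>sets M = sets borel\<close> refl])
  moreover have "(\<lambda>n. \<integral>\<^sup>+x. ennreal (f n x) \<partial>N) \<longlonglongrightarrow> emeasure N U"
    using nn_integral_LIMSEQ[of "\<lambda>n x. ennreal (f n x)" N "indicator U"] inc lim m
    by (auto simp: incseq_def le_fun_def measurable_cong_sets[OF \<open>sets N = sets borel\<close> refl])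
  ultimately show "emeasure M U = emeasure N U"
    using eq[OF fc f0] by (simp add: LIMSEQ_unique)
qed auto

subsection \<open>The constant of the moving sphere scheme\<close>

text \<open>Centred at x = d + 2, the exponent is minus one half of the second difference, with step
  2, of the convex function x ln x.\<close>

lemma sphere_r_exp:
  assumes "d \<ge> 1"
  defines "x \<equiv> real d + 2"
  shows "sphere_r d = exp (x * ln x - (x - 2) / 2 * ln (x - 2) - (x + 2) / 2 * ln (x + 2))"
proof -
  have "real (d + 2) ^ (d + 2) = real (d + 2) powr real (d + 2)"
    by (rule powr_realpow[symmetric]) simp
  also have "\<dots> = exp (x * ln x)"
    by (simp add: powr_def x_def add.commute)
  finally have 1: "real (d + 2) ^ (d + 2) = exp (x * ln x)" .
  have 2: "real d powr (real d / 2) = exp ((x - 2) / 2 * ln (x - 2))"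
    using assms by (simp add: powr_def x_def)
  have 3: "real (d + 4) powr (real (d + 4) / 2) = exp ((x + 2) / 2 * ln (x + 2))"
    by (simp add: powr_def x_def add.commute)
  show ?thesis
    unfolding sphere_r_def 1 2 3 by (simp only: exp_diff divide_divide_eq_left)
qed

text \<open>y squared is the leading term of the power series of the right-hand side, all of whose
  coefficients are nonnegative. Differentiating the difference twice gives 2 w^2 / (1 - w^2), which
  is nonnegative.\<close>

lemma xlnx_even_part_ge:
  fixes y :: real assumes "0 \<le> y" "y < 1"
  shows "y\<^sup>2 \<le> (1 - y) * ln (1 - y) + (1 + y) * ln (1 + y)"
proof -
  define f where "f y = (1 - y) * ln (1 - y) + (1 + y) * ln (1 + y) - y\<^sup>2" for y :: real
  have "f 0 \<le> f y"
  proof (rule DERIV_nonneg_imp_nondecreasing[OF assms(1)])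
    fix z assume z: "0 \<le> z" "z \<le> y"
    have "(f has_real_derivative (ln (1 + z) - ln (1 - z) - 2 * z)) (at z)"
      unfolding f_def using z assms by (auto intro!: derivative_eq_intros)
    moreover have "ln (1 + z) - ln (1 - z) - 2 * z \<ge> 0"
    proof -
      define g where "g z = ln (1 + z) - ln (1 - z) - 2 * z" for z :: real
      have "g 0 \<le> g z"
      proof (rule DERIV_nonneg_imp_nondecreasing[OF z(1)])
        fix w assume w: "0 \<le> w" "w \<le> z"
        have "(g has_real_derivative (1 / (1 + w) + 1 / (1 - w) - 2)) (at w)"
          unfolding g_def using z w assms by (auto intro!: derivative_eq_intros)
        moreover have "1 / (1 + w) + 1 / (1 - w) - 2 \<ge> 0"
        proof -
          have "1 / (1 + w) + 1 / (1 - w) - 2 = 2 * w\<^sup>2 / ((1 + w) * (1 - w))"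
            using w z assms by (simp add: divide_simps) (simp add: algebra_simps power2_eq_square)
          then show ?thesis using w z assms by simp
        qed
        ultimately show "\<exists>y. (g has_real_derivative y) (at w) \<and> 0 \<le> y" by blast
      qed
      then show ?thesis by (simp add: g_def)
    qed
    ultimately show "\<exists>y. (f has_real_derivative y) (at z) \<and> 0 \<le> y" by blast
  qed
  then show ?thesis by (simp add: f_def)
qed

text \<open>With y = 2 / x the second difference is at least 2 / (d + 2), and this is at least 1 / d
  > ln (1 + 1 / d) as soon as d >= 2. Only d = 1 has to be computed.\<close>

lemma sphere_r_less:
  assumes "d \<ge> 1"
  shows "sphere_r d < real d / (real d + 1)"
proof (cases "d = 1")
  case True
  \<comment> \<open>For d = 1 the value is 27 / (25 sqrt 5); the crude bound sqrt 5 > 2.2 already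
    puts it below 1 / 2.\<close>
  have "(5::real) powr (5/2) = 25 * sqrt 5"
  proof -
    have "(5::real) powr (5/2) = 5 powr (2 + 1/2)" by simp
    also have "\<dots> = 5 powr 2 * 5 powr (1/2)" by (rule powr_add)
    also have "\<dots> = 25 * sqrt 5" by (simp add: powr_half_sqrt)
    finally show ?thesis .
  qed
  moreover have "sqrt 5 > (2.2::real)"
    by (rule real_less_rsqrt) (simp add: power2_eq_square)
  ultimately show ?thesis
    using True by (simp add: sphere_r_def divide_simps)
next
  case False
  with assms have d: "d \<ge> 2" by simp
  define x where "x = real d + 2"
  define y where "y = 2 / x"
  have x: "x \<ge> 4" using d by (simp add: x_def)
  have y: "0 < y" "y < 1" using x by (auto simp: y_def field_simps)
  have l: "ln (x - 2) = ln x + ln (1 - y)" "ln (x + 2) = ln x + ln (1 + y)"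
    using x y by (simp_all add: ln_mult_pos[symmetric]) (simp_all add: y_def field_simps)
  have "x * ln x - (x - 2) / 2 * ln (x - 2) - (x + 2) / 2 * ln (x + 2) =
     - (x / 2) * ((1 - y) * ln (1 - y) + (1 + y) * ln (1 + y))"
    unfolding l using x by (simp add: y_def field_simps)
  also have "\<dots> \<le> - (x / 2) * y\<^sup>2"
    using xlnx_even_part_ge[of y] x y by (intro mult_left_mono_neg) auto
  also have "\<dots> = - (2 / (real d + 2))"
    using x unfolding x_def[symmetric] by (simp add: y_def power2_eq_square)
  also have "\<dots> \<le> - (1 / real d)"
    using d by (simp add: field_simps)
  also have "\<dots> < - ln (1 + 1 / real d)"
    using d ln_add_one_self_less_self[of "1 / real d"] by simp
  also have "\<dots> = ln (real d / (real d + 1))"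
    using d by (subst ln_inverse[symmetric]) (auto simp: field_simps)
  finally have "sphere_r d < exp (ln (real d / (real d + 1)))"
    unfolding sphere_r_exp[OF assms] x_def[symmetric] by (subst exp_less_cancel_iff)
  then show ?thesis using d by simp
qed

subsection \<open>Brownian motion relative to a filtration\<close>

text \<open>Rounding \<open>U\<close> down to a grid leaves countably many time values, and path
  continuity recovers the limit. \<open>A\<close> is arbitrary: with a product sigma-algebra and
  \<open>U\<close> the time coordinate, the lemma yields joint measurability.\<close>

lemma measurable_random_time:
  fixes X :: "real \<Rightarrow> 'a \<Rightarrow> 'b::metric_space"
  assumes X: "\<And>r. r \<in> {0..s} \<Longrightarrow> X r \<in> borel_measurable A"
    and c: "\<And>\<omega>. \<omega> \<in> space A \<Longrightarrow> continuous_on {0..s} (\<lambda>r. X r \<omega>)"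
    and U [measurable]: "U \<in> borel_measurable A" and U0: "\<And>\<omega>. \<omega> \<in> space A \<Longrightarrow> U \<omega> \<in> {0..s}"
  shows "(\<lambda>\<omega>. X (U \<omega>) \<omega>) \<in> borel_measurable A"
proof (cases "0 \<le> s")
  case False
  then have "space A = {}" using U0 by fastforce
  then show ?thesis by (simp add: measurable_def)
next
  case s: True
  define Y where "Y k \<omega> = X (min s (real_of_int \<lfloor>real (Suc k) * U \<omega>\<rfloor> / real (Suc k))) \<omega>" for k \<omega>
  have Y: "Y k \<in> borel_measurable A" for k
  proof -
    \<comment> \<open>The \<open>max 0\<close> keeps every integer index, including negative ones,
      at an admissible time; on the values that occur it changes nothing.\<close>
    define Z where "Z i \<omega> = X (min s (max 0 (real_of_int i / real (Suc k)))) \<omega>" for i \<omega>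
    have "(\<lambda>\<omega>. Z \<lfloor>real (Suc k) * U \<omega>\<rfloor> \<omega>) \<in> borel_measurable A"
      by (rule measurable_compose_countable) (auto simp: Z_def s intro!: X)
    moreover have "Z \<lfloor>real (Suc k) * U \<omega>\<rfloor> \<omega> = Y k \<omega>" if "\<omega> \<in> space A" for \<omega>
      using U0[OF that] by (auto simp: Z_def Y_def max_def divide_less_0_iff)
    ultimately show ?thesis by (simp cong: measurable_cong)
  qed
  show ?thesis
  proof (rule borel_measurable_LIMSEQ_metric[of Y])
    fix \<omega> assume w: "\<omega> \<in> space A"
    have u: "U \<omega> \<in> {0..s}" by (rule U0[OF w])
    have "(\<lambda>k. min s (real_of_int \<lfloor>real (Suc k) * U \<omega>\<rfloor> / real (Suc k))) \<longlonglongrightarrow> min s (U \<omega>)"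
    proof (intro tendsto_intros)
      show "(\<lambda>k. real_of_int \<lfloor>real (Suc k) * U \<omega>\<rfloor> / real (Suc k)) \<longlonglongrightarrow> U \<omega>"
      proof (rule LIMSEQ_I)
        fix e :: real assume "0 < e"
        then obtain n0 :: nat where n0: "1 / e < real n0"
          using reals_Archimedean2 by blast
        show "\<exists>no. \<forall>n\<ge>no. norm (real_of_int \<lfloor>real (Suc n) * U \<omega>\<rfloor> / real (Suc n) - U \<omega>) < e"
        proof (intro exI allI impI)
          fix n assume "n0 \<le> n"
          then have n: "1 < e * real (Suc n)"
          proof -
            have "1 / e < real (Suc n)" using n0 \<open>n0 \<le> n\<close> by linarith
            then show ?thesis using \<open>0 < e\<close> by (simp only: pos_divide_less_eq mult.commute)
          qed
          have "\<bar>real_of_int \<lfloor>real (Suc n) * U \<omega>\<rfloor> - real (Suc n) * U \<omega>\<bar> \<le> 1"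
            by linarith
          also note n
          finally have "\<bar>real_of_int \<lfloor>real (Suc n) * U \<omega>\<rfloor> - real (Suc n) * U \<omega>\<bar> / real (Suc n) < e"
            by (subst pos_divide_less_eq) auto
          moreover have "real_of_int \<lfloor>real (Suc n) * U \<omega>\<rfloor> / real (Suc n) - U \<omega> =
              (real_of_int \<lfloor>real (Suc n) * U \<omega>\<rfloor> - real (Suc n) * U \<omega>) / real (Suc n)"
            by (simp add: field_simps)
          ultimately show "norm (real_of_int \<lfloor>real (Suc n) * U \<omega>\<rfloor> / real (Suc n) - U \<omega>) < e"
            by (simp only: real_norm_def abs_divide abs_of_nat)
        qed
      qed
    qed
    then have "(\<lambda>k. min s (real_of_int \<lfloor>real (Suc k) * U \<omega>\<rfloor> / real (Suc k))) \<longlonglongrightarrow> U \<omega>"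
      using u by simp
    from continuous_on_tendsto_compose[OF c[OF w] this] u s
    show "(\<lambda>k. Y k \<omega>) \<longlonglongrightarrow> X (U \<omega>) \<omega>"
      by (auto simp: Y_def)
  qed (rule Y)
qed

lemma measurable_ident_subalg:
  assumes "subalgebra N G"
  shows "(\<lambda>\<omega>. \<omega>) \<in> measurable N (restr_to_subalg N G)"
proof (rule measurableI)
  fix A assume "A \<in> sets (restr_to_subalg N G)"
  then have "A \<in> sets N"
    using assms by (auto simp: sets_restr_to_subalg[OF assms] subalgebra_def)
  then show "(\<lambda>\<omega>. \<omega>) -` A \<inter> space N \<in> sets N" by simp
qed (simp add: space_restr_to_subalg)

text \<open>The filtration is a parameter, restricted only by adaptedness and independent
  increments. The locale can thus be instantiated with the augmented filtration, with its right
  limits, and with conditional measures along stopped sigma-algebras. The starting point is left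
  open.\<close>

locale brownian = prob_space N for N :: "'a measure" +
  fixes F :: "real \<Rightarrow> 'a measure" and B :: "real \<Rightarrow> 'a \<Rightarrow> real ^ 'd::finite"
  assumes subalg: "0 \<le> s \<Longrightarrow> subalgebra N (F s)"
    and mono: "0 \<le> s \<Longrightarrow> s \<le> u \<Longrightarrow> sets (F s) \<subseteq> sets (F u)"
    and adapted: "0 \<le> s \<Longrightarrow> B s \<in> borel_measurable (F s)"
    and cont: "\<omega> \<in> space N \<Longrightarrow> continuous_on {0..} (\<lambda>s. B s \<omega>)"
    and indep: "0 \<le> s \<Longrightarrow> s < u \<Longrightarrow> A \<in> sets (F s) \<Longrightarrow> E \<in> sets borel \<Longrightarrow>
      emeasure N (A \<inter> {\<omega> \<in> space N. B u \<omega> - B s \<omega> \<in> E}) =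
      emeasure N A * emeasure (gauss (u - s)) E"
begin

lemma space_F: "0 \<le> s \<Longrightarrow> space (F s) = space N"
  using subalg by (auto simp: subalgebra_def)

lemma F_into: "0 \<le> s \<Longrightarrow> f \<in> measurable (F s) K \<Longrightarrow> f \<in> measurable N K"
  using subalg by (rule measurable_from_subalg)

lemma F_mono: "0 \<le> s \<Longrightarrow> s \<le> u \<Longrightarrow> f \<in> measurable (F s) K \<Longrightarrow> f \<in> measurable (F u) K"
  using mono[of s u] space_F[of s] space_F[of u] by (auto simp: measurable_def)

lemma B_measurable: "0 \<le> s \<Longrightarrow> B s \<in> borel_measurable N"
  by (rule F_into[OF _ adapted])

text \<open>The identity map into the sub-sigma-algebra plays the part of the whole past, so
  independence becomes a product measure and Fubini applies to functions of \<omega> and the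
  increment jointly.\<close>

lemma joint_distr:
  assumes s: "0 \<le> s" "s < u"
  shows "distr N (restr_to_subalg N (F s) \<Otimes>\<^sub>M borel) (\<lambda>\<omega>. (\<omega>, B u \<omega> - B s \<omega>)) =
    restr_to_subalg N (F s) \<Otimes>\<^sub>M gauss (u - s)"
proof (rule pair_measure_eqI[symmetric])
  interpret g: prob_space "gauss (u - s) :: (real ^ 'd) measure" using s by (intro prob_space_gauss) simp
  interpret r: prob_space "restr_to_subalg N (F s)"
    using subalg[OF s(1)] by (intro prob_space_restr_to_subalg prob_space_axioms)
  show "sigma_finite_measure (restr_to_subalg N (F s))" "sigma_finite_measure (gauss (u - s) :: (real ^ 'd) measure)"
    by unfold_locales
  have [measurable]: "B u \<in> borel_measurable N" "B s \<in> borel_measurable N"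
    using s by (auto intro: B_measurable)
  have [measurable]: "(\<lambda>\<omega>. \<omega>) \<in> measurable N (restr_to_subalg N (F s))"
    by (rule measurable_ident_subalg[OF subalg[OF s(1)]])
  fix A E assume A: "A \<in> sets (restr_to_subalg N (F s))" and "E \<in> sets (gauss (u - s) :: (real ^ 'd) measure)"
  then have E [measurable]: "E \<in> sets borel" by simp
  have A': "A \<in> sets (F s)" using A subalg[OF s(1)] by (simp add: sets_restr_to_subalg)
  then have "A \<subseteq> space N" using sets.sets_into_space[of A "F s"] by (simp add: space_F s)
  then have eq: "(\<lambda>\<omega>. (\<omega>, B u \<omega> - B s \<omega>)) -` (A \<times> E) \<inter> space N = A \<inter> {\<omega> \<in> space N. B u \<omega> - B s \<omega> \<in> E}"
    by auto
  have "emeasure (restr_to_subalg N (F s)) A = emeasure N A"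
    using subalg[OF s(1)] A' by (rule emeasure_restr_to_subalg)
  then show "emeasure (restr_to_subalg N (F s)) A * emeasure (gauss (u - s)) E =
    emeasure (distr N (restr_to_subalg N (F s) \<Otimes>\<^sub>M borel) (\<lambda>\<omega>. (\<omega>, B u \<omega> - B s \<omega>))) (A \<times> E)"
    using A indep[OF s A' E] by (subst emeasure_distr) (auto simp: eq)
qed (auto intro!: sets_pair_measure_cong)

lemma markov_joint:
  assumes s: "0 \<le> s" "s < u" and f: "f \<in> borel_measurable (F s \<Otimes>\<^sub>M borel)"
  shows "(\<integral>\<^sup>+\<omega>. f (\<omega>, B u \<omega> - B s \<omega>) \<partial>N) = (\<integral>\<^sup>+\<omega>. \<integral>\<^sup>+y. f (\<omega>, y) \<partial>gauss (u - s) \<partial>N)"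
    and "(\<lambda>\<omega>. \<integral>\<^sup>+y. f (\<omega>, y) \<partial>gauss (u - s)) \<in> borel_measurable (F s)"
proof -
  interpret g: prob_space "gauss (u - s) :: (real ^ 'd) measure" using s by (intro prob_space_gauss) simp
  let ?R = "restr_to_subalg N (F s)"
  have [measurable]: "B u \<in> borel_measurable N" "B s \<in> borel_measurable N"
    using s by (auto intro: B_measurable)
  have sR: "sets ?R = sets (F s)" by (rule sets_restr_to_subalg[OF subalg[OF s(1)]])
  have [measurable]: "(\<lambda>\<omega>. \<omega>) \<in> measurable N ?R"
    by (rule measurable_ident_subalg[OF subalg[OF s(1)]])
  have f1 [measurable]: "f \<in> borel_measurable (?R \<Otimes>\<^sub>M borel)"
    using f by (simp add: sR cong: measurable_cong_sets sets_pair_measure_cong)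
  have f2: "f \<in> borel_measurable (?R \<Otimes>\<^sub>M gauss (u - s))"
    using f by (simp add: sR cong: measurable_cong_sets sets_pair_measure_cong)
  have f3: "f \<in> borel_measurable (F s \<Otimes>\<^sub>M gauss (u - s))"
    using f by (simp cong: measurable_cong_sets sets_pair_measure_cong)
  show m: "(\<lambda>\<omega>. \<integral>\<^sup>+y. f (\<omega>, y) \<partial>gauss (u - s)) \<in> borel_measurable (F s)"
    using f3 by (rule g.borel_measurable_nn_integral_fst)
  have "(\<integral>\<^sup>+\<omega>. f (\<omega>, B u \<omega> - B s \<omega>) \<partial>N) =
      integral\<^sup>N (distr N (?R \<Otimes>\<^sub>M borel) (\<lambda>\<omega>. (\<omega>, B u \<omega> - B s \<omega>))) f"
    by (subst nn_integral_distr) auto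
  also have "\<dots> = (\<integral>\<^sup>+\<omega>. \<integral>\<^sup>+y. f (\<omega>, y) \<partial>gauss (u - s) \<partial>?R)"
    unfolding joint_distr[OF s] using f2 by (rule g.nn_integral_fst[symmetric])
  also have "\<dots> = (\<integral>\<^sup>+\<omega>. \<integral>\<^sup>+y. f (\<omega>, y) \<partial>gauss (u - s) \<partial>N)"
    using subalg[OF s(1)] m by (rule nn_integral_subalgebra2)
  finally show "(\<integral>\<^sup>+\<omega>. f (\<omega>, B u \<omega> - B s \<omega>) \<partial>N) = (\<integral>\<^sup>+\<omega>. \<integral>\<^sup>+y. f (\<omega>, y) \<partial>gauss (u - s) \<partial>N)" .
qed

lemma markov:
  assumes s: "0 \<le> s" "s < u" and H: "H \<in> borel_measurable (F s)"
    and \<theta> [measurable]: "\<theta> \<in> borel_measurable borel"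
  shows "(\<integral>\<^sup>+\<omega>. H \<omega> * \<theta> (B u \<omega>) \<partial>N) = (\<integral>\<^sup>+\<omega>. H \<omega> * (\<integral>\<^sup>+y. \<theta> (B s \<omega> + y) \<partial>gauss (u - s)) \<partial>N)"
proof -
  have [measurable]: "B s \<in> borel_measurable (F s)" using s by (intro adapted)
  note H [measurable]
  have "(\<integral>\<^sup>+\<omega>. H \<omega> * \<theta> (B u \<omega>) \<partial>N) =
      (\<integral>\<^sup>+\<omega>. (\<lambda>(\<omega>, y). H \<omega> * \<theta> (B s \<omega> + y)) (\<omega>, B u \<omega> - B s \<omega>) \<partial>N)"
    by simp
  also have "\<dots> = (\<integral>\<^sup>+\<omega>. \<integral>\<^sup>+y. (\<lambda>(\<omega>, y). H \<omega> * \<theta> (B s \<omega> + y)) (\<omega>, y) \<partial>gauss (u - s) \<partial>N)"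
    by (rule markov_joint[OF s]) measurable
  also have "\<dots> = (\<integral>\<^sup>+\<omega>. H \<omega> * (\<integral>\<^sup>+y. \<theta> (B s \<omega> + y) \<partial>gauss (u - s)) \<partial>N)"
    by (simp add: nn_integral_cmult)
  finally show ?thesis .
qed

text \<open>Iterated Markov property: given F(q n), observations at the later times q 0 > ... > q n
  act through one function of the position at q n. The times are indexed decreasingly because the
  reversed martingale will be sampled in that order.\<close>

lemma collapse:
  assumes q0: "\<And>i. i \<le> n \<Longrightarrow> 0 \<le> q i" and q: "\<And>i. i < n \<Longrightarrow> q (Suc i) < q i"
    and \<phi>: "\<And>i. i \<le> n \<Longrightarrow> \<phi> i \<in> borel_measurable borel"
  shows "\<exists>\<theta> \<in> borel_measurable borel. \<forall>H \<in> borel_measurable (F (q n)).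
    (\<integral>\<^sup>+\<omega>. H \<omega> * (\<Prod>i\<le>n. \<phi> i (B (q i) \<omega>)) \<partial>N) = (\<integral>\<^sup>+\<omega>. H \<omega> * \<theta> (B (q n) \<omega>) \<partial>N :: ennreal)"
  using assms
proof (induction n)
  case 0
  then show ?case by (auto intro!: bexI[of _ "\<phi> 0"])
next
  case (Suc n)
  have "\<exists>\<theta> \<in> borel_measurable borel. \<forall>H \<in> borel_measurable (F (q n)).
    (\<integral>\<^sup>+\<omega>. H \<omega> * (\<Prod>i\<le>n. \<phi> i (B (q i) \<omega>)) \<partial>N) = (\<integral>\<^sup>+\<omega>. H \<omega> * \<theta> (B (q n) \<omega>) \<partial>N)"
    by (rule Suc.IH) (use Suc.prems in auto)
  then obtain \<theta> where \<theta> [measurable]: "\<theta> \<in> borel_measurable borel"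
    and eq: "\<And>H. H \<in> borel_measurable (F (q n)) \<Longrightarrow>
      (\<integral>\<^sup>+\<omega>. H \<omega> * (\<Prod>i\<le>n. \<phi> i (B (q i) \<omega>)) \<partial>N) = (\<integral>\<^sup>+\<omega>. H \<omega> * \<theta> (B (q n) \<omega>) \<partial>N)"
    by blast
  let ?s = "q (Suc n)" and ?u = "q n"
  have s: "0 \<le> ?s" "?s < ?u" using Suc.prems by auto
  interpret g: prob_space "gauss (?u - ?s) :: (real ^ 'd) measure" using s by (intro prob_space_gauss) simp
  have \<phi>' [measurable]: "\<phi> (Suc n) \<in> borel_measurable borel" using Suc.prems by simp
  have [measurable]: "B ?s \<in> borel_measurable (F ?s)" using s by (intro adapted)
  show ?case
  proof (intro bexI[of _ "\<lambda>x. \<phi> (Suc n) x * (\<integral>\<^sup>+y. \<theta> (x + y) \<partial>gauss (?u - ?s))"] ballI)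
    fix H :: "'a \<Rightarrow> ennreal" assume H [measurable]: "H \<in> borel_measurable (F ?s)"
    have H': "(\<lambda>\<omega>. H \<omega> * \<phi> (Suc n) (B ?s \<omega>)) \<in> borel_measurable (F ?s)"
      by measurable
    have "(\<integral>\<^sup>+\<omega>. H \<omega> * (\<Prod>i\<le>Suc n. \<phi> i (B (q i) \<omega>)) \<partial>N) =
       (\<integral>\<^sup>+\<omega>. (H \<omega> * \<phi> (Suc n) (B ?s \<omega>)) * (\<Prod>i\<le>n. \<phi> i (B (q i) \<omega>)) \<partial>N)"
      by (simp add: ac_simps)
    also have "\<dots> = (\<integral>\<^sup>+\<omega>. (H \<omega> * \<phi> (Suc n) (B ?s \<omega>)) * \<theta> (B ?u \<omega>) \<partial>N)"
      using s by (intro eq F_mono[OF _ _ H']) auto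
    also have "\<dots> = (\<integral>\<^sup>+\<omega>. (H \<omega> * \<phi> (Suc n) (B ?s \<omega>)) * (\<integral>\<^sup>+y. \<theta> (B ?s \<omega> + y) \<partial>gauss (?u - ?s)) \<partial>N)"
      by (rule markov[OF s H']) measurable
    finally show "(\<integral>\<^sup>+\<omega>. H \<omega> * (\<Prod>i\<le>Suc n. \<phi> i (B (q i) \<omega>)) \<partial>N) =
      (\<integral>\<^sup>+\<omega>. H \<omega> * (\<phi> (Suc n) (B ?s \<omega>) * (\<integral>\<^sup>+y. \<theta> (B ?s \<omega> + y) \<partial>gauss (?u - ?s))) \<partial>N)"
      by (simp add: ac_simps)
  qed measurable
qed

text \<open>Fubini with \<open>lborel\<close> needs all real times, so the path is extended to
  negative times by its value at 0. Truncation at \<open>k\<close> brings in a compact time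
  interval.\<close>

lemma measurable_path_pair:
  "(\<lambda>(s, \<omega>). B (max 0 s) \<omega>) \<in> borel_measurable (borel \<Otimes>\<^sub>M N)"
proof (rule borel_measurable_LIMSEQ_metric)
  fix k :: nat
  show "(\<lambda>(s, \<omega>). B (max 0 (min (real k) s)) \<omega>) \<in> borel_measurable (borel \<Otimes>\<^sub>M N)"
  proof -
    have "(\<lambda>x. (\<lambda>r (s, \<omega>). B r \<omega>) (max 0 (min (real k) (fst x))) x) \<in> borel_measurable (borel \<Otimes>\<^sub>M N)"
    proof (rule measurable_random_time[where s="real k"])
      fix r :: real assume "r \<in> {0..real k}"
      then have [measurable]: "B r \<in> borel_measurable N" by (intro B_measurable) auto
      show "(\<lambda>(s, \<omega>). B r \<omega>) \<in> borel_measurable (borel \<Otimes>\<^sub>M N)" by measurable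
    next
      fix x :: "real \<times> 'a" assume "x \<in> space (borel \<Otimes>\<^sub>M N)"
      then show "continuous_on {0..real k} (\<lambda>r. (case x of (s, \<omega>) \<Rightarrow> B r \<omega>))"
        by (auto simp: space_pair_measure intro!: continuous_on_subset[OF cont])
    qed auto
    then show ?thesis by (simp add: case_prod_beta')
  qed
next
  fix x :: "real \<times> 'a" assume "x \<in> space (borel \<Otimes>\<^sub>M N)"
  obtain m :: nat where m: "fst x \<le> real m" using real_arch_simple by blast
  have "min (real k) (fst x) = fst x" if "m \<le> k" for k
    using m that by (simp add: min_def)
  then have "\<forall>\<^sub>F k in sequentially. (\<lambda>(s, \<omega>). B (max 0 (min (real k) s)) \<omega>) x = (\<lambda>(s, \<omega>). B (max 0 s) \<omega>) x"
    by (auto simp: eventually_sequentially case_prod_beta intro!: exI[of _ m])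
  then show "(\<lambda>k. (\<lambda>(s, \<omega>). B (max 0 (min (real k) s)) \<omega>) x) \<longlonglongrightarrow> (\<lambda>(s, \<omega>). B (max 0 s) \<omega>) x"
    by (rule tendsto_eventually)
qed

end

subsection \<open>The time-reversed martingale\<close>

text \<open>
  \<open>sphere_R d s x\<close> is \<open>c / p s x\<close> for the Brownian transition density \<open>p\<close> and the constant
  \<open>c = sphere_c d\<close>. It is normalised so that the boundary \<open>|x|\<^sup>2 = \<psi> s\<close> is its level set \<open>1\<close>.
\<close>

definition sphere_R :: "nat \<Rightarrow> real \<Rightarrow> 'b::real_normed_vector \<Rightarrow> real" where
  "sphere_R d s x = (s / sphere_a d) powr (real d / 2) * exp ((norm x)\<^sup>2 / (2 * s))"

definition sphere_c :: "nat \<Rightarrow> real" where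
  "sphere_c d = (2 * pi * sphere_a d) powr (- real d / 2)"

lemma sphere_a_pos: "d \<ge> 1 \<Longrightarrow> 0 < sphere_a d"
proof -
  have "0 < 1 + 2 / real d" by (simp add: add_pos_nonneg)
  then show ?thesis by (simp add: sphere_a_def)
qed

lemma sphere_R_pos: "0 < s \<Longrightarrow> d \<ge> 1 \<Longrightarrow> 0 < sphere_R d s x"
  using sphere_a_pos[of d] by (simp add: sphere_R_def)

lemma sphere_R_measurable [measurable]:
  "(\<lambda>x::'b::{real_normed_vector, second_countable_topology}. sphere_R d s x) \<in> borel_measurable borel"
  unfolding sphere_R_def by measurable

text \<open>Multiplying the logarithm of \<open>sphere_R\<close> by 2 s gives exactly |x|^2 -
  psi(s).\<close>

lemma sphere_R_gt_1_iff:
  assumes "0 < s" "d \<ge> 1"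
  shows "1 < sphere_R d s x \<longleftrightarrow> sphere_psi d s < (norm x)\<^sup>2"
proof -
  have a: "0 < sphere_a d" using assms by (simp add: sphere_a_pos)
  have l: "ln (sphere_R d s x) = real d / 2 * ln (s / sphere_a d) + (norm x)\<^sup>2 / (2 * s)"
    using assms a by (simp add: sphere_R_def ln_mult_pos ln_powr)
  have "1 < sphere_R d s x \<longleftrightarrow> 0 < ln (sphere_R d s x)"
    using sphere_R_pos[OF assms, of x] by (simp add: ln_gt_zero_iff)
  also have "\<dots> \<longleftrightarrow> 0 < 2 * s * ln (sphere_R d s x)"
    using assms by (simp add: zero_less_mult_iff)
  also have "2 * s * ln (sphere_R d s x) = (norm x)\<^sup>2 - sphere_psi d s"
    using assms a unfolding l by (simp add: sphere_psi_def ln_div field_simps)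
  finally show ?thesis by simp
qed

lemma gauss_density_R:
  fixes x :: "real ^ 'd::finite"
  assumes r: "0 < r"
  shows "(\<Prod>j\<in>UNIV. normal_density 0 (sqrt r) (x $ j)) * sphere_R CARD('d) r x = sphere_c CARD('d)"
proof -
  let ?d = "CARD('d)"
  have a: "0 < sphere_a ?d" by (simp add: sphere_a_pos)
  have "(\<Prod>j\<in>UNIV. normal_density 0 (sqrt r) (x $ j)) =
      (\<Prod>j\<in>(UNIV::'d set). 1 / sqrt (2 * pi * r)) * (\<Prod>j\<in>UNIV. exp (- (x $ j)\<^sup>2 / (2 * r)))"
  proof -
    have "normal_density 0 (sqrt r) z = 1 / sqrt (2 * pi * r) * exp (- z\<^sup>2 / (2 * r))" for z
      using r by (simp add: normal_density_def)
    then show ?thesis by (simp only: prod.distrib)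
  qed
  also have "(\<Prod>j\<in>(UNIV::'d set). 1 / sqrt (2 * pi * r)) = (2 * pi * r) powr (- real ?d / 2)"
  proof -
    have "1 / sqrt (2 * pi * r) = (2 * pi * r) powr (- 1 / 2)"
      using r by (simp add: powr_minus_divide powr_half_sqrt[symmetric])
    then show ?thesis using r by (simp add: powr_power)
  qed
  also have "(\<Prod>j\<in>UNIV. exp (- (x $ j)\<^sup>2 / (2 * r))) = exp (- (norm x)\<^sup>2 / (2 * r))"
    by (simp add: norm_power2_vec exp_sum[symmetric] sum_divide_distrib sum_negf)
  finally have p: "(\<Prod>j\<in>UNIV. normal_density 0 (sqrt r) (x $ j)) =
     (2 * pi * r) powr (- real ?d / 2) * exp (- (norm x)\<^sup>2 / (2 * r))" .
  have "(2 * pi * r) powr (- real ?d / 2) * (r / sphere_a ?d) powr (real ?d / 2) =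
      (2 * pi * r) powr (- real ?d / 2) * (sphere_a ?d / r) powr (- real ?d / 2)"
    using r a by (simp add: powr_minus powr_divide field_simps)
  also have "\<dots> = sphere_c ?d"
    using r a by (simp add: sphere_c_def powr_mult[symmetric] mult.assoc)
  finally show ?thesis
    by (simp add: p sphere_R_def exp_minus field_simps)
qed

text \<open>\<open>sphere_R\<close> cancels the Gaussian density up to a constant independent of
  \<open>r\<close>: weighted by it, the position at every time is distributed like the same multiple
  of Lebesgue measure.\<close>

lemma nn_integral_gauss_R:
  fixes f :: "real ^ 'd::finite \<Rightarrow> ennreal"
  assumes r: "0 < r" and [measurable]: "f \<in> borel_measurable borel"
  shows "(\<integral>\<^sup>+x. ennreal (sphere_R CARD('d) r x) * f x \<partial>gauss r) =
    ennreal (sphere_c CARD('d)) * (\<integral>\<^sup>+x. f x \<partial>lborel)"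
proof -
  have "(\<integral>\<^sup>+x. ennreal (sphere_R CARD('d) r x) * f x \<partial>gauss r) =
      (\<integral>\<^sup>+x. ennreal (\<Prod>j\<in>UNIV. normal_density 0 (sqrt r) (x $ j)) * (ennreal (sphere_R CARD('d) r x) * f x) \<partial>lborel)"
    by (rule nn_integral_gauss) measurable
  also have "\<dots> = (\<integral>\<^sup>+x. ennreal (sphere_c CARD('d)) * f x \<partial>lborel)"
  proof (intro nn_integral_cong)
    fix x :: "real^'d"
    have "ennreal (\<Prod>j\<in>UNIV. normal_density 0 (sqrt r) (x $ j)) * ennreal (sphere_R CARD('d) r x) =
        ennreal (sphere_c CARD('d))"
      unfolding gauss_density_R[OF r, of x, symmetric]
      by (rule ennreal_mult'[symmetric]) (simp add: prod_nonneg)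
    then show "ennreal (\<Prod>j\<in>UNIV. normal_density 0 (sqrt r) (x $ j)) * (ennreal (sphere_R CARD('d) r x) * f x) =
        ennreal (sphere_c CARD('d)) * f x"
      by (simp only: mult.assoc[symmetric])
  qed
  finally show ?thesis by (simp add: nn_integral_cmult)
qed

text \<open>Translation invariance and Tonelli. With \<open>g\<close> constant it is the invariance
  of Lebesgue measure under convolution; with \<open>g\<close> the indicator of large increments it
  yields the overshoot bound.\<close>

lemma nn_integral_translate_lborel:
  fixes g \<theta> :: "'b::euclidean_space \<Rightarrow> ennreal"
  assumes "sigma_finite_measure \<mu>" and [measurable_cong]: "sets \<mu> = sets borel"
    and [measurable]: "g \<in> borel_measurable borel" "\<theta> \<in> borel_measurable borel"
  shows "(\<integral>\<^sup>+x. \<integral>\<^sup>+y. g y * \<theta> (x + y) \<partial>\<mu> \<partial>lborel) = (\<integral>\<^sup>+y. g y \<partial>\<mu>) * (\<integral>\<^sup>+x. \<theta> x \<partial>lborel)"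
proof -
  interpret \<mu>: sigma_finite_measure \<mu> by fact
  interpret pair_sigma_finite lborel \<mu> ..
  have t: "(\<integral>\<^sup>+x. \<theta> (x + y) \<partial>lborel) = (\<integral>\<^sup>+x. \<theta> x \<partial>lborel)" for y
  proof -
    have "(\<integral>\<^sup>+x. \<theta> x \<partial>lborel) = (\<integral>\<^sup>+x. \<theta> x \<partial>distr lborel borel ((+) y))"
      by (simp only: lborel_distr_plus)
    also have "\<dots> = (\<integral>\<^sup>+x. \<theta> (y + x) \<partial>lborel)"
      by (rule nn_integral_distr) auto
    finally show ?thesis by (simp add: add.commute)
  qed
  have "(\<integral>\<^sup>+x. \<integral>\<^sup>+y. g y * \<theta> (x + y) \<partial>\<mu> \<partial>lborel) = (\<integral>\<^sup>+y. \<integral>\<^sup>+x. g y * \<theta> (x + y) \<partial>lborel \<partial>\<mu>)"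
    by (rule Fubini'[symmetric]) measurable
  also have "\<dots> = (\<integral>\<^sup>+y. g y * (\<integral>\<^sup>+x. \<theta> x \<partial>lborel) \<partial>\<mu>)"
  proof (intro nn_integral_cong)
    fix y
    have "(\<integral>\<^sup>+x. g y * \<theta> (x + y) \<partial>lborel) = g y * (\<integral>\<^sup>+x. \<theta> (x + y) \<partial>lborel)"
      by (rule nn_integral_cmult) measurable
    then show "(\<integral>\<^sup>+x. g y * \<theta> (x + y) \<partial>lborel) = g y * (\<integral>\<^sup>+x. \<theta> x \<partial>lborel)"
      by (simp only: t)
  qed
  also have "\<dots> = (\<integral>\<^sup>+y. g y \<partial>\<mu>) * (\<integral>\<^sup>+x. \<theta> x \<partial>lborel)"
    by (rule nn_integral_multc) measurable
  finally show ?thesis .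
qed

text \<open>If |y| >= \<kappa>, some squared coordinate is at least \<kappa>^2 / d; then use fourth
  moments. The power h^2 matters: summed over a grid of mesh h it still tends to 0.\<close>

lemma gauss_tail:
  assumes h: "0 < h" and \<kappa>: "0 < \<kappa>"
  shows "emeasure (gauss h) {y :: real ^ 'd::finite. \<kappa> \<le> norm y} \<le> ennreal (3 * real CARD('d) ^ 3 / \<kappa> ^ 4 * h\<^sup>2)"
proof -
  let ?d = "real CARD('d)"
  have "?d > 0" by simp
  have pt: "indicator {y :: real ^ 'd. \<kappa> \<le> norm y} y \<le> ennreal (\<Sum>j\<in>UNIV. ?d\<^sup>2 / \<kappa> ^ 4 * (y $ j) ^ 4)" for y
  proof (cases "\<kappa> \<le> norm y")
    case True
    then have "\<kappa>\<^sup>2 \<le> (\<Sum>j\<in>UNIV. (y $ j)\<^sup>2)"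
      using \<kappa> unfolding norm_power2_vec[symmetric] by (intro power_mono) auto
    have "\<exists>j. \<kappa>\<^sup>2 / ?d \<le> (y $ j)\<^sup>2"
    proof (rule ccontr)
      assume "\<not> ?thesis"
      then have "(\<Sum>j\<in>UNIV. (y $ j)\<^sup>2) < ?d * (\<kappa>\<^sup>2 / ?d)"
        by (intro sum_bounded_above_strict) (auto simp: not_le)
      with \<open>\<kappa>\<^sup>2 \<le> (\<Sum>j\<in>UNIV. (y $ j)\<^sup>2)\<close> show False by simp
    qed
    then obtain j where "\<kappa>\<^sup>2 / ?d \<le> (y $ j)\<^sup>2" by blast
    then have "(\<kappa>\<^sup>2 / ?d)\<^sup>2 \<le> ((y $ j)\<^sup>2)\<^sup>2"
      using \<kappa> by (intro power_mono) auto
    then have "1 \<le> ?d\<^sup>2 / \<kappa> ^ 4 * (y $ j) ^ 4"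
      using \<kappa> by (simp add: field_simps)
    also have "\<dots> \<le> (\<Sum>j\<in>UNIV. ?d\<^sup>2 / \<kappa> ^ 4 * (y $ j) ^ 4)"
      using \<kappa> by (intro member_le_sum) auto
    finally show ?thesis using True by simp
  qed simp
  have "emeasure (gauss h) {y :: real ^ 'd. \<kappa> \<le> norm y} \<le>
      (\<integral>\<^sup>+y. ennreal (\<Sum>j\<in>UNIV. ?d\<^sup>2 / \<kappa> ^ 4 * (y $ j) ^ 4) \<partial>(gauss h :: (real ^ 'd) measure))"
  proof -
    have "emeasure (gauss h) {y :: real ^ 'd. \<kappa> \<le> norm y} =
        (\<integral>\<^sup>+y. indicator {y. \<kappa> \<le> norm y} y \<partial>(gauss h :: (real ^ 'd) measure))"
      by (rule nn_integral_indicator[symmetric]) simp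
    also have "\<dots> \<le> (\<integral>\<^sup>+y. ennreal (\<Sum>j\<in>UNIV. ?d\<^sup>2 / \<kappa> ^ 4 * (y $ j) ^ 4) \<partial>(gauss h :: (real ^ 'd) measure))"
      by (intro nn_integral_mono pt)
    finally show ?thesis .
  qed
  also have "has_bochner_integral (gauss h) (\<lambda>y :: real ^ 'd. \<Sum>j\<in>UNIV. ?d\<^sup>2 / \<kappa> ^ 4 * (y $ j) ^ 4)
      (\<Sum>j\<in>(UNIV :: 'd set). ?d\<^sup>2 / \<kappa> ^ 4 * (3 * h\<^sup>2))"
    using gauss_moments(4)[OF h] by (intro has_bochner_integral_sum has_bochner_integral_mult_right) auto
  then have "(\<integral>\<^sup>+y. ennreal (\<Sum>j\<in>UNIV. ?d\<^sup>2 / \<kappa> ^ 4 * (y $ j) ^ 4) \<partial>(gauss h :: (real ^ 'd) measure)) =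
      ennreal (\<Sum>j\<in>(UNIV :: 'd set). ?d\<^sup>2 / \<kappa> ^ 4 * (3 * h\<^sup>2))"
    using \<kappa> by (subst nn_integral_eq_integral) (auto simp: has_bochner_integral_iff intro!: sum_nonneg)
  also have "(\<Sum>j\<in>(UNIV :: 'd set). ?d\<^sup>2 / \<kappa> ^ 4 * (3 * h\<^sup>2)) = 3 * ?d ^ 3 / \<kappa> ^ 4 * h\<^sup>2"
    by (simp add: power3_eq_cube power2_eq_square)
  finally show ?thesis .
qed

definition exit_time :: "(real \<Rightarrow> 'a \<Rightarrow> real ^ 'd::finite) \<Rightarrow> 'a \<Rightarrow> real" where
  "exit_time B \<omega> = Inf {v. 0 < v \<and> sphere_psi CARD('d) v < (norm (B v \<omega>))\<^sup>2}"

lemma sphere_psi_neg: "d \<ge> 1 \<Longrightarrow> sphere_a d < v \<Longrightarrow> sphere_psi d v < 0"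
  using sphere_a_pos[of d] by (auto simp: sphere_psi_def mult_less_0_iff ln_less_zero_iff)

lemma exit_set:
  "{v. 0 < v \<and> sphere_psi CARD('d) v < (norm (B v \<omega> :: real ^ 'd::finite))\<^sup>2} \<noteq> {}"
  "bdd_below {v. 0 < v \<and> sphere_psi CARD('d) v < (norm (B v \<omega> :: real ^ 'd::finite))\<^sup>2}"
proof -
  have "sphere_a CARD('d) + 1 \<in> {v. 0 < v \<and> sphere_psi CARD('d) v < (norm (B v \<omega> :: real ^ 'd))\<^sup>2}"
    using sphere_psi_neg[of "CARD('d)" "sphere_a CARD('d) + 1"] sphere_a_pos[of "CARD('d)"]
    by (auto intro: less_le_trans)
  then show "{v. 0 < v \<and> sphere_psi CARD('d) v < (norm (B v \<omega> :: real ^ 'd))\<^sup>2} \<noteq> {}" by blast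
  show "bdd_below {v. 0 < v \<and> sphere_psi CARD('d) v < (norm (B v \<omega> :: real ^ 'd::finite))\<^sup>2}"
    by (rule bdd_belowI[of _ 0]) auto
qed

lemma exit_time_less_iff:
  "exit_time B \<omega> < s \<longleftrightarrow> (\<exists>v. 0 < v \<and> v < s \<and> 1 < sphere_R CARD('d) v (B v \<omega> :: real ^ 'd::finite))"
  unfolding exit_time_def using cInf_less_iff[OF exit_set[of B \<omega>]] sphere_R_gt_1_iff[of _ "CARD('d)"] by fastforce

lemma exit_time_nonneg: "0 \<le> exit_time B \<omega>"
  unfolding exit_time_def using exit_set by (intro cInf_greatest) auto

lemma exit_time_le: "exit_time (B :: real \<Rightarrow> 'a \<Rightarrow> real ^ 'd::finite) \<omega> \<le> sphere_a CARD('d)"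
proof (rule field_le_epsilon)
  fix e :: real assume "0 < e"
  then have "exit_time B \<omega> \<le> sphere_a CARD('d) + e"
    unfolding exit_time_def
    using sphere_psi_neg[of "CARD('d)" "sphere_a CARD('d) + e"] sphere_a_pos[of "CARD('d)"]
    by (intro cInf_lower exit_set) (auto intro: less_le_trans)
  then show "exit_time B \<omega> \<le> sphere_a CARD('d) + e" .
qed

lemma continuous_on_sphere_R:
  fixes f :: "'t::topological_space \<Rightarrow> 'b::real_normed_vector"
  assumes "d \<ge> 1" "continuous_on S g" "continuous_on S f" "\<And>x. x \<in> S \<Longrightarrow> 0 < g x"
  shows "continuous_on S (\<lambda>x. sphere_R d (g x) (f x))"
  unfolding sphere_R_def using assms sphere_a_pos[of d]
  by (auto intro!: continuous_intros simp: less_imp_neq[symmetric])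

locale brownian0 = brownian N F B
  for N :: "'a measure" and F and B :: "real \<Rightarrow> 'a \<Rightarrow> real ^ 'd::finite" +
  assumes B0: "\<omega> \<in> space N \<Longrightarrow> B 0 \<omega> = 0"
begin

lemma law: "0 < s \<Longrightarrow> distr N borel (B s) = gauss s"
proof (rule measure_eqI)
  fix E assume s: "0 < s" and "E \<in> sets (distr N borel (B s))"
  then have E: "E \<in> sets borel" by simp
  have "{\<omega> \<in> space N. B s \<omega> - B 0 \<omega> \<in> E} = B s -` E \<inter> space N"
    by (auto simp: B0)
  moreover have "space N \<in> sets (F 0)"
    using space_F[of 0] sets.top[of "F 0"] by simp
  ultimately show "emeasure (distr N borel (B s)) E = emeasure (gauss s) E"
    using indep[of 0 s "space N" E] s E B_measurable[of s]
    by (simp add: emeasure_distr emeasure_space_1 Int_absorb2 Int_commute)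
qed simp

lemma nn_integral_law:
  "0 < s \<Longrightarrow> f \<in> borel_measurable borel \<Longrightarrow> (\<integral>\<^sup>+\<omega>. f (B s \<omega>) \<partial>N) = (\<integral>\<^sup>+x. f x \<partial>gauss s)"
  using B_measurable[of s] by (simp add: law[symmetric] nn_integral_distr)

lemma two_time:
  assumes r: "0 < r" "r < u" and [measurable]: "f \<in> borel_measurable borel" "\<theta> \<in> borel_measurable borel"
  shows "(\<integral>\<^sup>+\<omega>. ennreal (sphere_R CARD('d) r (B r \<omega>)) * f (B r \<omega>) * \<theta> (B u \<omega>) \<partial>N) =
    ennreal (sphere_c CARD('d)) * (\<integral>\<^sup>+x. \<integral>\<^sup>+y. f x * \<theta> (x + y) \<partial>gauss (u - r) \<partial>lborel)"
proof -
  interpret g: prob_space "gauss (u - r) :: (real ^ 'd) measure" using r by (intro prob_space_gauss) simp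
  have [measurable]: "B r \<in> borel_measurable (F r)" using r by (intro adapted) simp
  have "(\<integral>\<^sup>+\<omega>. ennreal (sphere_R CARD('d) r (B r \<omega>)) * f (B r \<omega>) * \<theta> (B u \<omega>) \<partial>N) =
      (\<integral>\<^sup>+\<omega>. ennreal (sphere_R CARD('d) r (B r \<omega>)) * f (B r \<omega>) * (\<integral>\<^sup>+y. \<theta> (B r \<omega> + y) \<partial>gauss (u - r)) \<partial>N)"
    using r by (intro markov) auto
  also have "\<dots> = (\<integral>\<^sup>+x. ennreal (sphere_R CARD('d) r x) * f x * (\<integral>\<^sup>+y. \<theta> (x + y) \<partial>gauss (u - r)) \<partial>gauss r)"
    using r by (intro nn_integral_law) auto
  also have "\<dots> = (\<integral>\<^sup>+x. ennreal (sphere_R CARD('d) r x) * (\<integral>\<^sup>+y. f x * \<theta> (x + y) \<partial>gauss (u - r)) \<partial>gauss r)"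
    by (simp add: nn_integral_cmult mult.assoc)
  also have "\<dots> = ennreal (sphere_c CARD('d)) * (\<integral>\<^sup>+x. \<integral>\<^sup>+y. f x * \<theta> (x + y) \<partial>gauss (u - r) \<partial>lborel)"
    using r(1) by (intro nn_integral_gauss_R) measurable
  finally show ?thesis .
qed

text \<open>The test products depend on what reversed time has already seen. By
  \<open>collapse\<close> they reduce to a function \<theta> of the position at \<open>q n\<close>,
  and then both sides equal \<open>sphere_c\<close> times the Lebesgue integral of \<theta>.\<close>

lemma reverse_martingale:
  assumes q0: "\<And>i. i \<le> Suc n \<Longrightarrow> 0 < q i" and q: "\<And>i. i < Suc n \<Longrightarrow> q (Suc i) < q i"
    and \<phi>: "\<And>i. i \<le> n \<Longrightarrow> \<phi> i \<in> borel_measurable borel"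
  shows "(\<integral>\<^sup>+\<omega>. ennreal (sphere_R CARD('d) (q (Suc n)) (B (q (Suc n)) \<omega>)) * (\<Prod>i\<le>n. \<phi> i (B (q i) \<omega>)) \<partial>N) =
    (\<integral>\<^sup>+\<omega>. ennreal (sphere_R CARD('d) (q n) (B (q n) \<omega>)) * (\<Prod>i\<le>n. \<phi> i (B (q i) \<omega>)) \<partial>N :: ennreal)"
proof -
  have "\<exists>\<theta> \<in> borel_measurable borel. \<forall>H \<in> borel_measurable (F (q n)).
    (\<integral>\<^sup>+\<omega>. H \<omega> * (\<Prod>i\<le>n. \<phi> i (B (q i) \<omega>)) \<partial>N) = (\<integral>\<^sup>+\<omega>. H \<omega> * \<theta> (B (q n) \<omega>) \<partial>N)"
    using assms by (intro collapse) (auto simp: less_imp_le)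
  then obtain \<theta> where \<theta> [measurable]: "\<theta> \<in> borel_measurable borel"
    and eq: "\<And>H. H \<in> borel_measurable (F (q n)) \<Longrightarrow>
      (\<integral>\<^sup>+\<omega>. H \<omega> * (\<Prod>i\<le>n. \<phi> i (B (q i) \<omega>)) \<partial>N) = (\<integral>\<^sup>+\<omega>. H \<omega> * \<theta> (B (q n) \<omega>) \<partial>N)"
    by blast
  let ?r = "q (Suc n)" and ?u = "q n"
  have r: "0 < ?r" "?r < ?u" using assms by auto
  interpret g: prob_space "gauss (?u - ?r) :: (real ^ 'd) measure" using r by (intro prob_space_gauss) simp
  have m: "(\<lambda>\<omega>. ennreal (sphere_R CARD('d) s (B s \<omega>))) \<in> borel_measurable (F ?u)" if "0 < s" "s \<le> ?u" for s
  proof -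
    have [measurable]: "B s \<in> borel_measurable (F ?u)" using that by (intro F_mono[OF _ _ adapted]) auto
    show ?thesis by measurable
  qed
  have "(\<integral>\<^sup>+\<omega>. ennreal (sphere_R CARD('d) ?r (B ?r \<omega>)) * (\<Prod>i\<le>n. \<phi> i (B (q i) \<omega>)) \<partial>N) =
      (\<integral>\<^sup>+\<omega>. ennreal (sphere_R CARD('d) ?r (B ?r \<omega>)) * 1 * \<theta> (B ?u \<omega>) \<partial>N)"
    using r by (subst eq) (auto intro!: m)
  also have "\<dots> = ennreal (sphere_c CARD('d)) * (\<integral>\<^sup>+x. \<integral>\<^sup>+y. 1 * \<theta> (x + y) \<partial>gauss (?u - ?r) \<partial>lborel)"
    using r by (intro two_time) auto
  also have "\<dots> = ennreal (sphere_c CARD('d)) * (\<integral>\<^sup>+x. \<theta> x \<partial>lborel)"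
    using g.emeasure_space_1 g.sigma_finite_measure_axioms
    by (subst nn_integral_translate_lborel) (auto simp: nn_integral_const)
  also have "\<dots> = (\<integral>\<^sup>+x. ennreal (sphere_R CARD('d) ?u x) * \<theta> x \<partial>gauss ?u)"
    using r by (intro nn_integral_gauss_R[symmetric]) auto
  also have "\<dots> = (\<integral>\<^sup>+\<omega>. ennreal (sphere_R CARD('d) ?u (B ?u \<omega>)) * \<theta> (B ?u \<omega>) \<partial>N)"
    using r by (intro nn_integral_law[symmetric]) auto
  also have "\<dots> = (\<integral>\<^sup>+\<omega>. ennreal (sphere_R CARD('d) ?u (B ?u \<omega>)) * (\<Prod>i\<le>n. \<phi> i (B (q i) \<omega>)) \<partial>N)"
    using r by (subst eq) (auto intro!: m)
  finally show ?thesis .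
qed

subsubsection \<open>Optional stopping of the reversed martingale on a grid\<close>

text \<open>The path starts in \<open>A\<close> and the reversed martingale stays below the level
  \<open>l\<close> down to time \<open>q n\<close>. The product form is what
  \<open>reverse_martingale\<close> accepts as a test function; index 0 tests \<open>A\<close>
  instead of the level.\<close>

definition surv :: "(nat \<Rightarrow> real) \<Rightarrow> (real ^ 'd) set \<Rightarrow> real \<Rightarrow> nat \<Rightarrow> 'a \<Rightarrow> ennreal" where
  "surv q A l n \<omega> = (\<Prod>i\<le>n. indicator (if i = 0 then A else {x. sphere_R CARD('d) (q i) x < l}) (B (q i) \<omega>))"

definition hit :: "(nat \<Rightarrow> real) \<Rightarrow> (real ^ 'd) set \<Rightarrow> real \<Rightarrow> nat \<Rightarrow> 'a \<Rightarrow> ennreal" where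
  "hit q A l i \<omega> = surv q A l i \<omega> * indicator {x. l \<le> sphere_R CARD('d) (q (Suc i)) x} (B (q (Suc i)) \<omega>)"

lemma surv_split: "surv q A l i \<omega> = hit q A l i \<omega> + surv q A l (Suc i) \<omega>"
  by (auto simp: hit_def surv_def indicator_def)

lemma hit_sum: "(\<Sum>i<n. hit q A l i \<omega>) + surv q A l n \<omega> = indicator A (B (q 0) \<omega>)"
proof (induction n)
  case 0 show ?case by (simp add: surv_def)
next
  case (Suc n)
  then show ?case by (simp add: surv_split[of q A l n] add.assoc)
qed

lemma surv_measurable:
  assumes "\<And>i. i \<le> n \<Longrightarrow> 0 < q i" "A \<in> sets borel" shows "surv q A l n \<in> borel_measurable N"
proof -
  have [measurable]: "i \<le> n \<Longrightarrow> B (q i) \<in> borel_measurable N" for i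
    using assms by (intro B_measurable) (simp add: less_imp_le)
  have "(if i = 0 then A else {x. sphere_R CARD('d) (q i) x < l}) \<in> sets borel" for i
    using assms by auto
  then show ?thesis unfolding surv_def[abs_def]
    by (intro borel_measurable_prod_ennreal measurable_compose[OF _ borel_measurable_indicator, of _ _ borel]) auto
qed

lemma hit_measurable:
  assumes "\<And>i. i \<le> Suc n \<Longrightarrow> 0 < q i" and [measurable]: "A \<in> sets borel"
  shows "hit q A l n \<in> borel_measurable N"
proof -
  have [measurable]: "surv q A l n \<in> borel_measurable N" using assms by (intro surv_measurable) auto
  have [measurable]: "B (q (Suc n)) \<in> borel_measurable N"
    using assms by (intro B_measurable) (simp add: less_imp_le)
  show ?thesis unfolding hit_def[abs_def] by measurable
qed

text \<open>Optional stopping on a finite grid: the mass alive at \<open>q n\<close> keeps its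
  expectation one step further and is then split into the part that reaches the level and the part
  that survives.\<close>

lemma ville_sum:
  assumes q0: "\<And>i. i \<le> n \<Longrightarrow> 0 < q i" and q: "\<And>i. i < n \<Longrightarrow> q (Suc i) < q i"
    and A [measurable]: "A \<in> sets borel"
  shows "(\<integral>\<^sup>+\<omega>. ennreal (sphere_R CARD('d) (q 0) (B (q 0) \<omega>)) * indicator A (B (q 0) \<omega>) \<partial>N) =
    (\<Sum>i<n. \<integral>\<^sup>+\<omega>. ennreal (sphere_R CARD('d) (q (Suc i)) (B (q (Suc i)) \<omega>)) * hit q A l i \<omega> \<partial>N) +
    (\<integral>\<^sup>+\<omega>. ennreal (sphere_R CARD('d) (q n) (B (q n) \<omega>)) * surv q A l n \<omega> \<partial>N)"
  using assms(1,2)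
proof (induction n)
  case 0 show ?case by (simp add: surv_def)
next
  case (Suc n)
  have [measurable]: "surv q A l (Suc n) \<in> borel_measurable N" "hit q A l n \<in> borel_measurable N"
    using Suc.prems A by (intro surv_measurable hit_measurable; simp)+
  have [measurable]: "B (q (Suc n)) \<in> borel_measurable N"
    using Suc.prems by (intro B_measurable) (simp add: less_imp_le)
  have "(\<integral>\<^sup>+\<omega>. ennreal (sphere_R CARD('d) (q n) (B (q n) \<omega>)) * surv q A l n \<omega> \<partial>N) =
     (\<integral>\<^sup>+\<omega>. ennreal (sphere_R CARD('d) (q (Suc n)) (B (q (Suc n)) \<omega>)) * surv q A l n \<omega> \<partial>N)"
    unfolding surv_def using Suc.prems by (intro reverse_martingale[symmetric]) auto
  also have "\<dots> = (\<integral>\<^sup>+\<omega>. ennreal (sphere_R CARD('d) (q (Suc n)) (B (q (Suc n)) \<omega>)) * hit q A l n \<omega> \<partial>N) +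
      (\<integral>\<^sup>+\<omega>. ennreal (sphere_R CARD('d) (q (Suc n)) (B (q (Suc n)) \<omega>)) * surv q A l (Suc n) \<omega> \<partial>N)"
    unfolding surv_split[of q A l n] distrib_left by (rule nn_integral_add) measurable
  finally show ?case using Suc by (simp add: add.assoc)
qed

subsubsection \<open>The law of the exit time\<close>

lemma exit_open:
  assumes \<omega>: "\<omega> \<in> space N" and r: "0 < r" "1 < sphere_R CARD('d) r (B r \<omega>)"
  obtains e where "0 < e" "\<And>v. \<bar>v - r\<bar> < e \<Longrightarrow> 0 < v \<and> 1 < sphere_R CARD('d) v (B v \<omega>)"
proof -
  have "continuous_on {0<..} (\<lambda>v. sphere_R CARD('d) v (B v \<omega>))"
    by (intro continuous_on_sphere_R continuous_on_subset[OF cont[OF \<omega>]]) (auto intro: continuous_intros)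
  then have "isCont (\<lambda>v. sphere_R CARD('d) v (B v \<omega>)) r"
    using r by (simp add: continuous_on_eq_continuous_at)
  then have "\<forall>\<^sub>F v in at r. 1 < sphere_R CARD('d) v (B v \<omega>)"
    using r by (intro order_tendstoD(1)[OF isContD])
  then obtain e where e: "0 < e" "\<And>v. v \<noteq> r \<Longrightarrow> dist v r < e \<Longrightarrow> 1 < sphere_R CARD('d) v (B v \<omega>)"
    by (auto simp: eventually_at)
  show ?thesis
  proof (rule that[of "min e r"])
    show "0 < min e r" using e r by simp
    fix v assume "\<bar>v - r\<bar> < min e r"
    then show "0 < v \<and> 1 < sphere_R CARD('d) v (B v \<omega>)"
      using e(2)[of v] r by (cases "v = r") (auto simp: dist_real_def)
  qed
qed

text \<open>The strict inequality and continuity make the set of exceedance times open, so it is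
  nonempty exactly if it contains a rational time.\<close>

lemma exit_time_less_rat:
  assumes "\<omega> \<in> space N"
  shows "exit_time B \<omega> < s \<longleftrightarrow> (\<exists>v\<in>\<rat> \<inter> {0<..<s}. 1 < sphere_R CARD('d) v (B v \<omega>))"
proof
  assume "exit_time B \<omega> < s"
  then obtain v where v: "0 < v" "v < s" "1 < sphere_R CARD('d) v (B v \<omega>)"
    by (auto simp: exit_time_less_iff)
  obtain e where e: "0 < e" "\<And>u. \<bar>u - v\<bar> < e \<Longrightarrow> 0 < u \<and> 1 < sphere_R CARD('d) u (B u \<omega>)"
    using exit_open[OF assms v(1,3)] by blast
  obtain u where "u \<in> \<rat>" "v < u" "u < min s (v + e)"
    using Rats_dense_in_real[of v "min s (v + e)"] v e by auto
  then show "\<exists>v\<in>\<rat> \<inter> {0<..<s}. 1 < sphere_R CARD('d) v (B v \<omega>)"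
    using e(2)[of u] by auto
qed (auto simp: exit_time_less_iff)

lemma exit_time_less_sets:
  assumes s: "0 \<le> s"
  shows "{\<omega> \<in> space N. exit_time B \<omega> < s} \<in> sets (F s)"
proof -
  have "{\<omega> \<in> space N. exit_time B \<omega> < s} =
      (\<Union>v\<in>\<rat> \<inter> {0<..<s}. {\<omega> \<in> space (F s). 1 < sphere_R CARD('d) v (B v \<omega>)})"
    using exit_time_less_rat space_F[OF s] by auto
  also have "\<dots> \<in> sets (F s)"
  proof (rule sets.countable_UN'')
    show "countable (\<rat> \<inter> {0<..<s})" by (intro countable_Int1 countable_rat)
  next
    fix v :: real assume "v \<in> \<rat> \<inter> {0<..<s}"
    then have [measurable]: "B v \<in> borel_measurable (F s)"
      by (intro F_mono[OF _ _ adapted]) auto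
    show "{\<omega> \<in> space (F s). 1 < sphere_R CARD('d) v (B v \<omega>)} \<in> sets (F s)" by measurable
  qed
  finally show ?thesis .
qed

lemma exit_time_ge_sets: "0 \<le> s \<Longrightarrow> {\<omega> \<in> space N. s \<le> exit_time B \<omega>} \<in> sets (F s)"
proof -
  assume s: "0 \<le> s"
  have "{\<omega> \<in> space N. s \<le> exit_time B \<omega>} = space (F s) - {\<omega> \<in> space N. exit_time B \<omega> < s}"
    by (auto simp: space_F s)
  then show ?thesis using exit_time_less_sets[OF s] by auto
qed

lemma exit_time_measurable [measurable]: "exit_time B \<in> borel_measurable N"
  unfolding borel_measurable_iff_less
proof (intro allI)
  fix a show "{\<omega> \<in> space N. exit_time B \<omega> < a} \<in> sets N"
  proof (cases "0 \<le> a")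
    case True
    then show ?thesis using exit_time_less_sets[OF True] subalg[OF True] by (auto simp: subalgebra_def)
  next
    case False
    then have "\<not> exit_time B \<omega> < a" for \<omega>
      using exit_time_nonneg[of B \<omega>] by linarith
    then show ?thesis by simp
  qed
qed

text \<open>Ville's inequality: at a hit of level 1 the martingale is at least 1, so the probability
  of a hit on the grid is bounded by its initial expectation on \<open>A\<close>. Fatou along
  refining grids passes to hits at arbitrary times.\<close>

lemma exit_lower:
  assumes s: "0 < s" and A [measurable]: "A \<in> sets borel"
  shows "(\<integral>\<^sup>+\<omega>. indicator A (B s \<omega>) * indicator {..<s} (exit_time B \<omega>) \<partial>N) \<le>
    (\<integral>\<^sup>+\<omega>. ennreal (sphere_R CARD('d) s (B s \<omega>)) * indicator A (B s \<omega>) \<partial>N)"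
    (is "?L \<le> ?X")
proof -
  \<comment> \<open>Only indices up to \<open>k\<close> are used, so the last grid time is s / (k +
    1) and time 0 is avoided.\<close>
  define q where "q k i = s * (1 - real i / real (Suc k))" for k i :: nat
  define U where "U k \<omega> = (\<Sum>i<k. hit (q k) A 1 i \<omega>)" for k \<omega>
  have q0: "q k 0 = s" for k by (simp add: q_def)
  have qpos: "0 < q k i" if "i \<le> k" for i k
    using s that by (auto simp: q_def intro!: mult_pos_pos)
  have qdec: "q k (Suc i) < q k i" for i k
    using s by (auto simp: q_def intro!: mult_strict_left_mono divide_strict_right_mono)
  have Um: "U k \<in> borel_measurable N" for k
    unfolding U_def by (intro borel_measurable_sum hit_measurable qpos A) auto
  have UX: "(\<integral>\<^sup>+\<omega>. U k \<omega> \<partial>N) \<le> ?X" for k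
  proof -
    have "(\<integral>\<^sup>+\<omega>. U k \<omega> \<partial>N) = (\<Sum>i<k. \<integral>\<^sup>+\<omega>. hit (q k) A 1 i \<omega> \<partial>N)"
      unfolding U_def by (rule nn_integral_sum) (auto intro!: hit_measurable qpos)
    also have "\<dots> \<le> (\<Sum>i<k. \<integral>\<^sup>+\<omega>. ennreal (sphere_R CARD('d) (q k (Suc i)) (B (q k (Suc i)) \<omega>)) * hit (q k) A 1 i \<omega> \<partial>N)"
    proof (intro sum_mono nn_integral_mono)
      fix i \<omega>
      show "hit (q k) A 1 i \<omega> \<le> ennreal (sphere_R CARD('d) (q k (Suc i)) (B (q k (Suc i)) \<omega>)) * hit (q k) A 1 i \<omega>"
      proof (cases "1 \<le> sphere_R CARD('d) (q k (Suc i)) (B (q k (Suc i)) \<omega>)")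
        case True
        then show ?thesis
          using mult_right_mono[of 1 "ennreal (sphere_R CARD('d) (q k (Suc i)) (B (q k (Suc i)) \<omega>))" "hit (q k) A 1 i \<omega>"]
          by simp
      qed (simp add: hit_def)
    qed
    also have "\<dots> \<le> ?X"
      using ville_sum[of k "q k" A 1] qpos qdec by (simp add: q0)
    finally show ?thesis .
  qed
  have lim: "indicator A (B s \<omega>) * indicator {..<s} (exit_time B \<omega>) \<le> liminf (\<lambda>k. U k \<omega>)"
    if \<omega>: "\<omega> \<in> space N" for \<omega>
  proof (cases "B s \<omega> \<in> A \<and> exit_time B \<omega> < s")
    case True
    then obtain v where v: "0 < v" "v < s" "1 < sphere_R CARD('d) v (B v \<omega>)"
      by (auto simp: exit_time_less_iff)
    obtain e where e: "0 < e" "\<And>u. \<bar>u - v\<bar> < e \<Longrightarrow> 0 < u \<and> 1 < sphere_R CARD('d) u (B u \<omega>)"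
      using exit_open[OF \<omega> v(1,3)] by blast
    obtain n0 :: nat where n0: "s / e < real n0" "s / v < real n0"
      using reals_Archimedean2[of "max (s / e) (s / v)"] by auto
    have "U k \<omega> = 1" if k: "n0 \<le> k" for k
    proof -
      let ?n = "real (Suc k)"
      have n: "s / e < ?n" "s / v < ?n" using n0 k by auto
      \<comment> \<open>\<open>j\<close> counts grid points upwards from time 0, hence the reversed
        index \<open>Suc k - j\<close>. The choice of \<open>n0\<close> gives \<open>j\<close> at
        least 1 and a mesh below \<open>e\<close>, and \<open>v < s\<close> gives \<open>j\<close>
        at most \<open>k\<close>.\<close>
      define j where "j = nat \<lfloor>v * ?n / s\<rfloor>"
      have "1 < v * ?n / s" using n(2) v s by (simp add: field_simps)
      then have j1: "1 \<le> j" and jr: "real j = real_of_int \<lfloor>v * ?n / s\<rfloor>"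
        unfolding j_def by linarith+
      have "v * ?n < s * ?n" using v by (intro mult_strict_right_mono) auto
      then have "v * ?n / s < ?n" using s by (simp only: pos_divide_less_eq mult.commute)
      then have jk: "j \<le> k" using jr by linarith
      have "\<bar>real j - v * ?n / s\<bar> \<le> 1" unfolding jr by linarith
      then have "\<bar>real j - v * ?n / s\<bar> * (s / ?n) \<le> 1 * (s / ?n)"
        using s by (intro mult_right_mono) auto
      moreover have "\<bar>real j - v * ?n / s\<bar> * (s / ?n) = \<bar>(real j - v * ?n / s) * (s / ?n)\<bar>"
        using s by (simp add: abs_mult)
      moreover have "(real j - v * ?n / s) * (s / ?n) = s * real j / ?n - v"
        using s by (simp add: field_simps del: of_nat_Suc)
      moreover have "s / ?n < e" using n(1) e(1) by (simp add: field_simps)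
      ultimately have "\<bar>s * real j / ?n - v\<bar> < e" by (metis le_less_trans mult_1)
      moreover have "q k (Suc k - j) = s * real j / ?n"
      proof -
        have "real (Suc k - j) = ?n - real j" using jk by (simp add: of_nat_diff)
        then show ?thesis unfolding q_def by (simp add: diff_divide_distrib del: of_nat_Suc)
      qed
      ultimately have "1 < sphere_R CARD('d) (q k (Suc k - j)) (B (q k (Suc k - j)) \<omega>)"
        using e(2) by simp
      then have "surv (q k) A 1 k \<omega> = 0"
        unfolding surv_def using j1 jk
        by (intro prod_zero) (auto intro!: bexI[of _ "Suc k - j"])
      then show "U k \<omega> = 1"
        using hit_sum[where q="q k" and A=A and l=1 and n=k and \<omega>=\<omega>] True by (simp add: U_def q0)
    qed
    then have "\<forall>\<^sub>F k in sequentially. 1 \<le> U k \<omega>"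
      by (auto simp: eventually_sequentially intro!: exI[of _ n0])
    then have "1 \<le> liminf (\<lambda>k. U k \<omega>)" by (rule Liminf_bounded)
    then show ?thesis using True by simp
  qed auto
  have "?L \<le> (\<integral>\<^sup>+\<omega>. liminf (\<lambda>k. U k \<omega>) \<partial>N)"
    by (intro nn_integral_mono lim)
  also have "\<dots> \<le> liminf (\<lambda>k. \<integral>\<^sup>+\<omega>. U k \<omega> \<partial>N)"
    by (rule nn_integral_liminf[OF Um])
  also have "\<dots> \<le> liminf (\<lambda>k. ?X)"
    by (intro Liminf_mono) (simp add: UX)
  finally show ?thesis by (simp add: Liminf_const)
qed

text \<open>
  The overshoot of the reversed martingale in one time step is \<open>o(u - r)\<close>, so summed over a grid
  it vanishes with the mesh.
\<close>

lemma jump_bound: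
  assumes e: "0 < e" "e \<le> s" and l: "0 < l" and \<eta>: "0 < \<eta>"
  obtains C \<kappa> where "0 \<le> C" "0 < \<kappa>"
    "\<And>r u. e \<le> r \<Longrightarrow> r < u \<Longrightarrow> u \<le> s \<Longrightarrow> u - r < \<kappa> \<Longrightarrow>
      (\<integral>\<^sup>+\<omega>. ennreal (sphere_R CARD('d) r (B r \<omega>)) * indicator {x. l + \<eta> < sphere_R CARD('d) r x} (B r \<omega>)
        * indicator {x. sphere_R CARD('d) u x < l} (B u \<omega>) \<partial>N) \<le> ennreal (C * (u - r)\<^sup>2)"
proof -
  let ?d = "CARD('d)" and ?a = "sphere_a CARD('d)"
  have a: "0 < ?a" by (simp add: sphere_a_pos)
  define b where "b = (e / ?a) powr (real ?d / 2)"
  have b: "0 < b" using a e by (simp add: b_def)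
  \<comment> \<open>A common radius for the sets where \<open>sphere_R\<close> is below
    \<open>l\<close>, for all times in [e, s]: the prefactor is at least \<open>b\<close> and the
    exponential at least its argument.\<close>
  define \<rho> where "\<rho> = sqrt (2 * s * (l / b))"
  have \<rho>: "norm x \<le> \<rho>" if u: "e \<le> u" "u \<le> s" and x: "sphere_R ?d u x < l" for u and x :: "real ^ 'd"
  proof -
    have "b * ((norm x)\<^sup>2 / (2 * s)) \<le> (u / ?a) powr (real ?d / 2) * exp ((norm x)\<^sup>2 / (2 * u))"
    proof (intro mult_mono)
      show "b \<le> (u / ?a) powr (real ?d / 2)"
        unfolding b_def using u e a by (intro powr_mono2 divide_right_mono) auto
      have "(norm x)\<^sup>2 / (2 * s) \<le> (norm x)\<^sup>2 / (2 * u)"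
        using u e by (intro divide_left_mono) auto
      also have "\<dots> \<le> exp ((norm x)\<^sup>2 / (2 * u))"
        using exp_ge_add_one_self[of "(norm x)\<^sup>2 / (2 * u)"] by linarith
      finally show "(norm x)\<^sup>2 / (2 * s) \<le> exp ((norm x)\<^sup>2 / (2 * u))" .
    qed (use e b in auto)
    also have "\<dots> < l" using x by (simp add: sphere_R_def)
    finally have "(norm x)\<^sup>2 \<le> 2 * s * (l / b)"
      using b e by (simp add: field_simps)
    then show ?thesis unfolding \<rho>_def by (rule real_le_rsqrt)
  qed
  define K where "K = {e..s} \<times> cball (0 :: real ^ 'd) (\<rho> + 1)"
  have "compact K" unfolding K_def by (intro compact_Times) auto
  moreover have "continuous_on K (\<lambda>p. sphere_R ?d (fst p) (snd p))"
    unfolding K_def using e by (intro continuous_on_sphere_R) (auto intro: continuous_intros)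
  ultimately have "uniformly_continuous_on K (\<lambda>p. sphere_R ?d (fst p) (snd p))"
    by (rule compact_uniformly_continuous[rotated])
  then obtain \<kappa>0 where \<kappa>0: "0 < \<kappa>0" "\<And>p p'. p \<in> K \<Longrightarrow> p' \<in> K \<Longrightarrow> dist p' p < \<kappa>0 \<Longrightarrow>
      dist (sphere_R ?d (fst p') (snd p')) (sphere_R ?d (fst p) (snd p)) < \<eta>"
    unfolding uniformly_continuous_on_def using \<eta> by blast
  define \<kappa> where "\<kappa> = min 1 (\<kappa>0 / 2)"
  have \<kappa>: "0 < \<kappa>" "\<kappa> \<le> 1" "2 * \<kappa> \<le> \<kappa>0" using \<kappa>0 by (auto simp: \<kappa>_def)
  have far: "\<kappa> \<le> norm y"
    if "e \<le> r" "r < u" "u \<le> s" "u - r < \<kappa>" "l + \<eta> < sphere_R ?d r x" "sphere_R ?d u (x + y) < l"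
    for r u and x y :: "real ^ 'd"
  proof (rule ccontr)
    assume y: "\<not> \<kappa> \<le> norm y"
    have z: "norm (x + y) \<le> \<rho>" using that by (intro \<rho>[of u]) auto
    have "norm x \<le> norm (x + y) + norm y"
      using norm_triangle_ineq4[of "x + y" y] by simp
    then have K: "(r, x) \<in> K" "(u, x + y) \<in> K"
      using that z y \<kappa> by (auto simp: K_def)
    have "dist (r, x) (u, x + y) \<le> dist r u + dist x (x + y)"
      unfolding dist_prod_def by (simp add: sqrt_sum_squares_le_sum)
    also have "\<dots> < \<kappa>0" using that y \<kappa> by (simp add: dist_real_def dist_norm)
    finally have "dist (sphere_R ?d r x) (sphere_R ?d u (x + y)) < \<eta>"
      using \<kappa>0(2)[OF K(2,1)] by simp
    then show False using that by (simp add: dist_real_def)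
  qed
  have fin: "emeasure lborel (cball (0::real^'d) \<rho>) < \<infinity>"
    by (rule emeasure_bounded_finite) simp
  define v where "v = measure lborel (cball (0::real^'d) \<rho>)"
  have v: "emeasure lborel (cball (0::real^'d) \<rho>) = ennreal v" "0 \<le> v"
    using fin by (auto simp: v_def emeasure_eq_ennreal_measure)
  have c: "0 \<le> sphere_c ?d" by (simp add: sphere_c_def)
  show ?thesis
  proof (rule that)
    show "0 \<le> sphere_c ?d * (3 * real ?d ^ 3 / \<kappa> ^ 4 * v)"
      using v c \<kappa> by simp
    show "0 < \<kappa>" by fact
    fix r u assume r: "e \<le> r" "r < u" "u \<le> s" "u - r < \<kappa>"
    interpret g: prob_space "gauss (u - r) :: (real ^ 'd) measure" using r by (intro prob_space_gauss) simp
    let ?f = "indicator {x. l + \<eta> < sphere_R ?d r x} :: real ^ 'd \<Rightarrow> ennreal"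
    let ?t = "indicator {x. sphere_R ?d u x < l} :: real ^ 'd \<Rightarrow> ennreal"
    have eq: "(\<integral>\<^sup>+\<omega>. ennreal (sphere_R ?d r (B r \<omega>)) * ?f (B r \<omega>) * ?t (B u \<omega>) \<partial>N) =
       ennreal (sphere_c ?d) * (\<integral>\<^sup>+x. \<integral>\<^sup>+y. ?f x * ?t (x + y) \<partial>gauss (u - r) \<partial>lborel)"
      using r e by (intro two_time) auto
    \<comment> \<open>The starting point is controlled through the ball containing
      \<open>x + y\<close>; the bound is the Gaussian tail times the volume of that ball.\<close>
    have "(\<integral>\<^sup>+x. \<integral>\<^sup>+y. ?f x * ?t (x + y) \<partial>gauss (u - r) \<partial>lborel) \<le>
       (\<integral>\<^sup>+x. \<integral>\<^sup>+y. indicator {y. \<kappa> \<le> norm y} y * indicator (cball (0::real^'d) \<rho>) (x + y) \<partial>gauss (u - r) \<partial>lborel)"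
      by (intro nn_integral_mono) (use far[OF r] \<rho>[of u] r in \<open>auto simp: indicator_def\<close>)
    also have "\<dots> = emeasure (gauss (u - r)) {y::real^'d. \<kappa> \<le> norm y} * emeasure lborel (cball (0::real^'d) \<rho>)"
      using g.sigma_finite_measure_axioms
      by (subst nn_integral_translate_lborel) (auto intro!: borel_measurable_indicator borel_closed)
    also have "\<dots> \<le> ennreal (3 * real ?d ^ 3 / \<kappa> ^ 4 * (u - r)\<^sup>2) * ennreal v"
      unfolding v using r \<kappa> by (intro mult_right_mono gauss_tail) auto
    finally have "(\<integral>\<^sup>+\<omega>. ennreal (sphere_R ?d r (B r \<omega>)) * ?f (B r \<omega>) * ?t (B u \<omega>) \<partial>N) \<le>
       ennreal (sphere_c ?d) * (ennreal (3 * real ?d ^ 3 / \<kappa> ^ 4 * (u - r)\<^sup>2) * ennreal v)"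
      unfolding eq by (intro mult_left_mono) auto
    also have "\<dots> = ennreal (sphere_c ?d * (3 * real ?d ^ 3 / \<kappa> ^ 4 * v) * (u - r)\<^sup>2)"
      using v c \<kappa> by (simp add: ennreal_mult'[symmetric] ennreal_mult[symmetric] mult_ac)
    finally show "(\<integral>\<^sup>+\<omega>. ennreal (sphere_R ?d r (B r \<omega>)) * ?f (B r \<omega>) * ?t (B u \<omega>) \<partial>N) \<le>
        ennreal (sphere_c ?d * (3 * real ?d ^ 3 / \<kappa> ^ 4 * v) * (u - r)\<^sup>2)" .
  qed
qed

lemma sphere_R_scaled:
  "0 < s \<Longrightarrow> sphere_R k s (sqrt s *\<^sub>R (x :: real ^ 'd)) = (s / sphere_a k) powr (real k / 2) * exp ((norm x)\<^sup>2 / 2)"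
  by (simp add: sphere_R_def power_mult_distrib)

text \<open>In terms of a standard normal z the value is (e / a)^(d/2) exp(|z|^2 / 2), which tends
  to 0 pointwise. Truncation at \<open>l\<close> supplies the dominating function; the untruncated
  expectation is infinite.\<close>

lemma small_time:
  assumes s: "0 < s" and l: "0 < l" and \<delta>: "0 < (\<delta>::real)"
  obtains e where "0 < e" "e < s"
    "(\<integral>\<^sup>+\<omega>. ennreal (sphere_R CARD('d) e (B e \<omega>)) * indicator {x. sphere_R CARD('d) e x < l} (B e \<omega>) \<partial>N) \<le> ennreal \<delta>"
proof -
  let ?d = "CARD('d)" and ?a = "sphere_a CARD('d)"
  have a: "0 < ?a" by (simp add: sphere_a_pos)
  define e where "e k = s / real (Suc (Suc k))" for k
  have e: "0 < e k" "e k < s" for k using s by (auto simp: e_def field_simps intro!: add_pos_nonneg)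
  have elim: "e \<longlonglongrightarrow> 0"
    unfolding e_def using LIMSEQ_Suc[OF LIMSEQ_Suc[OF lim_const_over_n[of s]]] by simp
  define h where "h k x = ennreal (sphere_R ?d (e k) (sqrt (e k) *\<^sub>R x)) *
      indicator {x. sphere_R ?d (e k) x < l} (sqrt (e k) *\<^sub>R x)" for k and x :: "real ^ 'd"
  interpret g: prob_space "gauss 1 :: (real ^ 'd) measure" by (intro prob_space_gauss) simp
  have hm [measurable]: "h k \<in> borel_measurable borel" for k unfolding h_def[abs_def] by measurable
  have "(\<lambda>k. \<integral>\<^sup>+x. h k x \<partial>gauss 1) \<longlonglongrightarrow> (\<integral>\<^sup>+x. 0 \<partial>(gauss 1 :: (real ^ 'd) measure))"
  proof (rule nn_integral_dominated_convergence[where w="\<lambda>_. ennreal l"])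
    show "AE x in gauss 1. h k x \<le> ennreal l" for k
      by (auto simp: h_def indicator_def intro!: ennreal_leI)
    show "AE x in gauss 1. (\<lambda>k. h k x) \<longlonglongrightarrow> 0"
    proof (rule AE_I2)
      fix x :: "real ^ 'd"
      have "((\<lambda>k. (e k / ?a) powr (real ?d / 2)) \<longlongrightarrow> 0) sequentially"
      proof (rule tendsto_zero_powrI[OF _ tendsto_const])
        show "(\<lambda>k. e k / ?a) \<longlonglongrightarrow> 0" using elim by (rule tendsto_divide_zero)
      qed (use e a in \<open>auto simp: less_imp_le\<close>)
      then have "(\<lambda>k. (e k / ?a) powr (real ?d / 2) * exp ((norm x)\<^sup>2 / 2)) \<longlonglongrightarrow> 0"
        by (rule tendsto_mult_left_zero)
      then have "(\<lambda>k. ennreal (sphere_R ?d (e k) (sqrt (e k) *\<^sub>R x))) \<longlonglongrightarrow> ennreal 0"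
        using e by (intro tendsto_ennrealI) (simp add: sphere_R_scaled)
      then have lim: "(\<lambda>k. ennreal (sphere_R ?d (e k) (sqrt (e k) *\<^sub>R x))) \<longlonglongrightarrow> 0" by simp
      have "h k x \<le> ennreal (sphere_R ?d (e k) (sqrt (e k) *\<^sub>R x))" for k
        by (auto simp: h_def indicator_def)
      then show "(\<lambda>k. h k x) \<longlonglongrightarrow> 0"
        by (intro tendsto_sandwich[OF _ _ tendsto_const lim]) auto
    qed
  qed (auto simp: g.emeasure_space_1[simplified])
  then have "(\<lambda>k. \<integral>\<^sup>+x. h k x \<partial>gauss 1) \<longlonglongrightarrow> 0" by simp
  then have "\<forall>\<^sub>F k in sequentially. (\<integral>\<^sup>+x. h k x \<partial>gauss 1) < ennreal \<delta>"
    using \<delta> by (intro order_tendstoD(2)) auto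
  then obtain k where k: "(\<integral>\<^sup>+x. h k x \<partial>gauss 1) < ennreal \<delta>"
    by (auto simp: eventually_sequentially)
  have "(\<integral>\<^sup>+\<omega>. ennreal (sphere_R ?d (e k) (B (e k) \<omega>)) * indicator {x. sphere_R ?d (e k) x < l} (B (e k) \<omega>) \<partial>N) =
     (\<integral>\<^sup>+x. ennreal (sphere_R ?d (e k) x) * indicator {x. sphere_R ?d (e k) x < l} x \<partial>(gauss (e k) :: (real ^ 'd) measure))"
    by (rule nn_integral_law[OF e(1), of "\<lambda>x. ennreal (sphere_R ?d (e k) x) * indicator {x. sphere_R ?d (e k) x < l} x"]) measurable
  also have "\<dots> = (\<integral>\<^sup>+x. h k x \<partial>gauss 1)"
    unfolding gauss_scale[OF e(1)] h_def by (rule nn_integral_distr) auto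
  finally show ?thesis using k e by (intro that[of "e k"]) auto
qed

text \<open>The converse estimate. The expectation on \<open>A\<close> is collected at hits, where
  the value exceeds 1 only by the overshoot, and at the survivors, who are negligible at a small
  time \<open>e\<close>. A hit of a level \<open>l > 1\<close> forces exit before
  \<open>s\<close>.\<close>

lemma exit_upper:
  assumes s: "0 < s" and A [measurable]: "A \<in> sets borel"
    and A1: "\<And>x. x \<in> A \<Longrightarrow> sphere_R CARD('d) s x \<le> 1"
  shows "(\<integral>\<^sup>+\<omega>. ennreal (sphere_R CARD('d) s (B s \<omega>)) * indicator A (B s \<omega>) \<partial>N) \<le>
    (\<integral>\<^sup>+\<omega>. indicator A (B s \<omega>) * indicator {..<s} (exit_time B \<omega>) \<partial>N)"
    (is "?X \<le> ?P")
proof (rule ennreal_le_epsilon)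
  fix \<epsilon> :: real assume \<epsilon>: "0 < \<epsilon>"
  let ?d = "CARD('d)"
  have [measurable]: "B s \<in> borel_measurable N" using s by (intro B_measurable) simp
  \<comment> \<open>The budget is \<epsilon> / 2 from the factor l + \<eta> = 1 + \<epsilon> / 2 on
    a probability, \<epsilon> / 4 from all large overshoots together, and \<epsilon> / 4 from the
    survivors at time \<open>e\<close>.\<close>
  define l \<eta> where "l = 1 + \<epsilon> / 4" and "\<eta> = \<epsilon> / 4"
  have l: "1 < l" "0 < \<eta>" using \<epsilon> by (auto simp: l_def \<eta>_def)
  obtain e where e: "0 < e" "e < s"
    and small: "(\<integral>\<^sup>+\<omega>. ennreal (sphere_R ?d e (B e \<omega>)) * indicator {x. sphere_R ?d e x < l} (B e \<omega>) \<partial>N) \<le> ennreal (\<epsilon> / 4)"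
    using small_time[OF s, of l "\<epsilon> / 4"] l \<epsilon> by auto
  obtain C \<kappa> where C: "0 \<le> C" "0 < \<kappa>" and jump: "\<And>r u. e \<le> r \<Longrightarrow> r < u \<Longrightarrow> u \<le> s \<Longrightarrow> u - r < \<kappa> \<Longrightarrow>
      (\<integral>\<^sup>+\<omega>. ennreal (sphere_R ?d r (B r \<omega>)) * indicator {x. l + \<eta> < sphere_R ?d r x} (B r \<omega>)
        * indicator {x. sphere_R ?d u x < l} (B u \<omega>) \<partial>N) \<le> ennreal (C * (u - r)\<^sup>2)"
    using jump_bound[of e s l \<eta>] e l by auto
  define D where "D = s - e"
  have D: "0 < D" using e by (simp add: D_def)
  \<comment> \<open>The number of steps makes the mesh smaller than \<kappa> and the sum n C (D /
    n)^2 of the jump bounds at most \<epsilon> / 4.\<close>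
  obtain n0 :: nat where "D / \<kappa> + C * D\<^sup>2 / (\<epsilon> / 4) < real n0"
    using reals_Archimedean2 by blast
  moreover define n where "n = Suc n0"
  moreover have "0 \<le> C * D\<^sup>2 / (\<epsilon> / 4)" "0 \<le> D / \<kappa>" using C D \<epsilon> by auto
  ultimately have n: "D / \<kappa> < real n" "C * D\<^sup>2 / (\<epsilon> / 4) < real n" "0 < n" by linarith+
  define q where "q i = s - real i * (D / real n)" for i
  have q0: "q 0 = s" and qn: "q n = e" using n by (auto simp: q_def D_def)
  have qdec: "q (Suc i) < q i" and qdiff: "q i - q (Suc i) = D / real n" for i
    using D n by (auto simp: q_def field_simps)
  have qge: "e \<le> q i" if "i \<le> n" for i
  proof -
    have "real i * (D / real n) \<le> real n * (D / real n)"
      using that D by (intro mult_right_mono) auto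
    then show ?thesis using n by (simp add: q_def D_def)
  qed
  have qle: "q i \<le> s" for i using D by (simp add: q_def)
  have qpos: "0 < q i" if "i \<le> n" for i using qge[OF that] e by simp
  have hm: "hit q A l i \<in> borel_measurable N" if "i < n" for i
    using that by (intro hit_measurable qpos A) auto
  have Bm [measurable]: "B (q i) \<in> borel_measurable N" if "i \<le> n" for i
    using qpos[OF that] by (intro B_measurable) simp
  have step: "(\<integral>\<^sup>+\<omega>. ennreal (sphere_R ?d (q (Suc i)) (B (q (Suc i)) \<omega>)) * hit q A l i \<omega> \<partial>N) \<le>
      ennreal (l + \<eta>) * (\<integral>\<^sup>+\<omega>. hit q A l i \<omega> \<partial>N) + ennreal (C * (D / real n)\<^sup>2)" if i: "i < n" for i
  proof -
    let ?J = "\<lambda>\<omega>. ennreal (sphere_R ?d (q (Suc i)) (B (q (Suc i)) \<omega>)) * indicator {x. l + \<eta> < sphere_R ?d (q (Suc i)) x} (B (q (Suc i)) \<omega>)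
        * indicator {x. sphere_R ?d (q i) x < l} (B (q i) \<omega>)"
    have [measurable]: "B (q (Suc i)) \<in> borel_measurable N" "B (q i) \<in> borel_measurable N" "hit q A l i \<in> borel_measurable N"
      using i Bm hm by auto
    \<comment> \<open>At index 0 \<open>surv\<close> only knows \<open>A\<close>; there
      \<open>A1\<close> and \<open>1 < l\<close> supply the bound below the level that the jump
      estimate requires.\<close>
    have le: "hit q A l i \<omega> \<le> indicator {x. sphere_R ?d (q i) x < l} (B (q i) \<omega>)" for \<omega>
    proof -
      have "surv q A l i \<omega> \<le> indicator {x. sphere_R ?d (q i) x < l} (B (q i) \<omega>)"
      proof (cases i)
        case 0
        then show ?thesis using A1 l by (force simp: surv_def q0 indicator_def)
      next
        case (Suc k)
        have "(\<Prod>i\<le>k. indicator (if i = 0 then A else {x. sphere_R ?d (q i) x < l}) (B (q i) \<omega>) :: ennreal) \<le> 1"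
          by (intro prod_le_1) (auto simp: indicator_def)
        then show ?thesis unfolding Suc surv_def
          by (auto simp: indicator_def)
      qed
      then show ?thesis unfolding hit_def by (auto simp: indicator_def)
    qed
    have "ennreal (sphere_R ?d (q (Suc i)) (B (q (Suc i)) \<omega>)) * hit q A l i \<omega> \<le>
       ennreal (l + \<eta>) * hit q A l i \<omega> + ?J \<omega>" for \<omega>
    proof (cases "sphere_R ?d (q (Suc i)) (B (q (Suc i)) \<omega>) \<le> l + \<eta>")
      case True
      show ?thesis by (intro add_increasing2[OF _ mult_right_mono[OF ennreal_leI[OF True]]]) auto
    next
      case False
      then have "ennreal (sphere_R ?d (q (Suc i)) (B (q (Suc i)) \<omega>)) * hit q A l i \<omega> \<le> ?J \<omega>"
        using le[of \<omega>] by (auto intro!: mult_left_mono)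
      then show ?thesis by (rule add_increasing[rotated]) simp
    qed
    then have "(\<integral>\<^sup>+\<omega>. ennreal (sphere_R ?d (q (Suc i)) (B (q (Suc i)) \<omega>)) * hit q A l i \<omega> \<partial>N) \<le>
       (\<integral>\<^sup>+\<omega>. ennreal (l + \<eta>) * hit q A l i \<omega> + ?J \<omega> \<partial>N)"
      by (intro nn_integral_mono)
    also have "\<dots> = ennreal (l + \<eta>) * (\<integral>\<^sup>+\<omega>. hit q A l i \<omega> \<partial>N) + (\<integral>\<^sup>+\<omega>. ?J \<omega> \<partial>N)"
      by (subst nn_integral_add) (auto simp: nn_integral_cmult)
    also have "(\<integral>\<^sup>+\<omega>. ?J \<omega> \<partial>N) \<le> ennreal (C * (q i - q (Suc i))\<^sup>2)"
    proof (rule jump)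
      show "q i - q (Suc i) < \<kappa>" using n C by (simp add: qdiff field_simps)
    qed (use qge[of "Suc i"] qle qdec i in auto)
    finally show ?thesis by (simp add: qdiff add_left_mono)
  qed
  have hits: "(\<Sum>i<n. \<integral>\<^sup>+\<omega>. hit q A l i \<omega> \<partial>N) \<le> ?P"
  proof -
    have "(\<Sum>i<n. \<integral>\<^sup>+\<omega>. hit q A l i \<omega> \<partial>N) = (\<integral>\<^sup>+\<omega>. (\<Sum>i<n. hit q A l i \<omega>) \<partial>N)"
      using hm by (intro nn_integral_sum[symmetric]) auto
    also have "\<dots> \<le> ?P"
    proof (intro nn_integral_mono)
      fix \<omega>
      show "(\<Sum>i<n. hit q A l i \<omega>) \<le> indicator A (B s \<omega>) * indicator {..<s} (exit_time B \<omega>)"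
      proof (cases "exit_time B \<omega> < s")
        case True
        then show ?thesis
          using hit_sum[where q=q and A=A and l=l and n=n and \<omega>=\<omega>] by (simp add: q0) (metis le_iff_add)
      next
        case False
        have "hit q A l i \<omega> = 0" if "i < n" for i
        proof -
          have "\<not> l \<le> sphere_R ?d (q (Suc i)) (B (q (Suc i)) \<omega>)"
            using False l qpos[of "Suc i"] that qdec[of i] qle[of i]
            unfolding exit_time_less_iff by (meson Suc_leI le_less_trans less_le_trans not_le order_trans)
          then show ?thesis by (simp add: hit_def)
        qed
        then show ?thesis by simp
      qed
    qed
    finally show ?thesis .
  qed
  have "?P \<le> (\<integral>\<^sup>+\<omega>. 1 \<partial>N)" by (intro nn_integral_mono) (auto simp: indicator_def)
  then have P1: "?P \<le> 1" by (simp add: emeasure_space_1)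
  have "?X = (\<Sum>i<n. \<integral>\<^sup>+\<omega>. ennreal (sphere_R ?d (q (Suc i)) (B (q (Suc i)) \<omega>)) * hit q A l i \<omega> \<partial>N) +
    (\<integral>\<^sup>+\<omega>. ennreal (sphere_R ?d (q n) (B (q n) \<omega>)) * surv q A l n \<omega> \<partial>N)"
    using ville_sum[of n q A l] qpos qdec by (simp add: q0)
  also have "\<dots> \<le> (\<Sum>i<n. ennreal (l + \<eta>) * (\<integral>\<^sup>+\<omega>. hit q A l i \<omega> \<partial>N) + ennreal (C * (D / real n)\<^sup>2)) + ennreal (\<epsilon> / 4)"
  proof (intro add_mono sum_mono step)
    have "surv q A l n \<omega> \<le> indicator {x. sphere_R ?d e x < l} (B e \<omega>)" for \<omega>
    proof -
      obtain k where k: "n = Suc k" using n by (cases n) auto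
      have "(\<Prod>i\<le>k. indicator (if i = 0 then A else {x. sphere_R ?d (q i) x < l}) (B (q i) \<omega>) :: ennreal) \<le> 1"
        by (intro prod_le_1) (auto simp: indicator_def)
      then show ?thesis unfolding qn[symmetric] unfolding k surv_def
        by (auto simp: indicator_def)
    qed
    then have "(\<integral>\<^sup>+\<omega>. ennreal (sphere_R ?d (q n) (B (q n) \<omega>)) * surv q A l n \<omega> \<partial>N) \<le>
       (\<integral>\<^sup>+\<omega>. ennreal (sphere_R ?d e (B e \<omega>)) * indicator {x. sphere_R ?d e x < l} (B e \<omega>) \<partial>N)"
      unfolding qn by (intro nn_integral_mono mult_left_mono) auto
    also note small
    finally show "(\<integral>\<^sup>+\<omega>. ennreal (sphere_R ?d (q n) (B (q n) \<omega>)) * surv q A l n \<omega> \<partial>N) \<le> ennreal (\<epsilon> / 4)" .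
  qed auto
  also have "(\<Sum>i<n. ennreal (l + \<eta>) * (\<integral>\<^sup>+\<omega>. hit q A l i \<omega> \<partial>N) + ennreal (C * (D / real n)\<^sup>2)) =
     ennreal (l + \<eta>) * (\<Sum>i<n. \<integral>\<^sup>+\<omega>. hit q A l i \<omega> \<partial>N) + ennreal (real n * (C * (D / real n)\<^sup>2))"
    using C by (simp add: sum.distrib sum_distrib_left ennreal_mult ennreal_of_nat_eq_real_of_nat)
  also have "\<dots> \<le> (?P + ennreal (\<epsilon> / 2)) + ennreal (\<epsilon> / 4)"
  proof (intro add_mono ennreal_leI)
    have "ennreal (l + \<eta>) * (\<Sum>i<n. \<integral>\<^sup>+\<omega>. hit q A l i \<omega> \<partial>N) \<le> (1 + ennreal (\<epsilon> / 2)) * ?P"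
    proof (intro mult_mono hits)
      have "l + \<eta> = 1 + \<epsilon> / 2" by (simp add: l_def \<eta>_def)
      then show "ennreal (l + \<eta>) \<le> 1 + ennreal (\<epsilon> / 2)"
        using \<epsilon> ennreal_plus[of 1 "\<epsilon> / 2"] by simp
    qed auto
    also have "\<dots> \<le> ?P + ennreal (\<epsilon> / 2)"
      using mult_left_mono[OF P1, of "ennreal (\<epsilon> / 2)"] by (simp add: distrib_right add_left_mono)
    finally show "ennreal (l + \<eta>) * (\<Sum>i<n. \<integral>\<^sup>+\<omega>. hit q A l i \<omega> \<partial>N) \<le> ?P + ennreal (\<epsilon> / 2)" .
    have "real n * (C * (D / real n)\<^sup>2) = C * D\<^sup>2 / real n"
      using n by (simp add: power2_eq_square)
    also have "\<dots> \<le> \<epsilon> / 4" using n \<epsilon> by (simp add: field_simps)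
    finally show "real n * (C * (D / real n)\<^sup>2) \<le> \<epsilon> / 4" .
  qed
  finally have "?X \<le> ((?P + ennreal (\<epsilon> / 2)) + ennreal (\<epsilon> / 4)) + ennreal (\<epsilon> / 4)"
    by (simp add: add_right_mono)
  also have "\<dots> = ?P + ennreal \<epsilon>"
    using \<epsilon> by (simp add: add.assoc ennreal_plus[symmetric] del: ennreal_plus)
  finally show "?X \<le> ?P + ennreal \<epsilon>" .
qed

end

text \<open>\<open>u\<close> is the zero of the integrand's last factor. Since
  \<open>ennreal\<close> cuts off negative values, the integral effectively runs over (0, u], where
  it is a difference of two power integrals. It is used with \<alpha> = d / 2 and E = exp(|z|^2 /
  2).\<close>

lemma occupation_time_integral:
  fixes k :: nat and a E \<alpha> :: real
  assumes a: "0 < a" and E: "0 < E" and \<alpha>: "0 < \<alpha>"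
  defines "u \<equiv> a * E powr (- 1 / \<alpha>)"
  shows "(\<integral>\<^sup>+v. indicator {0<..} v * ennreal (v ^ k * (1 - (v / a) powr \<alpha> * E)) \<partial>lborel) =
    ennreal (u ^ (k + 1) * (1 / (k + 1) - 1 / (\<alpha> + k + 1)))"
proof -
  have u: "0 < u" using a E by (simp add: u_def)
  have ua: "(u / a) powr \<alpha> * E = 1"
  proof -
    have "u / a = E powr (- 1 / \<alpha>)" using a by (simp add: u_def)
    then have "(u / a) powr \<alpha> = E powr (- 1)" using \<alpha> by (simp only: powr_powr) simp
    then show ?thesis using E by (simp add: powr_minus)
  qed
  have 1: "((\<lambda>v. v ^ k) has_integral (u ^ (k + 1) / (k + 1) - 0 ^ (k + 1) / (k + 1))) {0..u}"
  proof (rule fundamental_theorem_of_calculus)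
    show "((\<lambda>v. v ^ (k + 1) / (k + 1)) has_vector_derivative v ^ k) (at v within {0..u})" for v
      unfolding has_real_derivative_iff_has_vector_derivative[symmetric]
      by (auto intro!: derivative_eq_intros simp del: of_nat_Suc) (cases k; simp add: field_simps)
  qed (use u in simp)
  have 2: "((\<lambda>v. v powr (\<alpha> + k)) has_integral (u powr (\<alpha> + k + 1) / (\<alpha> + k + 1))) {0..u}"
    using \<alpha> u by (intro has_integral_powr_from_0) auto
  have "((\<lambda>v. v ^ k - E / a powr \<alpha> * v powr (\<alpha> + k)) has_integral
      (u ^ (k + 1) / (k + 1) - 0 ^ (k + 1) / (k + 1) - E / a powr \<alpha> * (u powr (\<alpha> + k + 1) / (\<alpha> + k + 1)))) {0..u}"
    by (intro has_integral_diff 1 has_integral_mult_right 2)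
  moreover have "v ^ k - E / a powr \<alpha> * v powr (\<alpha> + k) = v ^ k * (1 - (v / a) powr \<alpha> * E)" if "v \<in> {0..u}" for v
  proof (cases "v = 0")
    case False
    then have "v powr (\<alpha> + k) = v powr \<alpha> * v ^ k" using that by (simp add: powr_add powr_realpow)
    then show ?thesis using that a by (simp add: powr_divide field_simps)
  qed (use \<alpha> in auto)
  moreover have "u ^ (k + 1) / (k + 1) - 0 ^ (k + 1) / (k + 1) - E / a powr \<alpha> * (u powr (\<alpha> + k + 1) / (\<alpha> + k + 1)) =
     u ^ (k + 1) * (1 / (k + 1) - 1 / (\<alpha> + k + 1))"
  proof -
    have "u powr (\<alpha> + k + 1) = u powr \<alpha> * u ^ (k + 1)"
    proof -
      have "\<alpha> + k + 1 = \<alpha> + real (k + 1)" by simp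
      then show ?thesis by (simp only: powr_add powr_realpow[OF u])
    qed
    then have "E / a powr \<alpha> * u powr (\<alpha> + k + 1) = u ^ (k + 1) * ((u / a) powr \<alpha> * E)"
      using a u by (simp add: powr_divide)
    then show ?thesis unfolding ua by (simp add: algebra_simps)
  qed
  ultimately have I: "((\<lambda>v. v ^ k * (1 - (v / a) powr \<alpha> * E)) has_integral
     (u ^ (k + 1) * (1 / (k + 1) - 1 / (\<alpha> + k + 1)))) {0..u}"
    by (metis (no_types, lifting) has_integral_cong)
  have le: "(v / a) powr \<alpha> * E \<le> 1 \<longleftrightarrow> v \<le> u" if "0 \<le> v" for v
  proof -
    have "(v / a) powr \<alpha> * E \<le> (u / a) powr \<alpha> * E \<longleftrightarrow> (v / a) powr \<alpha> \<le> (u / a) powr \<alpha>"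
      using E by simp
    also have "\<dots> \<longleftrightarrow> v / a \<le> u / a"
      using that a u \<alpha> by (meson divide_nonneg_pos less_imp_le not_le powr_less_mono2 powr_mono2)
    also have "\<dots> \<longleftrightarrow> v \<le> u" using a by (simp add: divide_le_cancel)
    finally show ?thesis by (simp add: ua)
  qed
  have "(\<integral>\<^sup>+v. indicator {0<..} v * ennreal (v ^ k * (1 - (v / a) powr \<alpha> * E)) \<partial>lborel) =
      (\<integral>\<^sup>+v. ennreal (v ^ k * (1 - (v / a) powr \<alpha> * E)) * indicator {0..u} v \<partial>lborel)"
  proof (rule nn_integral_cong_AE, rule AE_mp[OF AE_lborel_singleton[of 0]], rule AE_I2, rule impI)
    fix v :: real assume "v \<noteq> 0"
    then consider "v < 0" | "0 < v" "v \<le> u" | "0 < v" "u < v" by linarith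
    then show "indicator {0<..} v * ennreal (v ^ k * (1 - (v / a) powr \<alpha> * E)) =
      ennreal (v ^ k * (1 - (v / a) powr \<alpha> * E)) * indicator {0..u} v"
    proof cases
      case 3
      then have "v ^ k * (1 - (v / a) powr \<alpha> * E) \<le> 0"
        using le[of v] by (intro mult_nonneg_nonpos) auto
      then show ?thesis using 3 by (simp add: ennreal_neg)
    qed auto
  qed
  also have "\<dots> = ennreal (u ^ (k + 1) * (1 / (k + 1) - 1 / (\<alpha> + k + 1)))"
    using le by (intro nn_integral_has_integral_lebesgue'[OF _ I]) auto
  finally show ?thesis .
qed

section \<open>Occupation law of the path before exit and its explicit integrals\<close>

context brownian0
begin

lemma exit_time_ge_imp:
  assumes \<omega>: "\<omega> \<in> space N" and s: "0 < s" "s \<le> exit_time B \<omega>"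
  shows "sphere_R CARD('d) s (B s \<omega>) \<le> 1"
proof (rule ccontr)
  assume "\<not> ?thesis"
  then obtain e where e: "0 < e" "\<And>v. \<bar>v - s\<bar> < e \<Longrightarrow> 0 < v \<and> 1 < sphere_R CARD('d) v (B v \<omega>)"
    using exit_open[OF \<omega> s(1)] by (auto simp: not_le)
  then have "exit_time B \<omega> < s"
    using e(2)[of "s - e / 2"] unfolding exit_time_less_iff by (intro exI[of _ "s - e / 2"]) auto
  then show False using s by simp
qed

text \<open>On {R <= 1} the two one-sided estimates meet, and subtraction leaves the weight 1 - R.
  Off that set both sides vanish: the path has already left, and \<open>ennreal\<close> of a
  negative number is 0.\<close>

lemma exit_law_set:
  assumes s: "0 < s" and A [measurable]: "A \<in> sets borel"
  shows "(\<integral>\<^sup>+\<omega>. indicator A (B s \<omega>) * indicator {s..} (exit_time B \<omega>) \<partial>N) =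
    (\<integral>\<^sup>+x. indicator A x * ennreal (1 - sphere_R CARD('d) s x) \<partial>gauss s)"
proof -
  let ?R = "sphere_R CARD('d) s"
  have [measurable]: "B s \<in> borel_measurable N" using s by (intro B_measurable) simp
  define A' where "A' = A \<inter> {x. ?R x \<le> 1}"
  have A' [measurable]: "A' \<in> sets borel" unfolding A'_def by measurable
  let ?p = "\<integral>\<^sup>+\<omega>. indicator A' (B s \<omega>) * indicator {..<s} (exit_time B \<omega>) \<partial>N"
  let ?L = "\<integral>\<^sup>+\<omega>. indicator A' (B s \<omega>) * indicator {s..} (exit_time B \<omega>) \<partial>N"
  let ?I = "\<integral>\<^sup>+\<omega>. indicator A' (B s \<omega>) * ennreal (1 - ?R (B s \<omega>)) \<partial>N"
  have eq: "(\<integral>\<^sup>+\<omega>. ennreal (?R (B s \<omega>)) * indicator A' (B s \<omega>) \<partial>N) = ?p"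
    by (intro antisym exit_upper exit_lower s A') (auto simp: A'_def)
  have "?p \<le> (\<integral>\<^sup>+\<omega>. 1 \<partial>N)" by (intro nn_integral_mono) (auto simp: indicator_def)
  then have "?p \<le> 1" by (simp add: emeasure_space_1)
  then have fin: "?p \<noteq> \<infinity>" by (auto simp: top_unique)
  have "?p + ?L = (\<integral>\<^sup>+\<omega>. indicator A' (B s \<omega>) \<partial>N)"
    by (subst nn_integral_add[symmetric]) (auto intro!: nn_integral_cong simp: indicator_def)
  also have "\<dots> = ?p + ?I"
    unfolding eq[symmetric]
  proof (subst nn_integral_add[symmetric]; (intro nn_integral_cong)?)
    fix \<omega>
    have "0 \<le> ?R (B s \<omega>)" using sphere_R_pos[OF s, of "CARD('d)" "B s \<omega>"] by (simp add: less_imp_le)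
    then have "ennreal (?R (B s \<omega>)) + ennreal (1 - ?R (B s \<omega>)) = 1" if "?R (B s \<omega>) \<le> 1"
      using that by (subst ennreal_plus[symmetric]) auto
    then show "indicator A' (B s \<omega>) = ennreal (?R (B s \<omega>)) * indicator A' (B s \<omega>) +
        indicator A' (B s \<omega>) * ennreal (1 - ?R (B s \<omega>))"
      by (auto simp: A'_def indicator_def)
  qed auto
  finally have "?L = ?I" using fin by (simp add: ennreal_add_left_cancel)
  moreover have "(\<integral>\<^sup>+\<omega>. indicator A (B s \<omega>) * indicator {s..} (exit_time B \<omega>) \<partial>N) = ?L"
    using exit_time_ge_imp[OF _ s] by (intro nn_integral_cong) (auto simp: A'_def indicator_def)
  moreover have "?I = (\<integral>\<^sup>+x. indicator A' x * ennreal (1 - ?R x) \<partial>gauss s)"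
    by (rule nn_integral_law[OF s]) measurable
  moreover have "\<dots> = (\<integral>\<^sup>+x. indicator A x * ennreal (1 - ?R x) \<partial>gauss s)"
    by (intro nn_integral_cong) (auto simp: A'_def indicator_def ennreal_neg)
  ultimately show ?thesis by simp
qed

lemma exit_law:
  assumes s: "0 < s" and [measurable]: "f \<in> borel_measurable borel"
  shows "(\<integral>\<^sup>+\<omega>. f (B s \<omega>) * indicator {s..} (exit_time B \<omega>) \<partial>N) =
    (\<integral>\<^sup>+x. f x * ennreal (1 - sphere_R CARD('d) s x) \<partial>gauss s)"
proof -
  have [measurable]: "B s \<in> borel_measurable N" using s by (intro B_measurable) simp
  let ?N = "density N (\<lambda>\<omega>. indicator {s..} (exit_time B \<omega>))"
  have eq: "distr ?N borel (B s) = density (gauss s) (\<lambda>x. ennreal (1 - sphere_R CARD('d) s x))"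
  proof (rule measure_eqI)
    fix A assume "A \<in> sets (distr ?N borel (B s))"
    then have A [measurable]: "A \<in> sets borel" by simp
    have "emeasure (distr ?N borel (B s)) A = (\<integral>\<^sup>+\<omega>. indicator A (B s \<omega>) * indicator {s..} (exit_time B \<omega>) \<partial>N)"
      by (subst emeasure_distr) (auto simp: emeasure_density intro!: nn_integral_cong split: split_indicator)
    also have "\<dots> = emeasure (density (gauss s) (\<lambda>x. ennreal (1 - sphere_R CARD('d) s x))) A"
      unfolding exit_law_set[OF s A]
      by (subst emeasure_density) (auto intro!: nn_integral_cong split: split_indicator)
    finally show "emeasure (distr ?N borel (B s)) A = emeasure (density (gauss s) (\<lambda>x. ennreal (1 - sphere_R CARD('d) s x))) A" .
  qed simp
  have "(\<integral>\<^sup>+\<omega>. f (B s \<omega>) * indicator {s..} (exit_time B \<omega>) \<partial>N) = (\<integral>\<^sup>+x. f x \<partial>distr ?N borel (B s))"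
    by (subst nn_integral_distr) (auto simp: nn_integral_density mult.commute)
  also have "\<dots> = (\<integral>\<^sup>+x. f x * ennreal (1 - sphere_R CARD('d) s x) \<partial>gauss s)"
    unfolding eq by (subst nn_integral_density) (auto simp: mult.commute)
  finally show ?thesis .
qed

lemma exit_law_flip:
  assumes s: "0 < s" and [measurable]: "f \<in> borel_measurable borel"
  shows "(\<integral>\<^sup>+\<omega>. f (flip i (B s \<omega>)) * indicator {s..} (exit_time B \<omega>) \<partial>N) =
    (\<integral>\<^sup>+\<omega>. f (B s \<omega>) * indicator {s..} (exit_time B \<omega>) \<partial>N)"
proof -
  have "(\<integral>\<^sup>+\<omega>. f (flip i (B s \<omega>)) * indicator {s..} (exit_time B \<omega>) \<partial>N) =
    (\<integral>\<^sup>+x. f (flip i x) * ennreal (1 - sphere_R CARD('d) s x) \<partial>gauss s)"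
    by (rule exit_law[OF s]) measurable
  also have "\<dots> = (\<integral>\<^sup>+x. f (flip i x) * ennreal (1 - sphere_R CARD('d) s (flip i x)) \<partial>gauss s)"
    by (simp add: sphere_R_def)
  also have "\<dots> = (\<integral>\<^sup>+x. f x * ennreal (1 - sphere_R CARD('d) s x) \<partial>distr (gauss s) borel (flip i))"
    by (rule nn_integral_distr[symmetric]) measurable
  also have "\<dots> = (\<integral>\<^sup>+\<omega>. f (B s \<omega>) * indicator {s..} (exit_time B \<omega>) \<partial>N)"
    unfolding distr_gauss_flip[OF s] by (rule exit_law[OF s, symmetric]) measurable
  finally show ?thesis .
qed

text \<open>The reflection exchanges the positive and the negative part. In the non-integrable case
  the integral is 0 by convention.\<close>

lemma exit_law_odd:
  fixes g :: "real ^ 'd \<Rightarrow> real"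
  assumes s: "0 < s" and [measurable]: "g \<in> borel_measurable borel" and odd: "\<And>x. g (flip i x) = - g x"
  shows "(\<integral>\<omega>. g (B s \<omega>) * indicator {s..} (exit_time B \<omega>) \<partial>N) = 0"
proof (cases "integrable N (\<lambda>\<omega>. g (B s \<omega>) * indicator {s..} (exit_time B \<omega>))")
  case True
  have e: "ennreal (c * g x * indicator {s..} t) = ennreal (c * g x) * indicator {s..} t" for c x and t :: real
    by (simp split: split_indicator)
  have "(\<integral>\<^sup>+\<omega>. ennreal (- (g (B s \<omega>) * indicator {s..} (exit_time B \<omega>))) \<partial>N) =
     (\<integral>\<^sup>+\<omega>. ennreal (g (flip i (B s \<omega>))) * indicator {s..} (exit_time B \<omega>) \<partial>N)"
    using e[of "-1"] by (simp add: odd)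
  also have "\<dots> = (\<integral>\<^sup>+\<omega>. ennreal (g (B s \<omega>)) * indicator {s..} (exit_time B \<omega>) \<partial>N)"
    by (rule exit_law_flip[OF s]) measurable
  also have "\<dots> = (\<integral>\<^sup>+\<omega>. ennreal (g (B s \<omega>) * indicator {s..} (exit_time B \<omega>)) \<partial>N)"
    using e[of 1] by simp
  finally show ?thesis
    using True by (simp add: real_lebesgue_integral_def)
qed (rule not_integrable_integral_eq)

text \<open>The inequality ln x <= x - 1 bounds psi(s) by d (a - s). The uniform bound on the path
  before exit justifies dominated convergence in what follows.\<close>

lemma exit_bound:
  assumes \<omega>: "\<omega> \<in> space N" and s: "0 \<le> s" "s \<le> exit_time B \<omega>"
  shows "(norm (B s \<omega>))\<^sup>2 \<le> real CARD('d) * sphere_a CARD('d)"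
proof (cases "s = 0")
  case True
  then show ?thesis using B0[OF \<omega>] sphere_a_pos[of "CARD('d)"] by simp
next
  case False
  with s have p: "0 < s" by simp
  let ?a = "sphere_a CARD('d)"
  have a: "0 < ?a" by (simp add: sphere_a_pos)
  have "(norm (B s \<omega>))\<^sup>2 \<le> sphere_psi CARD('d) s"
    using exit_time_ge_imp[OF \<omega> p s(2)] sphere_R_gt_1_iff[OF p, of "CARD('d)" "B s \<omega>"] by (simp add: not_less[symmetric])
  also have "\<dots> \<le> real CARD('d) * s * (?a / s - 1)"
    unfolding sphere_psi_def using a p ln_le_minus_one[of "?a / s"] by (intro mult_left_mono) auto
  also have "\<dots> \<le> real CARD('d) * ?a" using p by (simp add: field_simps)
  finally show ?thesis .
qed

lemma path_measurable [measurable]: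
  "(\<lambda>p. B (max 0 (fst p)) (snd p)) \<in> borel_measurable (lborel \<Otimes>\<^sub>M N)"
  using measurable_path_pair by (simp add: case_prod_beta' cong: measurable_cong_sets sets_pair_measure_cong)

text \<open>Substituting x = sqrt v z turns \<open>sphere_R\<close> into a pure power of v times
  exp(|z|^2 / 2), so that for fixed z the integral over v is elementary. Hence the exchange of the
  order of integration.\<close>

lemma occupation:
  assumes [measurable]: "f \<in> borel_measurable borel"
  shows "(\<integral>\<^sup>+\<omega>. \<integral>\<^sup>+v. f (B (max 0 v) \<omega>) * indicator {0<..exit_time B \<omega>} v \<partial>lborel \<partial>N) =
    (\<integral>\<^sup>+z. \<integral>\<^sup>+v. indicator {0<..} v * (f (sqrt v *\<^sub>R z) *
      ennreal (1 - (v / sphere_a CARD('d)) powr (real CARD('d) / 2) * exp ((norm z)\<^sup>2 / 2))) \<partial>lborel \<partial>gauss 1)"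
proof -
  interpret g: prob_space "gauss 1 :: (real ^ 'd) measure" by (intro prob_space_gauss) simp
  interpret pair_sigma_finite lborel N ..
  interpret gp: pair_sigma_finite lborel "gauss 1 :: (real ^ 'd) measure" ..
  have ind: "indicator {0<..exit_time B \<omega>} v = (indicator {0<..} v * indicator {v..} (exit_time B \<omega>) :: ennreal)" for v \<omega>
    by (auto simp: indicator_def)
  have ind': "(indicator {v..} t :: ennreal) = indicator {p. fst p \<le> snd p} (v, t)" for v t :: real
    by (auto simp: indicator_def)
  have "(\<integral>\<^sup>+\<omega>. \<integral>\<^sup>+v. f (B (max 0 v) \<omega>) * indicator {0<..exit_time B \<omega>} v \<partial>lborel \<partial>N) =
     (\<integral>\<^sup>+v. \<integral>\<^sup>+\<omega>. f (B (max 0 v) \<omega>) * indicator {0<..exit_time B \<omega>} v \<partial>N \<partial>lborel)"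
    unfolding ind ind' by (rule Fubini') (simp add: case_prod_beta', measurable)
  also have "\<dots> = (\<integral>\<^sup>+v. \<integral>\<^sup>+z. indicator {0<..} v * (f (sqrt v *\<^sub>R z) *
      ennreal (1 - (v / sphere_a CARD('d)) powr (real CARD('d) / 2) * exp ((norm z)\<^sup>2 / 2))) \<partial>gauss 1 \<partial>lborel)"
  proof (intro nn_integral_cong)
    fix v :: real
    show "(\<integral>\<^sup>+\<omega>. f (B (max 0 v) \<omega>) * indicator {0<..exit_time B \<omega>} v \<partial>N) =
      (\<integral>\<^sup>+z. indicator {0<..} v * (f (sqrt v *\<^sub>R z) *
      ennreal (1 - (v / sphere_a CARD('d)) powr (real CARD('d) / 2) * exp ((norm z)\<^sup>2 / 2))) \<partial>gauss 1)"
    proof (cases "0 < v")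
      case True
      then have "(\<integral>\<^sup>+\<omega>. f (B (max 0 v) \<omega>) * indicator {0<..exit_time B \<omega>} v \<partial>N) =
        (\<integral>\<^sup>+x. f x * ennreal (1 - sphere_R CARD('d) v x) \<partial>gauss v)"
        unfolding ind using exit_law[OF True, of f] by simp
      also have "\<dots> = (\<integral>\<^sup>+z. f (sqrt v *\<^sub>R z) * ennreal (1 - sphere_R CARD('d) v (sqrt v *\<^sub>R z)) \<partial>gauss 1)"
        unfolding gauss_scale[OF True] by (rule nn_integral_distr) measurable
      finally show ?thesis using True by (simp add: sphere_R_scaled)
    qed (simp add: ind)
  qed
  also have "\<dots> = (\<integral>\<^sup>+z. \<integral>\<^sup>+v. indicator {0<..} v * (f (sqrt v *\<^sub>R z) *
      ennreal (1 - (v / sphere_a CARD('d)) powr (real CARD('d) / 2) * exp ((norm z)\<^sup>2 / 2))) \<partial>lborel \<partial>gauss 1)"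
    by (rule gp.Fubini'[symmetric]) (simp add: case_prod_beta')
  finally show ?thesis .
qed

text \<open>The occupation formula for f = 1 gives a (d / (d + 2)) (1 + 2 / d)^(- d / 2). That this
  equals 1 is the origin of the constant \<open>sphere_a\<close>.\<close>

lemma exit_time_mean_nn: "(\<integral>\<^sup>+\<omega>. ennreal (exit_time B \<omega>) \<partial>N) = 1"
proof -
  let ?d = "CARD('d)" and ?r = "real CARD('d)" and ?a = "sphere_a CARD('d)"
  have d: "0 < ?r" by simp
  have a: "0 < ?a" by (simp add: sphere_a_pos)
  have "(\<integral>\<^sup>+\<omega>. ennreal (exit_time B \<omega>) \<partial>N) = (\<integral>\<^sup>+\<omega>. \<integral>\<^sup>+v. 1 * indicator {0<..exit_time B \<omega>} v \<partial>lborel \<partial>N)"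
    using exit_time_nonneg[of B] by (simp add: emeasure_lborel_Ioc)
  also have "\<dots> = (\<integral>\<^sup>+z. \<integral>\<^sup>+v. indicator {0<..} v * (1 *
      ennreal (1 - (v / ?a) powr (?r / 2) * exp ((norm (z::real^'d))\<^sup>2 / 2))) \<partial>lborel \<partial>gauss 1)"
    by (rule occupation) measurable
  also have "\<dots> = (\<integral>\<^sup>+z. ennreal (?a * (1 - 1 / (?r / 2 + 1))) * ennreal (exp (- (1 / ?r) * (norm (z :: real ^ 'd))\<^sup>2)) \<partial>gauss 1)"
  proof (intro nn_integral_cong)
    fix z :: "real ^ 'd"
    have "exp ((norm z)\<^sup>2 / 2) powr (- 1 / (?r / 2)) = exp (- (1 / ?r) * (norm z)\<^sup>2)"
      by (simp add: powr_def)
    then show "(\<integral>\<^sup>+v. indicator {0<..} v * (1 * ennreal (1 - (v / ?a) powr (?r / 2) * exp ((norm z)\<^sup>2 / 2))) \<partial>lborel) =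
      ennreal (?a * (1 - 1 / (?r / 2 + 1))) * ennreal (exp (- (1 / ?r) * (norm z)\<^sup>2))"
      using occupation_time_integral[OF a, of "exp ((norm z)\<^sup>2 / 2)" "?r / 2" 0] a d
      by (simp add: ennreal_mult''[symmetric] mult_ac)
  qed
  also have "\<dots> = ennreal (?a * (1 - 1 / (?r / 2 + 1))) * ennreal ((1 + 2 * (1 / ?r)) powr (- ?r / 2))"
    by (subst nn_integral_cmult) (auto simp: nn_integral_gauss_exp(1)[of "1 / ?r", simplified])
  also have "\<dots> = ennreal (?a * (1 + 2 / ?r) powr (- ?r / 2) * (1 - 1 / (?r / 2 + 1)))"
    by (simp add: ennreal_mult''[symmetric] mult_ac)
  also have "?a * (1 + 2 / ?r) powr (- ?r / 2) = 1 + 2 / ?r"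
    unfolding sphere_a_def powr_add[symmetric] using d by (simp add: add_pos_pos)
  also have "(1 + 2 / ?r) * (1 - 1 / (?r / 2 + 1)) = 1"
  proof -
    have "(1 + 2 / r) * (1 - 1 / (r / 2 + 1)) = 1" if "0 < r" for r :: real
    proof -
      have "1 - 1 / (r / 2 + 1) = r / (r + 2)" using that by (simp add: field_simps)
      moreover have "1 + 2 / r = (r + 2) / r" "r + 2 \<noteq> 0" using that by (simp_all add: field_simps)
      ultimately show ?thesis using that by simp
    qed
    then show ?thesis using d by blast
  qed
  finally show ?thesis by simp
qed

text \<open>Origin of \<open>sphere_r\<close>: the left side is what the occupation formula yields
  for a squared coordinate. Writing each factor as an exponential reduces the identity to one
  between linear combinations of logarithms.\<close>

lemma sphere_r_second_moment:
  fixes d :: nat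
  assumes "d \<ge> 1"
  shows "(sphere_a d)\<^sup>2 * (1 + 4 / d) powr (- real d / 2 - 1) * (1 / 2 - 1 / (real d / 2 + 2)) = sphere_r d / 2"
proof -
  define r where "r = real d"
  have r: "0 < r" using assms by (simp add: r_def)
  have e: "1 + 2 / r = exp (ln (r + 2) - ln r)" "1 + 4 / r = exp (ln (r + 4) - ln r)"
    using r by (simp_all add: exp_diff field_simps)
  have "(sphere_a d)\<^sup>2 = exp ((r + 2) * (ln (r + 2) - ln r))"
    unfolding sphere_a_def r_def[symmetric] e powr_def
    by (simp add: power2_eq_square exp_add[symmetric])
  moreover have "(1 + 4 / r) powr (- r / 2 - 1) = exp ((- r / 2 - 1) * (ln (r + 4) - ln r))"
    unfolding e powr_def by simp
  moreover have "1 / 2 - 1 / (r / 2 + 2) = exp (ln r - ln (r + 4)) / 2"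
    using r by (simp add: exp_diff field_simps)
  ultimately have "(sphere_a d)\<^sup>2 * (1 + 4 / r) powr (- r / 2 - 1) * (1 / 2 - 1 / (r / 2 + 2)) =
     exp ((r + 2) * (ln (r + 2) - ln r) + (- r / 2 - 1) * (ln (r + 4) - ln r) + (ln r - ln (r + 4))) / 2"
    by (simp add: exp_add)
  also have "(r + 2) * (ln (r + 2) - ln r) + (- r / 2 - 1) * (ln (r + 4) - ln r) + (ln r - ln (r + 4)) =
     (r + 2) * ln (r + 2) - r / 2 * ln r - (r + 4) / 2 * ln (r + 4)"
    by (simp add: field_simps)
  finally show ?thesis
    using sphere_r_exp[OF assms] by (simp add: r_def add.commute)
qed

text \<open>The rescaled square contributes a factor v, so the time integral is the case k = 1. The
  value r(d) / 2 becomes 3 r(d) in the fourth moment through the coefficient 6 of Dynkin's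
  formula.\<close>

lemma occupation_square:
  "(\<integral>\<^sup>+\<omega>. \<integral>\<^sup>+v. ennreal ((B (max 0 v) \<omega> $ j)\<^sup>2) * indicator {0<..exit_time B \<omega>} v \<partial>lborel \<partial>N) =
    ennreal (sphere_r CARD('d) / 2)"
proof -
  let ?d = "CARD('d)" and ?r = "real CARD('d)" and ?a = "sphere_a CARD('d)"
  have d: "0 < ?r" by simp
  have a: "0 < ?a" by (simp add: sphere_a_pos)
  have c: "0 \<le> 1 / 2 - 1 / (?r / 2 + 2)" using d by (simp add: field_simps)
  have "(\<integral>\<^sup>+\<omega>. \<integral>\<^sup>+v. ennreal ((B (max 0 v) \<omega> $ j)\<^sup>2) * indicator {0<..exit_time B \<omega>} v \<partial>lborel \<partial>N) =
      (\<integral>\<^sup>+z. \<integral>\<^sup>+v. indicator {0<..} v * (ennreal (((sqrt v *\<^sub>R z) $ j)\<^sup>2) *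
      ennreal (1 - (v / ?a) powr (?r / 2) * exp ((norm (z::real^'d))\<^sup>2 / 2))) \<partial>lborel \<partial>gauss 1)"
    by (rule occupation) measurable
  also have "\<dots> = (\<integral>\<^sup>+z. ennreal (?a\<^sup>2 * (1 / 2 - 1 / (?r / 2 + 2))) *
      ennreal ((z $ j)\<^sup>2 * exp (- (2 / ?r) * (norm (z :: real ^ 'd))\<^sup>2)) \<partial>gauss 1)"
  proof (intro nn_integral_cong)
    fix z :: "real ^ 'd"
    have p: "(exp ((norm z)\<^sup>2 / 2) powr (- 1 / (?r / 2)))\<^sup>2 = exp (- (2 / ?r) * (norm z)\<^sup>2)"
      by (simp add: powr_def power2_eq_square exp_add[symmetric])
    have "(\<integral>\<^sup>+v. indicator {0<..} v * (ennreal (((sqrt v *\<^sub>R z) $ j)\<^sup>2) *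
        ennreal (1 - (v / ?a) powr (?r / 2) * exp ((norm z)\<^sup>2 / 2))) \<partial>lborel) =
      (\<integral>\<^sup>+v. ennreal ((z $ j)\<^sup>2) * (indicator {0<..} v * ennreal (v ^ 1 * (1 - (v / ?a) powr (?r / 2) * exp ((norm z)\<^sup>2 / 2)))) \<partial>lborel)"
    proof (intro nn_integral_cong)
      fix v :: real
      show "indicator {0<..} v * (ennreal (((sqrt v *\<^sub>R z) $ j)\<^sup>2) *
        ennreal (1 - (v / ?a) powr (?r / 2) * exp ((norm z)\<^sup>2 / 2))) =
        ennreal ((z $ j)\<^sup>2) * (indicator {0<..} v * ennreal (v ^ 1 * (1 - (v / ?a) powr (?r / 2) * exp ((norm z)\<^sup>2 / 2))))"
      proof (cases "0 < v")
        case True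
        then have "((sqrt v *\<^sub>R z) $ j)\<^sup>2 = (z $ j)\<^sup>2 * v"
          by (simp add: power_mult_distrib)
        then show ?thesis using True by (simp add: ennreal_mult' mult.assoc)
      qed simp
    qed
    also have "\<dots> = ennreal ((z $ j)\<^sup>2) * ennreal ((?a * exp ((norm z)\<^sup>2 / 2) powr (- 1 / (?r / 2))) ^ (1 + 1) * (1 / (real 1 + 1) - 1 / (?r / 2 + real 1 + 1)))"
      using occupation_time_integral[OF a, of "exp ((norm z)\<^sup>2 / 2)" "?r / 2" 1] d
      by (subst nn_integral_cmult) auto
    also have "(?a * exp ((norm z)\<^sup>2 / 2) powr (- 1 / (?r / 2))) ^ (1 + 1) * (1 / (real 1 + 1) - 1 / (?r / 2 + real 1 + 1)) =
       ?a\<^sup>2 * (1 / 2 - 1 / (?r / 2 + 2)) * exp (- (2 / ?r) * (norm z)\<^sup>2)"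
      unfolding p[symmetric] by (simp add: power_mult_distrib power2_eq_square add.assoc)
    also have "ennreal ((z $ j)\<^sup>2) * ennreal \<dots> = ennreal (?a\<^sup>2 * (1 / 2 - 1 / (?r / 2 + 2))) *
      ennreal ((z $ j)\<^sup>2 * exp (- (2 / ?r) * (norm z)\<^sup>2))"
      by (subst (1 2) ennreal_mult''[symmetric]) (auto simp: mult_ac)
    finally show "(\<integral>\<^sup>+v. indicator {0<..} v * (ennreal (((sqrt v *\<^sub>R z) $ j)\<^sup>2) *
        ennreal (1 - (v / ?a) powr (?r / 2) * exp ((norm z)\<^sup>2 / 2))) \<partial>lborel) =
      ennreal (?a\<^sup>2 * (1 / 2 - 1 / (?r / 2 + 2))) *
      ennreal ((z $ j)\<^sup>2 * exp (- (2 / ?r) * (norm z)\<^sup>2))" .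
  qed
  also have "\<dots> = ennreal (?a\<^sup>2 * (1 / 2 - 1 / (?r / 2 + 2))) * ennreal ((1 + 2 * (2 / ?r)) powr (- ?r / 2 - 1))"
    using nn_integral_gauss_exp(2)[of "2 / ?r" j] by (subst nn_integral_cmult) auto
  also have "\<dots> = ennreal (?a\<^sup>2 * (1 + 4 / ?r) powr (- ?r / 2 - 1) * (1 / 2 - 1 / (?r / 2 + 2)))"
    by (subst ennreal_mult''[symmetric]) (auto simp: mult_ac)
  also have "\<dots> = ennreal (sphere_r CARD('d) / 2)"
    by (subst sphere_r_second_moment) (auto simp: Suc_le_eq)
  finally show ?thesis .
qed

end

section \<open>Time grids, Riemann sums and integrals against independent increments\<close>

lemma borel_measurable_vec_nth' [measurable (raw)]:
  fixes f :: "'a \<Rightarrow> real ^ 'd::finite"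
  assumes "f \<in> borel_measurable M"
  shows "(\<lambda>x. f x $ j) \<in> borel_measurable M"
  by (rule measurable_compose[OF assms borel_measurable_continuous_onI]) (intro continuous_intros)

lemma tendsto_floor_grid:
  fixes x :: real
  assumes n: "filterlim n at_top sequentially"
  shows "(\<lambda>k. real_of_int \<lfloor>real (n k) * x\<rfloor> / real (n k)) \<longlonglongrightarrow> x"
proof (rule LIMSEQ_I)
  fix e :: real assume "0 < e"
  then obtain n0 :: nat where n0: "1 / e < real n0"
    using reals_Archimedean2 by blast
  have "\<forall>\<^sub>F k in sequentially. Suc n0 \<le> n k"
    using n by (simp add: filterlim_at_top)
  then obtain k0 where k0: "\<And>k. k0 \<le> k \<Longrightarrow> Suc n0 \<le> n k"
    by (auto simp: eventually_sequentially)
  show "\<exists>no. \<forall>k\<ge>no. norm (real_of_int \<lfloor>real (n k) * x\<rfloor> / real (n k) - x) < e"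
  proof (intro exI allI impI)
    fix k assume "k0 \<le> k"
    then have nk: "Suc n0 \<le> n k" by (rule k0)
    then have "1 / e < real (n k)" using n0 by linarith
    then have n1: "1 < e * real (n k)" using \<open>0 < e\<close> by (simp only: pos_divide_less_eq mult.commute)
    have p: "0 < real (n k)" using nk by simp
    have "\<bar>real_of_int \<lfloor>real (n k) * x\<rfloor> - real (n k) * x\<bar> \<le> 1" by linarith
    also note n1
    finally have "\<bar>real_of_int \<lfloor>real (n k) * x\<rfloor> - real (n k) * x\<bar> / real (n k) < e"
      using p by (subst pos_divide_less_eq) auto
    moreover have "real_of_int \<lfloor>real (n k) * x\<rfloor> / real (n k) - x =
        (real_of_int \<lfloor>real (n k) * x\<rfloor> - real (n k) * x) / real (n k)"
      using p by (simp add: field_simps)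
    ultimately show "norm (real_of_int \<lfloor>real (n k) * x\<rfloor> / real (n k) - x) < e"
      by (simp only: real_norm_def abs_divide abs_of_nat)
  qed
qed

text \<open>A left-endpoint sum is the integral of a step function of v; its convergence can then be
  had from dominated convergence on the line.\<close>

lemma riemann_sum:
  fixes g :: "real \<Rightarrow> real"
  assumes n: "0 < n"
  shows "has_bochner_integral lborel (\<lambda>v. g (real_of_int \<lfloor>real n * v\<rfloor> / real n) * indicator {0..<real A} v)
    (\<Sum>i<A * n. g (real i / real n) / real n)"
proof -
  have "has_bochner_integral lborel (\<lambda>v. \<Sum>i<A * n. g (real i / real n) * indicator {real i / real n..<(real i + 1) / real n} v)
    (\<Sum>i<A * n. g (real i / real n) * ((real i + 1) / real n - real i / real n))"
  proof (intro has_bochner_integral_sum has_bochner_integral_mult_right)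
    fix i
    have le: "real i / real n \<le> (real i + 1) / real n" by (intro divide_right_mono) auto
    then have "measure lborel {real i / real n..<(real i + 1) / real n} = (real i + 1) / real n - real i / real n"
      by (rule measure_lborel_Ico)
    then show "has_bochner_integral lborel (indicator {real i / real n..<(real i + 1) / real n}) ((real i + 1) / real n - real i / real n)"
      using has_bochner_integral_real_indicator[of "{real i / real n..<(real i + 1) / real n}" lborel]
      using emeasure_lborel_Ico[OF le] by simp
  qed
  moreover have "(\<Sum>i<A * n. g (real i / real n) * indicator {real i / real n..<(real i + 1) / real n} v) =
      g (real_of_int \<lfloor>real n * v\<rfloor> / real n) * indicator {0..<real A} v" for v
  proof (cases "0 \<le> v \<and> v < real A")
    case True
    define k where "k = nat \<lfloor>real n * v\<rfloor>"
    have k: "real k = real_of_int \<lfloor>real n * v\<rfloor>" using True by (simp add: k_def)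
    have "real n * v < real n * real A" using True n by simp
    then have "real k < real (A * n)" unfolding k by (simp add: mult.commute) linarith
    then have kA: "k < A * n" by linarith
    have ind: "(indicator {real i / real n..<(real i + 1) / real n} v :: real) = (if i = k then 1 else 0)" for i
    proof -
      have "v \<in> {real i / real n..<(real i + 1) / real n} \<longleftrightarrow> real i \<le> real n * v \<and> real n * v < real i + 1"
        using n by (simp add: field_simps)
      also have "\<dots> \<longleftrightarrow> int i = \<lfloor>real n * v\<rfloor>" by linarith
      also have "\<dots> \<longleftrightarrow> i = k" using k by linarith
      finally show ?thesis by (simp add: indicator_def)
    qed
    show ?thesis using True kA by (simp add: ind k if_distrib sum.delta cong: if_cong)
  next
    case False
    have "v \<notin> {real i / real n..<(real i + 1) / real n}" if "i < A * n" for i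
    proof
      assume v: "v \<in> {real i / real n..<(real i + 1) / real n}"
      have "real i + 1 \<le> real (A * n)" using that by linarith
      then have "(real i + 1) / real n \<le> real (A * n) / real n" by (intro divide_right_mono) auto
      also have "\<dots> = real A" using n by simp
      finally have "v < real A" using v by simp
      moreover have "0 \<le> v"
        by (rule order_trans[of _ "real i / real n"]) (use v in auto)
      ultimately show False using False by simp
    qed
    then show ?thesis using False by (auto intro!: sum.neutral)
  qed
  ultimately show ?thesis by (simp add: add_divide_distrib)
qed

context brownian
begin

lemma incr_law:
  assumes s: "0 \<le> s" "s < u" shows "distr N borel (\<lambda>\<omega>. B u \<omega> - B s \<omega>) = gauss (u - s)"
proof (rule measure_eqI)
  have [measurable]: "B u \<in> borel_measurable N" "B s \<in> borel_measurable N"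
    using s by (auto intro: B_measurable)
  fix E assume "E \<in> sets (distr N borel (\<lambda>\<omega>. B u \<omega> - B s \<omega>))"
  then have E: "E \<in> sets borel" by simp
  have "space N \<in> sets (F s)" using space_F[of s] sets.top[of "F s"] s by simp
  moreover have "space N \<inter> {\<omega> \<in> space N. B u \<omega> - B s \<omega> \<in> E} = (\<lambda>\<omega>. B u \<omega> - B s \<omega>) -` E \<inter> space N" by auto
  ultimately show "emeasure (distr N borel (\<lambda>\<omega>. B u \<omega> - B s \<omega>)) E = emeasure (gauss (u - s)) E"
    using indep[OF s, of "space N" E] E by (simp add: emeasure_distr emeasure_space_1)
qed simp

lemma incr_integral:
  fixes g :: "real ^ 'd \<Rightarrow> real"
  assumes s: "0 \<le> s" "s < u" and g: "has_bochner_integral (gauss (u - s)) g c"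
  shows "has_bochner_integral N (\<lambda>\<omega>. g (B u \<omega> - B s \<omega>)) c"
proof -
  have [measurable]: "B u \<in> borel_measurable N" "B s \<in> borel_measurable N"
    using s by (auto intro: B_measurable)
  have gm [measurable]: "g \<in> borel_measurable borel"
    using borel_measurable_has_bochner_integral[OF g] by (simp cong: measurable_cong_sets)
  show ?thesis
    using g unfolding incr_law[OF s, symmetric]
    by (simp add: has_bochner_integral_iff integrable_distr_eq integral_distr)
qed

lemma incr_indep_integral:
  fixes g :: "real ^ 'd \<Rightarrow> real" and h :: "'a \<Rightarrow> real"
  assumes s: "0 \<le> s" "s < u" and g: "has_bochner_integral (gauss (u - s)) g c"
    and h: "h \<in> borel_measurable (F s)" and hb: "\<And>\<omega>. \<omega> \<in> space N \<Longrightarrow> \<bar>h \<omega>\<bar> \<le> K"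
  shows "has_bochner_integral N (\<lambda>\<omega>. h \<omega> * g (B u \<omega> - B s \<omega>)) (expectation h * c)"
proof -
  have [measurable]: "B u \<in> borel_measurable N" "B s \<in> borel_measurable N"
    using s by (auto intro: B_measurable)
  have gm [measurable]: "g \<in> borel_measurable borel"
    using borel_measurable_has_bochner_integral[OF g] by (simp cong: measurable_cong_sets)
  have hN [measurable]: "h \<in> borel_measurable N" using s(1) h by (rule F_into)
  let ?Y = "\<lambda>\<omega>. g (B u \<omega> - B s \<omega>)"
  interpret X: prob_space "distr N borel h" by (rule prob_space_distr) measurable
  interpret Y: prob_space "distr N borel ?Y" by (rule prob_space_distr) measurable
  have "distr N borel h \<Otimes>\<^sub>M distr N borel ?Y = distr N (borel \<Otimes>\<^sub>M borel) (\<lambda>\<omega>. (h \<omega>, ?Y \<omega>))"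
  proof (rule pair_measure_eqI)
    fix A E assume "A \<in> sets (distr N borel h)" "E \<in> sets (distr N borel ?Y)"
    then have A [measurable]: "A \<in> sets borel" and E [measurable]: "E \<in> sets borel" by auto
    have gE: "g -` E \<in> sets borel" using measurable_sets[OF gm E] by simp
    have hA: "h -` A \<inter> space N \<in> sets (F s)"
      using measurable_sets[OF h A] by (simp add: space_F s)
    have eq: "(\<lambda>\<omega>. (h \<omega>, ?Y \<omega>)) -` (A \<times> E) \<inter> space N =
      (h -` A \<inter> space N) \<inter> {\<omega> \<in> space N. B u \<omega> - B s \<omega> \<in> g -` E}" by auto
    have "emeasure (distr N borel ?Y) E = emeasure (distr N borel (\<lambda>\<omega>. B u \<omega> - B s \<omega>)) (g -` E)"
      using gE by (simp add: emeasure_distr) (auto intro!: arg_cong[where f="emeasure N"])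
    then show "emeasure (distr N borel h) A * emeasure (distr N borel ?Y) E =
       emeasure (distr N (borel \<Otimes>\<^sub>M borel) (\<lambda>\<omega>. (h \<omega>, ?Y \<omega>))) (A \<times> E)"
      using indep[OF s hA gE] unfolding incr_law[OF s]
      by (simp add: emeasure_distr eq)
  qed (unfold_locales, auto intro!: sets_pair_measure_cong)
  then have ind: "indep_var borel h borel ?Y"
    by (subst indep_var_distribution_eq) auto
  have ih: "integrable N h" using hb by (intro integrable_const_bound[where B=K]) auto
  have iY: "has_bochner_integral N ?Y c" by (rule incr_integral[OF s g])
  show ?thesis
    using indep_var_lebesgue_integral[OF ind ih] indep_var_integrable[OF ind ih] iY
    by (simp add: has_bochner_integral_iff)
qed

end

context brownian0
begin

lemma exit_value_measurable [measurable]: "(\<lambda>\<omega>. B (exit_time B \<omega>) \<omega>) \<in> borel_measurable N"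
proof (rule measurable_random_time[where s="sphere_a CARD('d)"])
  show "\<omega> \<in> space N \<Longrightarrow> continuous_on {0..sphere_a CARD('d)} (\<lambda>r. B r \<omega>)" for \<omega>
    using cont by (rule continuous_on_subset) auto
qed (use exit_time_nonneg[of B] exit_time_le[of B] in \<open>auto intro: B_measurable\<close>)

lemma coord_bound:
  assumes "\<omega> \<in> space N" "0 \<le> s" "s \<le> exit_time B \<omega>"
  shows "\<bar>B s \<omega> $ j\<bar> \<le> sqrt (real CARD('d) * sphere_a CARD('d))"
proof -
  have "\<bar>B s \<omega> $ j\<bar> \<le> norm (B s \<omega>)" by (rule component_le_norm_cart)
  also have "\<dots> \<le> sqrt (real CARD('d) * sphere_a CARD('d))"
    using exit_bound[OF assms] by (rule real_le_rsqrt)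
  finally show ?thesis .
qed

subsubsection \<open>Moments of the exit position\<close>

text \<open>Discrete Dynkin formula. The sum of increments over the grid times not after the exit
  telescopes to the value at the first grid time beyond the exit, which differs from the exit value
  by at most two small pieces. The hypothesis \<open>fK\<close> is a growth bound that is integrable
  for Gaussian \<open>y\<close>.\<close>

lemma stopped_value_limit:
  fixes f :: "real \<Rightarrow> real"
  assumes f: "continuous_on UNIV f" and K: "0 \<le> K"
    and fK: "\<And>x y. \<bar>x\<bar> \<le> sqrt (real CARD('d) * sphere_a CARD('d)) \<Longrightarrow> \<bar>f (x + y) - f x\<bar> \<le> K * (\<bar>y\<bar> + y ^ 4)"
    and f0: "f 0 = 0"
  shows "(\<lambda>k. \<Sum>i<Suc (nat \<lceil>sphere_a CARD('d)\<rceil>) * Suc k ^ 4.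
      \<integral>\<omega>. indicator {real i / real (Suc k ^ 4)..} (exit_time B \<omega>) *
        (f (B (real (Suc i) / real (Suc k ^ 4)) \<omega> $ j) - f (B (real i / real (Suc k ^ 4)) \<omega> $ j)) \<partial>N)
    \<longlonglongrightarrow> (\<integral>\<omega>. f (B (exit_time B \<omega>) \<omega> $ j) \<partial>N)"
proof -
  let ?a = "sphere_a CARD('d)"
  define C where "C = sqrt (real CARD('d) * ?a)"
  define A where "A = Suc (nat \<lceil>?a\<rceil>)"
  have a: "0 < ?a" by (simp add: sphere_a_pos)
  have A: "?a < real A" unfolding A_def by linarith
  define n where "n k = Suc k ^ 4" for k :: nat
  have n0: "0 < n k" for k by (simp add: n_def)
  define X where "X k i \<omega> = B (real i / real (n k)) \<omega> $ j" for k i \<omega>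
  define m where "m k \<omega> = nat \<lfloor>real (n k) * exit_time B \<omega>\<rfloor>" for k \<omega>
  have X_meas [measurable]: "X k i \<in> borel_measurable N" for k i
  proof -
    have [measurable]: "B (real i / real (n k)) \<in> borel_measurable N" by (intro B_measurable) simp
    show ?thesis unfolding X_def[abs_def] by measurable
  qed
  have f_meas [measurable]: "f \<in> borel_measurable borel" using f by (rule borel_measurable_continuous_onI)
  have m_meas [measurable]: "m k \<in> measurable N (count_space UNIV)" for k
    unfolding m_def[abs_def] by measurable
  have Xm_meas [measurable]: "(\<lambda>\<omega>. X k (m k \<omega>) \<omega>) \<in> borel_measurable N"
       "(\<lambda>\<omega>. X k (Suc (m k \<omega>)) \<omega>) \<in> borel_measurable N" for k
    by (rule measurable_compose_countable[OF _ m_meas], measurable)+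
  have m_iff: "real i / real (n k) \<le> exit_time B \<omega> \<longleftrightarrow> i \<le> m k \<omega>" for i k \<omega>
  proof -
    have "real i / real (n k) \<le> exit_time B \<omega> \<longleftrightarrow> real i \<le> real (n k) * exit_time B \<omega>"
      using n0[of k] by (simp add: field_simps)
    also have "\<dots> \<longleftrightarrow> i \<le> m k \<omega>" 
      unfolding m_def using exit_time_nonneg[of B \<omega>] by (subst le_nat_iff) (auto simp: le_floor_iff)
    finally show ?thesis .
  qed
  have mA: "m k \<omega> < A * n k" for k \<omega>
  proof -
    have "real (m k \<omega>) / real (n k) \<le> exit_time B \<omega>" by (simp add: m_iff)
    also have "\<dots> \<le> ?a" by (rule exit_time_le)
    also note A
    finally have "real (m k \<omega>) < real (A * n k)" using n0[of k] by (simp add: field_simps)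
    then show ?thesis by linarith
  qed
  have Xb: "\<bar>X k (m k \<omega>) \<omega>\<bar> \<le> C" if "\<omega> \<in> space N" for k \<omega>
    unfolding X_def C_def by (rule coord_bound[OF that]) (auto simp: m_iff)
  \<comment> \<open>The indicator tests the left endpoint, which keeps it independent of the
    increment. The last increment kept starts at \<open>m\<close>, so the sum stops at
    \<open>Suc m\<close>.\<close>
  have telescope: "(\<Sum>i<A * n k. indicator {real i / real (n k)..} (exit_time B \<omega>) * (f (X k (Suc i) \<omega>) - f (X k i \<omega>))) =
     f (X k (Suc (m k \<omega>)) \<omega>)" if "\<omega> \<in> space N" for k \<omega>
  proof -
    have "(\<Sum>i<A * n k. indicator {real i / real (n k)..} (exit_time B \<omega>) * (f (X k (Suc i) \<omega>) - f (X k i \<omega>))) =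
      (\<Sum>i\<in>{..<A * n k}. if i \<le> m k \<omega> then f (X k (Suc i) \<omega>) - f (X k i \<omega>) else 0)"
      by (intro sum.cong) (auto simp: m_iff)
    also have "\<dots> = (\<Sum>i\<in>{..<A * n k} \<inter> {i. i \<le> m k \<omega>}. f (X k (Suc i) \<omega>) - f (X k i \<omega>))"
      by (subst sum.inter_restrict) auto
    also have "{..<A * n k} \<inter> {i. i \<le> m k \<omega>} = {..<Suc (m k \<omega>)}"
      using mA[of k \<omega>] by auto
    also have "(\<Sum>i<Suc (m k \<omega>). f (X k (Suc i) \<omega>) - f (X k i \<omega>)) = f (X k (Suc (m k \<omega>)) \<omega>) - f (X k 0 \<omega>)"
      by (rule sum_lessThan_telescope)
    also have "X k 0 \<omega> = 0" using B0[OF that] by (simp add: X_def)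
    finally show ?thesis by (simp add: f0)
  qed
  \<comment> \<open>The increment straddling the exit has a random index that depends on the
    increment itself, so its Gaussian law cannot be used directly. The sum of all fourth powers
    dominates it, with mean of order 1 / n.\<close>
  define S where "S k \<omega> = (\<Sum>i<A * n k. (X k (Suc i) \<omega> - X k i \<omega>) ^ 4)" for k \<omega>
  have incr4: "has_bochner_integral N (\<lambda>\<omega>. (X k (Suc i) \<omega> - X k i \<omega>) ^ 4) (3 / (real (n k))\<^sup>2)" for k i
  proof -
    let ?s = "real i / real (n k)" and ?u = "real (Suc i) / real (n k)"
    have d: "?u - ?s = 1 / real (n k)" by (simp add: diff_divide_distrib[symmetric])
    have "has_bochner_integral N (\<lambda>\<omega>. ((B ?u \<omega> - B ?s \<omega>) $ j) ^ 4) (3 * (1 / real (n k))\<^sup>2)"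
    proof (rule incr_integral)
      show "has_bochner_integral (gauss (?u - ?s)) (\<lambda>x :: real^'d. (x $ j) ^ 4) (3 * (1 / real (n k))\<^sup>2)"
        unfolding d by (rule gauss_moments) (use n0 in simp)
    qed (use n0 in \<open>auto intro!: divide_strict_right_mono\<close>)
    then show ?thesis by (simp add: X_def power_divide)
  qed
  have SI: "has_bochner_integral N (S k) (\<Sum>i<A * n k. 3 / (real (n k))\<^sup>2)" for k
    unfolding S_def[abs_def] by (intro has_bochner_integral_sum incr4)
  then have SI': "integrable N (S k)" "expectation (S k) = 3 * real A / real (n k)" for k
    using n0[of k] by (auto simp: has_bochner_integral_iff power2_eq_square)
  \<comment> \<open>Balances |y| <= \<eta> + y^4 / \<eta>^3: with n = (k + 1)^4 and \<eta> = 1 / (k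
    + 1) both terms contribute order 1 / (k + 1) to the mean. This explains the fourth power in the
    grid.\<close>
  define \<eta> where "\<eta> k = 1 / real (Suc k)" for k
  have \<eta>: "0 < \<eta> k" "\<eta> k \<le> 1" for k by (auto simp: \<eta>_def)
  have rem: "\<bar>f (X k (Suc (m k \<omega>)) \<omega>) - f (X k (m k \<omega>) \<omega>)\<bar> \<le> K * (\<eta> k + 2 / \<eta> k ^ 3 * S k \<omega>)"
    if \<omega>: "\<omega> \<in> space N" for k \<omega>
  proof -
    define y where "y = X k (Suc (m k \<omega>)) \<omega> - X k (m k \<omega>) \<omega>"
    have 0: "\<bar>f (X k (m k \<omega>) \<omega> + y) - f (X k (m k \<omega>) \<omega>)\<bar> \<le> K * (\<bar>y\<bar> + y ^ 4)"
      using Xb[OF \<omega>] by (intro fK) (simp add: C_def)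
    have 2: "\<bar>y\<bar> + y ^ 4 \<le> \<eta> k + 2 / \<eta> k ^ 3 * y ^ 4"
    proof -
      have e3: "\<eta> k ^ 3 \<le> 1" using \<eta>[of k] by (intro power_le_one) auto
      have y4: "y ^ 4 \<le> 1 / \<eta> k ^ 3 * y ^ 4"
        using mult_right_mono[of 1 "1 / \<eta> k ^ 3" "y ^ 4"] e3 \<eta>[of k] by simp
      have "\<bar>y\<bar> \<le> \<eta> k + 1 / \<eta> k ^ 3 * y ^ 4"
      proof (cases "\<bar>y\<bar> \<le> \<eta> k")
        case True
        moreover have "0 \<le> 1 / \<eta> k ^ 3 * y ^ 4" using \<eta>[of k] by simp
        ultimately show ?thesis by linarith
      next
        case False
        then have "\<eta> k ^ 3 \<le> \<bar>y\<bar> ^ 3" using \<eta>[of k] by (intro power_mono) auto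
        then have "\<eta> k ^ 3 * \<bar>y\<bar> \<le> \<bar>y\<bar> ^ 3 * \<bar>y\<bar>" by (intro mult_right_mono) auto
        also have "\<bar>y\<bar> ^ 3 * \<bar>y\<bar> = y ^ 4" by (simp add: power_Suc2[symmetric] del: power_Suc)
        finally have "\<bar>y\<bar> \<le> 1 / \<eta> k ^ 3 * y ^ 4" using \<eta>[of k] by (simp add: field_simps)
        then show ?thesis using \<eta>[of k] by linarith
      qed
      with y4 show ?thesis by simp
    qed
    have 1: "\<bar>f (X k (m k \<omega>) \<omega> + y) - f (X k (m k \<omega>) \<omega>)\<bar> \<le> K * (\<eta> k + 2 / \<eta> k ^ 3 * y ^ 4)"
      using 0 mult_left_mono[OF 2 K] by (rule order_trans)
    have "y ^ 4 \<le> S k \<omega>"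
      unfolding S_def y_def using mA[of k \<omega>]
      by (intro member_le_sum[of "m k \<omega>" _ "\<lambda>i. (X k (Suc i) \<omega> - X k i \<omega>) ^ 4"]) auto
    then have "K * (\<eta> k + 2 / \<eta> k ^ 3 * y ^ 4) \<le> K * (\<eta> k + 2 / \<eta> k ^ 3 * S k \<omega>)"
      using K \<eta>[of k] by (intro mult_left_mono add_left_mono) auto
    with 1 show ?thesis by (simp add: y_def)
  qed
  obtain L where L: "\<And>x. \<bar>x\<bar> \<le> C \<Longrightarrow> \<bar>f x\<bar> \<le> L"
  proof -
    have "\<bar>f x\<bar> \<le> K * (C + C ^ 4)" if "\<bar>x\<bar> \<le> C" for x
    proof -
      have "0 \<le> C" using that by simp
      have "\<bar>f (0 + x) - f 0\<bar> \<le> K * (\<bar>x\<bar> + x ^ 4)"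
        by (rule fK) (use \<open>0 \<le> C\<close> in \<open>simp add: C_def\<close>)
      also have "\<dots> \<le> K * (C + C ^ 4)"
        using that K power_mono[of "\<bar>x\<bar>" C 4] by (intro mult_left_mono add_mono) auto
      finally show ?thesis by (simp add: f0)
    qed
    then show ?thesis using that by blast
  qed
  have i1: "integrable N (\<lambda>\<omega>. f (X k (m k \<omega>) \<omega>))" for k
    using Xb L by (intro integrable_const_bound[where B=L]) auto
  have i2: "integrable N (\<lambda>\<omega>. f (X k (Suc (m k \<omega>)) \<omega>) - f (X k (m k \<omega>) \<omega>))" for k
  proof (rule Bochner_Integration.integrable_bound)
    show "integrable N (\<lambda>\<omega>. K * (\<eta> k + 2 / \<eta> k ^ 3 * S k \<omega>))" using SI'(1) by auto
    show "AE \<omega> in N. norm (f (X k (Suc (m k \<omega>)) \<omega>) - f (X k (m k \<omega>) \<omega>)) \<le> norm (K * (\<eta> k + 2 / \<eta> k ^ 3 * S k \<omega>))"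
      using rem by (intro AE_I2) (fastforce intro: order_trans[OF _ abs_ge_self])
  qed measurable
  have lim1: "(\<lambda>k. \<integral>\<omega>. f (X k (m k \<omega>) \<omega>) \<partial>N) \<longlonglongrightarrow> (\<integral>\<omega>. f (B (exit_time B \<omega>) \<omega> $ j) \<partial>N)"
  proof (rule integral_dominated_convergence[where w="\<lambda>_. L"])
    show "AE \<omega> in N. norm (f (X k (m k \<omega>) \<omega>)) \<le> L" for k
      using Xb L by auto
    show "AE \<omega> in N. (\<lambda>k. f (X k (m k \<omega>) \<omega>)) \<longlonglongrightarrow> f (B (exit_time B \<omega>) \<omega> $ j)"
    proof (rule AE_I2)
      fix \<omega> assume \<omega>: "\<omega> \<in> space N"
      have "filterlim n at_top sequentially"
        unfolding filterlim_at_top eventually_sequentially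
      proof (intro allI exI impI)
        fix Z k :: nat assume "Z \<le> k"
        also have "k \<le> Suc k ^ 1" by simp
        also have "\<dots> \<le> Suc k ^ 4" by (intro power_increasing) auto
        finally show "Z \<le> n k" by (simp add: n_def)
      qed
      then have "(\<lambda>k. real_of_int \<lfloor>real (n k) * exit_time B \<omega>\<rfloor> / real (n k)) \<longlonglongrightarrow> exit_time B \<omega>"
        by (rule tendsto_floor_grid)
      moreover have "real_of_int \<lfloor>real (n k) * exit_time B \<omega>\<rfloor> = real (m k \<omega>)" for k
        using exit_time_nonneg[of B \<omega>] by (simp add: m_def)
      ultimately have "(\<lambda>k. real (m k \<omega>) / real (n k)) \<longlonglongrightarrow> exit_time B \<omega>" by simp
      from continuous_on_tendsto_compose[OF cont[OF \<omega>] this]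
      have "(\<lambda>k. B (real (m k \<omega>) / real (n k)) \<omega>) \<longlonglongrightarrow> B (exit_time B \<omega>) \<omega>"
        using exit_time_nonneg[of B \<omega>] by simp
      then have "(\<lambda>k. X k (m k \<omega>) \<omega>) \<longlonglongrightarrow> B (exit_time B \<omega>) \<omega> $ j"
        unfolding X_def by (rule tendsto_vec_nth)
      then show "(\<lambda>k. f (X k (m k \<omega>) \<omega>)) \<longlonglongrightarrow> f (B (exit_time B \<omega>) \<omega> $ j)"
        by (rule continuous_on_tendsto_compose[OF f]) auto
    qed
  qed auto
  have lim2: "(\<lambda>k. \<integral>\<omega>. f (X k (Suc (m k \<omega>)) \<omega>) - f (X k (m k \<omega>) \<omega>) \<partial>N) \<longlonglongrightarrow> 0"
  proof (rule Lim_null_comparison)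
    have le: "norm (\<integral>\<omega>. f (X k (Suc (m k \<omega>)) \<omega>) - f (X k (m k \<omega>) \<omega>) \<partial>N) \<le> K * (1 + 6 * real A) * (1 / real (Suc k))" for k
    proof -
      have "norm (\<integral>\<omega>. f (X k (Suc (m k \<omega>)) \<omega>) - f (X k (m k \<omega>) \<omega>) \<partial>N) \<le>
         (\<integral>\<omega>. norm (f (X k (Suc (m k \<omega>)) \<omega>) - f (X k (m k \<omega>) \<omega>)) \<partial>N)"
        by (rule integral_norm_bound)
      also have "\<dots> \<le> (\<integral>\<omega>. K * (\<eta> k + 2 / \<eta> k ^ 3 * S k \<omega>) \<partial>N)"
        using i2 SI'(1) rem by (intro integral_mono) auto
      also have "\<dots> = K * (\<eta> k + 2 / \<eta> k ^ 3 * (3 * real A / real (n k)))"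
        using SI' by (simp add: prob_space)
      also have "2 / \<eta> k ^ 3 * (3 * real A / real (n k)) = 6 * real A * (1 / real (Suc k))"
      proof -
        have "2 / (1 / x) ^ 3 * (3 * real A / x ^ 4) = 6 * real A * (1 / x)" if "0 < x" for x :: real
          using that by (simp add: field_simps power3_eq_cube power4_eq_xxxx)
        from this[of "real (Suc k)"] show ?thesis by (simp only: \<eta>_def n_def of_nat_power)
      qed
      finally show ?thesis by (simp add: \<eta>_def algebra_simps)
    qed
    then show "\<forall>\<^sub>F k in sequentially. norm (\<integral>\<omega>. f (X k (Suc (m k \<omega>)) \<omega>) - f (X k (m k \<omega>) \<omega>) \<partial>N) \<le> K * (1 + 6 * real A) * (1 / real (Suc k))"
      by (intro always_eventually allI)
    show "(\<lambda>k. K * (1 + 6 * real A) * (1 / real (Suc k))) \<longlonglongrightarrow> 0"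
      by (intro tendsto_mult_right_zero LIMSEQ_Suc[OF lim_1_over_n])
  qed
  have f_incr: "integrable N (\<lambda>\<omega>. indicator {real i / real (n k)..} (exit_time B \<omega>) * (f (X k (Suc i) \<omega>) - f (X k i \<omega>)))" for k i
  proof (rule Bochner_Integration.integrable_bound)
    show "integrable N (\<lambda>\<omega>. K * (1 + 2 * (X k (Suc i) \<omega> - X k i \<omega>) ^ 4))"
      using incr4 by (auto simp: has_bochner_integral_iff)
    show "AE \<omega> in N. norm (indicator {real i / real (n k)..} (exit_time B \<omega>) * (f (X k (Suc i) \<omega>) - f (X k i \<omega>)))
       \<le> norm (K * (1 + 2 * (X k (Suc i) \<omega> - X k i \<omega>) ^ 4))"
    proof (rule AE_I2)
      fix \<omega> assume \<omega>: "\<omega> \<in> space N"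
      define y where "y = X k (Suc i) \<omega> - X k i \<omega>"
      have "\<bar>y\<bar> \<le> 1 + y ^ 4"
      proof (cases "\<bar>y\<bar> \<le> 1")
        case True
        moreover have "0 \<le> y ^ 4" by simp
        ultimately show ?thesis by linarith
      next
        case False
        then have "\<bar>y\<bar> ^ 1 \<le> \<bar>y\<bar> ^ 4" by (intro power_increasing) auto
        then show ?thesis by simp
      qed
      then have y: "\<bar>y\<bar> + y ^ 4 \<le> 1 + 2 * y ^ 4" by simp
      show "norm (indicator {real i / real (n k)..} (exit_time B \<omega>) * (f (X k (Suc i) \<omega>) - f (X k i \<omega>)))
         \<le> norm (K * (1 + 2 * (X k (Suc i) \<omega> - X k i \<omega>) ^ 4))"
      proof (cases "real i / real (n k) \<le> exit_time B \<omega>")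
        case True
        then have "\<bar>X k i \<omega>\<bar> \<le> C" unfolding X_def C_def by (intro coord_bound[OF \<omega>]) auto
        then have "\<bar>f (X k i \<omega> + y) - f (X k i \<omega>)\<bar> \<le> K * (\<bar>y\<bar> + y ^ 4)"
          by (intro fK) (simp add: C_def)
        also have "\<dots> \<le> K * (1 + 2 * y ^ 4)" using K y by (rule mult_left_mono[rotated])
        also have "\<dots> \<le> norm (K * (1 + 2 * y ^ 4))" by simp
        finally show ?thesis using True by (simp add: y_def)
      qed simp
    qed
  qed measurable
  have "(\<lambda>k. (\<integral>\<omega>. f (X k (m k \<omega>) \<omega>) \<partial>N) + (\<integral>\<omega>. f (X k (Suc (m k \<omega>)) \<omega>) - f (X k (m k \<omega>) \<omega>) \<partial>N))
      \<longlonglongrightarrow> (\<integral>\<omega>. f (B (exit_time B \<omega>) \<omega> $ j) \<partial>N) + 0"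
    by (intro tendsto_add lim1 lim2)
  moreover have "(\<integral>\<omega>. f (X k (m k \<omega>) \<omega>) \<partial>N) + (\<integral>\<omega>. f (X k (Suc (m k \<omega>)) \<omega>) - f (X k (m k \<omega>) \<omega>) \<partial>N) =
     (\<Sum>i<A * n k. \<integral>\<omega>. indicator {real i / real (n k)..} (exit_time B \<omega>) * (f (X k (Suc i) \<omega>) - f (X k i \<omega>)) \<partial>N)" for k
  proof -
    have "(\<integral>\<omega>. f (X k (m k \<omega>) \<omega>) \<partial>N) + (\<integral>\<omega>. f (X k (Suc (m k \<omega>)) \<omega>) - f (X k (m k \<omega>) \<omega>) \<partial>N) =
       (\<integral>\<omega>. f (X k (Suc (m k \<omega>)) \<omega>) \<partial>N)"
      by (subst Bochner_Integration.integral_add[OF i1 i2, symmetric]) simp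
    also have "\<dots> = (\<integral>\<omega>. (\<Sum>i<A * n k. indicator {real i / real (n k)..} (exit_time B \<omega>) * (f (X k (Suc i) \<omega>) - f (X k i \<omega>))) \<partial>N)"
      using telescope by (intro Bochner_Integration.integral_cong) auto
    also have "\<dots> = (\<Sum>i<A * n k. \<integral>\<omega>. indicator {real i / real (n k)..} (exit_time B \<omega>) * (f (X k (Suc i) \<omega>) - f (X k i \<omega>)) \<partial>N)"
      using f_incr by (intro Bochner_Integration.integral_sum) auto
    finally show ?thesis .
  qed
  ultimately show ?thesis
    by (simp add: X_def n_def A_def)
qed

lemma exit_indicator_measurable:
  assumes "0 \<le> s" shows "(\<lambda>\<omega>. indicator {s..} (exit_time B \<omega>) :: real) \<in> borel_measurable (F s)"
proof -
  have "(indicator {\<omega> \<in> space N. s \<le> exit_time B \<omega>} :: _ \<Rightarrow> real) \<in> borel_measurable (F s)"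
    using exit_time_ge_sets[OF assms] by (rule borel_measurable_indicator)
  then show ?thesis
    by (rule measurable_cong[THEN iffD1, rotated]) (auto simp: space_F[OF assms] indicator_def)
qed

text \<open>Binomial expansion around the left endpoint: the odd moments of the increment vanish,
  and its even moments u - s and 3 (u - s)^2 factor out by independence from the past.\<close>

lemma exit_increment:
  assumes s: "0 \<le> s" "s < u"
  defines "I \<equiv> \<lambda>\<omega>. indicator {s..} (exit_time B \<omega>) :: real"
  shows "has_bochner_integral N (\<lambda>\<omega>. I \<omega> * ((B u \<omega> $ j) ^ 3 - (B s \<omega> $ j) ^ 3))
      (3 * (u - s) * expectation (\<lambda>\<omega>. I \<omega> * (B s \<omega> $ j)))"
    and "has_bochner_integral N (\<lambda>\<omega>. I \<omega> * ((B u \<omega> $ j) ^ 4 - (B s \<omega> $ j) ^ 4))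
      (6 * (u - s) * expectation (\<lambda>\<omega>. I \<omega> * (B s \<omega> $ j)\<^sup>2) + 3 * (u - s)\<^sup>2 * expectation I)"
proof -
  define C where "C = sqrt (real CARD('d) * sphere_a CARD('d))"
  have C: "0 \<le> C" using sphere_a_pos[of "CARD('d)"] by (simp add: C_def)
  define D where "D \<omega> = (B u \<omega> - B s \<omega>) $ j" for \<omega>
  define X where "X \<omega> = B s \<omega> $ j" for \<omega>
  have [measurable]: "B s \<in> borel_measurable (F s)" using s by (intro adapted)
  have [measurable]: "I \<in> borel_measurable (F s)" unfolding I_def by (rule exit_indicator_measurable[OF s(1)])
  have hm: "(\<lambda>\<omega>. I \<omega> * X \<omega> ^ l) \<in> borel_measurable (F s)" for l
    unfolding X_def by measurable
  have hb: "\<bar>I \<omega> * X \<omega> ^ l\<bar> \<le> C ^ l" if "\<omega> \<in> space N" for \<omega> l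
    using coord_bound[OF that s(1), of j] C
    by (auto simp: I_def X_def C_def abs_mult power_abs indicator_def intro!: power_mono)
  have us: "0 < u - s" using s by simp
  have m: "has_bochner_integral N (\<lambda>\<omega>. I \<omega> * X \<omega> ^ l * D \<omega>) (expectation (\<lambda>\<omega>. I \<omega> * X \<omega> ^ l) * 0)"
      "has_bochner_integral N (\<lambda>\<omega>. I \<omega> * X \<omega> ^ l * D \<omega> ^ 2) (expectation (\<lambda>\<omega>. I \<omega> * X \<omega> ^ l) * (u - s))"
      "has_bochner_integral N (\<lambda>\<omega>. I \<omega> * X \<omega> ^ l * D \<omega> ^ 3) (expectation (\<lambda>\<omega>. I \<omega> * X \<omega> ^ l) * 0)"
      "has_bochner_integral N (\<lambda>\<omega>. I \<omega> * X \<omega> ^ l * D \<omega> ^ 4) (expectation (\<lambda>\<omega>. I \<omega> * X \<omega> ^ l) * (3 * (u - s)\<^sup>2))" for l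
    unfolding D_def
    by (rule incr_indep_integral[OF s gauss_moments(1)[OF us] hm hb]
        incr_indep_integral[OF s gauss_moments(2)[OF us] hm hb]
        incr_indep_integral[OF s gauss_moments(3)[OF us] hm hb]
        incr_indep_integral[OF s gauss_moments(4)[OF us] hm hb]; assumption)+
  have Bu: "B u \<omega> $ j = X \<omega> + D \<omega>" for \<omega> by (simp add: X_def D_def)
  have "has_bochner_integral N (\<lambda>\<omega>. 3 * (I \<omega> * X \<omega> ^ 2 * D \<omega>) + 3 * (I \<omega> * X \<omega> ^ 1 * D \<omega> ^ 2) + I \<omega> * X \<omega> ^ 0 * D \<omega> ^ 3)
     (3 * (expectation (\<lambda>\<omega>. I \<omega> * X \<omega> ^ 2) * 0) + 3 * (expectation (\<lambda>\<omega>. I \<omega> * X \<omega> ^ 1) * (u - s)) + expectation (\<lambda>\<omega>. I \<omega> * X \<omega> ^ 0) * 0)"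
    by (intro has_bochner_integral_add has_bochner_integral_mult_right m)
  moreover have "3 * (I \<omega> * X \<omega> ^ 2 * D \<omega>) + 3 * (I \<omega> * X \<omega> ^ 1 * D \<omega> ^ 2) + I \<omega> * X \<omega> ^ 0 * D \<omega> ^ 3 =
     I \<omega> * ((B u \<omega> $ j) ^ 3 - (B s \<omega> $ j) ^ 3)" for \<omega>
    unfolding Bu X_def[symmetric] by (simp add: power3_eq_cube power2_eq_square algebra_simps)
  moreover have "3 * (expectation (\<lambda>\<omega>. I \<omega> * X \<omega> ^ 2) * 0) + 3 * (expectation (\<lambda>\<omega>. I \<omega> * X \<omega> ^ 1) * (u - s)) + expectation (\<lambda>\<omega>. I \<omega> * X \<omega> ^ 0) * 0 =
      3 * (u - s) * expectation (\<lambda>\<omega>. I \<omega> * (B s \<omega> $ j))"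
    by (simp add: X_def algebra_simps)
  ultimately show "has_bochner_integral N (\<lambda>\<omega>. I \<omega> * ((B u \<omega> $ j) ^ 3 - (B s \<omega> $ j) ^ 3))
      (3 * (u - s) * expectation (\<lambda>\<omega>. I \<omega> * (B s \<omega> $ j)))"
    by (simp only:)
  have "has_bochner_integral N (\<lambda>\<omega>. 4 * (I \<omega> * X \<omega> ^ 3 * D \<omega>) + 6 * (I \<omega> * X \<omega> ^ 2 * D \<omega> ^ 2) + 4 * (I \<omega> * X \<omega> ^ 1 * D \<omega> ^ 3) + I \<omega> * X \<omega> ^ 0 * D \<omega> ^ 4)
     (4 * (expectation (\<lambda>\<omega>. I \<omega> * X \<omega> ^ 3) * 0) + 6 * (expectation (\<lambda>\<omega>. I \<omega> * X \<omega> ^ 2) * (u - s)) +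
      4 * (expectation (\<lambda>\<omega>. I \<omega> * X \<omega> ^ 1) * 0) + expectation (\<lambda>\<omega>. I \<omega> * X \<omega> ^ 0) * (3 * (u - s)\<^sup>2))"
    by (intro has_bochner_integral_add has_bochner_integral_mult_right m)
  moreover have "4 * (I \<omega> * X \<omega> ^ 3 * D \<omega>) + 6 * (I \<omega> * X \<omega> ^ 2 * D \<omega> ^ 2) + 4 * (I \<omega> * X \<omega> ^ 1 * D \<omega> ^ 3) + I \<omega> * X \<omega> ^ 0 * D \<omega> ^ 4 =
     I \<omega> * ((B u \<omega> $ j) ^ 4 - (B s \<omega> $ j) ^ 4)" for \<omega>
  proof -
    have "(x + y) ^ 4 - x ^ 4 = 4 * x ^ 3 * y + 6 * x ^ 2 * y ^ 2 + 4 * x * y ^ 3 + y ^ 4" for x y :: real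
      by algebra
    then show ?thesis unfolding Bu X_def[symmetric] by (simp add: algebra_simps)
  qed
  moreover have "4 * (expectation (\<lambda>\<omega>. I \<omega> * X \<omega> ^ 3) * 0) + 6 * (expectation (\<lambda>\<omega>. I \<omega> * X \<omega> ^ 2) * (u - s)) +
      4 * (expectation (\<lambda>\<omega>. I \<omega> * X \<omega> ^ 1) * 0) + expectation (\<lambda>\<omega>. I \<omega> * X \<omega> ^ 0) * (3 * (u - s)\<^sup>2) =
      6 * (u - s) * expectation (\<lambda>\<omega>. I \<omega> * (B s \<omega> $ j)\<^sup>2) + 3 * (u - s)\<^sup>2 * expectation I"
    by (simp add: X_def algebra_simps)
  ultimately show "has_bochner_integral N (\<lambda>\<omega>. I \<omega> * ((B u \<omega> $ j) ^ 4 - (B s \<omega> $ j) ^ 4))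
      (6 * (u - s) * expectation (\<lambda>\<omega>. I \<omega> * (B s \<omega> $ j)\<^sup>2) + 3 * (u - s)\<^sup>2 * expectation I)"
    by (simp only:)
qed

text \<open>The first power dominates for |y| <= 1, the fourth otherwise. This yields the growth
  hypothesis of \<open>stopped_value_limit\<close> for the cube and the fourth power.\<close>

lemma abs_power_le_sum:
  "\<bar>y :: real\<bar> ^ 2 \<le> \<bar>y\<bar> + y ^ 4" "\<bar>y :: real\<bar> ^ 3 \<le> \<bar>y\<bar> + y ^ 4"
proof -
  have e: "\<bar>y\<bar> ^ 4 = y ^ 4" by simp
  have "\<bar>y\<bar> ^ k \<le> \<bar>y\<bar> + y ^ 4" if k: "1 \<le> k" "k \<le> 4" for k
  proof (cases "\<bar>y\<bar> \<le> 1")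
    case True
    then have "\<bar>y\<bar> ^ k \<le> \<bar>y\<bar> ^ 1" using k by (intro power_decreasing) auto
    then show ?thesis by (simp add: add_increasing2)
  next
    case False
    then have "\<bar>y\<bar> ^ k \<le> \<bar>y\<bar> ^ 4" using k by (intro power_increasing) auto
    then show ?thesis by (simp add: add_increasing)
  qed
  from this[of 2] this[of 3]
  show "\<bar>y :: real\<bar> ^ 2 \<le> \<bar>y\<bar> + y ^ 4" "\<bar>y :: real\<bar> ^ 3 \<le> \<bar>y\<bar> + y ^ 4" by auto
qed

lemma cube_increment:
  fixes x y C :: real
  assumes "\<bar>x\<bar> \<le> C"
  shows "\<bar>(x + y) ^ 3 - x ^ 3\<bar> \<le> (3 * C ^ 2 + 3 * C + 1) * (\<bar>y\<bar> + y ^ 4)"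
proof -
  let ?S = "\<bar>y\<bar> + y ^ 4"
  have C: "0 \<le> C" using assms by simp
  have S: "0 \<le> ?S" by simp
  have "(x + y) ^ 3 - x ^ 3 = 3 * x ^ 2 * y + 3 * x * y ^ 2 + y ^ 3" by algebra
  also have "\<bar>\<dots>\<bar> \<le> 3 * \<bar>x\<bar> ^ 2 * \<bar>y\<bar> + 3 * \<bar>x\<bar> * \<bar>y\<bar> ^ 2 + \<bar>y\<bar> ^ 3"
    by (intro order_trans[OF abs_triangle_ineq] add_mono) (simp_all add: abs_mult power_abs)
  also have "\<dots> \<le> 3 * C ^ 2 * ?S + 3 * C * ?S + ?S"
    using abs_power_le_sum[of y] assms C power_mono[OF assms, of 2]
    by (intro add_mono mult_mono) auto
  finally show ?thesis by (simp add: algebra_simps)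
qed

lemma fourth_increment:
  fixes x y C :: real
  assumes "\<bar>x\<bar> \<le> C"
  shows "\<bar>(x + y) ^ 4 - x ^ 4\<bar> \<le> (4 * C ^ 3 + 6 * C ^ 2 + 4 * C + 1) * (\<bar>y\<bar> + y ^ 4)"
proof -
  let ?S = "\<bar>y\<bar> + y ^ 4"
  have C: "0 \<le> C" using assms by simp
  have S: "0 \<le> ?S" by simp
  have "(x + y) ^ 4 - x ^ 4 = 4 * x ^ 3 * y + 6 * x ^ 2 * y ^ 2 + 4 * x * y ^ 3 + y ^ 4" by algebra
  also have "\<bar>\<dots>\<bar> \<le> 4 * \<bar>x\<bar> ^ 3 * \<bar>y\<bar> + 6 * \<bar>x\<bar> ^ 2 * \<bar>y\<bar> ^ 2 + 4 * \<bar>x\<bar> * \<bar>y\<bar> ^ 3 + y ^ 4"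
    by (intro order_trans[OF abs_triangle_ineq] add_mono) (simp_all add: abs_mult power_abs)
  also have "\<dots> \<le> 4 * C ^ 3 * ?S + 6 * C ^ 2 * ?S + 4 * C * ?S + ?S"
    using abs_power_le_sum[of y] assms C power_mono[OF assms, of 2] power_mono[OF assms, of 3]
    by (intro add_mono mult_mono) auto
  finally show ?thesis by (simp add: algebra_simps)
qed

lemma exit_first_moment_zero:
  assumes "0 \<le> s"
  shows "expectation (\<lambda>\<omega>. indicator {s..} (exit_time B \<omega>) * (B s \<omega> $ j)) = 0"
proof (cases "s = 0")
  case True
  then have "expectation (\<lambda>\<omega>. indicator {s..} (exit_time B \<omega>) * (B s \<omega> $ j)) = expectation (\<lambda>\<omega>. 0)"
    using B0 by (intro Bochner_Integration.integral_cong) auto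
  then show ?thesis by simp
next
  case False
  then show ?thesis
    using exit_law_odd[of s "\<lambda>x. x $ j" j] assms by (simp add: flip_nth mult.commute)
qed

text \<open>Every grid term is a multiple of a first moment before exit, and these vanish by
  reflection; the limit is taken of a sequence of zeros.\<close>

lemma exit_cube: "expectation (\<lambda>\<omega>. (B (exit_time B \<omega>) \<omega> $ j) ^ 3) = 0"
proof -
  define C where "C = sqrt (real CARD('d) * sphere_a CARD('d))"
  have C: "0 \<le> C" using sphere_a_pos[of "CARD('d)"] by (simp add: C_def)
  have z: "(\<integral>\<omega>. indicator {real i / real (Suc k ^ 4)..} (exit_time B \<omega>) *
        ((B (real (Suc i) / real (Suc k ^ 4)) \<omega> $ j) ^ 3 - (B (real i / real (Suc k ^ 4)) \<omega> $ j) ^ 3) \<partial>N) = 0" for i k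
  proof -
    have s: "0 \<le> real i / real (Suc k ^ 4)" "real i / real (Suc k ^ 4) < real (Suc i) / real (Suc k ^ 4)"
      by (auto intro!: divide_strict_right_mono)
    show ?thesis
      using exit_increment(1)[OF s, of j] exit_first_moment_zero[OF s(1), of j]
      by (simp only: has_bochner_integral_iff mult_zero_right)
  qed
  have "(\<lambda>k. 0) \<longlonglongrightarrow> (\<integral>\<omega>. (B (exit_time B \<omega>) \<omega> $ j) ^ 3 \<partial>N)"
    using stopped_value_limit[of "\<lambda>x. x ^ 3" "3 * C ^ 2 + 3 * C + 1" j] C cube_increment[of _ C]
    unfolding z by (simp add: C_def continuous_on_power)
  then show ?thesis by (simp add: LIMSEQ_const_iff)
qed

text \<open>Up to an error of order 1 / n the grid sum is 6 times a Riemann sum of \<kappa>(v), the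
  second moment of the coordinate at time v before exit, and the integral of \<kappa> is
  \<open>occupation_square\<close>.\<close>

lemma exit_fourth: "expectation (\<lambda>\<omega>. (B (exit_time B \<omega>) \<omega> $ j) ^ 4) = 3 * sphere_r CARD('d)"
proof -
  let ?a = "sphere_a CARD('d)"
  define C where "C = sqrt (real CARD('d) * ?a)"
  have C: "0 \<le> C" using sphere_a_pos[of "CARD('d)"] by (simp add: C_def)
  define A where "A = Suc (nat \<lceil>?a\<rceil>)"
  have A: "?a < real A" unfolding A_def by linarith
  define n where "n k = Suc k ^ 4" for k :: nat
  have n0: "0 < n k" for k by (simp add: n_def)
  have ntop: "filterlim n at_top sequentially"
    unfolding filterlim_at_top eventually_sequentially
  proof (intro allI exI impI)
    fix Z k :: nat assume "Z \<le> k"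
    also have "k \<le> Suc k ^ 1" by simp
    also have "\<dots> \<le> Suc k ^ 4" by (intro power_increasing) auto
    finally show "Z \<le> n k" by (simp add: n_def)
  qed
  define h where "h v \<omega> = indicator {v..} (exit_time B \<omega>) * (B (max 0 v) \<omega> $ j)\<^sup>2" for v \<omega>
  have ind: "(indicator {v..} t :: real) = indicator {p. fst p \<le> snd p} (v, t)" for v t :: real
    by (auto simp: indicator_def)
  have h_meas [measurable]: "(\<lambda>p. h (fst p) (snd p)) \<in> borel_measurable (lborel \<Otimes>\<^sub>M N)"
    unfolding h_def ind by measurable
  have h_meas2 [measurable]: "h v \<in> borel_measurable N" for v
  proof -
    have [measurable]: "B (max 0 v) \<in> borel_measurable N" by (rule B_measurable) simp
    show ?thesis unfolding h_def[abs_def] by measurable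
  qed
  have hb: "0 \<le> h v \<omega>" "h v \<omega> \<le> C\<^sup>2" if "\<omega> \<in> space N" for v \<omega>
  proof -
    show "0 \<le> h v \<omega>" by (simp add: h_def)
    have "\<bar>B (max 0 v) \<omega> $ j\<bar> \<le> C" if "v \<le> exit_time B \<omega>"
      unfolding C_def using coord_bound[OF \<open>\<omega> \<in> space N\<close>, of "max 0 v" j] that exit_time_nonneg[of B \<omega>] by auto
    then show "h v \<omega> \<le> C\<^sup>2"
      using C power_mono[of "\<bar>B (max 0 v) \<omega> $ j\<bar>" C 2] by (auto simp: h_def indicator_def)
  qed
  define \<kappa> where "\<kappa> v = (\<integral>\<omega>. h v \<omega> \<partial>N)" for v
  have h_int: "integrable N (h v)" for v
    using hb by (intro integrable_const_bound[where B="C\<^sup>2"]) auto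
  have \<kappa>_meas [measurable]: "\<kappa> \<in> borel_measurable lborel"
    unfolding \<kappa>_def[abs_def] by (rule borel_measurable_lebesgue_integral) (simp add: case_prod_beta')
  have \<kappa>b: "0 \<le> \<kappa> v" "\<kappa> v \<le> C\<^sup>2" for v
  proof -
    show "0 \<le> \<kappa> v" unfolding \<kappa>_def using hb by (intro Bochner_Integration.integral_nonneg_AE AE_I2) auto
    have "\<kappa> v \<le> (\<integral>\<omega>. C\<^sup>2 \<partial>N)" unfolding \<kappa>_def using hb h_int by (intro integral_mono) auto
    then show "\<kappa> v \<le> C\<^sup>2" by (simp add: prob_space)
  qed
  \<comment> \<open>The grid points approach v from below, and the indicator of v <= exit time is
    left-continuous in v. Possible atoms of the exit time therefore do no harm.\<close>
  have \<kappa>_lim: "(\<lambda>k. \<kappa> (real_of_int \<lfloor>real (n k) * v\<rfloor> / real (n k))) \<longlonglongrightarrow> \<kappa> v" if v: "0 \<le> v" for v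
    unfolding \<kappa>_def
  proof (rule integral_dominated_convergence[where w="\<lambda>_. C\<^sup>2"])
    let ?r = "\<lambda>k. real_of_int \<lfloor>real (n k) * v\<rfloor> / real (n k)"
    have r0: "0 \<le> ?r k" for k using v by simp
    have rv: "?r k \<le> v" for k
    proof -
      have "real_of_int \<lfloor>real (n k) * v\<rfloor> \<le> v * real (n k)" by (simp add: mult.commute)
      then show ?thesis using n0[of k] by (simp add: pos_divide_le_eq)
    qed
    have rlim: "?r \<longlonglongrightarrow> v" by (rule tendsto_floor_grid[OF ntop])
    show "AE \<omega> in N. (\<lambda>k. h (?r k) \<omega>) \<longlonglongrightarrow> h v \<omega>"
    proof (rule AE_I2)
      fix \<omega> assume \<omega>: "\<omega> \<in> space N"
      have "(\<lambda>k. B (max 0 (?r k)) \<omega>) \<longlonglongrightarrow> B (max 0 v) \<omega>"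
        using continuous_on_tendsto_compose[OF cont[OF \<omega>] rlim] v r0 by (simp add: max_def)
      then have "(\<lambda>k. (B (max 0 (?r k)) \<omega> $ j)\<^sup>2) \<longlonglongrightarrow> (B (max 0 v) \<omega> $ j)\<^sup>2"
        by (intro tendsto_power tendsto_vec_nth)
      moreover have "(\<lambda>k. indicator {?r k..} (exit_time B \<omega>) :: real) \<longlonglongrightarrow> indicator {v..} (exit_time B \<omega>)"
      proof (rule tendsto_eventually)
        show "\<forall>\<^sub>F k in sequentially. (indicator {?r k..} (exit_time B \<omega>) :: real) = indicator {v..} (exit_time B \<omega>)"
        proof (cases "v \<le> exit_time B \<omega>")
          case True
          then show ?thesis using rv by (intro always_eventually allI) (auto simp: indicator_def intro: order_trans)
        next
          case False
          then have "\<forall>\<^sub>F k in sequentially. exit_time B \<omega> < ?r k"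
            by (intro order_tendstoD(1)[OF rlim]) simp
          then show ?thesis by (rule eventually_mono) (use False in \<open>auto simp: indicator_def\<close>)
        qed
      qed
      ultimately show "(\<lambda>k. h (?r k) \<omega>) \<longlonglongrightarrow> h v \<omega>"
        unfolding h_def by (intro tendsto_mult)
    qed
    show "AE \<omega> in N. norm (h (?r k) \<omega>) \<le> C\<^sup>2" for k using hb by auto
  qed auto
  have \<kappa>_int: "(\<integral>v. \<kappa> v * indicator {0..<real A} v \<partial>lborel) = sphere_r CARD('d) / 2"
  proof -
    interpret pair_sigma_finite lborel N ..
    have r: "0 \<le> sphere_r CARD('d) / 2" by (simp add: sphere_r_def)
    have m: "(\<lambda>p. ennreal ((B (max 0 (fst p)) (snd p) $ j)\<^sup>2) * indicator {0<..exit_time B (snd p)} (fst p)) \<in> borel_measurable (lborel \<Otimes>\<^sub>M N)"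
    proof -
      have "(indicator {0<..exit_time B (snd p)} (fst p) :: ennreal) = indicator {p. 0 < fst p \<and> fst p \<le> snd p} (fst p, exit_time B (snd p))" for p :: "real \<times> 'a"
        by (auto simp: indicator_def)
      then show ?thesis by simp
    qed
    have "ennreal (sphere_r CARD('d) / 2) = (\<integral>\<^sup>+v. \<integral>\<^sup>+\<omega>. ennreal ((B (max 0 v) \<omega> $ j)\<^sup>2) * indicator {0<..exit_time B \<omega>} v \<partial>N \<partial>lborel)"
      unfolding occupation_square[symmetric, of j]
      by (rule Fubini') (use m in \<open>simp add: case_prod_beta'\<close>)
    also have "\<dots> = (\<integral>\<^sup>+v. ennreal (\<kappa> v * indicator {0..<real A} v) \<partial>lborel)"
    proof (rule nn_integral_cong_AE, rule AE_mp[OF AE_lborel_singleton[of 0]], rule AE_I2, rule impI)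
      fix v :: real assume v: "v \<noteq> 0"
      show "(\<integral>\<^sup>+\<omega>. ennreal ((B (max 0 v) \<omega> $ j)\<^sup>2) * indicator {0<..exit_time B \<omega>} v \<partial>N) =
        ennreal (\<kappa> v * indicator {0..<real A} v)"
      proof (cases "0 < v \<and> v < real A")
        case True
        then have "(\<integral>\<^sup>+\<omega>. ennreal ((B (max 0 v) \<omega> $ j)\<^sup>2) * indicator {0<..exit_time B \<omega>} v \<partial>N) = (\<integral>\<^sup>+\<omega>. ennreal (h v \<omega>) \<partial>N)"
          by (intro nn_integral_cong) (auto simp: h_def indicator_def)
        also have "\<dots> = ennreal (\<kappa> v)"
          unfolding \<kappa>_def using h_int hb by (intro nn_integral_eq_integral) auto
        finally show ?thesis using True by simp
      next
        case False
        have "indicator {0<..exit_time B \<omega>} v = (0 :: ennreal)" for \<omega>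
          using False v A exit_time_le[of B \<omega>] by (auto simp: indicator_def)
        then show ?thesis using False v by auto
      qed
    qed
    finally have "(\<integral>\<^sup>+v. ennreal (\<kappa> v * indicator {0..<real A} v) \<partial>lborel) = ennreal (sphere_r CARD('d) / 2)" ..
    then show ?thesis
      using r \<kappa>b by (subst integral_eq_nn_integral) auto
  qed
  \<comment> \<open>The leading part is the Riemann sum in the form of \<open>riemann_sum\<close>;
    the squares of the time steps add up to at most 3 A / n.\<close>
  have grid: "(\<Sum>i<A * n k. \<integral>\<omega>. indicator {real i / real (n k)..} (exit_time B \<omega>) *
        ((B (real (Suc i) / real (n k)) \<omega> $ j) ^ 4 - (B (real i / real (n k)) \<omega> $ j) ^ 4) \<partial>N) =
     6 * (\<integral>v. \<kappa> (real_of_int \<lfloor>real (n k) * v\<rfloor> / real (n k)) * indicator {0..<real A} v \<partial>lborel) +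
     3 / real (n k) * ((\<Sum>i<A * n k. prob {\<omega> \<in> space N. real i / real (n k) \<le> exit_time B \<omega>}) / real (n k))" for k
  proof -
    have "(\<integral>\<omega>. indicator {real i / real (n k)..} (exit_time B \<omega>) *
        ((B (real (Suc i) / real (n k)) \<omega> $ j) ^ 4 - (B (real i / real (n k)) \<omega> $ j) ^ 4) \<partial>N) =
       6 * (\<kappa> (real i / real (n k)) / real (n k)) + 3 / real (n k) * (prob {\<omega> \<in> space N. real i / real (n k) \<le> exit_time B \<omega>} / real (n k))" for i
    proof -
      have s: "0 \<le> real i / real (n k)" "real i / real (n k) < real (Suc i) / real (n k)"
        using n0[of k] by (auto intro!: divide_strict_right_mono)
      have d: "real (Suc i) / real (n k) - real i / real (n k) = 1 / real (n k)"
        by (simp add: diff_divide_distrib[symmetric])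
      have "expectation (\<lambda>\<omega>. indicator {real i / real (n k)..} (exit_time B \<omega>) :: real) = expectation (indicator {\<omega> \<in> space N. real i / real (n k) \<le> exit_time B \<omega>})"
        by (intro Bochner_Integration.integral_cong) (auto simp: indicator_def)
      then have e: "expectation (\<lambda>\<omega>. indicator {real i / real (n k)..} (exit_time B \<omega>) :: real) = prob {\<omega> \<in> space N. real i / real (n k) \<le> exit_time B \<omega>}"
        by simp
      have "\<kappa> (real i / real (n k)) = expectation (\<lambda>\<omega>. indicator {real i / real (n k)..} (exit_time B \<omega>) * (B (real i / real (n k)) \<omega> $ j)\<^sup>2)"
        by (simp add: \<kappa>_def h_def)
      then show ?thesis
        using exit_increment(2)[OF s, of j] unfolding d e
        by (simp add: has_bochner_integral_iff power2_eq_square)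
    qed
    then show ?thesis
      using riemann_sum[OF n0, of \<kappa> k A]
      by (simp add: sum.distrib sum_distrib_left[symmetric] sum_divide_distrib[symmetric] has_bochner_integral_iff)
  qed
  have "(\<lambda>k. 6 * (\<integral>v. \<kappa> (real_of_int \<lfloor>real (n k) * v\<rfloor> / real (n k)) * indicator {0..<real A} v \<partial>lborel) +
     3 / real (n k) * ((\<Sum>i<A * n k. prob {\<omega> \<in> space N. real i / real (n k) \<le> exit_time B \<omega>}) / real (n k))) \<longlonglongrightarrow>
     6 * (\<integral>v. \<kappa> v * indicator {0..<real A} v \<partial>lborel) + 0"
  proof (intro tendsto_add tendsto_mult_left)
    show "(\<lambda>k. \<integral>v. \<kappa> (real_of_int \<lfloor>real (n k) * v\<rfloor> / real (n k)) * indicator {0..<real A} v \<partial>lborel)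
        \<longlonglongrightarrow> (\<integral>v. \<kappa> v * indicator {0..<real A} v \<partial>lborel)"
    proof (rule integral_dominated_convergence[where w="\<lambda>v. C\<^sup>2 * indicator {0..<real A} v"])
      show "AE v in lborel. (\<lambda>k. \<kappa> (real_of_int \<lfloor>real (n k) * v\<rfloor> / real (n k)) * indicator {0..<real A} v) \<longlonglongrightarrow> \<kappa> v * indicator {0..<real A} v"
        by (rule AE_I2) (auto simp: indicator_def intro!: \<kappa>_lim)
      show "AE v in lborel. norm (\<kappa> (real_of_int \<lfloor>real (n k) * v\<rfloor> / real (n k)) * indicator {0..<real A} v) \<le> C\<^sup>2 * indicator {0..<real A} v" for k
        using \<kappa>b by (auto simp: indicator_def)
    qed measurable
    show "(\<lambda>k. 3 / real (n k) * ((\<Sum>i<A * n k. prob {\<omega> \<in> space N. real i / real (n k) \<le> exit_time B \<omega>}) / real (n k))) \<longlonglongrightarrow> 0"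
    proof (rule Lim_null_comparison)
      have le: "norm (3 / real (n k) * ((\<Sum>i<A * n k. prob {\<omega> \<in> space N. real i / real (n k) \<le> exit_time B \<omega>}) / real (n k))) \<le> 3 * real A * (1 / real (n k))" for k
      proof -
        have "(\<Sum>i<A * n k. prob {\<omega> \<in> space N. real i / real (n k) \<le> exit_time B \<omega>}) \<le> (\<Sum>i<A * n k. 1)"
          by (intro sum_mono) simp
        then have "(\<Sum>i<A * n k. prob {\<omega> \<in> space N. real i / real (n k) \<le> exit_time B \<omega>}) / real (n k) \<le> real A"
          using n0[of k] by (simp add: pos_divide_le_eq)
        then have "3 / real (n k) * ((\<Sum>i<A * n k. prob {\<omega> \<in> space N. real i / real (n k) \<le> exit_time B \<omega>}) / real (n k)) \<le> 3 / real (n k) * real A"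
          by (intro mult_left_mono) auto
        then show ?thesis by (simp add: sum_nonneg mult_ac)
      qed
      show "\<forall>\<^sub>F k in sequentially. norm (3 / real (n k) * ((\<Sum>i<A * n k. prob {\<omega> \<in> space N. real i / real (n k) \<le> exit_time B \<omega>}) / real (n k))) \<le> 3 * real A * (1 / real (n k))"
        using le by (rule always_eventually[OF allI])
      show "(\<lambda>k. 3 * real A * (1 / real (n k))) \<longlonglongrightarrow> 0"
        by (intro tendsto_mult_right_zero filterlim_compose[OF lim_1_over_n ntop])
    qed
  qed
  then have "(\<lambda>k. \<Sum>i<A * n k. \<integral>\<omega>. indicator {real i / real (n k)..} (exit_time B \<omega>) *
        ((B (real (Suc i) / real (n k)) \<omega> $ j) ^ 4 - (B (real i / real (n k)) \<omega> $ j) ^ 4) \<partial>N) \<longlonglongrightarrow> 3 * sphere_r CARD('d)"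
    unfolding grid \<kappa>_int by simp
  moreover have "(\<lambda>k. \<Sum>i<A * n k. \<integral>\<omega>. indicator {real i / real (n k)..} (exit_time B \<omega>) *
        ((B (real (Suc i) / real (n k)) \<omega> $ j) ^ 4 - (B (real i / real (n k)) \<omega> $ j) ^ 4) \<partial>N) \<longlonglongrightarrow> expectation (\<lambda>\<omega>. (B (exit_time B \<omega>) \<omega> $ j) ^ 4)"
    using stopped_value_limit[of "\<lambda>x. x ^ 4" "4 * C ^ 3 + 6 * C ^ 2 + 4 * C + 1" j] C fourth_increment[of _ C]
    unfolding n_def A_def by (simp add: C_def continuous_on_power)
  ultimately show ?thesis by (rule LIMSEQ_unique[symmetric])
qed

lemma exit_time_mean: "has_bochner_integral N (exit_time B) 1"
  using exit_time_mean_nn exit_time_nonneg[of B]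
  by (intro has_bochner_integral_nn_integral) auto

definition exit_covariation :: "'d \<Rightarrow> 'd \<Rightarrow> 'a \<Rightarrow> real" where
  "exit_covariation i k \<omega> = (LINT v:{0..exit_time B \<omega>}|lborel. B v \<omega> $ i * B v \<omega> $ k)"

text \<open>At each fixed time the product of two different coordinates is odd under one reflection,
  so its expectation before exit vanishes; Fubini then integrates zeros. The bound is d a for the
  integrand times a for the length.\<close>

lemma exit_covariation:
  assumes "i \<noteq> k"
  shows "exit_covariation i k \<in> borel_measurable N"
    and "\<And>\<omega>. \<omega> \<in> space N \<Longrightarrow> \<bar>exit_covariation i k \<omega>\<bar> \<le> real CARD('d) * (sphere_a CARD('d))\<^sup>2"
    and "expectation (exit_covariation i k) = 0"
proof -
  let ?a = "sphere_a CARD('d)"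
  interpret pair_sigma_finite lborel N ..
  define C where "C = sqrt (real CARD('d) * ?a)"
  have a: "0 < ?a" by (simp add: sphere_a_pos)
  have C: "0 \<le> C" "C * C = real CARD('d) * ?a" using a by (auto simp: C_def)
  have da: "0 \<le> real CARD('d) * ?a" using a by simp
  define h where "h v \<omega> = indicator {0..exit_time B \<omega>} v * (B (max 0 v) \<omega> $ i * B (max 0 v) \<omega> $ k)" for v \<omega>
  have eq: "exit_covariation i k \<omega> = (\<integral>v. h v \<omega> \<partial>lborel)" for \<omega>
    unfolding exit_covariation_def set_lebesgue_integral_def h_def
    by (intro Bochner_Integration.integral_cong) (auto simp: indicator_def)
  have m [measurable]: "(\<lambda>p. h (fst p) (snd p)) \<in> borel_measurable (lborel \<Otimes>\<^sub>M N)"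
  proof -
    have "(indicator {0..exit_time B (snd p)} (fst p) :: real) = indicator {p. 0 \<le> fst p \<and> fst p \<le> snd p} (fst p, exit_time B (snd p))" for p :: "real \<times> 'a"
      by (auto simp: indicator_def)
    then show ?thesis unfolding h_def by simp
  qed
  have hb: "\<bar>h v \<omega>\<bar> \<le> real CARD('d) * ?a * indicator {0..?a} v" if \<omega>: "\<omega> \<in> space N" for v \<omega>
  proof (cases "0 \<le> v \<and> v \<le> exit_time B \<omega>")
    case True
    then have "\<bar>B v \<omega> $ i * B v \<omega> $ k\<bar> \<le> C * C"
      unfolding abs_mult C_def by (intro mult_mono coord_bound \<omega>) (use da in auto)
    moreover have "indicator {0..?a} v = (1 :: real)" using True exit_time_le[of B \<omega>] by (simp add: indicator_def)
    ultimately show ?thesis using True C by (simp add: h_def)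
  next
    case False
    then show ?thesis using da by (auto simp: h_def)
  qed
  have hm: "(\<lambda>v. h v \<omega>) \<in> borel_measurable lborel" if "\<omega> \<in> space N" for \<omega>
    using measurable_compose[OF measurable_Pair2'[OF that] m] by simp
  have hi: "integrable lborel (\<lambda>v. real CARD('d) * ?a * indicator {0..?a} v)"
    by (intro integrable_mult_right integrable_real_indicator) (auto simp: emeasure_lborel_Icc_eq)
  have "(\<lambda>\<omega>. \<integral>v. h v \<omega> \<partial>lborel) \<in> borel_measurable N"
    by (rule lborel.borel_measurable_lebesgue_integral)
       (use measurable_pair_swap[OF m] in \<open>simp add: case_prod_beta'\<close>)
  then show "exit_covariation i k \<in> borel_measurable N" by (simp add: eq[abs_def])
  show "\<bar>exit_covariation i k \<omega>\<bar> \<le> real CARD('d) * ?a\<^sup>2" if \<omega>: "\<omega> \<in> space N" for \<omega>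
  proof -
    have f: "integrable lborel (\<lambda>v. h v \<omega>)"
      by (rule Bochner_Integration.integrable_bound[OF hi hm[OF \<omega>]])
         (use hb[OF \<omega>] in \<open>auto intro!: AE_I2 intro: order_trans[OF _ abs_ge_self]\<close>)
    have "\<bar>exit_covariation i k \<omega>\<bar> \<le> (\<integral>v. norm (h v \<omega>) \<partial>lborel)"
      unfolding eq using integral_norm_bound[of lborel "\<lambda>v. h v \<omega>"] by simp
    also have "\<dots> \<le> (\<integral>v. real CARD('d) * ?a * indicator {0..?a} v \<partial>lborel)"
      using hb[OF \<omega>] by (intro integral_mono integrable_norm f hi) simp
    also have "\<dots> = real CARD('d) * ?a\<^sup>2" using a by (simp add: power2_eq_square)
    finally show ?thesis .
  qed
  have hI: "integrable (lborel \<Otimes>\<^sub>M N) (\<lambda>p. h (fst p) (snd p))"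
  proof (rule Bochner_Integration.integrable_bound[OF _ m])
    have "emeasure (lborel \<Otimes>\<^sub>M N) ({0..?a} \<times> space N) < \<infinity>"
      using sigma_finite_measure.emeasure_pair_measure_Times[OF prob_space_imp_sigma_finite[OF prob_space_axioms], of "{0..?a}" lborel "space N"] a
      by (simp add: emeasure_space_1)
    then show "integrable (lborel \<Otimes>\<^sub>M N) (\<lambda>p. real CARD('d) * ?a * indicator ({0..?a} \<times> space N) p)"
      by (intro integrable_mult_right integrable_real_indicator) auto
    show "AE p in lborel \<Otimes>\<^sub>M N. norm (h (fst p) (snd p)) \<le> norm (real CARD('d) * ?a * indicator ({0..?a} \<times> space N) p)"
    proof (rule AE_I2)
      fix p :: "real \<times> 'a" assume "p \<in> space (lborel \<Otimes>\<^sub>M N)"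
      then have p: "snd p \<in> space N" "indicator ({0..?a} \<times> space N) p = (indicator {0..?a} (fst p) :: real)"
        by (auto simp: space_pair_measure indicator_def mem_Times_iff)
      show "norm (h (fst p) (snd p)) \<le> norm (real CARD('d) * ?a * indicator ({0..?a} \<times> space N) p)"
        unfolding p(2) real_norm_def by (rule order_trans[OF hb[OF p(1)] abs_ge_self])
    qed
  qed
  have z: "(\<integral>\<omega>. h v \<omega> \<partial>N) = 0" for v
  proof (cases "0 < v")
    case True
    then have "(\<integral>\<omega>. h v \<omega> \<partial>N) = (\<integral>\<omega>. (B v \<omega> $ i * B v \<omega> $ k) * indicator {v..} (exit_time B \<omega>) \<partial>N)"
      by (intro Bochner_Integration.integral_cong) (auto simp: h_def indicator_def)
    also have "\<dots> = 0"
      using assms by (intro exit_law_odd[OF True, where i=i]) (auto simp: flip_nth)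
    finally show ?thesis .
  next
    case False
    then have "(\<integral>\<omega>. h v \<omega> \<partial>N) = (\<integral>\<omega>. 0 \<partial>N)"
      using B0 by (intro Bochner_Integration.integral_cong) (auto simp: h_def indicator_def max_def)
    then show ?thesis by simp
  qed
  have "expectation (exit_covariation i k) = (\<integral>\<omega>. \<integral>v. h v \<omega> \<partial>lborel \<partial>N)"
    by (simp add: eq[abs_def])
  also have "\<dots> = (\<integral>v. \<integral>\<omega>. h v \<omega> \<partial>N \<partial>lborel)"
    using hI by (intro Fubini_integral) (simp add: case_prod_beta')
  finally show "expectation (exit_covariation i k) = 0" by (simp add: z)
qed

end

subsection \<open>The augmented Brownian filtration\<close>

context brownian
begin

text \<open>Independence with a Gaussian law survives pointwise limits, tested on bounded continuous
  functions. Used with varying variances for right limits of the filtration, and with constant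
  variance for stopping times approximated by discrete ones.\<close>

lemma limit_independent:
  assumes A: "A \<in> sets N" and Y: "\<And>k. Y k \<in> borel_measurable N" "Z \<in> borel_measurable N"
    and lim: "\<And>\<omega>. \<omega> \<in> space N \<Longrightarrow> (\<lambda>k. Y k \<omega>) \<longlonglongrightarrow> (Z \<omega> :: real ^ 'd)"
    and h: "\<And>k. 0 < h k" "0 < h'" "h \<longlonglongrightarrow> h'"
    and eq: "\<And>k f. continuous_on UNIV f \<Longrightarrow> (\<And>x. 0 \<le> f x) \<Longrightarrow> (\<And>x. f x \<le> 1) \<Longrightarrow>
      (\<integral>\<^sup>+\<omega>. indicator A \<omega> * ennreal (f (Y k \<omega>)) \<partial>N) = emeasure N A * (\<integral>\<^sup>+x. ennreal (f x) \<partial>gauss (h k))"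
    and E: "E \<in> sets borel"
  shows "emeasure N (A \<inter> {\<omega> \<in> space N. Z \<omega> \<in> E}) = emeasure N A * emeasure (gauss h') E"
proof -
  note [measurable] = A Y
  interpret g: prob_space "gauss h' :: (real ^ 'd) measure" using h by (intro prob_space_gauss)
  interpret g1: prob_space "gauss 1 :: (real ^ 'd) measure" by (intro prob_space_gauss) simp
  define \<mu> where "\<mu> = distr (density N (indicator A)) borel Z"
  define \<nu> where "\<nu> = density (gauss h' :: (real ^ 'd) measure) (\<lambda>_. emeasure N A)"
  have "\<mu> = \<nu>"
  proof (rule measure_eqI_continuous)
    show "finite_measure \<mu>"
      unfolding \<mu>_def
      by (intro finite_measure.finite_measure_distr finite_measureI) (auto simp: emeasure_density)
    show "sets \<mu> = sets borel" "sets \<nu> = sets borel" by (auto simp: \<mu>_def \<nu>_def)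
    fix f :: "real ^ 'd \<Rightarrow> real" assume f: "continuous_on UNIV f" "\<And>x. 0 \<le> f x" "\<And>x. f x \<le> 1"
    have [measurable]: "f \<in> borel_measurable borel" using f(1) by (rule borel_measurable_continuous_onI)
    have "(\<lambda>k. \<integral>\<^sup>+\<omega>. indicator A \<omega> * ennreal (f (Y k \<omega>)) \<partial>N) \<longlonglongrightarrow> (\<integral>\<^sup>+\<omega>. indicator A \<omega> * ennreal (f (Z \<omega>)) \<partial>N)"
    proof (rule nn_integral_dominated_convergence[where w="\<lambda>_. 1"])
      show "AE \<omega> in N. (\<lambda>k. indicator A \<omega> * ennreal (f (Y k \<omega>))) \<longlonglongrightarrow> indicator A \<omega> * ennreal (f (Z \<omega>))"
      proof (rule AE_I2)
        fix \<omega> assume "\<omega> \<in> space N"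
        then have "(\<lambda>k. f (Y k \<omega>)) \<longlonglongrightarrow> f (Z \<omega>)"
          using lim by (intro continuous_on_tendsto_compose[OF f(1)]) auto
        then show "(\<lambda>k. indicator A \<omega> * ennreal (f (Y k \<omega>))) \<longlonglongrightarrow> indicator A \<omega> * ennreal (f (Z \<omega>))"
          by (cases "\<omega> \<in> A") auto
      qed
    qed (use f in \<open>auto simp: indicator_def emeasure_space_1 ennreal_le_1\<close>)
    moreover have "(\<lambda>k. emeasure N A * (\<integral>\<^sup>+x. ennreal (f x) \<partial>(gauss (h k) :: (real ^ 'd) measure)))
        \<longlonglongrightarrow> emeasure N A * (\<integral>\<^sup>+x. ennreal (f x) \<partial>(gauss h' :: (real ^ 'd) measure))"
    proof (rule ennreal_tendsto_cmult)
      show "emeasure N A < top" by (rule less_top[THEN iffD1, OF emeasure_finite])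
      have s: "(\<integral>\<^sup>+x. ennreal (f x) \<partial>(gauss r :: (real ^ 'd) measure)) = (\<integral>\<^sup>+x. ennreal (f (sqrt r *\<^sub>R x)) \<partial>gauss 1)" if "0 < r" for r
        unfolding gauss_scale[OF that] by (rule nn_integral_distr) measurable
      show "(\<lambda>k. \<integral>\<^sup>+x. ennreal (f x) \<partial>(gauss (h k) :: (real ^ 'd) measure)) \<longlonglongrightarrow> (\<integral>\<^sup>+x. ennreal (f x) \<partial>(gauss h' :: (real ^ 'd) measure))"
        unfolding s[OF h(1)] s[OF h(2)]
      proof (rule nn_integral_dominated_convergence[where w="\<lambda>_. 1"])
        show "AE x in gauss 1. (\<lambda>k. ennreal (f (sqrt (h k) *\<^sub>R x))) \<longlonglongrightarrow> ennreal (f (sqrt h' *\<^sub>R (x :: real ^ 'd)))"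
          using h by (intro AE_I2 tendsto_ennrealI continuous_on_tendsto_compose[OF f(1)] tendsto_intros) auto
      qed (use f g1.emeasure_space_1 in \<open>auto simp: ennreal_le_1\<close>)
    qed
    ultimately have "(\<integral>\<^sup>+\<omega>. indicator A \<omega> * ennreal (f (Z \<omega>)) \<partial>N) = emeasure N A * (\<integral>\<^sup>+x. ennreal (f x) \<partial>(gauss h' :: (real ^ 'd) measure))"
      unfolding eq[OF f] by (rule LIMSEQ_unique)
    then show "(\<integral>\<^sup>+x. ennreal (f x) \<partial>\<mu>) = (\<integral>\<^sup>+x. ennreal (f x) \<partial>\<nu>)"
      by (simp add: \<mu>_def \<nu>_def nn_integral_distr nn_integral_density nn_integral_cmult cong: measurable_cong_sets)
  qed
  then have "emeasure \<mu> E = emeasure \<nu> E" by simp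
  moreover have "emeasure \<nu> E = emeasure N A * emeasure (gauss h') E"
    using E by (simp add: \<nu>_def emeasure_density nn_integral_cmult)
  moreover have "emeasure \<mu> E = emeasure N (A \<inter> {\<omega> \<in> space N. Z \<omega> \<in> E})"
  proof -
    have "emeasure \<mu> E = (\<integral>\<^sup>+\<omega>. indicator A \<omega> * indicator (Z -` E \<inter> space N) \<omega> \<partial>N)"
      using E measurable_sets[OF Y(2) E] by (simp add: \<mu>_def emeasure_distr emeasure_density)
    also have "\<dots> = (\<integral>\<^sup>+\<omega>. indicator (A \<inter> {\<omega> \<in> space N. Z \<omega> \<in> E}) \<omega> \<partial>N)"
      by (intro nn_integral_cong) (auto simp: indicator_def)
    also have "\<dots> = emeasure N (A \<inter> {\<omega> \<in> space N. Z \<omega> \<in> E})"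
    proof (intro nn_integral_indicator sets.Int A)
      show "{\<omega> \<in> space N. Z \<omega> \<in> E} \<in> sets N" using E by measurable
    qed
    finally show ?thesis .
  qed
  ultimately show ?thesis by simp
qed

lemma indep_continuous:
  fixes f :: "real ^ 'd \<Rightarrow> real"
  assumes s: "0 \<le> s" "s < u" and A: "A \<in> sets (F s)" and [measurable]: "f \<in> borel_measurable borel"
  shows "(\<integral>\<^sup>+\<omega>. indicator A \<omega> * ennreal (f (B u \<omega> - B s \<omega>)) \<partial>N) = emeasure N A * (\<integral>\<^sup>+x. ennreal (f x) \<partial>gauss (u - s))"
proof -
  have [measurable]: "A \<in> sets (F s)" by fact
  have AN: "A \<in> sets N" using A subalg[OF s(1)] by (auto simp: subalgebra_def)
  have "(\<integral>\<^sup>+\<omega>. indicator A \<omega> * ennreal (f (B u \<omega> - B s \<omega>)) \<partial>N) =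
    (\<integral>\<^sup>+\<omega>. (\<lambda>(\<omega>, y). indicator A \<omega> * ennreal (f y)) (\<omega>, B u \<omega> - B s \<omega>) \<partial>N)" by simp
  also have "\<dots> = (\<integral>\<^sup>+\<omega>. \<integral>\<^sup>+y. (\<lambda>(\<omega>, y). indicator A \<omega> * ennreal (f y)) (\<omega>, y) \<partial>gauss (u - s) \<partial>N)"
    by (rule markov_joint[OF s]) measurable
  also have "\<dots> = (\<integral>\<^sup>+\<omega>. indicator A \<omega> * (\<integral>\<^sup>+y. ennreal (f y) \<partial>gauss (u - s)) \<partial>N)"
    by (simp add: nn_integral_cmult cong: measurable_cong_sets)
  also have "\<dots> = emeasure N A * (\<integral>\<^sup>+x. ennreal (f x) \<partial>gauss (u - s))"
    using AN by (subst nn_integral_multc) auto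
  finally show ?thesis .
qed

text \<open>An event known immediately after \<open>s\<close> is independent of the increment from
  \<open>q\<close> to \<open>u\<close> for every q > s; let q decrease to s. The intersection is
  already a sigma-algebra for \<open>0 \<le> s\<close>, and \<open>sigma\<close> merely makes a
  measure of it.\<close>

lemma brownian_right_limit: "brownian N (\<lambda>s. sigma (space N) (\<Inter>q\<in>{s<..}. sets (F q))) B"
proof -
  let ?G = "\<lambda>s. sigma (space N) (\<Inter>q\<in>{s<..}. sets (F q))"
  have sG: "sets (?G s) = (\<Inter>q\<in>{s<..}. sets (F q))" if s: "0 \<le> s" for s
  proof (rule sigma_algebra.sets_measure_of_eq)
    have sp: "space N = space (F q)" if "s < q" for q using s that by (simp add: space_F)
    show "sigma_algebra (space N) (\<Inter>q\<in>{s<..}. sets (F q))"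
      unfolding sigma_algebra_iff2
    proof (intro conjI ballI allI impI)
      show "(\<Inter>q\<in>{s<..}. sets (F q)) \<subseteq> Pow (space N)"
      proof
        fix A assume "A \<in> (\<Inter>q\<in>{s<..}. sets (F q))"
        then have "A \<in> sets (F (s + 1))" by (rule INT_D) simp
        then show "A \<in> Pow (space N)" using sets.sets_into_space[of A "F (s + 1)"] sp[of "s + 1"] by auto
      qed
      show "\<And>A. A \<in> (\<Inter>q\<in>{s<..}. sets (F q)) \<Longrightarrow> space N - A \<in> (\<Inter>q\<in>{s<..}. sets (F q))"
      proof (rule INT_I)
        fix A q assume A: "A \<in> (\<Inter>q\<in>{s<..}. sets (F q))" and q: "q \<in> {s<..}"
        have "A \<in> sets (F q)" using A q by (rule INT_D)
        then show "space N - A \<in> sets (F q)" using sp[of q] q by (simp add: sets.compl_sets)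
      qed
      show "\<And>A :: nat \<Rightarrow> _. range A \<subseteq> (\<Inter>q\<in>{s<..}. sets (F q)) \<Longrightarrow> (\<Union>i. A i) \<in> (\<Inter>q\<in>{s<..}. sets (F q))"
        by (auto intro!: sets.countable_UN)
    qed auto
  qed
  show ?thesis
  proof (unfold_locales, goal_cases)
    case (1 s)
    have "sets (F (s + 1)) \<subseteq> sets N" using subalg[of "s + 1"] 1 by (auto simp: subalgebra_def)
    then show ?case unfolding subalgebra_def sG[OF 1] by (auto simp: space_measure_of_conv)
  next
    case (2 s u)
    then show ?case by (auto simp: sG)
  next
    case (3 s)
    have "B s \<in> borel_measurable (F q)" if "s < q" for q
      using that 3 by (intro F_mono[OF _ _ adapted]) auto
    then have m: "B s -` E \<inter> space N \<in> sets (F q)" if "s < q" "E \<in> sets borel" for q E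
      using measurable_sets[of "B s" "F q" borel E] that 3 by (simp add: space_F)
    show ?case
    proof (rule measurableI)
      fix E :: "(real ^ 'd) set" assume "E \<in> sets borel"
      then show "B s -` E \<inter> space (?G s) \<in> sets (?G s)"
        unfolding sG[OF 3] using m by (auto simp: space_measure_of_conv)
    qed simp
  next
    case (4 \<omega>) then show ?case by (rule cont)
  next
    case (5 s u A E)
    define q where "q k = s + (u - s) / real (Suc (Suc k))" for k
    have q: "s < q k" "q k < u" for k
    proof -
      have "(u - s) / real (Suc (Suc k)) < (u - s) / 1"
        using 5(2) by (intro divide_strict_left_mono) auto
      then show "q k < u" by (simp add: q_def)
      show "s < q k" using 5(2) by (simp add: q_def)
    qed
    have "(\<lambda>k. (u - s) / real (Suc (Suc k))) \<longlonglongrightarrow> 0"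
      using LIMSEQ_Suc[OF LIMSEQ_Suc[OF lim_const_over_n[of "u - s"]]] by simp
    from tendsto_add[OF tendsto_const[of s] this]
    have ql: "q \<longlonglongrightarrow> s" by (simp add: q_def[abs_def])
    have A: "A \<in> sets (F (q k))" for k
      using 5(3) q(1)[of k] unfolding sG[OF 5(1)] by auto
    have [measurable]: "B u \<in> borel_measurable N" "B s \<in> borel_measurable N" "B (q k) \<in> borel_measurable N" for k
      using 5 less_imp_le[OF q(1), of k] by (auto intro!: B_measurable)
    show ?case
    proof (rule limit_independent[where Y="\<lambda>k \<omega>. B u \<omega> - B (q k) \<omega>" and h="\<lambda>k. u - q k"])
      show "A \<in> sets N" using A[of 0] subalg[of "q 0"] 5 q[of 0] by (auto simp: subalgebra_def)
      show "(\<lambda>k. u - q k) \<longlonglongrightarrow> u - s" using ql by (intro tendsto_intros)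
      show "(\<lambda>k. B u \<omega> - B (q k) \<omega>) \<longlonglongrightarrow> B u \<omega> - B s \<omega>" if "\<omega> \<in> space N" for \<omega>
      proof -
        have "0 \<le> q k" for k using 5(1) q(1)[of k] by linarith
        then show ?thesis
          using 5(1) by (intro tendsto_diff tendsto_const continuous_on_tendsto_compose[OF cont[OF that] ql]) auto
      qed
      fix k and f :: "real ^ 'd \<Rightarrow> real" assume "continuous_on UNIV f"
      then show "(\<integral>\<^sup>+\<omega>. indicator A \<omega> * ennreal (f (B u \<omega> - B (q k) \<omega>)) \<partial>N) = emeasure N A * (\<integral>\<^sup>+x. ennreal (f x) \<partial>gauss (u - q k))"
        using 5 q[of k] A by (intro indep_continuous borel_measurable_continuous_onI) auto
    qed (use 5 q in auto)
  qed
qed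

text \<open>The variant of \<open>collapse\<close> with all observations strictly after
  \<open>s\<close>. Applied to the right-limit filtration it replaces the future by a function of
  the present position alone.\<close>

lemma collapse_set:
  assumes "finite U" "0 \<le> s" "\<And>u. u \<in> U \<Longrightarrow> s < u" "\<And>u. u \<in> U \<Longrightarrow> \<phi> u \<in> borel_measurable borel"
  shows "\<exists>\<theta> \<in> borel_measurable borel. \<forall>H \<in> borel_measurable (F s).
    (\<integral>\<^sup>+\<omega>. H \<omega> * (\<Prod>u\<in>U. \<phi> u (B u \<omega>)) \<partial>N) = (\<integral>\<^sup>+\<omega>. H \<omega> * \<theta> (B s \<omega>) \<partial>N :: ennreal)"
  using assms
proof (induction U arbitrary: s rule: finite_linorder_min_induct)
  case empty
  then show ?case by (auto intro!: bexI[of _ "\<lambda>_. 1"])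
next
  case (insert b A)
  have s: "0 \<le> s" "s < b" using insert.prems by auto
  then have b0: "0 \<le> b" by simp
  have "\<exists>\<theta> \<in> borel_measurable borel. \<forall>H \<in> borel_measurable (F b).
    (\<integral>\<^sup>+\<omega>. H \<omega> * (\<Prod>u\<in>A. \<phi> u (B u \<omega>)) \<partial>N) = (\<integral>\<^sup>+\<omega>. H \<omega> * \<theta> (B b \<omega>) \<partial>N)"
    using b0 insert.prems insert.hyps by (intro insert.IH) auto
  then obtain \<theta> where \<theta> [measurable]: "\<theta> \<in> borel_measurable borel"
    and eq: "\<And>H. H \<in> borel_measurable (F b) \<Longrightarrow>
      (\<integral>\<^sup>+\<omega>. H \<omega> * (\<Prod>u\<in>A. \<phi> u (B u \<omega>)) \<partial>N) = (\<integral>\<^sup>+\<omega>. H \<omega> * \<theta> (B b \<omega>) \<partial>N)"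
    by blast
  have [measurable]: "\<phi> b \<in> borel_measurable borel" using insert.prems by simp
  have [measurable]: "B b \<in> borel_measurable (F b)" using s by (intro adapted) simp
  interpret g: prob_space "gauss (b - s) :: (real ^ 'd) measure" using s by (intro prob_space_gauss) simp
  show ?case
  proof (intro bexI[of _ "\<lambda>x. \<integral>\<^sup>+y. \<phi> b (x + y) * \<theta> (x + y) \<partial>gauss (b - s)"] ballI)
    fix H :: "'a \<Rightarrow> ennreal" assume H: "H \<in> borel_measurable (F s)"
    have [measurable]: "H \<in> borel_measurable (F b)" using s by (intro F_mono[OF _ _ H]) auto
    have bA: "b \<notin> A" using insert.hyps by auto
    have "(\<integral>\<^sup>+\<omega>. H \<omega> * (\<Prod>u\<in>insert b A. \<phi> u (B u \<omega>)) \<partial>N) =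
       (\<integral>\<^sup>+\<omega>. (H \<omega> * \<phi> b (B b \<omega>)) * (\<Prod>u\<in>A. \<phi> u (B u \<omega>)) \<partial>N)"
      using insert.hyps bA by (simp add: mult.assoc)
    also have "\<dots> = (\<integral>\<^sup>+\<omega>. (H \<omega> * \<phi> b (B b \<omega>)) * \<theta> (B b \<omega>) \<partial>N)"
      by (intro eq) measurable
    also have "\<dots> = (\<integral>\<^sup>+\<omega>. H \<omega> * (\<lambda>x. \<phi> b x * \<theta> x) (B b \<omega>) \<partial>N)"
      by (simp add: mult.assoc)
    also have "\<dots> = (\<integral>\<^sup>+\<omega>. H \<omega> * (\<integral>\<^sup>+y. \<phi> b (B s \<omega> + y) * \<theta> (B s \<omega> + y) \<partial>gauss (b - s)) \<partial>N)"
      by (rule markov[OF s H]) measurable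
    finally show "(\<integral>\<^sup>+\<omega>. H \<omega> * (\<Prod>u\<in>insert b A. \<phi> u (B u \<omega>)) \<partial>N) =
       (\<integral>\<^sup>+\<omega>. H \<omega> * (\<integral>\<^sup>+y. \<phi> b (B s \<omega> + y) * \<theta> (B s \<omega> + y) \<partial>gauss (b - s)) \<partial>N)" .
  qed measurable
qed

end

section \<open>The given Brownian motion on the completed space; right-continuity of its
  filtration\<close>

locale std_bm = M: prob_space M for M :: "'a measure" +
  fixes W :: "real \<Rightarrow> 'a \<Rightarrow> real ^ 'd::finite"
  assumes SBM: "standard_brownian_motion M W"
begin

abbreviation P :: "'a measure" where "P \<equiv> completion M"
abbreviation F :: "real \<Rightarrow> 'a measure" where "F \<equiv> augmented_filtration M W"

lemma W_measurable: "0 \<le> s \<Longrightarrow> W s \<in> borel_measurable M"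
  and W_cont: "\<omega> \<in> space M \<Longrightarrow> continuous_on {0..} (\<lambda>s. W s \<omega>)"
  using SBM by (auto simp: standard_brownian_motion_def)

lemma space_natural [simp]: "space (natural_filtration M W s) = space M"
  by (auto simp: natural_filtration_def intro!: space_measure_of)

lemma sets_natural:
  "sets (natural_filtration M W s) =
    sigma_sets (space M) {W u -` B \<inter> space M | u B. 0 \<le> u \<and> u \<le> s \<and> B \<in> sets borel}"
  unfolding natural_filtration_def by (rule sets_measure_of) auto

lemma sets_natural_subset: "sets (natural_filtration M W s) \<subseteq> sets M"
  unfolding sets_natural
  by (intro sets.sigma_sets_subset) (auto intro: measurable_sets[OF W_measurable])

lemma aug_generator: "sets (natural_filtration M W s) \<union> null_sets (completion M) \<subseteq> Pow (space M)"
  using sets.space_closed[of "natural_filtration M W s"] sets.space_closed[of "completion M"]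
  by (auto dest: null_setsD2)

lemma space_aug [simp]: "space (F s) = space M"
  unfolding augmented_filtration_def by (rule space_measure_of[OF aug_generator])

lemma sets_aug: "sets (F s) = sigma_sets (space M) (sets (natural_filtration M W s) \<union> null_sets (completion M))"
  unfolding augmented_filtration_def by (rule sets_measure_of[OF aug_generator])

lemma natural_in_aug: "sets (natural_filtration M W s) \<subseteq> sets (F s)"
  and null_in_aug: "null_sets P \<subseteq> sets (F s)"
  unfolding sets_aug by auto

lemma sets_aug_subset: "sets (F s) \<subseteq> sets P"
  unfolding sets_aug using sets_natural_subset[of s] sets.sigma_sets_subset[of _ P]
  by (metis Un_least null_sets_def Collect_subset sets_completionI_sets space_completion subset_iff null_setsD2)

lemma aug_mono: "s \<le> u \<Longrightarrow> sets (F s) \<subseteq> sets (F u)"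
  unfolding sets_aug sets_natural by (intro sigma_sets_mono' Un_mono sigma_sets_mono') force+

lemma filtration: "filtration (space M) F"
  by (rule filtration.intro) (auto dest: aug_mono)

lemma subalgebra_aug: "subalgebra P (F s)"
  using sets_aug_subset by (auto simp: subalgebra_def)

lemma W_adapted: "0 \<le> u \<Longrightarrow> u \<le> s \<Longrightarrow> W u \<in> borel_measurable (F s)"
proof (rule measurableI)
  fix E :: "(real ^ 'd) set" assume u: "0 \<le> u" "u \<le> s" and E: "E \<in> sets borel"
  have "W u -` E \<inter> space M \<in> sets (natural_filtration M W s)"
    unfolding sets_natural using u E by blast
  then show "W u -` E \<inter> space (F s) \<in> sets (F s)" using natural_in_aug by auto
qed simp

text \<open>The events that agree almost surely with a natural one form a sigma-algebra containing
  the null sets. Through this, independence and equality of integrals pass from the natural to the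
  augmented filtration.\<close>

lemma aug_approx:
  assumes "A \<in> sets (F s)"
  shows "\<exists>A'\<in>sets (natural_filtration M W s). AE \<omega> in P. \<omega> \<in> A \<longleftrightarrow> \<omega> \<in> A'"
  using assms unfolding sets_aug
proof (induction rule: sigma_sets.induct)
  case (Basic a)
  then show ?case
  proof
    assume "a \<in> null_sets P"
    then have "AE \<omega> in P. \<omega> \<notin> a" by (rule AE_not_in)
    then show ?thesis by (intro bexI[of _ "{}"]) auto
  qed auto
next
  case Empty
  then show ?case by (intro bexI[of _ "{}"]) auto
next
  case (Compl a)
  then obtain A' where A': "A' \<in> sets (natural_filtration M W s)" "AE \<omega> in P. \<omega> \<in> a \<longleftrightarrow> \<omega> \<in> A'" by blast
  have "space M - A' \<in> sets (natural_filtration M W s)"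
    using sets.compl_sets[OF A'(1)] by simp
  moreover have "AE \<omega> in P. \<omega> \<in> space M - a \<longleftrightarrow> \<omega> \<in> space M - A'"
    using A'(2) by eventually_elim auto
  ultimately show ?case by blast
next
  case (Union a)
  then have "\<forall>i. \<exists>A'\<in>sets (natural_filtration M W s). AE \<omega> in P. \<omega> \<in> a i \<longleftrightarrow> \<omega> \<in> A'" by blast
  then obtain A' where A': "\<And>i. A' i \<in> sets (natural_filtration M W s)" "\<And>i. AE \<omega> in P. \<omega> \<in> a i \<longleftrightarrow> \<omega> \<in> A' i"
    by metis
  have "AE \<omega> in P. \<forall>i. \<omega> \<in> a i \<longleftrightarrow> \<omega> \<in> A' i" using A'(2) by (simp add: AE_all_countable)
  then have "AE \<omega> in P. \<omega> \<in> (\<Union>i. a i) \<longleftrightarrow> \<omega> \<in> (\<Union>i. A' i)"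
    by eventually_elim auto
  then show ?case using A'(1) by (intro bexI[of _ "\<Union>i. A' i"]) auto
qed

lemma W_incr_law:
  assumes s: "0 \<le> s" "s < u"
  shows "distr M borel (\<lambda>\<omega>. W u \<omega> - W s \<omega>) = gauss (u - s)"
proof (rule measure_eqI_rectangles)
  have [measurable]: "W u \<in> borel_measurable M" "W s \<in> borel_measurable M"
    using s by (auto intro: W_measurable)
  show "finite_measure (distr M borel (\<lambda>\<omega>. W u \<omega> - W s \<omega>))"
    by (intro prob_space.finite_measure M.prob_space_distr) auto
  fix E :: "'d \<Rightarrow> real set" assume [measurable]: "\<And>j. E j \<in> sets borel"
  have iv: "M.indep_vars (\<lambda>_. borel) (\<lambda>j \<omega>. W u \<omega> $ j - W s \<omega> $ j) UNIV"
    and di: "\<And>j. distributed M lborel (\<lambda>\<omega>. W u \<omega> $ j - W s \<omega> $ j) (\<lambda>x. ennreal (normal_density 0 (sqrt (u - s)) x))"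
    using SBM s by (auto simp: standard_brownian_motion_def)
  have "(\<lambda>\<omega>. W u \<omega> - W s \<omega>) -` {x. \<forall>j. x $ j \<in> E j} \<inter> space M =
     (\<Inter>j\<in>UNIV. (\<lambda>\<omega>. W u \<omega> $ j - W s \<omega> $ j) -` E j \<inter> space M)"
    by auto
  then have "emeasure (distr M borel (\<lambda>\<omega>. W u \<omega> - W s \<omega>)) {x. \<forall>j. x $ j \<in> E j} =
     ennreal (M.prob (\<Inter>j\<in>UNIV. (\<lambda>\<omega>. W u \<omega> $ j - W s \<omega> $ j) -` E j \<inter> space M))"
    by (simp add: emeasure_distr M.emeasure_eq_measure)
  also have "\<dots> = (\<Prod>j\<in>UNIV. ennreal (M.prob ((\<lambda>\<omega>. W u \<omega> $ j - W s \<omega> $ j) -` E j \<inter> space M)))"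
    using iv by (subst M.indep_varsD_finite[OF iv]) (auto simp: prod_ennreal)
  also have "\<dots> = (\<Prod>j\<in>UNIV. \<integral>\<^sup>+x. ennreal (normal_density 0 (sqrt (u - s)) x) * indicator (E j) x \<partial>lborel)"
    by (intro prod.cong refl) (simp add: M.emeasure_eq_measure[symmetric] distributed_emeasure[OF di])
  also have "\<dots> = emeasure (gauss (u - s)) {x. \<forall>j. x $ j \<in> E j}"
    by (rule emeasure_gauss_rectangle[symmetric]) simp
  finally show "emeasure (distr M borel (\<lambda>\<omega>. W u \<omega> - W s \<omega>)) {x. \<forall>j. x $ j \<in> E j} =
    emeasure (gauss (u - s)) {x. \<forall>j. x $ j \<in> E j}" .
qed auto

lemma brownian: "brownian P F W"
proof (intro brownian.intro brownian_axioms.intro)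
  show "prob_space P" by (rule M.prob_space_completion)
  fix s u :: real and A E assume s: "0 \<le> s" "s < u" and A: "A \<in> sets (F s)" and E [measurable]: "E \<in> sets (borel :: (real ^ 'd) measure)"
  have [measurable]: "W u \<in> borel_measurable M" "W s \<in> borel_measurable M"
    using s by (auto intro: W_measurable)
  obtain A' where A': "A' \<in> sets (natural_filtration M W s)" "AE \<omega> in P. \<omega> \<in> A \<longleftrightarrow> \<omega> \<in> A'"
    using aug_approx[OF A] by blast
  then have A'M: "A' \<in> sets M" using sets_natural_subset by auto
  have AP: "A \<in> sets P" using A sets_aug_subset by auto
  let ?D = "\<lambda>\<omega>. W u \<omega> - W s \<omega>"
  have D: "{\<omega> \<in> space M. ?D \<omega> \<in> E} \<in> sets M" by measurable
  have eqD: "?D -` E \<inter> space M = {\<omega> \<in> space M. ?D \<omega> \<in> E}" by auto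
  have "M.indep_set (sets (natural_filtration M W s)) (sets (vimage_algebra (space M) ?D borel))"
    using SBM s by (auto simp: standard_brownian_motion_def)
  then have "M.prob (A' \<inter> {\<omega> \<in> space M. ?D \<omega> \<in> E}) = M.prob A' * M.prob {\<omega> \<in> space M. ?D \<omega> \<in> E}"
    using A'(1) in_vimage_algebra[OF E, of ?D "space M"] unfolding eqD M.indep_sets2_eq by blast
  then have "emeasure M (A' \<inter> {\<omega> \<in> space M. ?D \<omega> \<in> E}) = emeasure M A' * emeasure M {\<omega> \<in> space M. ?D \<omega> \<in> E}"
    by (simp add: M.emeasure_eq_measure ennreal_mult)
  also have "emeasure M {\<omega> \<in> space M. ?D \<omega> \<in> E} = emeasure (gauss (u - s)) E"
    unfolding W_incr_law[OF s, symmetric] by (simp add: emeasure_distr eqD)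
  also have "emeasure M A' = emeasure P A"
  proof -
    have "emeasure P A = emeasure P A'" using A'(2) AP A'M by (intro emeasure_eq_AE) auto
    then show ?thesis using A'M by simp
  qed
  also have "emeasure M (A' \<inter> {\<omega> \<in> space M. ?D \<omega> \<in> E}) = emeasure P (A \<inter> {\<omega> \<in> space P. ?D \<omega> \<in> E})"
  proof -
    have "emeasure P (A \<inter> {\<omega> \<in> space P. ?D \<omega> \<in> E}) = emeasure P (A' \<inter> {\<omega> \<in> space P. ?D \<omega> \<in> E})"
      using A'(2) AP A'M D by (intro emeasure_eq_AE) auto
    then show ?thesis using A'M D by simp
  qed
  finally show "emeasure P (A \<inter> {\<omega> \<in> space P. ?D \<omega> \<in> E}) = emeasure P A * emeasure (gauss (u - s)) E" .
qed (use subalgebra_aug aug_mono W_adapted W_cont in auto)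

text \<open>Blumenthal's argument. Past and right-limit past predict the future through the same
  function of the position at \<open>s\<close>, so the conditional expectation of the indicator of
  \<open>A\<close> given F(s) is the indicator itself. Then \<open>A\<close> differs from an event
  of F(s) by null sets, and F(s) contains those.\<close>

lemma right_continuous:
  assumes s: "0 \<le> s" and A: "\<And>q. s < q \<Longrightarrow> A \<in> sets (F q)"
  shows "A \<in> sets (F s)"
proof -
  let ?G = "\<lambda>s. sigma (space P) (\<Inter>q\<in>{s<..}. sets (F q))"
  interpret B: brownian P F W by (rule brownian)
  interpret R: brownian P ?G W by (rule B.brownian_right_limit)
  interpret S: finite_measure_subalgebra P "F s"
    by unfold_locales (rule subalgebra_aug)
  interpret S1: finite_measure_subalgebra P "F (s + 1)"
    by unfold_locales (rule subalgebra_aug)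
  have "(\<Inter>q\<in>{s<..}. sets (F q)) \<subseteq> Pow (space P)"
  proof
    fix C assume "C \<in> (\<Inter>q\<in>{s<..}. sets (F q))"
    then have "C \<in> sets (F (s + 1))" by (rule INT_D) simp
    then show "C \<in> Pow (space P)" using sets.sets_into_space[of C "F (s + 1)"] by auto
  qed
  note sGs = sets_measure_of[OF this]
  have sG: "sets (F s) \<subseteq> sets (?G s)"
  proof -
    have "(\<Inter>q\<in>{s<..}. sets (F q)) \<subseteq> sets (?G s)"
      unfolding sGs by (rule sigma_sets_superset_generator)
    moreover have "sets (F s) \<subseteq> (\<Inter>q\<in>{s<..}. sets (F q))"
      by (intro INT_greatest aug_mono) simp
    ultimately show ?thesis by (rule order_trans[rotated])
  qed
  have FG: "f \<in> borel_measurable (F s) \<Longrightarrow> f \<in> borel_measurable (?G s)" for f :: "'a \<Rightarrow> ennreal"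
    using sG by (rule borel_measurable_subalgebra) (simp add: space_measure_of_conv)
  have AG: "A \<in> sets (?G s)"
    unfolding sGs using A by (intro sigma_sets.Basic) auto
  have AP [measurable]: "A \<in> sets P" using A[of "s + 1"] sets_aug_subset by auto
  define e where "e = nn_cond_exp P (F s) (indicator A)"
  have e [measurable]: "e \<in> borel_measurable (F s)" "e \<in> borel_measurable P" by (auto simp: e_def)
  have eI: "(\<integral>\<^sup>+\<omega>. H \<omega> * indicator A \<omega> \<partial>P) = (\<integral>\<^sup>+\<omega>. H \<omega> * e \<omega> \<partial>P)" if "H \<in> borel_measurable (F s)" for H
    unfolding e_def using that by (intro S.nn_cond_exp_intg[symmetric]) auto
  \<comment> \<open>Observations up to \<open>s\<close> stay as they are. Those after
    \<open>s\<close> are replaced by \<theta>(W s), legitimately so because \<open>A\<close> and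
    \<open>e\<close> are both measurable for the right limit; as \<theta>(W s) lies in F(s),
    \<open>A\<close> may be exchanged for \<open>e\<close>, and then the replacement is
    undone.\<close>
  have cyl: "(\<integral>\<^sup>+\<omega>. (\<Prod>u\<in>U. indicator (E u) (W u \<omega>)) * indicator A \<omega> \<partial>P) =
      (\<integral>\<^sup>+\<omega>. (\<Prod>u\<in>U. indicator (E u) (W u \<omega>)) * e \<omega> \<partial>P)"
    if U: "finite U" "\<And>u. u \<in> U \<Longrightarrow> 0 \<le> u" and E: "\<And>u. u \<in> U \<Longrightarrow> E u \<in> sets borel" for U E
  proof -
    define U1 U2 where "U1 = {u\<in>U. u \<le> s}" and "U2 = {u\<in>U. s < u}"
    have U12: "U = U1 \<union> U2" "U1 \<inter> U2 = {}" "finite U1" "finite U2" using U by (auto simp: U1_def U2_def)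
    define H where "H \<omega> = (\<Prod>u\<in>U1. indicator (E u) (W u \<omega>) :: ennreal)" for \<omega>
    have H: "H \<in> borel_measurable (F s)"
      unfolding H_def[abs_def]
    proof (intro borel_measurable_prod_ennreal)
      fix u assume "u \<in> U1"
      then have "W u \<in> borel_measurable (F s)" "E u \<in> sets borel" using U E by (auto simp: U1_def intro!: W_adapted)
      then show "(\<lambda>\<omega>. indicator (E u) (W u \<omega>) :: ennreal) \<in> borel_measurable (F s)" by measurable
    qed
    have "\<exists>\<theta> \<in> borel_measurable borel. \<forall>H \<in> borel_measurable (?G s).
      (\<integral>\<^sup>+\<omega>. H \<omega> * (\<Prod>u\<in>U2. indicator (E u) (W u \<omega>)) \<partial>P) = (\<integral>\<^sup>+\<omega>. H \<omega> * \<theta> (W s \<omega>) \<partial>P)"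
      using s U12 E by (intro R.collapse_set) (auto simp: U2_def)
    then obtain \<theta> :: "real ^ 'd \<Rightarrow> ennreal" where \<theta> [measurable]: "\<theta> \<in> borel_measurable borel"
      and eq: "\<And>H. H \<in> borel_measurable (?G s) \<Longrightarrow>
        (\<integral>\<^sup>+\<omega>. H \<omega> * (\<Prod>u\<in>U2. indicator (E u) (W u \<omega>)) \<partial>P) = (\<integral>\<^sup>+\<omega>. H \<omega> * \<theta> (W s \<omega>) \<partial>P)"
      by blast
    have th: "(\<lambda>\<omega>. \<theta> (W s \<omega>)) \<in> borel_measurable (F s)"
      using s by (intro measurable_compose[OF W_adapted \<theta>]) auto
    have p: "(\<Prod>u\<in>U. indicator (E u) (W u \<omega>)) = H \<omega> * (\<Prod>u\<in>U2. indicator (E u) (W u \<omega>))" for \<omega>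
      unfolding H_def U12(1) using U12 by (intro prod.union_disjoint) auto
    have "(\<integral>\<^sup>+\<omega>. (\<Prod>u\<in>U. indicator (E u) (W u \<omega>)) * indicator A \<omega> \<partial>P) =
        (\<integral>\<^sup>+\<omega>. (H \<omega> * indicator A \<omega>) * (\<Prod>u\<in>U2. indicator (E u) (W u \<omega>)) \<partial>P)"
      unfolding p by (simp add: mult_ac)
    also have "\<dots> = (\<integral>\<^sup>+\<omega>. (H \<omega> * indicator A \<omega>) * \<theta> (W s \<omega>) \<partial>P)"
      using FG[OF H] AG by (intro eq borel_measurable_times_ennreal borel_measurable_indicator) auto
    also have "\<dots> = (\<integral>\<^sup>+\<omega>. (H \<omega> * \<theta> (W s \<omega>)) * indicator A \<omega> \<partial>P)"
      by (simp add: mult_ac)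
    also have "\<dots> = (\<integral>\<^sup>+\<omega>. (H \<omega> * \<theta> (W s \<omega>)) * e \<omega> \<partial>P)"
      by (intro eI borel_measurable_times_ennreal H th)
    also have "\<dots> = (\<integral>\<^sup>+\<omega>. (H \<omega> * e \<omega>) * \<theta> (W s \<omega>) \<partial>P)"
      by (simp add: mult_ac)
    also have "\<dots> = (\<integral>\<^sup>+\<omega>. (H \<omega> * e \<omega>) * (\<Prod>u\<in>U2. indicator (E u) (W u \<omega>)) \<partial>P)"
      using FG[OF H] FG[OF e(1)] by (intro eq[symmetric] borel_measurable_times_ennreal) auto
    also have "\<dots> = (\<integral>\<^sup>+\<omega>. (\<Prod>u\<in>U. indicator (E u) (W u \<omega>)) * e \<omega> \<partial>P)"
      unfolding p by (simp add: mult_ac)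
    finally show ?thesis .
  qed
  \<comment> \<open>Any horizon beyond \<open>s\<close> would do: \<open>A\<close> lies in F(s + 1),
    so its indicator is its own conditional expectation there, and testing on cylinders up to s + 1
    determines it.\<close>
  let ?K = "natural_filtration M W (s + 1)"
  let ?\<G> = "{{\<omega> \<in> space M. \<forall>u\<in>U. W u \<omega> \<in> E u} | U E. finite U \<and> (\<forall>u\<in>U. 0 \<le> u \<and> u \<le> s + 1 \<and> E u \<in> sets borel)}"
  have KP: "subalgebra P ?K" using sets_natural_subset by (auto simp: subalgebra_def)
  have KD: "subalgebra (density P f) ?K" for f using KP by (simp add: subalgebra_def)
  have eq: "restr_to_subalg (density P (indicator A)) ?K = restr_to_subalg (density P e) ?K"
  proof (rule measure_eqI_generator_eq[where \<Omega>="space M" and A="\<lambda>_. space M" and E="?\<G>"])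
    show "Int_stable ?\<G>"
    proof (rule Int_stableI, safe)
      fix U U' and E E' :: "real \<Rightarrow> (real ^ 'd) set"
      assume 1: "finite U" "finite U'" "\<forall>u\<in>U. 0 \<le> u \<and> u \<le> s + 1 \<and> E u \<in> sets borel" "\<forall>u\<in>U'. 0 \<le> u \<and> u \<le> s + 1 \<and> E' u \<in> sets borel"
      let ?E = "\<lambda>u. (if u \<in> U then E u else UNIV) \<inter> (if u \<in> U' then E' u else UNIV)"
      show "\<exists>Ua Ea. {\<omega> \<in> space M. \<forall>u\<in>U. W u \<omega> \<in> E u} \<inter> {\<omega> \<in> space M. \<forall>u\<in>U'. W u \<omega> \<in> E' u} =
         {\<omega> \<in> space M. \<forall>u\<in>Ua. W u \<omega> \<in> Ea u} \<and> finite Ua \<and> (\<forall>u\<in>Ua. 0 \<le> u \<and> u \<le> s + 1 \<and> Ea u \<in> sets borel)"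
        using 1 by (intro exI[of _ "U \<union> U'"] exI[of _ ?E]) auto
    qed
    have sK: "sets ?K = sigma_sets (space M) ?\<G>"
    proof
      have "{\<omega> \<in> space M. \<forall>u\<in>U. W u \<omega> \<in> E u} \<in> sets ?K"
        if 1: "finite U" "\<forall>u\<in>U. 0 \<le> u \<and> u \<le> s + 1 \<and> E u \<in> sets borel" for U and E :: "real \<Rightarrow> (real ^ 'd) set"
      proof -
        have "W u -` E u \<inter> space M \<in> sets ?K" if "u \<in> U" for u
          unfolding sets_natural using 1 that by (intro sigma_sets.Basic) blast
        then have "{\<omega> \<in> space ?K. \<forall>u\<in>U. W u \<omega> \<in> E u} \<in> sets ?K"
          using 1 by (intro sets.sets_Collect_finite_All) (auto simp: vimage_def Int_def conj_commute)
        then show ?thesis by simp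
      qed
      then have "?\<G> \<subseteq> sets ?K" by blast
      from sets.sigma_sets_subset[OF this]
      show "sigma_sets (space M) ?\<G> \<subseteq> sets ?K" by simp
      show "sets ?K \<subseteq> sigma_sets (space M) ?\<G>"
        unfolding sets_natural
      proof (rule sigma_sets_mono, safe)
        fix u and C :: "(real ^ 'd) set" assume u: "0 \<le> u" "u \<le> s + 1" "C \<in> sets borel"
        have "W u -` C \<inter> space M = {\<omega> \<in> space M. \<forall>v\<in>{u}. W v \<omega> \<in> C}" by auto
        then show "W u -` C \<inter> space M \<in> sigma_sets (space M) ?\<G>"
          using u by (intro sigma_sets.Basic CollectI exI[of _ "{u}"] exI[of _ "\<lambda>_. C"]) auto
      qed
    qed
    show "sets (restr_to_subalg (density P (indicator A)) ?K) = sigma_sets (space M) ?\<G>"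
      "sets (restr_to_subalg (density P e) ?K) = sigma_sets (space M) ?\<G>"
      unfolding sets_restr_to_subalg[OF KD] sK by auto
    show "(\<Union>i::nat. space M) = space M" by simp
    show "range (\<lambda>_::nat. space M) \<subseteq> ?\<G>"
      by (auto intro!: exI[of _ "{}"])
    have "emeasure (density P (indicator A)) (space P) = emeasure P A"
      using AP sets.sets_into_space[OF AP] by (subst emeasure_density) (auto simp: indicator_inter_arith[symmetric] Int_absorb1 Int_absorb2)
    then have "emeasure (density P (indicator A)) (space M) \<noteq> \<infinity>"
      using B.emeasure_finite[of A] by simp
    then show "emeasure (restr_to_subalg (density P (indicator A)) ?K) (space M) \<noteq> \<infinity>" for i :: nat
      using sets.top[of ?K] by (simp add: emeasure_restr_to_subalg[OF KD])
    show "?\<G> \<subseteq> Pow (space M)" by auto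
    fix X assume X: "X \<in> ?\<G>"
    then obtain U E where U: "X = {\<omega> \<in> space M. \<forall>u\<in>U. W u \<omega> \<in> E u}" "finite U"
      "\<And>u. u \<in> U \<Longrightarrow> 0 \<le> u \<and> u \<le> s + 1 \<and> E u \<in> sets borel" by blast
    have XK: "X \<in> sets ?K" using X unfolding sK by (rule sigma_sets.Basic)
    then have XP: "X \<in> sets P" using KP by (auto simp: subalgebra_def)
    have ind: "indicator X \<omega> = (\<Prod>u\<in>U. indicator (E u) (W u \<omega>) :: ennreal)" if "\<omega> \<in> space M" for \<omega>
      using U(1,2) that by (auto simp: indicator_def prod_zero_iff)
    have "emeasure (density P f) X = (\<integral>\<^sup>+\<omega>. (\<Prod>u\<in>U. indicator (E u) (W u \<omega>)) * f \<omega> \<partial>P)"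
      if "f \<in> borel_measurable P" for f
      using that XP by (subst emeasure_density) (auto simp: ind mult.commute intro!: nn_integral_cong)
    then show "emeasure (restr_to_subalg (density P (indicator A)) ?K) X = emeasure (restr_to_subalg (density P e) ?K) X"
      using XK cyl[of U E] U(2,3) by (simp add: emeasure_restr_to_subalg[OF KD])
  qed
  have eqD: "(\<integral>\<^sup>+\<omega>. e \<omega> * indicator D \<omega> \<partial>P) = (\<integral>\<^sup>+\<omega>. indicator A \<omega> * indicator D \<omega> \<partial>P)" if D: "D \<in> sets (F (s + 1))" for D
  proof -
    obtain D' where D': "D' \<in> sets ?K" "AE \<omega> in P. \<omega> \<in> D \<longleftrightarrow> \<omega> \<in> D'" using aug_approx[OF D] by blast
    have D'P: "D' \<in> sets P" using D' KP by (auto simp: subalgebra_def)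
    have r: "(\<integral>\<^sup>+\<omega>. f \<omega> * indicator D \<omega> \<partial>P) = (\<integral>\<^sup>+\<omega>. f \<omega> * indicator D' \<omega> \<partial>P)" for f :: "'a \<Rightarrow> ennreal"
    proof (intro nn_integral_cong_AE)
      show "AE \<omega> in P. f \<omega> * indicator D \<omega> = f \<omega> * indicator D' \<omega>"
        using D'(2) by eventually_elim (simp add: indicator_def)
    qed
    have "emeasure (density P f) D' = (\<integral>\<^sup>+\<omega>. f \<omega> * indicator D' \<omega> \<partial>P)" if "f \<in> borel_measurable P" for f
      using that D'P by (rule emeasure_density)
    moreover have "emeasure (density P (indicator A)) D' = emeasure (density P e) D'"
      using arg_cong[OF eq, of "\<lambda>\<mu>. emeasure \<mu> D'"] D'(1) by (simp add: emeasure_restr_to_subalg[OF KD])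
    ultimately show ?thesis unfolding r by simp
  qed
  have "AE \<omega> in P. e \<omega> = nn_cond_exp P (F (s + 1)) (indicator A) \<omega>"
  proof (rule S1.nn_cond_exp_charact)
    show "e \<in> borel_measurable (F (s + 1))"
      using s by (intro B.F_mono[OF _ _ e(1)]) auto
  qed (use eqD in \<open>auto simp: mult.commute\<close>)
  moreover have "AE \<omega> in P. indicator A \<omega> = nn_cond_exp P (F (s + 1)) (indicator A) \<omega>"
    using A[of "s + 1"] by (intro S1.nn_cond_exp_F_meas borel_measurable_indicator) auto
  ultimately have AE: "AE \<omega> in P. indicator A \<omega> = e \<omega>" by eventually_elim simp
  \<comment> \<open>An event of F(s) representing \<open>A\<close>, since \<open>e\<close> takes
    almost surely only the values 0 and 1.\<close>
  define A1 where "A1 = {\<omega> \<in> space (F s). e \<omega> = 1}"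
  have A1: "A1 \<in> sets (F s)" unfolding A1_def by measurable
  have "AE \<omega> in P. \<omega> \<in> A \<longleftrightarrow> \<omega> \<in> A1"
    using AE AE_space by eventually_elim (auto simp: A1_def indicator_def split: if_splits)
  then have ae: "AE \<omega> in P. \<omega> \<notin> A - A1" "AE \<omega> in P. \<omega> \<notin> A1 - A"
    by (eventually_elim, simp)+
  have "A1 \<in> sets P" using A1 sets_aug_subset by blast
  then have N: "A - A1 \<in> null_sets P" "A1 - A \<in> null_sets P"
    using ae AP AE_iff_null_sets[of "A - A1" P] AE_iff_null_sets[of "A1 - A" P] by auto
  then have "A = (A1 - (A1 - A)) \<union> (A - A1)" by auto
  also have "\<dots> \<in> sets (F s)"
    by (rule sets.Un[OF sets.Diff[OF A1 subsetD[OF null_in_aug N(2)]] subsetD[OF null_in_aug N(1)]])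
  finally show ?thesis .
qed

text \<open>The event {T <= s} is an intersection of events {T < q} with q decreasing to s;
  right-continuity brings it back into F(s). Exits through a strict inequality provide just this
  weaker information.\<close>

lemma stopping_timeI_less:
  assumes T: "\<And>\<omega>. \<omega> \<in> space M \<Longrightarrow> 0 \<le> T \<omega>" and m: "\<And>q. 0 < q \<Longrightarrow> {\<omega> \<in> space M. T \<omega> < q} \<in> sets (F q)"
  shows "stopping_time F T"
proof (rule stopping_timeI)
  fix s :: real
  have "{\<omega> \<in> space M. T \<omega> \<le> s} \<in> sets (F s)"
  proof (cases "0 \<le> s")
    case True
    show ?thesis
    proof (rule right_continuous[OF True])
      fix q assume q: "s < q"
      have "{\<omega> \<in> space M. T \<omega> \<le> s} = (\<Inter>k. {\<omega> \<in> space M. T \<omega> < s + (q - s) / real (Suc k)})"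
      proof (intro equalityI subsetI)
        fix \<omega> assume w: "\<omega> \<in> (\<Inter>k. {\<omega> \<in> space M. T \<omega> < s + (q - s) / real (Suc k)})"
        have "(\<lambda>k. s + (q - s) / real (Suc k)) \<longlonglongrightarrow> s + 0"
          by (intro tendsto_add tendsto_const LIMSEQ_Suc[OF lim_const_over_n])
        then have "T \<omega> \<le> s"
          using w by (intro LIMSEQ_le_const[of _ "s"]) (auto intro!: exI[of _ 0] less_imp_le)
        then show "\<omega> \<in> {\<omega> \<in> space M. T \<omega> \<le> s}" using w by auto
      qed (use q in \<open>auto intro: le_less_trans\<close>)
      also have "\<dots> \<in> sets (F q)"
      proof (intro sets.countable_INT subsetI; (elim imageE)?)
        fix k :: nat and C assume C: "C = {\<omega> \<in> space M. T \<omega> < s + (q - s) / real (Suc k)}"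
        have "0 < s + (q - s) / real (Suc k)" using True q by (simp add: add_nonneg_pos)
        moreover have "s + (q - s) / real (Suc k) \<le> q"
        proof -
          have "(q - s) / real (Suc k) \<le> (q - s) / 1" using q by (intro divide_left_mono) auto
          then show ?thesis by simp
        qed
        ultimately show "C \<in> sets (F q)"
          unfolding C using m aug_mono by blast
      qed auto
      finally show "{\<omega> \<in> space M. T \<omega> \<le> s} \<in> sets (F q)" .
    qed
  next
    case False
    then have "{\<omega> \<in> space M. T \<omega> \<le> s} = {}" using T by force
    then show ?thesis by (simp only: sets.empty_sets)
  qed
  then show "Measurable.pred (F s) (\<lambda>\<omega>. T \<omega> \<le> s)" by (simp add: pred_def)
qed

end

subsection \<open>The strong Markov property with random scaling\<close>

context std_bm
begin

sublocale filt: filtration "space M" F by (rule filtration)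
sublocale B: brownian P F W by (rule brownian)

lemma stopping_time_measurable: "stopping_time F T \<Longrightarrow> T \<in> borel_measurable P"
  by (rule measurable_stopping_time[of F]) (auto dest: subsetD[OF sets_aug_subset])

lemma pre_subalgebra:
  assumes T: "stopping_time F T"
  shows "subalgebra P (filt.pre_sigma T)"
proof -
  have "A \<in> sets P" if A: "A \<in> sets (filt.pre_sigma T)" for A
  proof -
    have "{\<omega> \<in> A. T \<omega> \<le> real n} \<in> sets P" for n
      using filt.sets_pre_sigmaD[OF T A, of "real n"] sets_aug_subset by blast
    then have "(\<Union>n. {\<omega> \<in> A. T \<omega> \<le> real n}) \<in> sets P" by auto
    also have "(\<Union>n. {\<omega> \<in> A. T \<omega> \<le> real n}) = A" using real_arch_simple by auto
    finally show ?thesis .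
  qed
  then show ?thesis by (auto simp: subalgebra_def filt.space_pre_sigma)
qed

lemma pre_measurable_P: "stopping_time F T \<Longrightarrow> f \<in> measurable (filt.pre_sigma T) K \<Longrightarrow> f \<in> measurable P K"
  by (rule measurable_from_subalg[OF pre_subalgebra])

text \<open>On {T <= s} the stopped value is the value at min T s, a random time in [0, s]
  measurable for F(s), so \<open>measurable_random_time\<close> applies inside F(s).\<close>

lemma stopped_measurable:
  fixes X :: "real \<Rightarrow> 'a \<Rightarrow> 'b::metric_space"
  assumes T: "stopping_time F T" and T0: "\<And>\<omega>. \<omega> \<in> space M \<Longrightarrow> 0 \<le> T \<omega>"
    and X: "\<And>r. 0 \<le> r \<Longrightarrow> X r \<in> borel_measurable (F r)"
    and c: "\<And>\<omega>. \<omega> \<in> space M \<Longrightarrow> continuous_on {0..} (\<lambda>r. X r \<omega>)"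
  shows "(\<lambda>\<omega>. X (T \<omega>) \<omega>) \<in> borel_measurable (filt.pre_sigma T)"
proof (rule measurableI)
  fix E :: "'b set" assume E: "E \<in> sets borel"
  show "(\<lambda>\<omega>. X (T \<omega>) \<omega>) -` E \<inter> space (filt.pre_sigma T) \<in> sets (filt.pre_sigma T)"
  proof (rule filt.sets_pre_sigmaI[OF T])
    fix s :: real
    show "{\<omega> \<in> (\<lambda>\<omega>. X (T \<omega>) \<omega>) -` E \<inter> space (filt.pre_sigma T). T \<omega> \<le> s} \<in> sets (F s)"
    proof (cases "0 \<le> s")
      case False
      then have "{\<omega> \<in> (\<lambda>\<omega>. X (T \<omega>) \<omega>) -` E \<inter> space (filt.pre_sigma T). T \<omega> \<le> s} = {}"
        using T0 by (force simp: filt.space_pre_sigma)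
      then show ?thesis by (simp only: sets.empty_sets)
    next
      case True
      have U: "(\<lambda>\<omega>. min (T \<omega>) s) \<in> borel_measurable (F s)"
      proof (rule borel_measurableI_le)
        fix x
        have "{\<omega> \<in> space (F s). min (T \<omega>) s \<le> x} = (if s \<le> x then space (F s) else {\<omega> \<in> space (F s). T \<omega> \<le> x})"
          by auto
        also have "\<dots> \<in> sets (F s)"
          using filt.stopping_time_le_const[OF T, of x s] sets.top[of "F s"] by (auto simp: pred_def)
        finally show "{\<omega> \<in> space (F s). min (T \<omega>) s \<le> x} \<in> sets (F s)" .
      qed
      have "(\<lambda>\<omega>. X (min (T \<omega>) s) \<omega>) \<in> borel_measurable (F s)"
      proof (rule measurable_random_time[where s=s, OF _ _ U])
        show "X r \<in> borel_measurable (F s)" if "r \<in> {0..s}" for r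
          using that by (intro B.F_mono[OF _ _ X]) auto
        show "continuous_on {0..s} (\<lambda>r. X r \<omega>)" if "\<omega> \<in> space (F s)" for \<omega>
          using that by (intro continuous_on_subset[OF c]) auto
      qed (use T0 True in auto)
      then have "(\<lambda>\<omega>. X (min (T \<omega>) s) \<omega>) -` E \<inter> space (F s) \<inter> {\<omega> \<in> space (F s). T \<omega> \<le> s} \<in> sets (F s)"
        using E stopping_timeD[OF T, of s] by (intro sets.Int measurable_sets) (auto simp: pred_def)
      also have "(\<lambda>\<omega>. X (min (T \<omega>) s) \<omega>) -` E \<inter> space (F s) \<inter> {\<omega> \<in> space (F s). T \<omega> \<le> s} =
         {\<omega> \<in> (\<lambda>\<omega>. X (T \<omega>) \<omega>) -` E \<inter> space (filt.pre_sigma T). T \<omega> \<le> s}"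
        by (auto simp: filt.space_pre_sigma min_def)
      finally show ?thesis .
    qed
  qed
qed simp

text \<open>Strong Markov property and Brownian scaling at once. Both \<open>T\<close> and
  \<open>g\<close> are discretised; on each of countably many pieces the start and the scale are
  constants, and the scale cancels from the Gaussian law. The pieces are summed and the mesh tends
  to 0.\<close>

lemma strong_increment:
  assumes T: "stopping_time F T" and T0: "\<And>\<omega>. \<omega> \<in> space M \<Longrightarrow> 0 \<le> T \<omega>"
    and g: "g \<in> borel_measurable (filt.pre_sigma T)" and g0: "\<And>\<omega>. \<omega> \<in> space M \<Longrightarrow> 0 < g \<omega>"
    and h: "0 < h" and A: "A \<in> sets (filt.pre_sigma T)" and E: "E \<in> sets borel"
  shows "emeasure P (A \<inter> {\<omega> \<in> space P. (1 / sqrt (g \<omega>)) *\<^sub>R (W (T \<omega> + g \<omega> * h) \<omega> - W (T \<omega>) \<omega>) \<in> E}) =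
    emeasure P A * emeasure (gauss h) E"
proof -
  define fl where "fl k x = (real (nat \<lfloor>real (Suc k) * x\<rfloor>) + 1) / real (Suc k)" for k and x :: real
  define D where "D r c \<omega> = (1 / sqrt c) *\<^sub>R (W (r + c * h) \<omega> - W r \<omega>)" for r c \<omega>
  \<comment> \<open>The grid time used is (J + 1) / (k + 1), which is not before \<open>T\<close>.
    Rounding up makes each piece an event of the filtration at its own grid time.\<close>
  define J where "J k \<omega> = nat \<lfloor>real (Suc k) * T \<omega>\<rfloor>" for k \<omega>
  define L where "L k \<omega> = nat \<lfloor>real (Suc k) * g \<omega>\<rfloor>" for k \<omega>
  define Y where "Y k \<omega> = D ((real (J k \<omega>) + 1) / real (Suc k)) ((real (L k \<omega>) + 1) / real (Suc k)) \<omega>" for k \<omega>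
  have D_meas [measurable]: "D r c \<in> borel_measurable P" if "0 \<le> r" "0 \<le> c" for r c
  proof -
    have [measurable]: "W (r + c * h) \<in> borel_measurable P" "W r \<in> borel_measurable P"
      using that h by (auto intro!: B.B_measurable)
    show ?thesis unfolding D_def[abs_def] by measurable
  qed
  have JL_pre: "J k \<in> measurable (filt.pre_sigma T) (count_space UNIV)" "L k \<in> measurable (filt.pre_sigma T) (count_space UNIV)" for k
  proof -
    have [measurable]: "T \<in> borel_measurable (filt.pre_sigma T)" by (rule filt.measurable_stopping_time_pre_sigma[OF T])
    note [measurable] = g
    show "J k \<in> measurable (filt.pre_sigma T) (count_space UNIV)" "L k \<in> measurable (filt.pre_sigma T) (count_space UNIV)"
      unfolding J_def[abs_def] L_def[abs_def] by measurable
  qed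
  have JL_P [measurable]: "J k \<in> measurable P (count_space UNIV)" "L k \<in> measurable P (count_space UNIV)" for k
    by (rule pre_measurable_P[OF T], rule JL_pre)+
  have Y_meas [measurable]: "Y k \<in> borel_measurable P" for k
    unfolding Y_def
    by (rule measurable_compose_countable[OF _ JL_P(1), where f="\<lambda>j \<omega>. D ((real j + 1) / real (Suc k)) ((real (L k \<omega>) + 1) / real (Suc k)) \<omega>"],
        rule measurable_compose_countable[OF _ JL_P(2), where f="\<lambda>l \<omega>. D ((real j + 1) / real (Suc k)) ((real l + 1) / real (Suc k)) \<omega>" for j])
       (auto intro!: D_meas)
  have flim: "(\<lambda>k. (real (nat \<lfloor>real (Suc k) * x\<rfloor>) + 1) / real (Suc k)) \<longlonglongrightarrow> x" if "0 \<le> x" for x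
  proof -
    have "(\<lambda>k. real_of_int \<lfloor>real (Suc k) * x\<rfloor> / real (Suc k) + 1 / real (Suc k)) \<longlonglongrightarrow> x + 0"
      by (intro tendsto_add tendsto_floor_grid filterlim_Suc LIMSEQ_Suc[OF lim_1_over_n])
    moreover have "real_of_int \<lfloor>real (Suc k) * x\<rfloor> = real (nat \<lfloor>real (Suc k) * x\<rfloor>)" for k
      using that by simp
    ultimately show ?thesis by (simp only: add_divide_distrib[symmetric] add_0_right)
  qed
  have Wlim: "(\<lambda>k. W (f k) \<omega>) \<longlonglongrightarrow> W x \<omega>" if "\<omega> \<in> space M" "f \<longlonglongrightarrow> x" "\<And>k. 0 \<le> f k" "0 \<le> x" for f x \<omega>
    using that by (intro continuous_on_tendsto_compose[OF W_cont]) auto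
  have Ylim: "(\<lambda>k. Y k \<omega>) \<longlonglongrightarrow> (1 / sqrt (g \<omega>)) *\<^sub>R (W (T \<omega> + g \<omega> * h) \<omega> - W (T \<omega>) \<omega>)" if \<omega>: "\<omega> \<in> space M" for \<omega>
    unfolding Y_def D_def J_def L_def
    using T0[OF \<omega>] g0[OF \<omega>] h
    by (intro tendsto_scaleR tendsto_divide tendsto_const tendsto_real_sqrt tendsto_diff Wlim[OF \<omega>] tendsto_add tendsto_mult flim)
       (auto intro!: add_nonneg_nonneg mult_nonneg_nonneg divide_nonneg_nonneg)
  have AP: "A \<in> sets P" using A pre_subalgebra[OF T] by (auto simp: subalgebra_def)
  show ?thesis
  proof (rule B.limit_independent[where Y=Y and h="\<lambda>_. h"])
    have [measurable]: "T \<in> borel_measurable P" by (rule stopping_time_measurable[OF T])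
    show "(\<lambda>\<omega>. (1 / sqrt (g \<omega>)) *\<^sub>R (W (T \<omega> + g \<omega> * h) \<omega> - W (T \<omega>) \<omega>)) \<in> borel_measurable P"
    proof (rule borel_measurable_LIMSEQ_metric[where f=Y])
      show "Y k \<in> borel_measurable P" for k by (rule Y_meas)
    qed (simp add: Ylim)
    show "\<omega> \<in> space P \<Longrightarrow> (\<lambda>k. Y k \<omega>) \<longlonglongrightarrow> (1 / sqrt (g \<omega>)) *\<^sub>R (W (T \<omega> + g \<omega> * h) \<omega> - W (T \<omega>) \<omega>)" for \<omega>
      using Ylim by simp
    fix k and f :: "real ^ 'd \<Rightarrow> real"
    assume f: "continuous_on UNIV f" "\<And>x. 0 \<le> f x" "\<And>x. f x \<le> 1"
    have [measurable]: "f \<in> borel_measurable borel" using f(1) by (rule borel_measurable_continuous_onI)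
    \<comment> \<open>The pairs of grid values of \<open>T\<close> and \<open>g\<close> are
      enumerated by \<open>prod_decode\<close>, so that \<open>A\<close> becomes a countable
      disjoint union.\<close>
    define C where "C n = A \<inter> {\<omega> \<in> space M. J k \<omega> = fst (prod_decode n) \<and> L k \<omega> = snd (prod_decode n)}" for n
    define r where "r n = (real (fst (prod_decode n)) + 1) / real (Suc k)" for n
    define c where "c n = (real (snd (prod_decode n)) + 1) / real (Suc k)" for n
    have rc: "0 < r n" "0 < c n" for n by (auto simp: r_def c_def intro!: divide_pos_pos)
    have Cr: "C n \<in> sets (F (r n))" for n
    proof -
      note [measurable] = JL_pre
      have "{\<omega> \<in> space (filt.pre_sigma T). J k \<omega> = fst (prod_decode n) \<and> L k \<omega> = snd (prod_decode n)} \<in> sets (filt.pre_sigma T)"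
        by measurable
      then have "C n \<in> sets (filt.pre_sigma T)"
        unfolding C_def filt.space_pre_sigma by (rule sets.Int[OF A])
      from filt.sets_pre_sigmaD[OF T this, of "r n"]
      have "{\<omega> \<in> C n. T \<omega> \<le> r n} \<in> sets (F (r n))" .
      moreover have "{\<omega> \<in> C n. T \<omega> \<le> r n} = C n"
      proof -
        have "T \<omega> \<le> r n" if "\<omega> \<in> C n" for \<omega>
        proof -
          have "nat \<lfloor>real (Suc k) * T \<omega>\<rfloor> = fst (prod_decode n)" using that by (simp add: C_def J_def)
          then have "real (Suc k) * T \<omega> \<le> real (fst (prod_decode n)) + 1"
            by linarith
          then show ?thesis by (simp add: r_def pos_le_divide_eq mult.commute)
        qed
        then show ?thesis by auto
      qed
      ultimately show ?thesis by simp
    qed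
    have CP [measurable]: "C n \<in> sets P" for n using Cr sets_aug_subset by blast
    have C: "\<omega> \<in> C n \<longleftrightarrow> \<omega> \<in> A \<and> \<omega> \<in> space M \<and> n = prod_encode (J k \<omega>, L k \<omega>)" for n \<omega>
    proof -
      have "J k \<omega> = fst (prod_decode n) \<and> L k \<omega> = snd (prod_decode n) \<longleftrightarrow> prod_decode n = (J k \<omega>, L k \<omega>)"
        by (auto simp: prod_eq_iff)
      also have "\<dots> \<longleftrightarrow> n = prod_encode (J k \<omega>, L k \<omega>)"
        by (metis prod_decode_inverse prod_encode_inverse)
      finally show ?thesis by (simp add: C_def)
    qed
    have sum1: "(\<Sum>n. indicator (C n) \<omega> * x) = indicator A \<omega> * x" if "\<omega> \<in> space M" for \<omega> and x :: ennreal
    proof -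
      have "(\<lambda>n. indicator (C n) \<omega> * x) = (\<lambda>n. if n = prod_encode (J k \<omega>, L k \<omega>) then indicator A \<omega> * x else 0)"
        using that by (intro ext) (simp add: C indicator_def)
      then show ?thesis
        by (simp only: sums_unique[OF sums_single[of "prod_encode (J k \<omega>, L k \<omega>)" "\<lambda>_. indicator A \<omega> * x"], symmetric])
    qed
    have "(\<integral>\<^sup>+\<omega>. indicator A \<omega> * ennreal (f (Y k \<omega>)) \<partial>P) = (\<integral>\<^sup>+\<omega>. (\<Sum>n. indicator (C n) \<omega> * ennreal (f (Y k \<omega>))) \<partial>P)"
      using sum1 by (intro nn_integral_cong) simp
    also have "\<dots> = (\<Sum>n. \<integral>\<^sup>+\<omega>. indicator (C n) \<omega> * ennreal (f (Y k \<omega>)) \<partial>P)"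
      using CP by (intro nn_integral_suminf) measurable
    also have "\<dots> = (\<Sum>n. emeasure P (C n) * (\<integral>\<^sup>+x. ennreal (f x) \<partial>gauss h))"
    proof (intro suminf_cong)
      fix n
      have "(\<integral>\<^sup>+\<omega>. indicator (C n) \<omega> * ennreal (f (Y k \<omega>)) \<partial>P) =
        (\<integral>\<^sup>+\<omega>. indicator (C n) \<omega> * ennreal (f ((1 / sqrt (c n)) *\<^sub>R (W (r n + c n * h) \<omega> - W (r n) \<omega>))) \<partial>P)"
      proof (intro nn_integral_cong)
        fix \<omega>
        show "indicator (C n) \<omega> * ennreal (f (Y k \<omega>)) =
          indicator (C n) \<omega> * ennreal (f ((1 / sqrt (c n)) *\<^sub>R (W (r n + c n * h) \<omega> - W (r n) \<omega>)))"
        proof (cases "\<omega> \<in> C n")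
          case True
          then have "J k \<omega> = fst (prod_decode n)" "L k \<omega> = snd (prod_decode n)" by (simp_all add: C_def)
          then have "Y k \<omega> = (1 / sqrt (c n)) *\<^sub>R (W (r n + c n * h) \<omega> - W (r n) \<omega>)"
            unfolding Y_def D_def r_def c_def by (simp only:)
          then show ?thesis by (simp only:)
        qed simp
      qed
      also have "\<dots> = emeasure P (C n) * (\<integral>\<^sup>+x. ennreal (f ((1 / sqrt (c n)) *\<^sub>R x)) \<partial>gauss (r n + c n * h - r n))"
      proof (rule B.indep_continuous[where f="\<lambda>x. f ((1 / sqrt (c n)) *\<^sub>R x)", OF _ _ Cr])
        show "0 \<le> r n" "r n < r n + c n * h" using rc[of n] h by simp_all
      qed measurable
      also have "(\<integral>\<^sup>+x. ennreal (f ((1 / sqrt (c n)) *\<^sub>R x)) \<partial>gauss (r n + c n * h - r n)) = (\<integral>\<^sup>+x. ennreal (f x) \<partial>gauss h)"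
      proof -
        have ch: "0 < c n * h" using rc h by simp
        have "(\<integral>\<^sup>+x. ennreal (f ((1 / sqrt (c n)) *\<^sub>R x)) \<partial>gauss (c n * h)) = (\<integral>\<^sup>+x. ennreal (f ((1 / sqrt (c n)) *\<^sub>R sqrt (c n * h) *\<^sub>R x)) \<partial>gauss 1)"
          unfolding gauss_scale[OF ch] by (rule nn_integral_distr) measurable
        also have "\<dots> = (\<integral>\<^sup>+x. ennreal (f (sqrt h *\<^sub>R x)) \<partial>gauss 1)"
        proof (intro nn_integral_cong)
          fix x :: "real ^ 'd"
          have "1 / sqrt (c n) * sqrt (c n * h) = sqrt h" using rc(2)[of n] by (simp add: real_sqrt_mult)
          then show "ennreal (f ((1 / sqrt (c n)) *\<^sub>R sqrt (c n * h) *\<^sub>R x)) = ennreal (f (sqrt h *\<^sub>R x))"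
            by (simp only: scaleR_scaleR)
        qed
        also have "\<dots> = (\<integral>\<^sup>+x. ennreal (f x) \<partial>gauss h)"
          unfolding gauss_scale[OF h] by (rule nn_integral_distr[symmetric]) measurable
        finally show ?thesis by simp
      qed
      finally show "(\<integral>\<^sup>+\<omega>. indicator (C n) \<omega> * ennreal (f (Y k \<omega>)) \<partial>P) = emeasure P (C n) * (\<integral>\<^sup>+x. ennreal (f x) \<partial>gauss h)" .
    qed
    also have "\<dots> = (\<Sum>n. emeasure P (C n)) * (\<integral>\<^sup>+x. ennreal (f x) \<partial>gauss h)"
      by (rule ennreal_suminf_multc)
    also have "(\<Sum>n. emeasure P (C n)) = emeasure P (\<Union>n. C n)"
      using CP by (intro suminf_emeasure) (auto simp: disjoint_family_on_def C)
    also have "(\<Union>n. C n) = A"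
      using sets.sets_into_space[OF AP] by (auto simp: C)
    finally show "(\<integral>\<^sup>+\<omega>. indicator A \<omega> * ennreal (f (Y k \<omega>)) \<partial>P) = emeasure P A * (\<integral>\<^sup>+x. ennreal (f x) \<partial>gauss h)" .
  qed (use AP E h in auto)
qed

definition rescaled :: "('a \<Rightarrow> real) \<Rightarrow> ('a \<Rightarrow> real) \<Rightarrow> real \<Rightarrow> 'a \<Rightarrow> real ^ 'd" where
  "rescaled T g v \<omega> = (1 / sqrt (g \<omega>)) *\<^sub>R (W (T \<omega> + g \<omega> * v) \<omega> - W (T \<omega>) \<omega>)"

text \<open>\<open>g\<close> is known at time \<open>T\<close>, and T + g v <= s implies T <= s, so
  the event is decided by time s.\<close>

lemma stopping_time_shift:
  assumes T: "stopping_time F T"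
    and g: "g \<in> borel_measurable (filt.pre_sigma T)" and g0: "\<And>\<omega>. \<omega> \<in> space M \<Longrightarrow> 0 < g \<omega>" and v: "0 \<le> v"
  shows "stopping_time F (\<lambda>\<omega>. T \<omega> + g \<omega> * v)"
proof (rule stopping_timeI)
  fix s
  have [measurable]: "T \<in> borel_measurable (filt.pre_sigma T)" by (rule filt.measurable_stopping_time_pre_sigma[OF T])
  note [measurable] = g
  have "{\<omega> \<in> space (filt.pre_sigma T). T \<omega> + g \<omega> * v \<le> s} \<in> sets (filt.pre_sigma T)" by measurable
  from filt.sets_pre_sigmaD[OF T this, of s]
  have "{\<omega> \<in> {\<omega> \<in> space (filt.pre_sigma T). T \<omega> + g \<omega> * v \<le> s}. T \<omega> \<le> s} \<in> sets (F s)" .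
  also have "{\<omega> \<in> {\<omega> \<in> space (filt.pre_sigma T). T \<omega> + g \<omega> * v \<le> s}. T \<omega> \<le> s} = {\<omega> \<in> space (F s). T \<omega> + g \<omega> * v \<le> s}"
  proof -
    have "T \<omega> \<le> s" if "\<omega> \<in> space M" "T \<omega> + g \<omega> * v \<le> s" for \<omega>
      using mult_nonneg_nonneg[OF less_imp_le[OF g0[OF that(1)]] v] that by simp
    then show ?thesis by (auto simp: filt.space_pre_sigma)
  qed
  finally show "Measurable.pred (F s) (\<lambda>\<omega>. T \<omega> + g \<omega> * v \<le> s)" by (simp add: pred_def)
qed

lemma pre_mono:
  assumes "stopping_time F S" "stopping_time F T" "\<And>\<omega>. \<omega> \<in> space M \<Longrightarrow> S \<omega> \<le> T \<omega>"
    and "f \<in> measurable (filt.pre_sigma S) K"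
  shows "f \<in> measurable (filt.pre_sigma T) K"
  using filt.mono_pre_sigma[OF assms(1,2,3)] assms(4)
  by (auto simp: measurable_def filt.space_pre_sigma)

text \<open>This turns conditioning on the stopped sigma-algebra into unconditional statements:
  every fact proved in \<open>brownian0\<close> holds verbatim under each P( . | A), with the
  filtration stopped at T + g v.\<close>

lemma rescaled_brownian:
  assumes T: "stopping_time F T" and T0: "\<And>\<omega>. \<omega> \<in> space M \<Longrightarrow> 0 \<le> T \<omega>"
    and g: "g \<in> borel_measurable (filt.pre_sigma T)" and g0: "\<And>\<omega>. \<omega> \<in> space M \<Longrightarrow> 0 < g \<omega>"
    and A: "A \<in> sets (filt.pre_sigma T)" and pos: "emeasure P A \<noteq> 0"
  shows "brownian0 (uniform_measure P A) (\<lambda>v. filt.pre_sigma (\<lambda>\<omega>. T \<omega> + g \<omega> * v)) (rescaled T g)"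
proof -
  let ?U = "uniform_measure P A" and ?S = "\<lambda>v \<omega>. T \<omega> + g \<omega> * v"
  have S: "stopping_time F (?S v)" if "0 \<le> v" for v by (rule stopping_time_shift[OF T g g0 that])
  have S0: "0 \<le> ?S v \<omega>" "T \<omega> \<le> ?S v \<omega>" if "\<omega> \<in> space M" "0 \<le> v" for v \<omega>
    using T0[OF that(1)] g0[OF that(1)] that by (auto intro!: add_nonneg_nonneg mult_nonneg_nonneg)
  have Smono: "?S v \<omega> \<le> ?S w \<omega>" if "\<omega> \<in> space M" "v \<le> w" for v w \<omega>
    using g0[OF that(1)] that by (auto intro!: mult_left_mono)
  have AP: "A \<in> sets P" using A pre_subalgebra[OF T] by (auto simp: subalgebra_def)
  have gS: "g \<in> borel_measurable (filt.pre_sigma (?S v))" if "0 \<le> v" for v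
    using S0 that by (intro pre_mono[OF T S _ g]) auto
  have WS: "(\<lambda>\<omega>. W (?S v \<omega>) \<omega>) \<in> borel_measurable (filt.pre_sigma (?S v))" if "0 \<le> v" for v
    using S0 that by (intro stopped_measurable S W_adapted W_cont) auto
  have WT: "(\<lambda>\<omega>. W (T \<omega>) \<omega>) \<in> borel_measurable (filt.pre_sigma T)"
    using T0 by (intro stopped_measurable T W_adapted W_cont) auto
  show ?thesis
  proof (intro brownian0.intro brownian.intro brownian_axioms.intro brownian0_axioms.intro)
    show "prob_space ?U" using pos B.emeasure_finite[of A] by (intro prob_space_uniform_measure) auto
    show "subalgebra ?U (filt.pre_sigma (?S s))" if "0 \<le> s" for s
      using pre_subalgebra[OF S[OF that]] by (simp add: subalgebra_def)
    show "sets (filt.pre_sigma (?S s)) \<subseteq> sets (filt.pre_sigma (?S u))" if "0 \<le> s" "s \<le> u" for s u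
      using that Smono by (intro filt.mono_pre_sigma S) auto
    show "rescaled T g s \<in> borel_measurable (filt.pre_sigma (?S s))" if "0 \<le> s" for s
    proof -
      have "(\<lambda>\<omega>. W (T \<omega>) \<omega>) \<in> borel_measurable (filt.pre_sigma (?S s))"
        using S0 that by (intro pre_mono[OF T S _ WT]) auto
      then show ?thesis
        unfolding rescaled_def[abs_def] using WS[OF that] gS[OF that] by measurable
    qed
    show "continuous_on {0..} (\<lambda>s. rescaled T g s \<omega>)" if "\<omega> \<in> space ?U" for \<omega>
      unfolding rescaled_def using that S0[of \<omega>]
      by (intro continuous_on_scaleR continuous_on_const continuous_on_diff
          continuous_on_compose2[OF W_cont] continuous_intros) auto
    show "rescaled T g 0 \<omega> = 0" for \<omega> by (simp add: rescaled_def)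
    fix s u C E assume s: "0 \<le> s" "s < u" and C: "C \<in> sets (filt.pre_sigma (?S s))" and E: "E \<in> sets (borel :: (real ^ 'd) measure)"
    have AC: "A \<inter> C \<in> sets (filt.pre_sigma (?S s))"
      using C filt.mono_pre_sigma[OF T S[OF s(1)]] S0 s A by auto
    then have ACP: "A \<inter> C \<in> sets P" using pre_subalgebra[OF S[OF s(1)]] by (auto simp: subalgebra_def)
    have CP: "C \<in> sets P" using C pre_subalgebra[OF S[OF s(1)]] by (auto simp: subalgebra_def)
    have su: "0 \<le> u" using s by simp
    have m [measurable]: "rescaled T g u \<in> borel_measurable P" "rescaled T g s \<in> borel_measurable P"
    proof -
      have 1: "g \<in> borel_measurable P" "(\<lambda>\<omega>. W (T \<omega>) \<omega>) \<in> borel_measurable P"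
        "(\<lambda>\<omega>. W (?S u \<omega>) \<omega>) \<in> borel_measurable P" "(\<lambda>\<omega>. W (?S s \<omega>) \<omega>) \<in> borel_measurable P"
        using pre_measurable_P[OF T g] pre_measurable_P[OF T WT] pre_measurable_P[OF S WS, OF su su] pre_measurable_P[OF S WS, OF s(1) s(1)] by auto
      then show "rescaled T g u \<in> borel_measurable P" "rescaled T g s \<in> borel_measurable P"
        unfolding rescaled_def[abs_def] by measurable
    qed
    have diff: "rescaled T g u \<omega> - rescaled T g s \<omega> = (1 / sqrt (g \<omega>)) *\<^sub>R (W (?S s \<omega> + g \<omega> * (u - s)) \<omega> - W (?S s \<omega>) \<omega>)" for \<omega>
    proof -
      have "?S s \<omega> + g \<omega> * (u - s) = ?S u \<omega>" by (simp add: algebra_simps)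
      then show ?thesis unfolding rescaled_def by (simp only: scaleR_diff_right[symmetric]) simp
    qed
    let ?X = "{\<omega> \<in> space P. rescaled T g u \<omega> - rescaled T g s \<omega> \<in> E}"
    have X: "?X \<in> sets P" using E by measurable
    \<comment> \<open>An increment of the rescaled path from s to u is the situation of
      \<open>strong_increment\<close> at the stopping time T + g s, with the same scale; dividing by
      the probability of \<open>A\<close> gives the conditional form.\<close>
    have "emeasure P ((A \<inter> C) \<inter> ?X) = emeasure P (A \<inter> C) * emeasure (gauss (u - s)) E"
      unfolding diff using s S0 by (intro strong_increment S gS g0 AC E) auto
    then have "emeasure P (A \<inter> (C \<inter> ?X)) / emeasure P A = emeasure P (A \<inter> C) / emeasure P A * emeasure (gauss (u - s)) E"
      by (simp add: Int_assoc ennreal_times_divide mult.commute)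
    then show "emeasure ?U (C \<inter> {\<omega> \<in> space ?U. rescaled T g u \<omega> - rescaled T g s \<omega> \<in> E}) =
        emeasure ?U C * emeasure (gauss (u - s)) E"
      using AP CP sets.Int[OF CP X] by simp
  qed
qed

lemma pre_finite_subalgebra:
  "stopping_time F T \<Longrightarrow> finite_measure_subalgebra P (filt.pre_sigma T)"
  using pre_subalgebra B.finite_measure_axioms
  by (intro finite_measure_subalgebra.intro finite_measure_subalgebra_axioms.intro)

lemma integral_uniform:
  assumes A: "A \<in> sets P" "emeasure P A \<noteq> 0" and Y [measurable]: "Y \<in> borel_measurable P"
  shows "(\<integral>\<omega>. Y \<omega> \<partial>uniform_measure P A) = (\<integral>\<omega>. indicator A \<omega> * Y \<omega> \<partial>P) / measure P A"
proof -
  note [measurable] = A(1)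
  have p: "0 < measure P A"
    using A B.emeasure_eq_measure[of A] by (simp add: zero_less_measure_iff)
  have "uniform_measure P A = density P (\<lambda>\<omega>. ennreal (indicator A \<omega> / measure P A))"
    unfolding uniform_measure_def B.emeasure_eq_measure using p
    by (intro density_cong AE_I2) (auto simp: indicator_def divide_ennreal ennreal_1[symmetric] simp del: ennreal_1)
  then have "(\<integral>\<omega>. Y \<omega> \<partial>uniform_measure P A) = (\<integral>\<omega>. (indicator A \<omega> / measure P A) *\<^sub>R Y \<omega> \<partial>P)"
    using p by (simp only:) (rule integral_density, auto)
  also have "\<dots> = (\<integral>\<omega>. (indicator A \<omega> * Y \<omega>) / measure P A \<partial>P)"
    by (intro Bochner_Integration.integral_cong) auto
  finally show ?thesis by simp
qed

text \<open>The characterising integrals over A are P(A) times the mean under P( . | A), hence P(A)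
  times \<open>y\<close>; null events contribute 0 to both sides.\<close>

lemma cond_exp_const:
  assumes T: "stopping_time F T" and Y [measurable]: "Y \<in> borel_measurable P"
    and K: "\<And>\<omega>. \<omega> \<in> space M \<Longrightarrow> \<bar>Y \<omega>\<bar> \<le> K"
    and y: "\<And>A. A \<in> sets (filt.pre_sigma T) \<Longrightarrow> emeasure P A \<noteq> 0 \<Longrightarrow> (\<integral>\<omega>. Y \<omega> \<partial>uniform_measure P A) = y"
  shows "AE \<omega> in P. real_cond_exp P (filt.pre_sigma T) Y \<omega> = y"
proof -
  interpret S: finite_measure_subalgebra P "filt.pre_sigma T" by (rule pre_finite_subalgebra[OF T])
  show ?thesis
  proof (rule S.real_cond_exp_charact)
    show "integrable P Y" using K by (intro B.integrable_const_bound[where B=K]) auto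
    show "integrable P (\<lambda>_. y)" by simp
    fix A assume A: "A \<in> sets (filt.pre_sigma T)"
    then have AP [measurable]: "A \<in> sets P" using pre_subalgebra[OF T] by (auto simp: subalgebra_def)
    show "(LINT \<omega>:A|P. Y \<omega>) = (LINT \<omega>:A|P. y)"
    proof (cases "emeasure P A = 0")
      case True
      then have "A \<in> null_sets P" using AP by auto
      then have "AE \<omega> in P. \<omega> \<notin> A" by (rule AE_not_in)
      then have "(LINT \<omega>:A|P. Y \<omega>) = (\<integral>\<omega>. 0 \<partial>P)" "(LINT \<omega>:A|P. y) = (\<integral>\<omega>. 0 \<partial>P)"
        unfolding set_lebesgue_integral_def by (intro integral_cong_AE; (simp; fail)?; (elim AE_mp, intro AE_I2, simp))+
      then show ?thesis by simp
    next
      case False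
      then have "measure P A \<noteq> 0" using B.emeasure_eq_measure[of A] by simp
      then show ?thesis
        using y[OF A False] integral_uniform[OF AP False Y] sets.sets_into_space[OF AP]
        by (simp add: Int_absorb2 set_lebesgue_integral_def field_simps)
    qed
  qed auto
qed

text \<open>\<open>c\<close> may be unbounded and \<open>X\<close> not integrable, so the factor is
  pulled out of the nonnegative conditional expectations of the two parts. Boundedness of
  \<open>Y\<close> keeps these finite, so the subtraction is meaningful.\<close>

lemma scaled_cond_exp:
  assumes T: "stopping_time F T" and Y [measurable]: "Y \<in> borel_measurable P"
    and K: "\<And>\<omega>. \<omega> \<in> space M \<Longrightarrow> \<bar>Y \<omega>\<bar> \<le> K"
    and y: "AE \<omega> in P. real_cond_exp P (filt.pre_sigma T) Y \<omega> = y"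
    and c: "c \<in> borel_measurable (filt.pre_sigma T)" and c0: "\<And>\<omega>. \<omega> \<in> space M \<Longrightarrow> 0 \<le> c \<omega>"
    and X: "\<And>\<omega>. \<omega> \<in> space M \<Longrightarrow> X \<omega> = c \<omega> * Y \<omega>"
  shows "cond_integrable P (filt.pre_sigma T) X"
    and "AE \<omega> in P. real_cond_exp P (filt.pre_sigma T) X \<omega> = c \<omega> * y"
proof -
  let ?S = "filt.pre_sigma T"
  interpret S: finite_measure_subalgebra P ?S by (rule pre_finite_subalgebra[OF T])
  note [measurable] = c
  have cP [measurable]: "c \<in> borel_measurable P" by (rule pre_measurable_P[OF T c])
  have Xm [measurable]: "X \<in> borel_measurable P"
    using X by (subst measurable_cong[of _ _ "\<lambda>\<omega>. c \<omega> * Y \<omega>"]) auto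
  \<comment> \<open>Positive homogeneity treats |x|, x and - x uniformly; under
    \<open>ennreal\<close> the last two give the positive and the negative part.\<close>
  have prod: "AE \<omega> in P. nn_cond_exp P ?S (\<lambda>\<omega>. ennreal (f (X \<omega>))) \<omega> = ennreal (c \<omega>) * nn_cond_exp P ?S (\<lambda>\<omega>. ennreal (f (Y \<omega>))) \<omega>"
    if f [measurable]: "f \<in> borel_measurable borel" and fh: "\<And>a b. 0 \<le> a \<Longrightarrow> f (a * b) = a * f b" for f :: "real \<Rightarrow> real"
  proof -
    have "AE \<omega> in P. nn_cond_exp P ?S (\<lambda>\<omega>. ennreal (f (X \<omega>))) \<omega> = nn_cond_exp P ?S (\<lambda>\<omega>. ennreal (c \<omega>) * ennreal (f (Y \<omega>))) \<omega>"
      using X c0 by (intro S.nn_cond_exp_cong AE_I2) (auto simp: fh ennreal_mult')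
    moreover have "AE \<omega> in P. ennreal (c \<omega>) * nn_cond_exp P ?S (\<lambda>\<omega>. ennreal (f (Y \<omega>))) \<omega> = nn_cond_exp P ?S (\<lambda>\<omega>. ennreal (c \<omega>) * ennreal (f (Y \<omega>))) \<omega>"
      by (intro S.nn_cond_exp_prod) auto
    ultimately show ?thesis by eventually_elim simp
  qed
  have bound: "AE \<omega> in P. nn_cond_exp P ?S (\<lambda>\<omega>. ennreal (f (Y \<omega>))) \<omega> \<le> ennreal K"
    if f [measurable]: "f \<in> borel_measurable borel" and fh: "\<And>a. f a \<le> \<bar>a\<bar>" for f :: "real \<Rightarrow> real"
  proof -
    have "AE \<omega> in P. nn_cond_exp P ?S (\<lambda>\<omega>. ennreal (f (Y \<omega>))) \<omega> \<le> nn_cond_exp P ?S (\<lambda>\<omega>. ennreal K) \<omega>"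
      using K by (intro S.nn_cond_exp_mono AE_I2) (auto intro!: ennreal_leI order_trans[OF fh])
    moreover have "AE \<omega> in P. ennreal K = nn_cond_exp P ?S (\<lambda>\<omega>. ennreal K) \<omega>"
      by (intro S.nn_cond_exp_F_meas) auto
    ultimately show ?thesis by eventually_elim simp
  qed
  have "AE \<omega> in P. nn_cond_exp P ?S (\<lambda>\<omega>. ennreal \<bar>X \<omega>\<bar>) \<omega> < \<infinity>"
  proof -
    have "AE \<omega> in P. nn_cond_exp P ?S (\<lambda>\<omega>. ennreal \<bar>X \<omega>\<bar>) \<omega> = ennreal (c \<omega>) * nn_cond_exp P ?S (\<lambda>\<omega>. ennreal \<bar>Y \<omega>\<bar>) \<omega>"
      by (rule prod) (auto simp: abs_mult)
    moreover have "AE \<omega> in P. nn_cond_exp P ?S (\<lambda>\<omega>. ennreal \<bar>Y \<omega>\<bar>) \<omega> \<le> ennreal K"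
      by (rule bound) auto
    ultimately show ?thesis
      by eventually_elim (auto simp: ennreal_mult_less_top intro: le_less_trans)
  qed
  then show "cond_integrable P ?S X" by (simp add: cond_integrable_def)
  have b: "AE \<omega> in P. nn_cond_exp P ?S (\<lambda>\<omega>. ennreal (Y \<omega>)) \<omega> \<le> ennreal K"
    "AE \<omega> in P. nn_cond_exp P ?S (\<lambda>\<omega>. ennreal (- Y \<omega>)) \<omega> \<le> ennreal K"
    using bound[of "\<lambda>x. x"] bound[of uminus] by auto
  have p: "AE \<omega> in P. nn_cond_exp P ?S (\<lambda>\<omega>. ennreal (X \<omega>)) \<omega> = ennreal (c \<omega>) * nn_cond_exp P ?S (\<lambda>\<omega>. ennreal (Y \<omega>)) \<omega>"
    "AE \<omega> in P. nn_cond_exp P ?S (\<lambda>\<omega>. ennreal (- X \<omega>)) \<omega> = ennreal (c \<omega>) * nn_cond_exp P ?S (\<lambda>\<omega>. ennreal (- Y \<omega>)) \<omega>"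
    using prod[of "\<lambda>x. x"] prod[of uminus] by auto
  show "AE \<omega> in P. real_cond_exp P ?S X \<omega> = c \<omega> * y"
    using b p y AE_space
  proof eventually_elim
    case (elim \<omega>)
    then have "0 \<le> c \<omega>" using c0 by simp
    then show ?case
      using elim by (simp add: real_cond_exp_def enn2real_mult right_diff_distrib[symmetric])
  qed
qed

lemma nn_cond_exp_le:
  assumes T: "stopping_time F T" and [measurable]: "X \<in> borel_measurable P" "c \<in> borel_measurable (filt.pre_sigma T)"
    and le: "\<And>\<omega>. \<omega> \<in> space M \<Longrightarrow> X \<omega> \<le> c \<omega>"
  shows "AE \<omega> in P. nn_cond_exp P (filt.pre_sigma T) X \<omega> \<le> c \<omega>"
proof -
  interpret S: finite_measure_subalgebra P "filt.pre_sigma T" by (rule pre_finite_subalgebra[OF T])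
  have [measurable]: "c \<in> borel_measurable P" by (rule pre_measurable_P[OF T]) measurable
  have "AE \<omega> in P. nn_cond_exp P (filt.pre_sigma T) X \<omega> \<le> nn_cond_exp P (filt.pre_sigma T) c \<omega>"
    using le by (intro S.nn_cond_exp_mono AE_I2) auto
  moreover have "AE \<omega> in P. c \<omega> = nn_cond_exp P (filt.pre_sigma T) c \<omega>"
    by (intro S.nn_cond_exp_F_meas) measurable
  ultimately show ?thesis by eventually_elim simp
qed

text \<open>The exit facts of \<open>brownian0\<close> in conditional form. Measurability and
  pathwise bounds come from the instance with the whole space as event, the constants from all
  instances through \<open>cond_exp_const\<close>.\<close>

lemma rescaled_exit_facts:
  assumes T: "stopping_time F T" and T0: "\<And>\<omega>. \<omega> \<in> space M \<Longrightarrow> 0 \<le> T \<omega>"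
    and g: "g \<in> borel_measurable (filt.pre_sigma T)" and g0: "\<And>\<omega>. \<omega> \<in> space M \<Longrightarrow> 0 < g \<omega>"
  defines "R \<equiv> rescaled T g"
  shows "exit_time R \<in> borel_measurable P"
    and "AE \<omega> in P. real_cond_exp P (filt.pre_sigma T) (exit_time R) \<omega> = 1"
    and "(\<lambda>\<omega>. R (exit_time R \<omega>) \<omega> $ j) \<in> borel_measurable P"
    and "\<And>\<omega>. \<omega> \<in> space M \<Longrightarrow> \<bar>R (exit_time R \<omega>) \<omega> $ j\<bar> \<le> sqrt (real CARD('d) * sphere_a CARD('d))"
    and "AE \<omega> in P. real_cond_exp P (filt.pre_sigma T) (\<lambda>\<omega>. (R (exit_time R \<omega>) \<omega> $ j) ^ 3) \<omega> = 0"
    and "AE \<omega> in P. real_cond_exp P (filt.pre_sigma T) (\<lambda>\<omega>. (R (exit_time R \<omega>) \<omega> $ j) ^ 4) \<omega> = 3 * sphere_r CARD('d)"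
    and "i \<noteq> k \<Longrightarrow> (\<lambda>\<omega>. LINT v:{0..exit_time R \<omega>}|lborel. R v \<omega> $ i * R v \<omega> $ k) \<in> borel_measurable P"
    and "\<And>\<omega>. i \<noteq> k \<Longrightarrow> \<omega> \<in> space M \<Longrightarrow>
      \<bar>LINT v:{0..exit_time R \<omega>}|lborel. R v \<omega> $ i * R v \<omega> $ k\<bar> \<le> real CARD('d) * (sphere_a CARD('d))\<^sup>2"
    and "i \<noteq> k \<Longrightarrow> AE \<omega> in P. real_cond_exp P (filt.pre_sigma T)
      (\<lambda>\<omega>. LINT v:{0..exit_time R \<omega>}|lborel. R v \<omega> $ i * R v \<omega> $ k) \<omega> = 0"
proof -
  let ?C = "sqrt (real CARD('d) * sphere_a CARD('d))"
  have br: "brownian0 (uniform_measure P A) (\<lambda>v. filt.pre_sigma (\<lambda>\<omega>. T \<omega> + g \<omega> * v)) R"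
    if "A \<in> sets (filt.pre_sigma T)" "emeasure P A \<noteq> 0" for A
    unfolding R_def by (rule rescaled_brownian[OF T T0 g g0 that])
  have top: "space P \<in> sets (filt.pre_sigma T)" "emeasure P (space P) \<noteq> 0"
    using sets.top[of "filt.pre_sigma T"] B.emeasure_space_1 by (auto simp: filt.space_pre_sigma)
  interpret b: brownian0 "uniform_measure P (space P)" "\<lambda>v. filt.pre_sigma (\<lambda>\<omega>. T \<omega> + g \<omega> * v)" R
    by (rule br[OF top])
  have mU: "f \<in> borel_measurable (uniform_measure P (space P)) \<longleftrightarrow> f \<in> borel_measurable P" for f :: "'a \<Rightarrow> 'c::topological_space"
    by (intro arg_cong2[where f="(\<in>)"] refl measurable_cong_sets) auto
  show e [measurable]: "exit_time R \<in> borel_measurable P"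
    using b.exit_time_measurable by (simp only: mU)
  show "AE \<omega> in P. real_cond_exp P (filt.pre_sigma T) (exit_time R) \<omega> = 1"
  proof (rule cond_exp_const[OF T e])
    show "\<bar>exit_time R \<omega>\<bar> \<le> sphere_a CARD('d)" for \<omega>
      using exit_time_nonneg[of R \<omega>] exit_time_le[of R \<omega>] by simp
    fix A assume "A \<in> sets (filt.pre_sigma T)" "emeasure P A \<noteq> 0"
    from brownian0.exit_time_mean[OF br[OF this]]
    show "(\<integral>\<omega>. exit_time R \<omega> \<partial>uniform_measure P A) = 1" by (simp add: has_bochner_integral_iff)
  qed
  have Rm: "(\<lambda>\<omega>. R (exit_time R \<omega>) \<omega>) \<in> borel_measurable P"
    using b.exit_value_measurable by (simp only: mU)
  then show Rj [measurable]: "(\<lambda>\<omega>. R (exit_time R \<omega>) \<omega> $ j) \<in> borel_measurable P" by (rule borel_measurable_vec_nth')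
  show Rb: "\<bar>R (exit_time R \<omega>) \<omega> $ j\<bar> \<le> ?C" if "\<omega> \<in> space M" for \<omega>
    using that exit_time_nonneg[of R \<omega>] by (intro b.coord_bound) auto
  show "AE \<omega> in P. real_cond_exp P (filt.pre_sigma T) (\<lambda>\<omega>. (R (exit_time R \<omega>) \<omega> $ j) ^ 3) \<omega> = 0"
  proof (rule cond_exp_const[OF T])
    show "\<bar>(R (exit_time R \<omega>) \<omega> $ j) ^ 3\<bar> \<le> ?C ^ 3" if "\<omega> \<in> space M" for \<omega>
      unfolding power_abs using Rb[OF that] by (intro power_mono) auto
  qed (use brownian0.exit_cube[OF br] in auto)
  show "AE \<omega> in P. real_cond_exp P (filt.pre_sigma T) (\<lambda>\<omega>. (R (exit_time R \<omega>) \<omega> $ j) ^ 4) \<omega> = 3 * sphere_r CARD('d)"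
  proof (rule cond_exp_const[OF T])
    show "\<bar>(R (exit_time R \<omega>) \<omega> $ j) ^ 4\<bar> \<le> ?C ^ 4" if "\<omega> \<in> space M" for \<omega>
      unfolding power_abs using Rb[OF that] by (intro power_mono) auto
  qed (use brownian0.exit_fourth[OF br] in auto)
  have cov: "(\<lambda>\<omega>. LINT v:{0..exit_time R \<omega>}|lborel. R v \<omega> $ i * R v \<omega> $ k) = b.exit_covariation i k"
    by (rule ext) (simp add: b.exit_covariation_def)
  assume ik: "i \<noteq> k"
  show Lm: "(\<lambda>\<omega>. LINT v:{0..exit_time R \<omega>}|lborel. R v \<omega> $ i * R v \<omega> $ k) \<in> borel_measurable P"
    unfolding cov using b.exit_covariation(1)[OF ik] by (simp only: mU)
  show Lb: "\<bar>LINT v:{0..exit_time R \<omega>}|lborel. R v \<omega> $ i * R v \<omega> $ k\<bar> \<le> real CARD('d) * (sphere_a CARD('d))\<^sup>2"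
    if "\<omega> \<in> space M" for \<omega>
    using b.exit_covariation(2)[OF ik, of \<omega>] that by (simp add: b.exit_covariation_def)
  show "AE \<omega> in P. real_cond_exp P (filt.pre_sigma T) (\<lambda>\<omega>. LINT v:{0..exit_time R \<omega>}|lborel. R v \<omega> $ i * R v \<omega> $ k) \<omega> = 0"
  proof (rule cond_exp_const[OF T Lm Lb])
    fix A assume A: "A \<in> sets (filt.pre_sigma T)" "emeasure P A \<noteq> 0"
    interpret bA: brownian0 "uniform_measure P A" "\<lambda>v. filt.pre_sigma (\<lambda>\<omega>. T \<omega> + g \<omega> * v)" R
      by (rule br[OF A])
    show "(\<integral>\<omega>. (LINT v:{0..exit_time R \<omega>}|lborel. R v \<omega> $ i * R v \<omega> $ k) \<partial>uniform_measure P A) = 0"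
      using bA.exit_covariation(3)[OF ik] by (simp only: bA.exit_covariation_def[abs_def])
  qed
qed

text \<open>Wald's identity in the form needed for sums of scales: a weight known at
  \<open>T\<close> may be multiplied by the duration without changing the expectation, even if that
  expectation is infinite.\<close>

lemma exit_time_weighted_mean:
  assumes T: "stopping_time F T" and T0: "\<And>\<omega>. \<omega> \<in> space M \<Longrightarrow> 0 \<le> T \<omega>"
    and g: "g \<in> borel_measurable (filt.pre_sigma T)" and g0: "\<And>\<omega>. \<omega> \<in> space M \<Longrightarrow> 0 < g \<omega>"
    and H: "H \<in> borel_measurable (filt.pre_sigma T)"
  shows "(\<integral>\<^sup>+\<omega>. H \<omega> * ennreal (exit_time (rescaled T g) \<omega>) \<partial>P) = (\<integral>\<^sup>+\<omega>. H \<omega> \<partial>P)"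
proof -
  interpret S: finite_measure_subalgebra P "filt.pre_sigma T" by (rule pre_finite_subalgebra[OF T])
  let ?e = "exit_time (rescaled T g)"
  have [measurable]: "?e \<in> borel_measurable P" using T0 g0 by (intro rescaled_exit_facts(1) T g) auto
  have e0: "0 \<le> ?e \<omega>" for \<omega> by (rule exit_time_nonneg)
  have "AE \<omega> in P. nn_cond_exp P (filt.pre_sigma T) (\<lambda>\<omega>. ennreal (?e \<omega>)) \<omega> \<le> ennreal (sphere_a CARD('d))"
    using exit_time_le[of "rescaled T g"] by (intro nn_cond_exp_le[OF T]) (auto intro!: ennreal_leI)
  moreover have "AE \<omega> in P. nn_cond_exp P (filt.pre_sigma T) (\<lambda>\<omega>. ennreal (- ?e \<omega>)) \<omega> \<le> 0"
    using e0 by (intro nn_cond_exp_le[OF T]) (auto simp: ennreal_neg)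
  moreover have "AE \<omega> in P. real_cond_exp P (filt.pre_sigma T) ?e \<omega> = 1"
    using T0 g0 by (intro rescaled_exit_facts(2) T g) auto
  ultimately have ae: "AE \<omega> in P. nn_cond_exp P (filt.pre_sigma T) (\<lambda>\<omega>. ennreal (?e \<omega>)) \<omega> = 1"
  proof eventually_elim
    case (elim \<omega>)
    let ?x = "nn_cond_exp P (filt.pre_sigma T) (\<lambda>\<omega>. ennreal (?e \<omega>)) \<omega>"
    have "enn2real ?x = 1" using elim by (simp add: real_cond_exp_def)
    moreover have "?x < top" using elim(1) by (auto intro: le_less_trans)
    ultimately show ?case by (metis ennreal_1 ennreal_enn2real)
  qed
  have "(\<integral>\<^sup>+\<omega>. H \<omega> * ennreal (?e \<omega>) \<partial>P) = (\<integral>\<^sup>+\<omega>. H \<omega> * nn_cond_exp P (filt.pre_sigma T) (\<lambda>\<omega>. ennreal (?e \<omega>)) \<omega> \<partial>P)"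
    using H by (intro S.nn_cond_exp_intg[symmetric]) auto
  also have "\<dots> = (\<integral>\<^sup>+\<omega>. H \<omega> \<partial>P)"
    using ae by (intro nn_integral_cong_AE) (elim AE_mp, intro AE_I2, simp)
  finally show ?thesis .
qed

end

subsection \<open>The moving sphere scheme\<close>

lemma positive_at_rational:
  fixes f :: "real \<Rightarrow> real"
  assumes c: "continuous_on {a<..<b} f" and s: "s \<in> {a<..<b}" "0 < f s"
  shows "\<exists>v\<in>\<rat> \<inter> {a<..<b}. 0 < f v"
proof -
  have "open (f -` {0<..} \<inter> {a<..<b})"
    using c by (simp add: continuous_on_open_vimage)
  then obtain e where e: "0 < e" "ball s e \<subseteq> f -` {0<..} \<inter> {a<..<b}"
    using s unfolding open_contains_ball by (metis (no_types, lifting) IntI greaterThan_iff vimageI)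
  obtain u where "u \<in> \<rat>" "s < u" "u < s + e" using Rats_dense_in_real[of s "s + e"] e by auto
  moreover from this have "u \<in> f -` {0<..} \<inter> {a<..<b}"
    by (intro subsetD[OF e(2)]) (auto simp: dist_real_def)
  ultimately show ?thesis by auto
qed

lemma sphere_psi_borel [measurable]: "sphere_psi d \<in> borel_measurable borel"
  unfolding sphere_psi_def[abs_def] by measurable

context std_bm
begin

text \<open>The substitution s = T + g v is increasing and continuous, so it commutes with the
  infimum and carries one exceedance set onto the other.\<close>

lemma next_time_eq:
  assumes g: "0 < g \<omega>"
  shows "Inf {s. T \<omega> < s \<and> g \<omega> * sphere_psi CARD('d) ((s - T \<omega>) / g \<omega>) < (norm (W s \<omega> - W (T \<omega>) \<omega>))\<^sup>2} =
    T \<omega> + g \<omega> * exit_time (rescaled T g) \<omega>"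
proof -
  let ?E = "{v. 0 < v \<and> sphere_psi CARD('d) v < (norm (rescaled T g v \<omega>))\<^sup>2}"
  let ?f = "\<lambda>v. T \<omega> + g \<omega> * v"
  have nrm: "(norm (rescaled T g v \<omega>))\<^sup>2 = (norm (W (?f v) \<omega> - W (T \<omega>) \<omega>))\<^sup>2 / g \<omega>" for v
    using g by (simp add: rescaled_def power_mult_distrib power_divide)
  have iff: "sphere_psi CARD('d) v < (norm (rescaled T g v \<omega>))\<^sup>2 \<longleftrightarrow>
      g \<omega> * sphere_psi CARD('d) v < (norm (W (?f v) \<omega> - W (T \<omega>) \<omega>))\<^sup>2" for v
    unfolding nrm using g by (simp add: pos_less_divide_eq mult.commute)
  have "{s. T \<omega> < s \<and> g \<omega> * sphere_psi CARD('d) ((s - T \<omega>) / g \<omega>) < (norm (W s \<omega> - W (T \<omega>) \<omega>))\<^sup>2} = ?f ` ?E"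
  proof (intro equalityI subsetI)
    fix s assume "s \<in> {s. T \<omega> < s \<and> g \<omega> * sphere_psi CARD('d) ((s - T \<omega>) / g \<omega>) < (norm (W s \<omega> - W (T \<omega>) \<omega>))\<^sup>2}"
    then show "s \<in> ?f ` ?E"
      using g by (intro image_eqI[of _ _ "(s - T \<omega>) / g \<omega>"]) (auto simp: iff)
  qed (use g in \<open>auto simp: iff\<close>)
  moreover have "?f (Inf ?E) = (INF v\<in>?E. ?f v)"
    using g by (intro continuous_at_Inf_mono exit_set) (auto intro!: monoI continuous_intros)
  ultimately show ?thesis by (simp add: exit_time_def)
qed

text \<open>On {T < v} everything known at \<open>T\<close> is known at time \<open>v\<close>; the
  constant \<open>c\<close> fills the rest so that the function is defined everywhere.\<close>

lemma before_measurable: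
  assumes T: "stopping_time F T" and f: "f \<in> measurable (filt.pre_sigma T) N" and c: "c \<in> space N"
  shows "(\<lambda>\<omega>. if T \<omega> < v then f \<omega> else c) \<in> measurable (F v) N"
proof (rule measurableI)
  fix E assume E: "E \<in> sets N"
  have less: "{\<omega> \<in> space M. T \<omega> < v} \<in> sets (F v)"
    using filt.stopping_time_less_const[OF T, of v] by (simp add: pred_def)
  have "{\<omega> \<in> f -` E \<inter> space M. T \<omega> \<le> v} \<in> sets (F v)"
    using filt.sets_pre_sigmaD[OF T measurable_sets[OF f E], of v] by (simp add: filt.space_pre_sigma)
  then have "{\<omega> \<in> f -` E \<inter> space M. T \<omega> \<le> v} \<inter> {\<omega> \<in> space M. T \<omega> < v} \<union>
      (if c \<in> E then space M - {\<omega> \<in> space M. T \<omega> < v} else {}) \<in> sets (F v)"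
    using less sets.compl_sets[OF less] by auto
  also have "{\<omega> \<in> f -` E \<inter> space M. T \<omega> \<le> v} \<inter> {\<omega> \<in> space M. T \<omega> < v} \<union>
      (if c \<in> E then space M - {\<omega> \<in> space M. T \<omega> < v} else {}) =
      (\<lambda>\<omega>. if T \<omega> < v then f \<omega> else c) -` E \<inter> space (F v)"
    by (auto split: if_splits)
  finally show "(\<lambda>\<omega>. if T \<omega> < v then f \<omega> else c) -` E \<inter> space (F v) \<in> sets (F v)" .
qed (use c measurable_space[OF f] in \<open>auto simp: filt.space_pre_sigma\<close>)

text \<open>Being before q means exceeding the sphere at some rational time v with T < v < q, by
  continuity. Each such event lies in F(v), and \<open>stopping_timeI_less\<close> closes the gap
  between < and <=.\<close>

lemma next_time_stopping:
  assumes T: "stopping_time F T" and T0: "\<And>\<omega>. \<omega> \<in> space M \<Longrightarrow> 0 \<le> T \<omega>"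
    and g: "g \<in> borel_measurable (filt.pre_sigma T)" and g0: "\<And>\<omega>. \<omega> \<in> space M \<Longrightarrow> 0 < g \<omega>"
  shows "stopping_time F (\<lambda>\<omega>. T \<omega> + g \<omega> * exit_time (rescaled T g) \<omega>)"
proof (rule stopping_timeI_less)
  fix \<omega> assume "\<omega> \<in> space M"
  then show "0 \<le> T \<omega> + g \<omega> * exit_time (rescaled T g) \<omega>"
    using T0[of \<omega>] g0[of \<omega>] exit_time_nonneg[of "rescaled T g" \<omega>] by (auto intro: add_nonneg_nonneg)
next
  fix q :: real
  let ?f = "\<lambda>\<omega> s. (norm (W s \<omega> - W (T \<omega>) \<omega>))\<^sup>2 - g \<omega> * sphere_psi CARD('d) ((s - T \<omega>) / g \<omega>)"
  have eq: "T \<omega> + g \<omega> * exit_time (rescaled T g) \<omega> < q \<longleftrightarrow> (\<exists>v\<in>\<rat> \<inter> {0<..<q}. T \<omega> < v \<and> 0 < ?f \<omega> v)"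
    if \<omega>: "\<omega> \<in> space M" for \<omega>
  proof -
    let ?E = "{s. T \<omega> < s \<and> g \<omega> * sphere_psi CARD('d) ((s - T \<omega>) / g \<omega>) < (norm (W s \<omega> - W (T \<omega>) \<omega>))\<^sup>2}"
    have "T \<omega> + g \<omega> * (sphere_a CARD('d) + 1) \<in> ?E"
      using g0[OF \<omega>] sphere_a_pos[of "CARD('d)"] sphere_psi_neg[of "CARD('d)" "sphere_a CARD('d) + 1"]
      by (auto intro!: add_pos_pos less_le_trans[OF mult_pos_neg])
    then have ne: "?E \<noteq> {}" by blast
    have "bdd_below ?E" by (intro bdd_belowI[of _ "T \<omega>"]) auto
    then have "T \<omega> + g \<omega> * exit_time (rescaled T g) \<omega> < q \<longleftrightarrow> (\<exists>s\<in>?E. s < q)"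
      using cInf_less_iff[OF ne] next_time_eq[where g=g and T=T, OF g0[OF \<omega>]] by simp
    also have "\<dots> \<longleftrightarrow> (\<exists>v\<in>\<rat> \<inter> {T \<omega><..<q}. 0 < ?f \<omega> v)"
    proof
      assume "\<exists>s\<in>?E. s < q"
      then obtain s where s: "s \<in> {T \<omega><..<q}" "0 < ?f \<omega> s" by auto
      show "\<exists>v\<in>\<rat> \<inter> {T \<omega><..<q}. 0 < ?f \<omega> v"
      proof (rule positive_at_rational[where f="?f \<omega>", OF _ s])
        have "continuous_on {T \<omega><..<q} (\<lambda>s. W s \<omega>)"
          using T0[OF \<omega>] by (intro continuous_on_subset[OF W_cont[OF \<omega>]]) auto
        then show "continuous_on {T \<omega><..<q} (?f \<omega>)"
          unfolding sphere_psi_def using g0[OF \<omega>] sphere_a_pos[of "CARD('d)"]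
          by (auto intro!: continuous_intros)
      qed
    qed auto
    finally show ?thesis using T0[OF \<omega>] by auto
  qed
  have Wm: "(\<lambda>\<omega>. W (T \<omega>) \<omega>) \<in> borel_measurable (filt.pre_sigma T)"
    by (rule stopped_measurable[OF T T0]) (auto intro: W_adapted W_cont)
  have Tm: "T \<in> borel_measurable (filt.pre_sigma T)"
    by (rule stopped_measurable[OF T T0, where X="\<lambda>r \<omega>. r"]) auto
  have "{\<omega> \<in> space M. T \<omega> + g \<omega> * exit_time (rescaled T g) \<omega> < q} =
     (\<Union>v\<in>\<rat> \<inter> {0<..<q}. {\<omega> \<in> space (F v). T \<omega> < v \<and> 0 < ?f \<omega> v})"
    using eq by auto
  also have "\<dots> \<in> sets (F q)"
  proof (rule sets.countable_UN'')
    show "countable (\<rat> \<inter> {0<..<q})" by (intro countable_Int1 countable_rat)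
    fix v assume v: "v \<in> \<rat> \<inter> {0<..<q}"
    \<comment> \<open>\<open>T\<close>, \<open>g\<close> and the position at \<open>T\<close> need
      not be measurable for F(v) themselves; these versions are, and they agree with them on {T <
      v}.\<close>
    define T' where "T' \<omega> = (if T \<omega> < v then T \<omega> else 0)" for \<omega>
    define g' where "g' \<omega> = (if T \<omega> < v then g \<omega> else 1)" for \<omega>
    define Z where "Z \<omega> = (if T \<omega> < v then W (T \<omega>) \<omega> else 0)" for \<omega>
    have [measurable]: "T' \<in> borel_measurable (F v)" "g' \<in> borel_measurable (F v)" "Z \<in> borel_measurable (F v)"
      unfolding T'_def g'_def Z_def by (auto intro!: before_measurable T g Tm Wm)
    have [measurable]: "W v \<in> borel_measurable (F v)" using v by (intro W_adapted) auto
    have [measurable]: "Measurable.pred (F v) (\<lambda>\<omega>. T \<omega> < v)"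
      using filt.stopping_time_less_const[OF T, of v] by simp
    have "{\<omega> \<in> space (F v). T \<omega> < v \<and> 0 < ?f \<omega> v} =
        {\<omega> \<in> space (F v). T \<omega> < v \<and> 0 < (norm (W v \<omega> - Z \<omega>))\<^sup>2 - g' \<omega> * sphere_psi CARD('d) ((v - T' \<omega>) / g' \<omega>)}"
      by (auto simp: T'_def g'_def Z_def)
    also have "\<dots> \<in> sets (F v)" by measurable
    finally show "{\<omega> \<in> space (F v). T \<omega> < v \<and> 0 < ?f \<omega> v} \<in> sets (F q)"
      using aug_mono[of v q] v by auto
  qed
  finally show "{\<omega> \<in> space M. T \<omega> + g \<omega> * exit_time (rescaled T g) \<omega> < q} \<in> sets (F q)" .
qed

end

locale moving = std_bm M W for M :: "'a measure" and W :: "real \<Rightarrow> 'a \<Rightarrow> real ^ 'd::finite" +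
  fixes G :: "real \<Rightarrow> 'a \<Rightarrow> real" and t :: real
  assumes t_pos: "0 < t"
    and G_pos: "\<And>s \<omega>. s \<in> {0..t} \<Longrightarrow> \<omega> \<in> space M \<Longrightarrow> 0 < G s \<omega>"
    and G_cont: "\<And>\<omega>. \<omega> \<in> space M \<Longrightarrow> continuous_on {0..t} (\<lambda>s. G s \<omega>)"
    and G_adapted: "\<And>s. s \<in> {0..t} \<Longrightarrow> G s \<in> borel_measurable (F s)"
begin

lemma stopped_G:
  assumes T: "stopping_time F T" and T0: "\<And>\<omega>. \<omega> \<in> space M \<Longrightarrow> 0 \<le> T \<omega>"
  shows "(\<lambda>\<omega>. G (min (T \<omega>) t) \<omega>) \<in> borel_measurable (filt.pre_sigma T)"
proof (rule stopped_measurable[OF T T0, where X="\<lambda>r \<omega>. G (min r t) \<omega>"])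
  fix r :: real assume r: "0 \<le> r"
  show "(\<lambda>\<omega>. G (min r t) \<omega>) \<in> borel_measurable (F r)"
    using r t_pos by (intro B.F_mono[OF _ _ G_adapted]) auto
next
  fix \<omega> assume "\<omega> \<in> space M"
  then show "continuous_on {0..} (\<lambda>r. G (min r t) \<omega>)"
    using t_pos by (intro continuous_on_compose2[OF G_cont]) (auto intro!: continuous_intros)
qed

lemma scale_pos: "1 \<le> n \<Longrightarrow> 0 \<le> u \<Longrightarrow> \<omega> \<in> space M \<Longrightarrow> 0 < sphere_scale G t n u \<omega>"
  using G_pos[of "min u t" \<omega>] t_pos by (auto simp: sphere_scale_def)

abbreviation \<pi> :: "nat \<Rightarrow> nat \<Rightarrow> 'a \<Rightarrow> real" where "\<pi> \<equiv> moving_sphere W G t"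

definition scale :: "nat \<Rightarrow> nat \<Rightarrow> 'a \<Rightarrow> real" where "scale n m \<omega> = sphere_scale G t n (\<pi> n m \<omega>) \<omega>"

text \<open>The length of a step in units of its scale. Unlike the step it is bounded by
  \<open>sphere_a\<close>, uniformly in all indices, and its conditional mean is 1.\<close>

definition dur :: "nat \<Rightarrow> nat \<Rightarrow> 'a \<Rightarrow> real" where "dur n m = exit_time (rescaled (\<pi> n m) (scale n m))"

lemma dur_nonneg: "0 \<le> dur n m \<omega>" and dur_le: "dur n m \<omega> \<le> sphere_a CARD('d)"
  unfolding dur_def by (rule exit_time_nonneg exit_time_le)+

lemma next_sphere:
  assumes "1 \<le> n" "\<omega> \<in> space M" "0 \<le> \<pi> n m \<omega>"
  shows "\<pi> n (Suc m) \<omega> = \<pi> n m \<omega> + scale n m \<omega> * dur n m \<omega>"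
  unfolding dur_def
  using next_time_eq[where g="scale n m" and \<omega>=\<omega> and T="\<pi> n m"] scale_pos[OF assms(1,3,2)] by (simp add: scale_def Let_def)

lemma sphere_stopping:
  assumes n: "1 \<le> n"
  shows "stopping_time F (\<pi> n m) \<and> (\<forall>\<omega>\<in>space M. 0 \<le> \<pi> n m \<omega>)"
proof (induction m)
  case 0
  then show ?case by (auto intro: stopping_time_const)
next
  case (Suc m)
  then have s: "stopping_time F (\<pi> n m)" and p: "\<And>\<omega>. \<omega> \<in> space M \<Longrightarrow> 0 \<le> \<pi> n m \<omega>" by auto
  have g: "scale n m \<in> borel_measurable (filt.pre_sigma (\<pi> n m))"
    unfolding scale_def sphere_scale_def using stopped_G[OF s p] by measurable
  have g0: "0 < scale n m \<omega>" if "\<omega> \<in> space M" for \<omega>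
    using scale_pos[OF n p that] that by (simp add: scale_def)
  have "stopping_time F (\<pi> n (Suc m)) \<longleftrightarrow> stopping_time F (\<lambda>\<omega>. \<pi> n m \<omega> + scale n m \<omega> * dur n m \<omega>)"
    by (rule stopping_time_cong) (simp add: next_sphere[OF n] p del: moving_sphere.simps)
  moreover have "stopping_time F (\<lambda>\<omega>. \<pi> n m \<omega> + scale n m \<omega> * dur n m \<omega>)"
    unfolding dur_def by (rule next_time_stopping[OF s p g g0])
  moreover have "0 \<le> \<pi> n (Suc m) \<omega>" if "\<omega> \<in> space M" for \<omega>
    using next_sphere[OF n that p[OF that]] p[OF that] g0[OF that] dur_nonneg[of n m \<omega>] by simp
  ultimately show ?case by blast
qed

context
  fixes n :: nat
  assumes n: "1 \<le> n"
begin

lemma sphere_stopping_time: "stopping_time F (\<pi> n m)" and sphere_nonneg: "\<omega> \<in> space M \<Longrightarrow> 0 \<le> \<pi> n m \<omega>"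
  using sphere_stopping[OF n] by auto

lemma scale_measurable: "scale n m \<in> borel_measurable (filt.pre_sigma (\<pi> n m))"
  unfolding scale_def sphere_scale_def using stopped_G[OF sphere_stopping_time sphere_nonneg] by measurable

lemma scale_gt_0: "\<omega> \<in> space M \<Longrightarrow> 0 < scale n m \<omega>"
  using scale_pos[OF n sphere_nonneg] by (simp add: scale_def)

lemma sphere_Suc: "\<omega> \<in> space M \<Longrightarrow> \<pi> n (Suc m) \<omega> = \<pi> n m \<omega> + scale n m \<omega> * dur n m \<omega>"
  using next_sphere[OF n _ sphere_nonneg] .

lemma sphere_step: "\<omega> \<in> space M \<Longrightarrow> step (\<pi> n) m \<omega> = scale n m \<omega> * dur n m \<omega>"
  by (simp add: step_def sphere_Suc del: moving_sphere.simps)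

lemma sphere_incseq: "\<omega> \<in> space M \<Longrightarrow> incseq (\<lambda>m. \<pi> n m \<omega>)"
  using scale_gt_0 dur_nonneg by (intro incseq_SucI) (simp add: sphere_Suc less_imp_le del: moving_sphere.simps)

end

text \<open>For q > t the event is the whole space because t itself belongs to the set. Otherwise
  only times before q, hence inside [0, t], matter, and continuity reduces them to rational
  ones.\<close>

lemma level_exit_stopping: "stopping_time F (level_exit G t K)"
proof (rule stopping_timeI_less)
  fix \<omega>
  show "0 \<le> level_exit G t K \<omega>"
    unfolding level_exit_def using t_pos by (intro cInf_greatest) auto
next
  fix q :: real
  let ?bad = "\<lambda>s \<omega>. G s \<omega> > real K \<or> G s \<omega> < 1 / real K"
  have less: "level_exit G t K \<omega> < q \<longleftrightarrow> t < q \<or> (\<exists>s. 0 < s \<and> s \<le> t \<and> ?bad s \<omega> \<and> s < q)" for \<omega>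
    unfolding level_exit_def
    by (subst cInf_less_iff) (use t_pos in \<open>auto intro!: bdd_belowI[of _ 0]\<close>)
  show "{\<omega> \<in> space M. level_exit G t K \<omega> < q} \<in> sets (F q)"
  proof (cases "t < q")
    case True
    then have "{\<omega> \<in> space M. level_exit G t K \<omega> < q} = space (F q)"
      by (auto simp: less)
    then show ?thesis by (simp only: sets.top)
  next
    case False
    have eq: "level_exit G t K \<omega> < q \<longleftrightarrow> (\<exists>v\<in>\<rat> \<inter> {0<..<q}. ?bad v \<omega>)" if \<omega>: "\<omega> \<in> space M" for \<omega>
    proof
      assume "level_exit G t K \<omega> < q"
      then obtain s where s: "s \<in> {0<..<q}" "0 < max (G s \<omega> - real K) (1 / real K - G s \<omega>)"
        unfolding less using False by auto
      have "continuous_on {0<..<q} (\<lambda>s. G s \<omega>)"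
        using False by (intro continuous_on_subset[OF G_cont[OF \<omega>]]) auto
      then have "continuous_on {0<..<q} (\<lambda>s. max (G s \<omega> - real K) (1 / real K - G s \<omega>))"
        by (auto intro!: continuous_intros)
      from positive_at_rational[OF this s] show "\<exists>v\<in>\<rat> \<inter> {0<..<q}. ?bad v \<omega>"
        by (auto simp: less_max_iff_disj)
    next
      assume "\<exists>v\<in>\<rat> \<inter> {0<..<q}. ?bad v \<omega>"
      then show "level_exit G t K \<omega> < q"
        unfolding less using False by auto
    qed
    have "{\<omega> \<in> space M. level_exit G t K \<omega> < q} = (\<Union>v\<in>\<rat> \<inter> {0<..<q}. {\<omega> \<in> space (F v). ?bad v \<omega>})"
      using eq by auto
    also have "\<dots> \<in> sets (F q)"
    proof (rule sets.countable_UN'')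
      show "countable (\<rat> \<inter> {0<..<q})" by (intro countable_Int1 countable_rat)
      fix v assume v: "v \<in> \<rat> \<inter> {0<..<q}"
      then have [measurable]: "G v \<in> borel_measurable (F v)" using False by (intro G_adapted) auto
      have "{\<omega> \<in> space (F v). ?bad v \<omega>} \<in> sets (F v)" by measurable
      then show "{\<omega> \<in> space (F v). ?bad v \<omega>} \<in> sets (F q)" using aug_mono[of v q] v by auto
    qed
    finally show ?thesis .
  qed
qed

lemma scale_eq: "scale n m \<omega> = 1 / (real n * G (min (\<pi> n m \<omega>) t) \<omega>)"
  by (simp add: scale_def sphere_scale_def)

context
  fixes n :: nat
  assumes n: "1 \<le> n"
begin

lemma W_step_eq:
  assumes \<omega>: "\<omega> \<in> space M"
  shows "W_step W (\<pi> n) m j \<omega> = sqrt (scale n m \<omega>) * (rescaled (\<pi> n m) (scale n m) (dur n m \<omega>) \<omega> $ j)"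
  using scale_gt_0[OF n \<omega>, of m]
  by (simp add: W_step_def sphere_Suc[OF n \<omega>] rescaled_def del: moving_sphere.simps)

text \<open>The substitution s = p + g v gives one factor g from the time element and a factor sqrt
  g from each of the two coordinates.\<close>

lemma L_step_eq:
  assumes \<omega>: "\<omega> \<in> space M"
  shows "L_step W (\<pi> n) m i j \<omega> = (scale n m \<omega>)\<^sup>2 *
    (LINT v:{0..dur n m \<omega>}|lborel. rescaled (\<pi> n m) (scale n m) v \<omega> $ i * rescaled (\<pi> n m) (scale n m) v \<omega> $ j)"
proof -
  let ?g = "scale n m \<omega>" and ?p = "\<pi> n m \<omega>" and ?d = "dur n m \<omega>" and ?R = "\<lambda>v. rescaled (\<pi> n m) (scale n m) v \<omega>"
  have g: "0 < ?g" by (rule scale_gt_0[OF n \<omega>])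
  have "L_step W (\<pi> n) m i j \<omega> =
      ?g * (\<integral>v. indicator {?p..?p + ?g * ?d} (?p + ?g * v) * ((W (?p + ?g * v) \<omega> $ i - W ?p \<omega> $ i) * (W (?p + ?g * v) \<omega> $ j - W ?p \<omega> $ j)) \<partial>lborel)"
    using g lborel_integral_real_affine[of ?g "\<lambda>s. indicator {?p..?p + ?g * ?d} s * ((W s \<omega> $ i - W ?p \<omega> $ i) * (W s \<omega> $ j - W ?p \<omega> $ j))" ?p]
    by (simp add: L_step_def set_lebesgue_integral_def sphere_Suc[OF n \<omega>] del: moving_sphere.simps)
  also have "(\<lambda>v. indicator {?p..?p + ?g * ?d} (?p + ?g * v) * ((W (?p + ?g * v) \<omega> $ i - W ?p \<omega> $ i) * (W (?p + ?g * v) \<omega> $ j - W ?p \<omega> $ j))) =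
      (\<lambda>v. ?g * (indicator {0..?d} v * (?R v $ i * ?R v $ j)))"
    using g by (auto simp: fun_eq_iff indicator_def rescaled_def zero_le_mult_iff)
  finally show ?thesis
    by (simp add: set_lebesgue_integral_def power2_eq_square)
qed

lemma dur_measurable: "dur n m \<in> borel_measurable P"
  unfolding dur_def using sphere_nonneg[OF n] scale_gt_0[OF n]
  by (intro rescaled_exit_facts(1) sphere_stopping_time[OF n] scale_measurable[OF n]) auto

lemma step_cond:
  "cond_integrable P (filt.pre_sigma (\<pi> n m)) (step (\<pi> n) m)"
  "AE \<omega> in P. real_cond_exp P (filt.pre_sigma (\<pi> n m)) (step (\<pi> n) m) \<omega> = scale n m \<omega>"
proof -
  have e: "AE \<omega> in P. real_cond_exp P (filt.pre_sigma (\<pi> n m)) (dur n m) \<omega> = 1"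
    unfolding dur_def using sphere_nonneg[OF n] scale_gt_0[OF n]
    by (intro rescaled_exit_facts(2) sphere_stopping_time[OF n] scale_measurable[OF n]) auto
  have b: "\<bar>dur n m \<omega>\<bar> \<le> sphere_a CARD('d)" for \<omega> using dur_nonneg[of n m \<omega>] dur_le[of n m \<omega>] by simp
  note * = scaled_cond_exp[OF sphere_stopping_time[OF n] dur_measurable b e scale_measurable[OF n] less_imp_le[OF scale_gt_0[OF n]] sphere_step[OF n]]
  show "cond_integrable P (filt.pre_sigma (\<pi> n m)) (step (\<pi> n) m)" by (rule *(1))
  show "AE \<omega> in P. real_cond_exp P (filt.pre_sigma (\<pi> n m)) (step (\<pi> n) m) \<omega> = scale n m \<omega>"
    using *(2) by simp
qed

lemma step_rate_eq: "AE \<omega> in P. step_rate P F n (\<pi> n) m \<omega> = G (min (\<pi> n m \<omega>) t) \<omega>"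
  using step_cond(2)[of m]
  by eventually_elim (use n in \<open>simp add: step_rate_def scale_eq\<close>)

lemma power_bound: "\<bar>x\<bar> \<le> c \<Longrightarrow> \<bar>x ^ k\<bar> \<le> c ^ k" for x c :: real
  unfolding power_abs by (intro power_mono) auto

lemma cube_cond:
  "cond_integrable P (filt.pre_sigma (\<pi> n m)) (\<lambda>\<omega>. W_step W (\<pi> n) m j \<omega> ^ 3)"
  "AE \<omega> in P. real_cond_exp P (filt.pre_sigma (\<pi> n m)) (\<lambda>\<omega>. W_step W (\<pi> n) m j \<omega> ^ 3) \<omega> = 0"
  and fourth_cond:
  "cond_integrable P (filt.pre_sigma (\<pi> n m)) (\<lambda>\<omega>. \<bar>W_step W (\<pi> n) m j \<omega>\<bar> ^ 4)"
  "AE \<omega> in P. real_cond_exp P (filt.pre_sigma (\<pi> n m)) (\<lambda>\<omega>. \<bar>W_step W (\<pi> n) m j \<omega>\<bar> ^ 4) \<omega> =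
    (scale n m \<omega>)\<^sup>2 * (3 * sphere_r CARD('d))"
proof -
  let ?S = "filt.pre_sigma (\<pi> n m)"
  let ?Y = "\<lambda>\<omega>. rescaled (\<pi> n m) (scale n m) (dur n m \<omega>) \<omega> $ j"
  have Y [measurable]: "?Y \<in> borel_measurable P"
    unfolding dur_def using sphere_nonneg[OF n] scale_gt_0[OF n]
    by (intro rescaled_exit_facts(3) sphere_stopping_time[OF n] scale_measurable[OF n]) auto
  have b: "\<bar>?Y \<omega>\<bar> \<le> sqrt (real CARD('d) * sphere_a CARD('d))" if "\<omega> \<in> space M" for \<omega>
    unfolding dur_def using sphere_nonneg[OF n] scale_gt_0[OF n] that
    by (intro rescaled_exit_facts(4) sphere_stopping_time[OF n] scale_measurable[OF n]) auto
  have e3: "AE \<omega> in P. real_cond_exp P ?S (\<lambda>\<omega>. ?Y \<omega> ^ 3) \<omega> = 0"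
    unfolding dur_def using sphere_nonneg[OF n] scale_gt_0[OF n]
    by (intro rescaled_exit_facts(5) sphere_stopping_time[OF n] scale_measurable[OF n]) auto
  have e4: "AE \<omega> in P. real_cond_exp P ?S (\<lambda>\<omega>. ?Y \<omega> ^ 4) \<omega> = 3 * sphere_r CARD('d)"
    unfolding dur_def using sphere_nonneg[OF n] scale_gt_0[OF n]
    by (intro rescaled_exit_facts(6) sphere_stopping_time[OF n] scale_measurable[OF n]) auto
  note [measurable] = scale_measurable[OF n, of m]
  have m3: "(\<lambda>\<omega>. ?Y \<omega> ^ 3) \<in> borel_measurable P" "(\<lambda>\<omega>. sqrt (scale n m \<omega>) ^ 3) \<in> borel_measurable ?S"
    and m4: "(\<lambda>\<omega>. ?Y \<omega> ^ 4) \<in> borel_measurable P" "(\<lambda>\<omega>. (scale n m \<omega>)\<^sup>2) \<in> borel_measurable ?S"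
    by measurable
  have p: "0 \<le> sqrt (scale n m \<omega>) ^ 3" if "\<omega> \<in> space M" for \<omega> using scale_gt_0[OF n that, of m] by simp
  have x3: "W_step W (\<pi> n) m j \<omega> ^ 3 = sqrt (scale n m \<omega>) ^ 3 * ?Y \<omega> ^ 3" if "\<omega> \<in> space M" for \<omega>
    by (simp add: W_step_eq[OF that] power_mult_distrib)
  have x4: "\<bar>W_step W (\<pi> n) m j \<omega>\<bar> ^ 4 = (scale n m \<omega>)\<^sup>2 * ?Y \<omega> ^ 4" if "\<omega> \<in> space M" for \<omega>
  proof -
    have "sqrt (scale n m \<omega>) ^ 4 = (sqrt (scale n m \<omega>) ^ 2) ^ 2" by (simp flip: power_mult)
    then have "sqrt (scale n m \<omega>) ^ 4 = (scale n m \<omega>)\<^sup>2"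
      using scale_gt_0[OF n that, of m] by simp
    then show ?thesis by (simp add: W_step_eq[OF that] power_mult_distrib abs_mult power_even_abs)
  qed
  note c3 = scaled_cond_exp[OF sphere_stopping_time[OF n] m3(1) power_bound[OF b] e3 m3(2) p x3]
  show "cond_integrable P ?S (\<lambda>\<omega>. W_step W (\<pi> n) m j \<omega> ^ 3)" by (rule c3(1))
  show "AE \<omega> in P. real_cond_exp P ?S (\<lambda>\<omega>. W_step W (\<pi> n) m j \<omega> ^ 3) \<omega> = 0"
    using c3(2) by simp
  note c4 = scaled_cond_exp[OF sphere_stopping_time[OF n] m4(1) power_bound[OF b] e4 m4(2) zero_le_power2 x4]
  show "cond_integrable P ?S (\<lambda>\<omega>. \<bar>W_step W (\<pi> n) m j \<omega>\<bar> ^ 4)" by (rule c4(1))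
  show "AE \<omega> in P. real_cond_exp P ?S (\<lambda>\<omega>. \<bar>W_step W (\<pi> n) m j \<omega>\<bar> ^ 4) \<omega> =
    (scale n m \<omega>)\<^sup>2 * (3 * sphere_r CARD('d))" by (rule c4(2))
qed

lemma L_cond:
  assumes ij: "i \<noteq> j"
  shows "cond_integrable P (filt.pre_sigma (\<pi> n m)) (L_step W (\<pi> n) m i j)"
    and "AE \<omega> in P. real_cond_exp P (filt.pre_sigma (\<pi> n m)) (L_step W (\<pi> n) m i j) \<omega> = 0"
proof -
  let ?S = "filt.pre_sigma (\<pi> n m)"
  let ?Y = "\<lambda>\<omega>. LINT v:{0..dur n m \<omega>}|lborel. rescaled (\<pi> n m) (scale n m) v \<omega> $ i * rescaled (\<pi> n m) (scale n m) v \<omega> $ j"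
  have Y: "?Y \<in> borel_measurable P"
    unfolding dur_def using sphere_nonneg[OF n] scale_gt_0[OF n] ij
    by (intro rescaled_exit_facts(7) sphere_stopping_time[OF n] scale_measurable[OF n]) auto
  have b: "\<bar>?Y \<omega>\<bar> \<le> real CARD('d) * (sphere_a CARD('d))\<^sup>2" if "\<omega> \<in> space M" for \<omega>
    unfolding dur_def using sphere_nonneg[OF n] scale_gt_0[OF n] ij that
    by (intro rescaled_exit_facts(8) sphere_stopping_time[OF n] scale_measurable[OF n]) auto
  have e: "AE \<omega> in P. real_cond_exp P ?S ?Y \<omega> = 0"
    unfolding dur_def using sphere_nonneg[OF n] scale_gt_0[OF n] ij
    by (intro rescaled_exit_facts(9) sphere_stopping_time[OF n] scale_measurable[OF n]) auto
  note [measurable] = scale_measurable[OF n, of m]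
  have c: "(\<lambda>\<omega>. (scale n m \<omega>)\<^sup>2) \<in> borel_measurable ?S" by measurable
  note * = scaled_cond_exp[OF sphere_stopping_time[OF n] Y b e c zero_le_power2 L_step_eq]
  show "cond_integrable P ?S (L_step W (\<pi> n) m i j)" by (rule *(1))
  show "AE \<omega> in P. real_cond_exp P ?S (L_step W (\<pi> n) m i j) \<omega> = 0" using *(2) by simp
qed

end

text \<open>The same process for every n: the conditional fourth moment is exactly 3 r(d) times the
  squared scale, so no correction depending on n arises. Freezing at \<open>t\<close> extends it to
  all times, as the partition runs past \<open>t\<close>.\<close>

definition Hn :: "nat \<Rightarrow> real \<Rightarrow> 'a \<Rightarrow> real" where
  "Hn n s \<omega> = 3 * sphere_r CARD('d) / G (min s t) \<omega>"

lemma condition_B: "condition_B P F W \<pi> Hn"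
  unfolding condition_B_def Let_def space_completion
proof (intro allI impI conjI)
  fix n m :: nat and j :: 'd assume n: "1 \<le> n"
  show "AE \<omega> in P. real_cond_exp P (filt.pre_sigma (\<pi> n m)) (\<lambda>\<omega>. \<bar>W_step W (\<pi> n) m j \<omega>\<bar> ^ 4) \<omega> =
      1 / (real n)\<^sup>2 * (Hn n (\<pi> n m \<omega>) \<omega> / step_rate P F n (\<pi> n) m \<omega>)"
    using fourth_cond(2)[OF n, of m j] step_rate_eq[OF n, of m]
    by eventually_elim (simp add: Hn_def scale_eq power2_eq_square)
qed (rule step_cond cube_cond fourth_cond L_cond; assumption)+

end

text \<open>The supremum over a random interval becomes one over a fixed countable index set, so
  that it is measurable in \<omega>. Right-continuity covers the points before \<open>T\<close>; the
  endpoint is covered by q = 1.\<close>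

lemma sup_rational:
  fixes f :: "real \<Rightarrow> real"
  assumes T: "0 \<le> T" and rc: "\<And>s. 0 \<le> s \<Longrightarrow> s < T \<Longrightarrow> (f \<longlongrightarrow> f s) (at_right s)"
  shows "(SUP s\<in>{0..T}. ennreal \<bar>f s\<bar>) = (SUP q\<in>\<rat> \<inter> {0..1}. ennreal \<bar>f (q * T)\<bar>)" (is "_ = ?S")
proof (intro antisym SUP_least)
  fix q :: real assume "q \<in> \<rat> \<inter> {0..1}"
  then have "q * T \<in> {0..T}" using T by (auto simp: mult_left_le_one_le)
  then show "ennreal \<bar>f (q * T)\<bar> \<le> (SUP s\<in>{0..T}. ennreal \<bar>f s\<bar>)" by (rule SUP_upper)
next
  fix s assume s: "s \<in> {0..T}"
  show "ennreal \<bar>f s\<bar> \<le> ?S"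
  proof (cases "s = T")
    case True
    then show ?thesis using SUP_upper[of 1 "\<rat> \<inter> {0..1}" "\<lambda>q. ennreal \<bar>f (q * T)\<bar>"] by auto
  next
    case False
    then have sT: "0 \<le> s" "s < T" using s by auto
    show ?thesis
    proof (rule ccontr)
      assume "\<not> ennreal \<bar>f s\<bar> \<le> ?S"
      then have "?S < ennreal \<bar>f s\<bar>" by simp
      moreover have "((\<lambda>u. ennreal \<bar>f u\<bar>) \<longlongrightarrow> ennreal \<bar>f s\<bar>) (at_right s)"
        by (intro tendsto_intros tendsto_ennrealI rc sT)
      ultimately have "eventually (\<lambda>u. ?S < ennreal \<bar>f u\<bar>) (at_right s)" by (rule order_tendstoD(1)[rotated])
      then obtain b where b: "s < b" "\<And>u. s < u \<Longrightarrow> u < b \<Longrightarrow> ?S < ennreal \<bar>f u\<bar>"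
        unfolding eventually_at_right_field by blast
      obtain q where q: "q \<in> \<rat>" "s / T < q" "q < min b T / T"
        using Rats_dense_in_real[of "s / T" "min b T / T"] sT b(1) by (auto simp: divide_strict_right_mono)
      then have qT: "s < q * T" "q * T < b" "q * T < T" using sT by (auto simp: field_simps)
      moreover have "q < 1" using qT(3) sT by simp
      moreover have "0 < q" using q(2) sT by (meson divide_nonneg_pos le_less_trans)
      ultimately show False using q(1) b(2)[of "q * T"] SUP_upper[of q "\<rat> \<inter> {0..1}" "\<lambda>q. ennreal \<bar>f (q * T)\<bar>"] by auto
    qed
  qed
qed

text \<open>Completeness of the space enters here: suprema involving versions of conditional
  expectations, or partitions that diverge only almost surely, are known only up to null
  sets.\<close>

lemma (in complete_measure) borel_measurable_AE:
  assumes g: "g \<in> borel_measurable M" and ae: "AE x in M. f x = g x"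
  shows "f \<in> borel_measurable M"
proof (rule measurableI)
  fix A :: "'b set" assume A: "A \<in> sets borel"
  show "f -` A \<inter> space M \<in> sets M"
  proof (rule in_sets_AE)
    show "AE x in M. x \<in> g -` A \<inter> space M \<longleftrightarrow> x \<in> f -` A \<inter> space M" using ae by eventually_elim auto
  qed (use measurable_sets[OF g A] in auto)
qed simp

lemma (in prob_space) tends_to_0_in_probI_AE:
  assumes X: "\<And>n. 1 \<le> n \<Longrightarrow> X n \<in> borel_measurable M"
    and ae: "AE \<omega> in M. \<forall>e>0. eventually (\<lambda>n. X n \<omega> \<le> ennreal e) sequentially"
  shows "tends_to_0_in_prob M X"
  unfolding tends_to_0_in_prob_def
proof (intro conjI allI impI)
  fix e :: real assume e: "0 < e"
  have m [measurable]: "X (Suc n) \<in> borel_measurable M" for n by (rule X) simp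
  have "(\<lambda>n. \<integral>\<omega>. indicator {\<omega> \<in> space M. X (Suc n) \<omega> > ennreal e} \<omega> \<partial>M) \<longlonglongrightarrow> (\<integral>\<omega>. (0::real) \<partial>M)"
  proof (rule integral_dominated_convergence[where w="\<lambda>_. 1"])
    show "AE \<omega> in M. (\<lambda>n. indicator {\<omega> \<in> space M. X (Suc n) \<omega> > ennreal e} \<omega> :: real) \<longlonglongrightarrow> 0"
      using ae
    proof eventually_elim
      case (elim \<omega>)
      then have "eventually (\<lambda>n. X (Suc n) \<omega> \<le> ennreal e) sequentially"
        using e by (subst eventually_sequentially_Suc) auto
      then have "eventually (\<lambda>n. indicator {\<omega> \<in> space M. X (Suc n) \<omega> > ennreal e} \<omega> = (0::real)) sequentially"
        by eventually_elim (auto simp: indicator_def)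
      then show ?case by (rule tendsto_eventually)
    qed
  qed (auto simp: indicator_def)
  then have "(\<lambda>n. measure M {\<omega> \<in> space M. X (Suc n) \<omega> > ennreal e}) \<longlonglongrightarrow> 0" by simp
  then show "(\<lambda>n. measure M {\<omega> \<in> space M. X n \<omega> > ennreal e}) \<longlonglongrightarrow> 0"
    by (rule LIMSEQ_imp_Suc)
qed (use X in auto)

text \<open>Markov's inequality. \<open>max C 0\<close> keeps the bound nonnegative, whatever the
  sign of \<open>C\<close>.\<close>

lemma (in prob_space) tends_to_0_in_probI_mean:
  assumes X: "\<And>n. 1 \<le> n \<Longrightarrow> X n \<in> borel_measurable M"
    and mean: "\<And>n. 1 \<le> n \<Longrightarrow> (\<integral>\<^sup>+\<omega>. X n \<omega> \<partial>M) \<le> ennreal (C / real n)"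
  shows "tends_to_0_in_prob M X"
  unfolding tends_to_0_in_prob_def
proof (intro conjI allI impI)
  fix e :: real assume e: "0 < e"
  have "measure M {\<omega> \<in> space M. X n \<omega> > ennreal e} \<le> (max C 0 / e) / real n" if n: "1 \<le> n" for n
  proof -
    note [measurable] = X[OF n]
    have "emeasure M {\<omega> \<in> space M. X n \<omega> > ennreal e} \<le> emeasure M ({\<omega> \<in> space M. 1 \<le> ennreal (1 / e) * X n \<omega>})"
    proof (intro emeasure_mono subsetI)
      fix \<omega> assume "\<omega> \<in> {\<omega> \<in> space M. X n \<omega> > ennreal e}"
      moreover from this have "ennreal (1 / e) * ennreal e \<le> ennreal (1 / e) * X n \<omega>" by (intro mult_left_mono) auto
      ultimately show "\<omega> \<in> {\<omega> \<in> space M. 1 \<le> ennreal (1 / e) * X n \<omega>}"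
        using e by (simp add: ennreal_mult[symmetric])
    qed auto
    also have "\<dots> \<le> ennreal (1 / e) * (\<integral>\<^sup>+\<omega>. X n \<omega> * indicator (space M) \<omega> \<partial>M)"
      using nn_integral_Markov_inequality[of "X n" "space M" M "ennreal (1 / e)"] by simp
    also have "(\<integral>\<^sup>+\<omega>. X n \<omega> * indicator (space M) \<omega> \<partial>M) = (\<integral>\<^sup>+\<omega>. X n \<omega> \<partial>M)"
      by (intro nn_integral_cong) auto
    also have "ennreal (1 / e) * (\<integral>\<^sup>+\<omega>. X n \<omega> \<partial>M) \<le> ennreal (1 / e) * ennreal (max C 0 / real n)"
      by (intro mult_left_mono order_trans[OF mean[OF n]] ennreal_leI divide_right_mono) auto
    also have "\<dots> = ennreal (max C 0 / e / real n)"
      using e by (subst ennreal_mult[symmetric]) (auto simp: mult.commute)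
    finally show ?thesis
      unfolding emeasure_eq_measure using e by (simp add: ennreal_le_iff)
  qed
  then show "(\<lambda>n. measure M {\<omega> \<in> space M. X n \<omega> > ennreal e}) \<longlonglongrightarrow> 0"
    by (intro real_tendsto_sandwich[OF _ _ tendsto_const lim_const_over_n[of "max C 0 / e"]])
      (auto simp: eventually_sequentially intro!: exI[of _ 1])
qed (use X in auto)

section \<open>The partition times tend to infinity\<close>

context moving
begin

context
  fixes n :: nat
  assumes n: "1 \<le> n"
begin

lemma sphere_mono: "\<omega> \<in> space M \<Longrightarrow> i \<le> j \<Longrightarrow> \<pi> n i \<omega> \<le> \<pi> n j \<omega>"
  using sphere_incseq[OF n] by (auto simp: incseq_def)

lemma sphere_measurable: "\<pi> n m \<in> borel_measurable (filt.pre_sigma (\<pi> n m))"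
  using sphere_nonneg[OF n] by (intro stopped_measurable[OF sphere_stopping_time[OF n], where X="\<lambda>r \<omega>. r"]) auto

text \<open>A past duration is recovered from the partition times as the step divided by its scale,
  all of which are known at time \<pi> n m.\<close>

lemma dur_pre:
  assumes "i < m"
  shows "dur n i \<in> borel_measurable (filt.pre_sigma (\<pi> n m))"
proof -
  have up: "f \<in> borel_measurable (filt.pre_sigma (\<pi> n k)) \<Longrightarrow> f \<in> borel_measurable (filt.pre_sigma (\<pi> n m))"
    if "k \<le> m" for k and f :: "'a \<Rightarrow> real"
    by (rule pre_mono[OF sphere_stopping_time[OF n, of k] sphere_stopping_time[OF n] sphere_mono]) (use that in auto)
  have [measurable]: "\<pi> n (Suc i) \<in> borel_measurable (filt.pre_sigma (\<pi> n m))"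
    "\<pi> n i \<in> borel_measurable (filt.pre_sigma (\<pi> n m))" "scale n i \<in> borel_measurable (filt.pre_sigma (\<pi> n m))"
    using assms by (auto intro: up[OF _ sphere_measurable] up[OF _ scale_measurable[OF n]] simp del: moving_sphere.simps)
  have "dur n i \<omega> = (\<pi> n (Suc i) \<omega> - \<pi> n i \<omega>) / scale n i \<omega>" if "\<omega> \<in> space M" for \<omega>
    using scale_gt_0[OF n that, of i] by (simp add: sphere_Suc[OF n that] del: moving_sphere.simps)
  then show ?thesis
    by (subst measurable_cong[where g="\<lambda>\<omega>. (\<pi> n (Suc i) \<omega> - \<pi> n i \<omega>) / scale n i \<omega>"])
      (auto simp: filt.space_pre_sigma simp del: moving_sphere.simps)
qed

lemma dur_weighted_mean:
  assumes "H \<in> borel_measurable (filt.pre_sigma (\<pi> n m))"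
  shows "(\<integral>\<^sup>+\<omega>. H \<omega> * ennreal (dur n m \<omega>) \<partial>P) = (\<integral>\<^sup>+\<omega>. H \<omega> \<partial>P)"
  unfolding dur_def using sphere_nonneg[OF n] scale_gt_0[OF n]
  by (intro exit_time_weighted_mean sphere_stopping_time[OF n] scale_measurable[OF n] assms) auto

lemma total_dur_decay:
  "(\<integral>\<omega>. exp (- (\<Sum>i<m. dur n i \<omega>)) \<partial>P) \<le> (1 - 1 / (1 + sphere_a CARD('d))) ^ m"
proof (induction m)
  case 0
  then show ?case using B.prob_space by simp
next
  case (Suc m)
  let ?a = "sphere_a CARD('d)" and ?f = "\<lambda>\<omega>. exp (- (\<Sum>i<m. dur n i \<omega>))"
  have a: "0 < ?a" by (rule sphere_a_pos) (simp add: Suc_leI)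
  have [measurable]: "dur n i \<in> borel_measurable P" for i by (rule dur_measurable[OF n])
  have f: "?f \<in> borel_measurable (filt.pre_sigma (\<pi> n m))"
    using dur_pre by (intro measurable_compose[OF _ borel_measurable_exp] borel_measurable_uminus borel_measurable_sum) auto
  have fb: "0 \<le> ?f \<omega>" "?f \<omega> \<le> 1" for \<omega> by (auto intro: sum_nonneg dur_nonneg)
  have int: "integrable P ?f" using fb by (intro B.integrable_const_bound[where B=1]) auto
  have fd: "\<bar>?f \<omega> * dur n m \<omega>\<bar> \<le> ?a" for \<omega>
    using mult_mono[of "?f \<omega>" 1 "dur n m \<omega>" ?a] fb[of \<omega>] dur_nonneg[of n m \<omega>] dur_le[of n m \<omega>] by (simp add: abs_mult)
  have int2: "integrable P (\<lambda>\<omega>. ?f \<omega> * dur n m \<omega>)"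
    using fd by (intro B.integrable_const_bound[where B="?a"]) auto
  have "(\<integral>\<^sup>+\<omega>. ennreal (?f \<omega>) * ennreal (dur n m \<omega>) \<partial>P) = (\<integral>\<^sup>+\<omega>. ennreal (?f \<omega>) \<partial>P)"
    by (intro dur_weighted_mean measurable_compose[OF f measurable_ennreal])
  then have eq: "(\<integral>\<omega>. ?f \<omega> * dur n m \<omega> \<partial>P) = (\<integral>\<omega>. ?f \<omega> \<partial>P)"
    using dur_nonneg[of n m] fb by (simp add: integral_eq_nn_integral ennreal_mult)
  \<comment> \<open>From exp x >= 1 + x, followed by enlarging the denominator in x / (1 + x) to 1 +
    a.\<close>
  have ex: "exp (- x) \<le> 1 - x / (1 + ?a)" if x: "0 \<le> x" "x \<le> ?a" for x
  proof -
    have "exp (- x) \<le> 1 / (1 + x)"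
      using exp_ge_add_one_self[of x] x by (simp add: exp_minus field_simps)
    also have "\<dots> = 1 - x / (1 + x)" using x by (simp add: field_simps)
    also have "\<dots> \<le> 1 - x / (1 + ?a)" using x by (simp add: frac_le)
    finally show ?thesis .
  qed
  have "(\<integral>\<omega>. exp (- (\<Sum>i<Suc m. dur n i \<omega>)) \<partial>P) \<le> (\<integral>\<omega>. ?f \<omega> - (?f \<omega> * dur n m \<omega>) / (1 + ?a) \<partial>P)"
  proof (rule integral_mono)
    show "integrable P (\<lambda>\<omega>. exp (- (\<Sum>i<Suc m. dur n i \<omega>)))"
      using sum_nonneg[of "{..<Suc m}" "\<lambda>i. dur n i _"] dur_nonneg
      by (intro B.integrable_const_bound[where B=1]) (auto simp del: sum.lessThan_Suc)
    show "integrable P (\<lambda>\<omega>. ?f \<omega> - (?f \<omega> * dur n m \<omega>) / (1 + ?a))" using int int2 by auto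
    fix \<omega>
    have "exp (- (\<Sum>i<Suc m. dur n i \<omega>)) = ?f \<omega> * exp (- dur n m \<omega>)" by (simp flip: exp_add)
    also have "\<dots> \<le> ?f \<omega> * (1 - dur n m \<omega> / (1 + ?a))" by (intro mult_left_mono ex dur_nonneg dur_le) simp
    finally show "exp (- (\<Sum>i<Suc m. dur n i \<omega>)) \<le> ?f \<omega> - (?f \<omega> * dur n m \<omega>) / (1 + ?a)" by (simp add: right_diff_distrib)
  qed
  also have "\<dots> = (1 - 1 / (1 + ?a)) * (\<integral>\<omega>. ?f \<omega> \<partial>P)"
    using int int2 by (simp add: eq left_diff_distrib)
  also have "\<dots> \<le> (1 - 1 / (1 + ?a)) * (1 - 1 / (1 + ?a)) ^ m" using Suc a by (intro mult_left_mono) auto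
  finally show ?case by simp
qed

text \<open>The geometric decay makes the exponentials of minus the total durations summable almost
  surely, so the total durations diverge. Pathwise G is bounded on [0, t], which bounds every scale
  below by a positive constant and carries the divergence over to the partition.\<close>

lemma sphere_at_top: "AE \<omega> in P. filterlim (\<lambda>m. \<pi> n m \<omega>) at_top sequentially"
proof -
  let ?a = "sphere_a CARD('d)"
  let ?k = "1 - 1 / (1 + ?a)" and ?f = "\<lambda>m \<omega>. exp (- (\<Sum>i<m. dur n i \<omega>))"
  have a: "0 < ?a" by (rule sphere_a_pos) (simp add: Suc_leI)
  have [measurable]: "dur n i \<in> borel_measurable P" for i by (rule dur_measurable[OF n])
  have int: "integrable P (?f m)" for m
    using sum_nonneg[of "{..<m}" "\<lambda>i. dur n i _"] dur_nonneg
    by (intro B.integrable_const_bound[where B=1]) auto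
  have k: "0 \<le> ?k" "?k < 1" using a by auto
  have "(\<integral>\<^sup>+\<omega>. (\<Sum>m. ennreal (?f m \<omega>)) \<partial>P) = (\<Sum>m. \<integral>\<^sup>+\<omega>. ennreal (?f m \<omega>) \<partial>P)"
    by (rule nn_integral_suminf) measurable
  also have "\<dots> \<le> (\<Sum>m. ennreal (?k ^ m))"
    using int total_dur_decay by (intro suminf_le) (auto simp: nn_integral_eq_integral intro!: ennreal_leI)
  also have "\<dots> = ennreal (\<Sum>m. ?k ^ m)" using k by (intro suminf_ennreal2) auto
  finally have "(\<integral>\<^sup>+\<omega>. (\<Sum>m. ennreal (?f m \<omega>)) \<partial>P) \<noteq> \<infinity>" by (auto simp: top_unique)
  then have "AE \<omega> in P. (\<Sum>m. ennreal (?f m \<omega>)) \<noteq> \<infinity>" by (intro nn_integral_PInf_AE) auto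
  then show ?thesis using AE_space
  proof eventually_elim
    case (elim \<omega>)
    then have \<omega>: "\<omega> \<in> space M" by simp
    have "summable (\<lambda>m. ?f m \<omega>)" using elim(1) by (intro summable_suminf_not_top) auto
    then have lim: "(\<lambda>m. ?f m \<omega>) \<longlonglongrightarrow> 0" by (rule summable_LIMSEQ_zero)
    have "compact ((\<lambda>s. G s \<omega>) ` {0..t})" by (intro compact_continuous_image G_cont[OF \<omega>]) auto
    then obtain C where C: "0 < C" "\<And>s. s \<in> {0..t} \<Longrightarrow> G s \<omega> \<le> C"
      using compact_imp_bounded bounded_pos by (metis abs_le_D1 image_eqI real_norm_def)
    let ?c = "1 / (real n * C)"
    have c: "0 < ?c" using n C by simp
    have sc: "?c \<le> scale n m \<omega>" for m
      unfolding scale_eq using n C(2) G_pos[OF _ \<omega>] sphere_nonneg[OF n \<omega>, of m] t_pos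
      by (intro divide_left_mono mult_left_mono mult_pos_pos) (auto intro: C(1))
    have low: "?c * (\<Sum>i<m. dur n i \<omega>) \<le> \<pi> n m \<omega>" for m
    proof (induction m)
      case (Suc m)
      have "?c * dur n m \<omega> \<le> scale n m \<omega> * dur n m \<omega>" by (intro mult_right_mono sc dur_nonneg)
      then show ?case using Suc by (simp add: sphere_Suc[OF n \<omega>] distrib_left del: moving_sphere.simps)
    qed simp
    show ?case
      unfolding filterlim_at_top
    proof
      fix Z :: real
      have "eventually (\<lambda>m. ?f m \<omega> < exp (- (Z / ?c))) sequentially" by (rule order_tendstoD(2)[OF lim]) simp
      then show "eventually (\<lambda>m. Z \<le> \<pi> n m \<omega>) sequentially"
      proof eventually_elim
        case (elim m)
        then have "Z / ?c < (\<Sum>i<m. dur n i \<omega>)" by simp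
        then have "Z < ?c * (\<Sum>i<m. dur n i \<omega>)" using c by (simp only: pos_divide_less_eq mult.commute)
        then show ?case using low[of m] by simp
      qed
    qed
  qed
qed

lemma stopping_partition: "stopping_partition P F (\<pi> n)"
  unfolding stopping_partition_def
  using sphere_at_top sphere_stopping_time[OF n] sphere_incseq[OF n] by auto

end

text \<open>The definite description in \<open>step_index\<close> has a value only if some interval
  contains s. That follows from divergence of the partition, hence almost surely; uniqueness comes
  from monotonicity.\<close>

lemma step_index_props:
  assumes n: "1 \<le> n" and \<omega>: "\<omega> \<in> space M" and top: "filterlim (\<lambda>m. \<pi> n m \<omega>) at_top sequentially" and s: "0 \<le> s"
  shows "\<pi> n (step_index (\<pi> n) s \<omega>) \<omega> \<le> s" "s < \<pi> n (Suc (step_index (\<pi> n) s \<omega>)) \<omega>"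
    and "\<pi> n m \<omega> \<le> s \<Longrightarrow> s < \<pi> n (Suc m) \<omega> \<Longrightarrow> step_index (\<pi> n) s \<omega> = m"
proof -
  let ?Q = "\<lambda>m. \<pi> n m \<omega> \<le> s \<and> s < \<pi> n (Suc m) \<omega>"
  have uniq: "i = j" if "?Q i" "?Q j" for i j
  proof (rule ccontr)
    assume "i \<noteq> j"
    then consider "Suc i \<le> j" | "Suc j \<le> i" by linarith
    then show False
      by cases (use that sphere_mono[OF n \<omega>, of "Suc i" j] sphere_mono[OF n \<omega>, of "Suc j" i] in \<open>auto simp del: moving_sphere.simps\<close>)
  qed
  have ex: "\<exists>m. s < \<pi> n m \<omega>"
    using top unfolding filterlim_at_top_dense eventually_sequentially by blast
  define k where "k = (LEAST m. s < \<pi> n m \<omega>)"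
  have k: "s < \<pi> n k \<omega>" unfolding k_def by (rule LeastI_ex[OF ex])
  then obtain m where m: "k = Suc m" using s by (cases k) auto
  have "?Q m" using k not_less_Least[of m "\<lambda>m. s < \<pi> n m \<omega>"] unfolding k_def[symmetric] m by auto
  then have e: "\<exists>!m. ?Q m" using uniq by blast
  have q: "?Q (step_index (\<pi> n) s \<omega>)" unfolding step_index_def by (rule theI'[OF e])
  then show "\<pi> n (step_index (\<pi> n) s \<omega>) \<omega> \<le> s" "s < \<pi> n (Suc (step_index (\<pi> n) s \<omega>)) \<omega>" by auto
  show "step_index (\<pi> n) s \<omega> = m" if "\<pi> n m \<omega> \<le> s" "s < \<pi> n (Suc m) \<omega>" for m
    using uniq[OF q, of m] that by auto
qed

end

lemma tendsto_at_right_of_continuous_on: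
  fixes f :: "real \<Rightarrow> real"
  assumes "continuous_on {0..t} f" "0 \<le> s" "s < t"
  shows "(f \<longlongrightarrow> f s) (at_right s)"
proof -
  have "(f \<longlongrightarrow> f s) (at s within {0..t})" using assms by (auto simp: continuous_on_def)
  then have "(f \<longlongrightarrow> f s) (at s within {s..t})" by (rule tendsto_within_subset) (use assms in auto)
  then show ?thesis using assms by (simp add: at_within_Icc_at_right)
qed

section \<open>Conditions (A) and (C): uniform convergence and moment sums\<close>

context moving
begin

lemma sphere_a_gt_0: "0 < sphere_a CARD('d)"
  by (rule sphere_a_pos) (simp add: Suc_leI)

text \<open>Serves both G and H. The step containing s has length at most a / (n min G), so pathwise
  uniform continuity on [0, t] suffices. \<open>X\<close> is prescribed only almost surely because
  \<open>step_rate\<close> involves a version of a conditional expectation.\<close>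

lemma oscillation_tends_to_0:
  fixes \<Phi> :: "real \<Rightarrow> 'a \<Rightarrow> real"
  assumes \<Phi>: "\<And>s. s \<in> {0..t} \<Longrightarrow> \<Phi> s \<in> borel_measurable P"
    and \<Phi>c: "\<And>\<omega>. \<omega> \<in> space M \<Longrightarrow> continuous_on {0..t} (\<lambda>s. \<Phi> s \<omega>)"
    and \<tau> [measurable]: "\<tau> \<in> borel_measurable P" and \<tau>t: "\<And>\<omega>. \<omega> \<in> space M \<Longrightarrow> \<tau> \<omega> \<in> {0..t}"
    and X: "\<And>n. 1 \<le> n \<Longrightarrow> AE \<omega> in P. X n \<omega> =
      (SUP s\<in>{0..\<tau> \<omega>}. ennreal \<bar>\<Phi> (min (\<pi> n (step_index (\<pi> n) s \<omega>) \<omega>) t) \<omega> - \<Phi> s \<omega>\<bar>)"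
  shows "tends_to_0_in_prob P X"
proof (rule B.tends_to_0_in_probI_AE)
  fix n :: nat assume n: "1 \<le> n"
  \<comment> \<open>To avoid the random index, the value is split over all m: exactly one of the
    \<open>h q m\<close> can be nonzero, so their supremum over m is the oscillation at the time q
    \<tau>.\<close>
  define h where "h q m \<omega> = (if \<pi> n m \<omega> \<le> q * \<tau> \<omega> \<and> q * \<tau> \<omega> < \<pi> n (Suc m) \<omega>
      then ennreal \<bar>\<Phi> (min (\<pi> n m \<omega>) t) \<omega> - \<Phi> (q * \<tau> \<omega>) \<omega>\<bar> else 0)" for q m \<omega>
  have [measurable]: "\<pi> n m \<in> borel_measurable P" for m by (rule stopping_time_measurable[OF sphere_stopping_time[OF n]])
  have U: "(\<lambda>\<omega>. \<Phi> (U \<omega>) \<omega>) \<in> borel_measurable P"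
    if "U \<in> borel_measurable P" "\<And>\<omega>. \<omega> \<in> space M \<Longrightarrow> U \<omega> \<in> {0..t}" for U
    by (rule measurable_random_time[where s=t]) (use \<Phi> \<Phi>c that in auto)
  have hm: "h q m \<in> borel_measurable P" if q: "q \<in> \<rat> \<inter> {0..1}" for q m
  proof -
    have [measurable]: "(\<lambda>\<omega>. \<Phi> (min (\<pi> n m \<omega>) t) \<omega>) \<in> borel_measurable P"
      using sphere_nonneg[OF n] t_pos by (intro U) auto
    have [measurable]: "(\<lambda>\<omega>. \<Phi> (q * \<tau> \<omega>) \<omega>) \<in> borel_measurable P"
      using q \<tau>t by (intro U) (auto intro: order_trans[OF mult_left_le_one_le])
    show ?thesis unfolding h_def by measurable
  qed
  show "X n \<in> borel_measurable P"
  proof (rule completion.borel_measurable_AE)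
    show "(\<lambda>\<omega>. SUP q\<in>\<rat> \<inter> {0..1}. SUP m. h q m \<omega>) \<in> borel_measurable P"
      using hm by (intro borel_measurable_SUP countable_Int1 countable_rat) auto
    show "AE \<omega> in P. X n \<omega> = (SUP q\<in>\<rat> \<inter> {0..1}. SUP m. h q m \<omega>)"
      using X[OF n] sphere_at_top[OF n] AE_space
    proof eventually_elim
      case (elim \<omega>)
      then have \<omega>: "\<omega> \<in> space M" by simp
      note idx = step_index_props[OF n \<omega> elim(2)]
      let ?f = "\<lambda>s. \<Phi> (min (\<pi> n (step_index (\<pi> n) s \<omega>) \<omega>) t) \<omega> - \<Phi> s \<omega>"
      have "X n \<omega> = (SUP q\<in>\<rat> \<inter> {0..1}. ennreal \<bar>?f (q * \<tau> \<omega>)\<bar>)"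
        unfolding elim(1)
      proof (rule sup_rational)
        fix s assume s: "0 \<le> s" "s < \<tau> \<omega>"
        let ?m = "step_index (\<pi> n) s \<omega>"
        have "((\<lambda>u. \<Phi> (min (\<pi> n ?m \<omega>) t) \<omega> - \<Phi> u \<omega>) \<longlongrightarrow> ?f s) (at_right s)"
          using \<tau>t[OF \<omega>] s by (intro tendsto_intros tendsto_at_right_of_continuous_on[OF \<Phi>c[OF \<omega>]]) auto
        moreover have "eventually (\<lambda>u. \<Phi> (min (\<pi> n ?m \<omega>) t) \<omega> - \<Phi> u \<omega> = ?f u) (at_right s)"
          unfolding eventually_at_right_field
        proof (intro exI[of _ "\<pi> n (Suc ?m) \<omega>"] conjI allI impI)
          show "s < \<pi> n (Suc ?m) \<omega>" by (rule idx(2)[OF s(1)])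
          fix u assume u: "s < u" "u < \<pi> n (Suc ?m) \<omega>"
          then have "step_index (\<pi> n) u \<omega> = ?m" using idx(1)[OF s(1)] s(1) by (intro idx(3)) auto
          then show "\<Phi> (min (\<pi> n ?m \<omega>) t) \<omega> - \<Phi> u \<omega> = ?f u" by simp
        qed
        ultimately show "(?f \<longlongrightarrow> ?f s) (at_right s)" by (rule Lim_transform_eventually)
      qed (use \<tau>t[OF \<omega>] in auto)
      moreover have "ennreal \<bar>?f (q * \<tau> \<omega>)\<bar> = (SUP m. h q m \<omega>)" if "q \<in> \<rat> \<inter> {0..1}" for q
      proof (intro antisym SUP_least)
        have q0: "0 \<le> q * \<tau> \<omega>" using that \<tau>t[OF \<omega>] by auto
        have "ennreal \<bar>?f (q * \<tau> \<omega>)\<bar> = h q (step_index (\<pi> n) (q * \<tau> \<omega>) \<omega>) \<omega>"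
          using idx(1,2)[OF q0] by (simp add: h_def del: moving_sphere.simps)
        also have "\<dots> \<le> (SUP m. h q m \<omega>)" by (rule SUP_upper) simp
        finally show "ennreal \<bar>?f (q * \<tau> \<omega>)\<bar> \<le> (SUP m. h q m \<omega>)" .
        show "h q m \<omega> \<le> ennreal \<bar>?f (q * \<tau> \<omega>)\<bar>" for m
          using idx(3)[OF q0, of m] by (auto simp: h_def simp del: moving_sphere.simps)
      qed
      ultimately show ?case by simp
    qed
  qed
next
  have "AE \<omega> in P. \<forall>n. 1 \<le> n \<longrightarrow> filterlim (\<lambda>m. \<pi> n m \<omega>) at_top sequentially \<and> X n \<omega> =
      (SUP s\<in>{0..\<tau> \<omega>}. ennreal \<bar>\<Phi> (min (\<pi> n (step_index (\<pi> n) s \<omega>) \<omega>) t) \<omega> - \<Phi> s \<omega>\<bar>)"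
    unfolding AE_all_countable
  proof
    fix n
    show "AE \<omega> in P. 1 \<le> n \<longrightarrow> filterlim (\<lambda>m. \<pi> n m \<omega>) at_top sequentially \<and> X n \<omega> =
      (SUP s\<in>{0..\<tau> \<omega>}. ennreal \<bar>\<Phi> (min (\<pi> n (step_index (\<pi> n) s \<omega>) \<omega>) t) \<omega> - \<Phi> s \<omega>\<bar>)"
    proof (cases "1 \<le> n")
      case True
      from X[OF True] sphere_at_top[OF True] show ?thesis by eventually_elim simp
    qed simp
  qed
  then show "AE \<omega> in P. \<forall>e>0. eventually (\<lambda>n. X n \<omega> \<le> ennreal e) sequentially"
    using AE_space
  proof eventually_elim
    case (elim \<omega>)
    then have \<omega>: "\<omega> \<in> space M" by simp
    show ?case
    proof (intro allI impI)
      fix e :: real assume e: "0 < e"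
      have "uniformly_continuous_on {0..t} (\<lambda>s. \<Phi> s \<omega>)"
        by (intro compact_uniformly_continuous \<Phi>c[OF \<omega>]) auto
      then obtain \<delta> where \<delta>: "0 < \<delta>" "\<And>x y. x \<in> {0..t} \<Longrightarrow> y \<in> {0..t} \<Longrightarrow> dist y x < \<delta> \<Longrightarrow> dist (\<Phi> y \<omega>) (\<Phi> x \<omega>) < e"
        using e unfolding uniformly_continuous_on_def by metis
      obtain s0 where s0: "s0 \<in> {0..t}" "\<And>s. s \<in> {0..t} \<Longrightarrow> G s0 \<omega> \<le> G s \<omega>"
        using continuous_attains_inf[OF _ _ G_cont[OF \<omega>]] t_pos by (metis atLeastatMost_empty_iff2 compact_Icc less_le_not_le)
      have c: "0 < G s0 \<omega>" by (rule G_pos[OF s0(1) \<omega>])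
      let ?a = "sphere_a CARD('d)"
      have "eventually (\<lambda>n. (?a / G s0 \<omega>) / real n < \<delta>) sequentially"
        by (rule order_tendstoD(2)[OF lim_const_over_n \<delta>(1)])
      with eventually_ge_at_top[of 1] show "eventually (\<lambda>n. X n \<omega> \<le> ennreal e) sequentially"
      proof eventually_elim
        case (elim n)
        then have n: "1 \<le> n" by simp
        have top: "filterlim (\<lambda>m. \<pi> n m \<omega>) at_top sequentially" and
          Xn: "X n \<omega> = (SUP s\<in>{0..\<tau> \<omega>}. ennreal \<bar>\<Phi> (min (\<pi> n (step_index (\<pi> n) s \<omega>) \<omega>) t) \<omega> - \<Phi> s \<omega>\<bar>)"
          using \<open>\<forall>n. 1 \<le> n \<longrightarrow> _ n\<close> n by auto
        show "X n \<omega> \<le> ennreal e"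
          unfolding Xn
        proof (intro SUP_least ennreal_leI)
          fix s assume "s \<in> {0..\<tau> \<omega>}"
          then have s: "0 \<le> s" "s \<le> t" using \<tau>t[OF \<omega>] by auto
          let ?m = "step_index (\<pi> n) s \<omega>"
          note idx = step_index_props(1,2)[OF n \<omega> top s(1)]
          have u: "0 \<le> \<pi> n ?m \<omega>" by (rule sphere_nonneg[OF n \<omega>])
          have "scale n ?m \<omega> \<le> 1 / (real n * G s0 \<omega>)"
            unfolding scale_eq using n c s0(2)[of "min (\<pi> n ?m \<omega>) t"] u t_pos
            by (intro divide_left_mono mult_left_mono mult_pos_pos) (auto simp del: moving_sphere.simps)
          then have "scale n ?m \<omega> * dur n ?m \<omega> \<le> 1 / (real n * G s0 \<omega>) * ?a"
            using dur_nonneg dur_le c by (intro mult_mono) auto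
          also have "\<dots> < \<delta>" using elim(2) by (simp add: field_simps)
          finally have "\<bar>\<pi> n ?m \<omega> - s\<bar> < \<delta>" using idx unfolding sphere_Suc[OF n \<omega>] by linarith
          then have "dist (\<Phi> (\<pi> n ?m \<omega>) \<omega>) (\<Phi> s \<omega>) < e" using idx(1) s u by (intro \<delta>(2)) (auto simp: dist_real_def)
          then show "\<bar>\<Phi> (min (\<pi> n ?m \<omega>) t) \<omega> - \<Phi> s \<omega>\<bar> \<le> e"
            using idx(1) s by (simp add: dist_real_def min_absorb1)
        qed
      qed
    qed
  qed
qed

lemma level_exit_bdd: "bdd_below (insert t {s. 0 < s \<and> s \<le> t \<and> (real K < G s \<omega> \<or> G s \<omega> < 1 / real K)})"
  using t_pos by (intro bdd_belowI[of _ 0]) auto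

lemma level_exit_range: "level_exit G t K \<omega> \<in> {0..t}"
proof -
  have "level_exit G t K \<omega> \<le> t" unfolding level_exit_def by (rule cInf_lower[OF _ level_exit_bdd]) simp
  moreover have "0 \<le> level_exit G t K \<omega>" unfolding level_exit_def using t_pos by (intro cInf_greatest) auto
  ultimately show ?thesis by simp
qed

text \<open>\<open>level_exit\<close> inspects only times s > 0, so the bound at u = 0 has to be
  obtained as a limit from the right; the same argument serves every u before the exit.\<close>

lemma before_level_exit:
  assumes \<omega>: "\<omega> \<in> space M" and u: "0 \<le> u" "u < level_exit G t K \<omega>"
  shows "u < t" "1 / real K \<le> G u \<omega>"
proof -
  show "u < t" using level_exit_range[of K \<omega>] u by auto
  then have "((\<lambda>s. G s \<omega>) \<longlongrightarrow> G u \<omega>) (at_right u)" using u by (intro tendsto_at_right_of_continuous_on[OF G_cont[OF \<omega>]])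
  moreover have "eventually (\<lambda>s. 1 / real K \<le> G s \<omega>) (at_right u)"
    unfolding eventually_at_right_field
  proof (intro exI[of _ "level_exit G t K \<omega>"] conjI allI impI u(2))
    fix s assume s: "u < s" "s < level_exit G t K \<omega>"
    show "1 / real K \<le> G s \<omega>"
    proof (rule ccontr)
      assume "\<not> 1 / real K \<le> G s \<omega>"
      then have "level_exit G t K \<omega> \<le> s"
        unfolding level_exit_def using s u level_exit_range[of K \<omega>] by (intro cInf_lower level_exit_bdd) auto
      then show False using s by simp
    qed
  qed
  ultimately show "1 / real K \<le> G u \<omega>" by (rule tendsto_lowerbound) simp
qed

text \<open>A conditional moment of order k + 1 is at most a power of \<open>a\<close> times (K /
  n)^k times the scale itself. The sum of the scales has the same mean as the sum of the
  corresponding steps, and those fit into [0, t] up to one final step.\<close>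

lemma step_moment_sum_mean:
  assumes n: "1 \<le> n" and K: "1 \<le> K"
  shows "step_moment_sum P F (Suc k) (\<pi> n) (level_exit G t K) \<in> borel_measurable P"
    and "(\<integral>\<^sup>+\<omega>. step_moment_sum P F (Suc k) (\<pi> n) (level_exit G t K) \<omega> \<partial>P) \<le>
      ennreal (sphere_a CARD('d) ^ Suc k * (real K / real n) ^ k * (t + sphere_a CARD('d) * (real K / real n)))"
proof -
  let ?a = "sphere_a CARD('d)" and ?S = "\<lambda>m. filt.pre_sigma (\<pi> n m)" and ?\<tau> = "level_exit G t K"
  let ?Z = "\<lambda>m. nn_cond_exp P (?S m) (\<lambda>\<omega>. ennreal (\<bar>step (\<pi> n) m \<omega>\<bar> ^ Suc k))"
  \<comment> \<open>The scale cut down to an event known at \<pi> n m that contains every step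
    starting before the level exit. On it the scale is at most K / n.\<close>
  define b where "b m \<omega> = (if \<pi> n m \<omega> < t \<and> 1 / real K \<le> G (min (\<pi> n m \<omega>) t) \<omega> then scale n m \<omega> else 0)" for m \<omega>
  note a = sphere_a_gt_0
  have \<pi>m: "\<pi> n m \<in> borel_measurable P" for m by (rule stopping_time_measurable[OF sphere_stopping_time[OF n]])
  have [measurable]: "?\<tau> \<in> borel_measurable P" by (rule stopping_time_measurable[OF level_exit_stopping])
  have sm [measurable]: "step (\<pi> n) m \<in> borel_measurable P" for m
    unfolding step_def[abs_def] using \<pi>m[of m] \<pi>m[of "Suc m"] by (rule borel_measurable_diff[rotated])
  have [measurable]: "?Z m \<in> borel_measurable P" for m
    by (rule measurable_from_subalg[OF pre_subalgebra[OF sphere_stopping_time[OF n]] borel_measurable_nn_cond_exp])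
  have N: "num_steps (\<pi> n) ?\<tau> \<in> measurable P (count_space UNIV)"
    unfolding num_steps_def[abs_def] using \<pi>m by measurable
  show "step_moment_sum P F (Suc k) (\<pi> n) ?\<tau> \<in> borel_measurable P"
    unfolding step_moment_sum_def[abs_def] space_completion
    by (rule measurable_compose_countable[OF _ N]) measurable
  have bm: "b m \<in> borel_measurable (?S m)" for m
  proof -
    have [measurable]: "\<pi> n m \<in> borel_measurable (?S m)" "scale n m \<in> borel_measurable (?S m)"
      "(\<lambda>\<omega>. G (min (\<pi> n m \<omega>) t) \<omega>) \<in> borel_measurable (?S m)"
      by (rule sphere_measurable[OF n] scale_measurable[OF n] stopped_G[OF sphere_stopping_time[OF n] sphere_nonneg[OF n]]; assumption)+
    show ?thesis unfolding b_def by measurable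
  qed
  then have [measurable]: "b m \<in> borel_measurable P" for m by (rule pre_measurable_P[OF sphere_stopping_time[OF n]])
  have [measurable]: "dur n m \<in> borel_measurable P" for m by (rule dur_measurable[OF n])
  have b0: "0 \<le> b m \<omega>" and bK: "b m \<omega> \<le> real K / real n" if "\<omega> \<in> space M" for m \<omega>
  proof -
    show "0 \<le> b m \<omega>" using scale_gt_0[OF n that, of m] by (simp add: b_def)
    have "1 / (real n * G (min (\<pi> n m \<omega>) t) \<omega>) \<le> 1 / (real n * (1 / real K))" if "1 / real K \<le> G (min (\<pi> n m \<omega>) t) \<omega>"
      using that n K by (intro divide_left_mono mult_left_mono mult_pos_pos) (auto intro: less_le_trans[of _ "1 / real K"])
    then show "b m \<omega> \<le> real K / real n" by (auto simp: b_def scale_eq)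
  qed
  have "AE \<omega> in P. \<forall>m. ?Z m \<omega> \<le> ennreal ((?a * scale n m \<omega>) ^ Suc k)"
    unfolding AE_all_countable
  proof
    fix m
    note [measurable] = scale_measurable[OF n, of m]
    show "AE \<omega> in P. ?Z m \<omega> \<le> ennreal ((?a * scale n m \<omega>) ^ Suc k)"
    proof (rule nn_cond_exp_le[OF sphere_stopping_time[OF n]])
      fix \<omega> assume \<omega>: "\<omega> \<in> space M"
      show "ennreal (\<bar>step (\<pi> n) m \<omega>\<bar> ^ Suc k) \<le> ennreal ((?a * scale n m \<omega>) ^ Suc k)"
        using scale_gt_0[OF n \<omega>, of m] dur_nonneg[of n m \<omega>] dur_le[of n m \<omega>]
        by (intro ennreal_leI power_mono) (auto simp: sphere_step[OF n \<omega>] abs_mult mult.commute)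
    qed measurable
  qed
  then have "AE \<omega> in P. step_moment_sum P F (Suc k) (\<pi> n) ?\<tau> \<omega> \<le>
      (\<Sum>m. ennreal (?a ^ Suc k * (real K / real n) ^ k) * ennreal (b m \<omega>))"
    using AE_space
  proof eventually_elim
    case (elim \<omega>)
    then have \<omega>: "\<omega> \<in> space M" by simp
    have "step_moment_sum P F (Suc k) (\<pi> n) ?\<tau> \<omega> \<le>
        (\<Sum>m<num_steps (\<pi> n) ?\<tau> \<omega>. ennreal (?a ^ Suc k * (real K / real n) ^ k) * ennreal (b m \<omega>))"
      unfolding step_moment_sum_def space_completion
    proof (rule sum_mono)
      fix m assume "m \<in> {..<num_steps (\<pi> n) ?\<tau> \<omega>}"
      then have "\<not> ?\<tau> \<omega> \<le> \<pi> n m \<omega>" using not_less_Least unfolding num_steps_def by blast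
      then have "\<pi> n m \<omega> < ?\<tau> \<omega>" by simp
      then have bs: "b m \<omega> = scale n m \<omega>"
        using before_level_exit[OF \<omega> sphere_nonneg[OF n \<omega>]] by (simp add: b_def min_absorb1 less_imp_le)
      have "(?a * scale n m \<omega>) ^ Suc k = ?a ^ Suc k * b m \<omega> ^ k * b m \<omega>"
        by (simp add: bs power_mult_distrib mult_ac)
      also have "\<dots> \<le> ?a ^ Suc k * (real K / real n) ^ k * b m \<omega>"
        using a b0[OF \<omega>] bK[OF \<omega>] by (intro mult_right_mono mult_left_mono power_mono) auto
      finally have "ennreal ((?a * scale n m \<omega>) ^ Suc k) \<le> ennreal (?a ^ Suc k * (real K / real n) ^ k) * ennreal (b m \<omega>)"
        using a b0[OF \<omega>] by (subst ennreal_mult[symmetric]) (auto intro: ennreal_leI)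
      then show "?Z m \<omega> \<le> ennreal (?a ^ Suc k * (real K / real n) ^ k) * ennreal (b m \<omega>)"
        using elim(1) order_trans by blast
    qed
    also have "\<dots> \<le> (\<Sum>m. ennreal (?a ^ Suc k * (real K / real n) ^ k) * ennreal (b m \<omega>))"
      by (rule sum_le_suminf) (auto simp: summableI)
    finally show ?case .
  qed
  then have "(\<integral>\<^sup>+\<omega>. step_moment_sum P F (Suc k) (\<pi> n) ?\<tau> \<omega> \<partial>P) \<le>
      (\<integral>\<^sup>+\<omega>. (\<Sum>m. ennreal (?a ^ Suc k * (real K / real n) ^ k) * ennreal (b m \<omega>)) \<partial>P)"
    by (rule nn_integral_mono_AE)
  also have "\<dots> = ennreal (?a ^ Suc k * (real K / real n) ^ k) * (\<Sum>m. \<integral>\<^sup>+\<omega>. ennreal (b m \<omega>) \<partial>P)"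
    by (subst nn_integral_suminf) (auto simp: nn_integral_cmult)
  finally have main: "(\<integral>\<^sup>+\<omega>. step_moment_sum P F (Suc k) (\<pi> n) ?\<tau> \<omega> \<partial>P) \<le>
      ennreal (?a ^ Suc k * (real K / real n) ^ k) * (\<Sum>m. \<integral>\<^sup>+\<omega>. ennreal (b m \<omega>) \<partial>P)" .
  \<comment> \<open>Each weight is known at the start of its step, so multiplying by the duration
    leaves the mean unchanged and turns scales into actual time increments.\<close>
  have "(\<Sum>m. \<integral>\<^sup>+\<omega>. ennreal (b m \<omega>) \<partial>P) = (\<Sum>m. \<integral>\<^sup>+\<omega>. ennreal (b m \<omega>) * ennreal (dur n m \<omega>) \<partial>P)"
    by (intro suminf_cong dur_weighted_mean[OF n, symmetric] measurable_compose[OF bm measurable_ennreal])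
  also have "\<dots> = (\<integral>\<^sup>+\<omega>. (\<Sum>m. ennreal (b m \<omega>) * ennreal (dur n m \<omega>)) \<partial>P)"
    by (rule nn_integral_suminf[symmetric]) measurable
  also have "\<dots> \<le> (\<integral>\<^sup>+\<omega>. ennreal (t + ?a * (real K / real n)) \<partial>P)"
  proof (rule nn_integral_mono)
    fix \<omega> assume "\<omega> \<in> space P"
    then have \<omega>: "\<omega> \<in> space M" by simp
    \<comment> \<open>The two bounds must be carried together: a new term is added only while \<pi>
      n L < t, so the sum is then below t, and one step adds at most a K / n.\<close>
    have part: "(\<Sum>m<L. b m \<omega> * dur n m \<omega>) \<le> min (\<pi> n L \<omega>) (t + ?a * (real K / real n))" for L
    proof (induction L)
      case 0
      then show ?case using t_pos a by simp
    next
      case (Suc L)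
      have d: "b L \<omega> * dur n L \<omega> \<le> real K / real n * ?a"
        using b0[OF \<omega>, of L] bK[OF \<omega>, of L] dur_nonneg dur_le by (intro mult_mono) auto
      show ?case
      proof (cases "\<pi> n L \<omega> < t \<and> 1 / real K \<le> G (min (\<pi> n L \<omega>) t) \<omega>")
        case True
        then have "b L \<omega> = scale n L \<omega>" unfolding b_def by (rule if_P)
        then show ?thesis using Suc d True by (simp add: sphere_Suc[OF n \<omega>] mult.commute del: moving_sphere.simps)
      next
        case False
        then have "b L \<omega> = 0" by (auto simp: b_def)
        then show ?thesis using Suc sphere_mono[OF n \<omega>, of L "Suc L"] by (simp del: moving_sphere.simps)
      qed
    qed
    show "(\<Sum>m. ennreal (b m \<omega>) * ennreal (dur n m \<omega>)) \<le> ennreal (t + ?a * (real K / real n))"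
    proof (rule suminf_le_const[OF summableI])
      fix L
      have "(\<Sum>m<L. ennreal (b m \<omega>) * ennreal (dur n m \<omega>)) = ennreal (\<Sum>m<L. b m \<omega> * dur n m \<omega>)"
        using b0[OF \<omega>] dur_nonneg by (simp add: ennreal_mult[symmetric] sum_ennreal)
      also have "\<dots> \<le> ennreal (t + ?a * (real K / real n))" using part[of L] by (intro ennreal_leI) simp
      finally show "(\<Sum>m<L. ennreal (b m \<omega>) * ennreal (dur n m \<omega>)) \<le> ennreal (t + ?a * (real K / real n))" .
    qed
  qed
  also have "\<dots> = ennreal (t + ?a * (real K / real n))" by (simp add: B.emeasure_space_1[simplified])
  finally have "ennreal (?a ^ Suc k * (real K / real n) ^ k) * (\<Sum>m. \<integral>\<^sup>+\<omega>. ennreal (b m \<omega>) \<partial>P) \<le>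
      ennreal (?a ^ Suc k * (real K / real n) ^ k) * ennreal (t + ?a * (real K / real n))"
    by (rule mult_left_mono) simp
  also have "\<dots> = ennreal (?a ^ Suc k * (real K / real n) ^ k * (t + ?a * (real K / real n)))"
    using a t_pos by (intro ennreal_mult[symmetric]) auto
  finally show "(\<integral>\<^sup>+\<omega>. step_moment_sum P F (Suc k) (\<pi> n) ?\<tau> \<omega> \<partial>P) \<le>
      ennreal (?a ^ Suc k * (real K / real n) ^ k * (t + ?a * (real K / real n)))"
    by (rule order_trans[OF main])
qed

text \<open>The mean is of order c(n) n^(-k). For condition (A) take c = 1 and k = 1; for condition
  (C) take c = n^2 with k = 3 and k = 5.\<close>

lemma step_moment_tends_to_0:
  assumes K: "1 \<le> K" and c: "\<And>n. 1 \<le> n \<Longrightarrow> 0 \<le> c n" "\<And>n. 1 \<le> n \<Longrightarrow> c n * (1 / real n) ^ k \<le> 1 / real n"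
  shows "tends_to_0_in_prob P (\<lambda>n \<omega>. ennreal (c n) * step_moment_sum P F (Suc k) (\<pi> n) (level_exit G t K) \<omega>)"
proof (rule B.tends_to_0_in_probI_mean)
  let ?a = "sphere_a CARD('d)"
  fix n :: nat assume n: "1 \<le> n"
  note [measurable] = step_moment_sum_mean(1)[OF n K, of k]
  show "(\<lambda>\<omega>. ennreal (c n) * step_moment_sum P F (Suc k) (\<pi> n) (level_exit G t K) \<omega>) \<in> borel_measurable P"
    by measurable
  note a = sphere_a_gt_0
  have "(\<integral>\<^sup>+\<omega>. ennreal (c n) * step_moment_sum P F (Suc k) (\<pi> n) (level_exit G t K) \<omega> \<partial>P) =
      ennreal (c n) * (\<integral>\<^sup>+\<omega>. step_moment_sum P F (Suc k) (\<pi> n) (level_exit G t K) \<omega> \<partial>P)"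
    by (rule nn_integral_cmult) measurable
  also have "\<dots> \<le> ennreal (c n) * ennreal (?a ^ Suc k * (real K / real n) ^ k * (t + ?a * (real K / real n)))"
    by (intro mult_left_mono step_moment_sum_mean(2)[OF n K]) simp
  also have "\<dots> = ennreal ((c n * (1 / real n) ^ k) * (?a ^ Suc k * real K ^ k * (t + ?a * (real K / real n))))"
    using a t_pos c(1)[OF n] by (subst ennreal_mult[symmetric]) (auto simp: power_divide mult_ac)
  also have "\<dots> \<le> ennreal ((1 / real n) * (?a ^ Suc k * real K ^ k * (t + ?a * real K)))"
    using a t_pos n c[OF n]
    by (intro ennreal_leI mult_mono mult_left_mono add_left_mono) (auto simp: divide_le_eq mult_le_cancel_left1)
  finally show "(\<integral>\<^sup>+\<omega>. ennreal (c n) * step_moment_sum P F (Suc k) (\<pi> n) (level_exit G t K) \<omega> \<partial>P) \<le>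
      ennreal (?a ^ Suc k * real K ^ k * (t + ?a * real K) / real n)" by simp
qed

lemma level_exit_measurable: "level_exit G t K \<in> borel_measurable P"
  by (rule stopping_time_measurable[OF level_exit_stopping])

lemma G_measurable: "s \<in> {0..t} \<Longrightarrow> G s \<in> borel_measurable P"
  by (rule B.F_into[OF _ G_adapted]) auto

lemma condition_A:
  assumes K: "1 \<le> K"
  shows "condition_A P F \<pi> G (level_exit G t K)"
  unfolding condition_A_def
proof (intro conjI allI impI)
  show "cond_integrable P (stopped_sigma P F (\<pi> n m)) (step (\<pi> n) m)" if "1 \<le> n" for n m
    using step_cond(1)[OF that] by simp
  show "tends_to_0_in_prob P (\<lambda>n. step_moment_sum P F 2 (\<pi> n) (level_exit G t K))"
    using step_moment_tends_to_0[OF K, of "\<lambda>_. 1" 1] by (simp add: numeral_2_eq_2)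
  show "tends_to_0_in_prob P (\<lambda>n \<omega>. SUP s\<in>{0..level_exit G t K \<omega>}.
      ennreal \<bar>step_rate P F n (\<pi> n) (step_index (\<pi> n) s \<omega>) \<omega> - G s \<omega>\<bar>)"
  proof (rule oscillation_tends_to_0[where \<Phi>=G])
    fix n :: nat assume n: "1 \<le> n"
    have "AE \<omega> in P. \<forall>m. step_rate P F n (\<pi> n) m \<omega> = G (min (\<pi> n m \<omega>) t) \<omega>"
      unfolding AE_all_countable using step_rate_eq[OF n] by blast
    then show "AE \<omega> in P. (SUP s\<in>{0..level_exit G t K \<omega>}.
        ennreal \<bar>step_rate P F n (\<pi> n) (step_index (\<pi> n) s \<omega>) \<omega> - G s \<omega>\<bar>) =
        (SUP s\<in>{0..level_exit G t K \<omega>}. ennreal \<bar>G (min (\<pi> n (step_index (\<pi> n) s \<omega>) \<omega>) t) \<omega> - G s \<omega>\<bar>)"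
      by eventually_elim simp
  qed (use level_exit_range G_cont G_measurable level_exit_measurable in auto)
qed

lemma condition_C:
  assumes K: "1 \<le> K"
  shows "condition_C P F \<pi> (\<lambda>s \<omega>. 3 * sphere_r CARD('d) / G s \<omega>) Hn (level_exit G t K)"
  unfolding condition_C_def
proof (intro conjI)
  have "(real n)\<^sup>2 * (1 / real n) ^ k \<le> 1 / real n" if n: "1 \<le> n" and k: "3 \<le> k" for n k :: nat
  proof -
    have "(real n)\<^sup>2 * (1 / real n) ^ k \<le> (real n)\<^sup>2 * (1 / real n) ^ 3"
      using n k by (intro mult_left_mono power_decreasing) auto
    also have "\<dots> = 1 / real n" using n by (simp add: power2_eq_square power3_eq_cube)
    finally show ?thesis .
  qed
  note c = this
  show "tends_to_0_in_prob P (\<lambda>n \<omega>. ennreal ((real n)\<^sup>2) * step_moment_sum P F 4 (\<pi> n) (level_exit G t K) \<omega>)"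
    using step_moment_tends_to_0[OF K _ c, of 3] by simp
  show "tends_to_0_in_prob P (\<lambda>n \<omega>. ennreal ((real n)\<^sup>2) * step_moment_sum P F 6 (\<pi> n) (level_exit G t K) \<omega>)"
    using step_moment_tends_to_0[OF K _ c, of 5] by simp
  have ne: "G s \<omega> \<noteq> 0" if "s \<in> {0..t}" "\<omega> \<in> space M" for s \<omega> using G_pos[OF that] by simp
  show "tends_to_0_in_prob P (\<lambda>n \<omega>. SUP s\<in>{0..level_exit G t K \<omega>}.
      ennreal \<bar>Hn n (\<pi> n (step_index (\<pi> n) s \<omega>) \<omega>) \<omega> - 3 * sphere_r CARD('d) / G s \<omega>\<bar>)"
  proof (rule oscillation_tends_to_0[where \<Phi>="\<lambda>s \<omega>. 3 * sphere_r CARD('d) / G s \<omega>"])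
    show "continuous_on {0..t} (\<lambda>s. 3 * sphere_r CARD('d) / G s \<omega>)" if "\<omega> \<in> space M" for \<omega>
      using ne that by (intro continuous_intros G_cont) auto
    show "(\<lambda>\<omega>. 3 * sphere_r CARD('d) / G s \<omega>) \<in> borel_measurable P" if "s \<in> {0..t}" for s
      using G_measurable[OF that] by measurable
  qed (use level_exit_range level_exit_measurable in \<open>auto simp: Hn_def\<close>)
qed

text \<open>On the product space the time coordinate is itself a random time with values in [0, T],
  so \<open>measurable_random_time\<close> gives joint measurability from adaptedness and
  continuity.\<close>

lemma progressive_Hn: "progressive F {0..} (Hn n)"
  unfolding progressive_def
proof
  fix T :: real assume "T \<in> {0..}"
  then have T: "0 \<le> T" by simp
  let ?A = "restrict_space borel {0..T} \<Otimes>\<^sub>M F T"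
  have fst: "fst \<in> borel_measurable ?A"
    by (rule measurable_compose[OF measurable_fst measurable_restrict_space1]) simp
  have "(\<lambda>p. G (min (fst p) t) (snd p)) \<in> borel_measurable ?A"
  proof (rule measurable_random_time[where s=T and X="\<lambda>r p. G (min r t) (snd p)", OF _ _ fst])
    fix r assume r: "r \<in> {0..T}"
    then have "G (min r t) \<in> borel_measurable (F T)"
      using t_pos by (intro B.F_mono[OF _ _ G_adapted]) auto
    then show "(\<lambda>p. G (min r t) (snd p)) \<in> borel_measurable ?A"
      by (rule measurable_compose[OF measurable_snd])
  next
    fix p assume "p \<in> space ?A"
    then have "snd p \<in> space M" by (auto simp: space_pair_measure)
    then show "continuous_on {0..T} (\<lambda>r. G (min r t) (snd p))"
      using t_pos by (intro continuous_on_compose2[OF G_cont]) (auto intro!: continuous_intros)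
  qed (auto simp: space_pair_measure space_restrict_space)
  then show "(\<lambda>(s, \<omega>). Hn n s \<omega>) \<in> borel_measurable ?A"
    unfolding Hn_def case_prod_beta by measurable
qed

text \<open>On [0, t] the freezing in \<open>Hn\<close> has no effect, so this process inherits
  progressive measurability from it.\<close>

lemma progressive_H: "progressive F {0..t} (\<lambda>s \<omega>. 3 * sphere_r CARD('d) / G s \<omega>)"
  unfolding progressive_def
proof
  fix T assume T: "T \<in> {0..t}"
  let ?A = "restrict_space borel {0..T} \<Otimes>\<^sub>M F T"
  have "(\<lambda>(s, \<omega>). Hn 0 s \<omega>) \<in> borel_measurable ?A" using progressive_Hn[of 0] T by (auto simp: progressive_def)
  then show "(\<lambda>(s, \<omega>). 3 * sphere_r CARD('d) / G s \<omega>) \<in> borel_measurable ?A"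
    by (rule measurable_cong[THEN iffD1, rotated])
      (use T in \<open>auto simp: space_pair_measure space_restrict_space Hn_def min_absorb1\<close>)
qed

end

theorem mainTheorem4:
  fixes M :: "'a measure" and W :: "real \<Rightarrow> 'a \<Rightarrow> real ^ 'd::finite"
    and G :: "real \<Rightarrow> 'a \<Rightarrow> real" and t :: real
  assumes "prob_space M"
    and "standard_brownian_motion M W"
    and "t > 0"
    and "\<And>s \<omega>. s \<in> {0..t} \<Longrightarrow> \<omega> \<in> space M \<Longrightarrow> G s \<omega> > 0"
    and "\<And>\<omega>. \<omega> \<in> space M \<Longrightarrow> continuous_on {0..t} (\<lambda>s. G s \<omega>)"
    and "\<And>s. s \<in> {0..t} \<Longrightarrow> G s \<in> borel_measurable (augmented_filtration M W s)"
  shows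
    "let P = completion M;
         F = augmented_filtration M W;
         \<pi> = moving_sphere W G t;
         H = (\<lambda>s \<omega>. 3 * sphere_r CARD('d) / G s \<omega>)
     in (\<forall>n\<ge>1. stopping_partition P F (\<pi> n)) \<and>
        (\<forall>K\<ge>1. stopping_time F (level_exit G t K)) \<and>
        (\<forall>K\<ge>1. condition_A P F \<pi> G (level_exit G t K)) \<and>
        progressive F {0..t} H \<and>
        (\<exists>Hn. (\<forall>n\<ge>1. progressive F {0..} (Hn n)) \<and>
              condition_B P F W \<pi> Hn \<and>
              (\<forall>K\<ge>1. condition_C P F \<pi> H Hn (level_exit G t K))) \<and>
        (\<forall>d\<ge>1. sphere_r d < real d / (real d + 1))"
proof -
  interpret moving M W G t
    by (intro moving.intro std_bm.intro std_bm_axioms.intro moving_axioms.intro assms)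
  show ?thesis
    unfolding Let_def
    using stopping_partition level_exit_stopping condition_A progressive_H progressive_Hn condition_B condition_C sphere_r_less
    by blast
qed

end
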